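(* Let $k$ be an algebraically closed field of characteristic $p>0$ and let $X$ be a variety over $k$. Suppose that $X$ is F-pure. Then the F-blowup sequence of $X$ is monotone; that is, for every integer $e\ge 0$ the natural birational map $\rho_e:\mathrm{FB}_{e+1}(X)\dashrightarrow \mathrm{FB}_e(X)$ is a morphism defined on all of $\mathrm{FB}_{e+1}(X)$ (has no indeterminacy).
   Context: A variety over $k$ is a separated integral scheme of finite type over $k$; points of varieties are closed points. For $e\ge 0$, let $F_e:X_e\to X$ be the $e$-times iterated $k$-linear Frobenius: concretely $X_e=\mathcal{S}pec_X\,\mathcal{O}_X^{1/p^e}$, where $\mathcal{O}_X^{1/p^e}=(F_e)_*\mathcal{O}_{X_e}$ is the sheaf of $p^e$-th roots of local sections of $\mathcal{O}_X$ (in an algebraic closure of the function field of $X$), $F_e$ corresponds to the inclusion $\mathcal{O}_X\hookrightarrow\mathcal{O}_X^{1/p^e}$, and $X_e$ is a $k$-scheme via $F_e$ and $X\to\operatorname{Spec}k$. $X$ is F-pure if the natural morphism $\mathcal{O}_X\to\mathcal{O}_X^{1/p}$ (also written $\mathcal{O}_X\to(F_1)_*\mathcal{O}_X$) locally splits as a morphism of $\mathcal{O}_X$-modules. F-blowup: let $d=\dim X$. For each smooth closed point $x\in X$, the scheme-theoretic fiber $F_e^{-1}(x)$ is a closed subscheme of $X_e$ of length $p^{ed}$ supported at one point (a fat point), hence a closed point of the Hilbert scheme $\mathrm{Hilb}_{p^{ed}}(X_e)$ of $0$-dimensional subschemes of $X_e$ of length $p^{ed}$. The $e$-th F-blowup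 $\mathrm{FB}_e(X)$ is the closure (with reduced structure) in $\mathrm{Hilb}_{p^{ed}}(X_e)$ of the set $\{F_e^{-1}(x)\mid x\in X(k)\text{ smooth}\}$. It is a variety, and is projective and birational over $X$ via $\pi_e:\mathrm{FB}_e(X)\to X$, $Z\mapsto F_e(Z)$ (scheme-theoretic image, a reduced point), which is an isomorphism over the smooth locus of $X$. The natural birational map $\rho_e:\mathrm{FB}_{e+1}(X)\dashrightarrow\mathrm{FB}_e(X)$ is the birational map over $X$ given by $\pi_e^{-1}\circ\pi_{e+1}$ over the smooth locus. *)

theory Defs
  imports
    "HOL-Algebra.Generated_Rings"
    "HOL-Algebra.Ideal_Product"
    "HOL-Algebra.RingHom"
    "HOL-Analysis.Function_Topology"
    "HOL-Computational_Algebra.Polynomial"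
begin

section \<open>Schemes over a field\<close>

text \<open>
  The ground field is a type \<open>'k\<close>; the section rings of the structure sheaf vary with the open set
  and are therefore ring records over one carrier type \<open>'s\<close>. \<open>cst X U\<close> is the structure
  homomorphism from \<open>'k\<close> to the sections over \<open>U\<close>.
\<close>

record ('p, 's, 'k) kspace =
  sp :: "'p topology"
  sec :: "'p set \<Rightarrow> 's ring"
  res :: "'p set \<Rightarrow> 'p set \<Rightarrow> 's \<Rightarrow> 's"
  cst :: "'p set \<Rightarrow> 'k \<Rightarrow> 's"

definition k_ring :: "'k::field ring" where
  "k_ring = \<lparr>carrier = UNIV, monoid.mult = (*), one = 1, zero = 0, add = (+)\<rparr>"

definition ringed_kspace :: "('p, 's, 'k::field) kspace \<Rightarrow> bool" where
  "ringed_kspace X \<longleftrightarrow>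
     (\<forall>U. openin (sp X) U \<longrightarrow>
        cring (sec X U) \<and> cst X U \<in> ring_hom k_ring (sec X U) \<and>
        (\<forall>f\<in>carrier (sec X U). res X U U f = f)) \<and>
     (\<forall>U V. openin (sp X) U \<longrightarrow> openin (sp X) V \<longrightarrow> V \<subseteq> U \<longrightarrow>
        res X U V \<in> ring_hom (sec X U) (sec X V) \<and>
        (\<forall>c. res X U V (cst X U c) = cst X V c)) \<and>
     (\<forall>U V W. openin (sp X) U \<longrightarrow> openin (sp X) V \<longrightarrow> openin (sp X) W \<longrightarrow> W \<subseteq> V \<longrightarrow> V \<subseteq> U \<longrightarrow>
        (\<forall>f\<in>carrier (sec X U). res X V W (res X U V f) = res X U W f)) \<and>
     (\<forall>\<U> s. (\<forall>V\<in>\<U>. openin (sp X) V \<and> s V \<in> carrier (sec X V)) \<longrightarrow>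
        (\<forall>V\<in>\<U>. \<forall>W\<in>\<U>. res X V (V \<inter> W) (s V) = res X W (V \<inter> W) (s W)) \<longrightarrow>
        (\<exists>!f. f \<in> carrier (sec X (\<Union>\<U>)) \<and> (\<forall>V\<in>\<U>. res X (\<Union>\<U>) V f = s V)))"

text \<open>The locus where the germ of \<open>f\<close> is a unit of the stalk.\<close>

definition nonvan :: "('p, 's, 'k) kspace \<Rightarrow> 'p set \<Rightarrow> 's \<Rightarrow> 'p set" where
  "nonvan X U f =
     {x. \<exists>W. openin (sp X) W \<and> x \<in> W \<and> W \<subseteq> U \<and> res X U W f \<in> Units (sec X W)}"

definition vanishing_at :: "('p, 's, 'k) kspace \<Rightarrow> 'p set \<Rightarrow> 'p \<Rightarrow> 's set" where
  "vanishing_at X U x = {f \<in> carrier (sec X U). x \<notin> nonvan X U f}"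

text \<open>
  \<open>U\<close> is affine: writing \<open>A\<close> for the sections over \<open>U\<close>, the canonical map from \<open>U\<close> to the prime
  spectrum of \<open>A\<close> is bijective, the sets corresponding to the principal open sets \<open>D(f)\<close> form a
  basis of the topology of \<open>U\<close>, and the sections over \<open>D(f)\<close> are the localization of \<open>A\<close> at \<open>f\<close>
  (that \<open>f\<close> is invertible over \<open>D(f)\<close> is automatic). This is what an isomorphism of
  \<open>U\<close> with the spectrum of \<open>A\<close> amounts to.
\<close>

definition affine_open :: "('p, 's, 'k) kspace \<Rightarrow> 'p set \<Rightarrow> bool" where
  "affine_open X U \<longleftrightarrow> openin (sp X) U \<and>
     bij_betw (vanishing_at X U) U {P. primeideal P (sec X U)} \<and>
     (\<forall>W x. openin (sp X) W \<longrightarrow> W \<subseteq> U \<longrightarrow> x \<in> W \<longrightarrow>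
        (\<exists>f\<in>carrier (sec X U). x \<in> nonvan X U f \<and> nonvan X U f \<subseteq> W)) \<and>
     (\<forall>f\<in>carrier (sec X U).
        (\<forall>g\<in>carrier (sec X (nonvan X U f)). \<exists>m::nat. \<exists>h\<in>carrier (sec X U).
           g \<otimes>\<^bsub>sec X (nonvan X U f)\<^esub> res X U (nonvan X U f) f [^]\<^bsub>sec X (nonvan X U f)\<^esub> m
             = res X U (nonvan X U f) h) \<and>
        (\<forall>h\<in>carrier (sec X U). res X U (nonvan X U f) h = \<zero>\<^bsub>sec X (nonvan X U f)\<^esub> \<longrightarrow>
           (\<exists>m::nat. f [^]\<^bsub>sec X U\<^esub> m \<otimes>\<^bsub>sec X U\<^esub> h = \<zero>\<^bsub>sec X U\<^esub>)))"

definition kscheme :: "('p, 's, 'k::field) kspace \<Rightarrow> bool" where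
  "kscheme X \<longleftrightarrow> ringed_kspace X \<and> (\<forall>x\<in>topspace (sp X). \<exists>U. affine_open X U \<and> x \<in> U)"

definition integral_kscheme :: "('p, 's, 'k) kspace \<Rightarrow> bool" where
  "integral_kscheme X \<longleftrightarrow> topspace (sp X) \<noteq> {} \<and>
     (\<forall>U. openin (sp X) U \<longrightarrow> U \<noteq> {} \<longrightarrow> domain (sec X U))"

definition finite_type :: "('p, 's, 'k) kspace \<Rightarrow> bool" where
  "finite_type X \<longleftrightarrow> (\<exists>\<U>. finite \<U> \<and> \<Union>\<U> = topspace (sp X) \<and>
     (\<forall>U\<in>\<U>. affine_open X U \<and>
        (\<exists>B. finite B \<and> B \<subseteq> carrier (sec X U) \<and>
             carrier (sec X U) = generate_ring (sec X U) (range (cst X U) \<union> B))))"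

text \<open>
  The diagonal of \<open>X \<times> X\<close> (product over the ground field) is a closed immersion. The products
  \<open>U \<times> V\<close> of affine open sets cover \<open>X \<times> X\<close> and \<open>U \<inter> V\<close> is the preimage of \<open>U \<times> V\<close>, so this
  says that \<open>U \<inter> V\<close> is affine and that the tensor product of the section rings over \<open>U\<close> and \<open>V\<close>
  surjects onto the sections over \<open>U \<inter> V\<close>.
\<close>

definition separated :: "('p, 's, 'k) kspace \<Rightarrow> bool" where
  "separated X \<longleftrightarrow> (\<forall>U V. affine_open X U \<longrightarrow> affine_open X V \<longrightarrow>
     affine_open X (U \<inter> V) \<and>
     carrier (sec X (U \<inter> V)) = generate_ring (sec X (U \<inter> V))
       (res X U (U \<inter> V) ` carrier (sec X U) \<union> res X V (U \<inter> V) ` carrier (sec X V)))"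

definition variety :: "('p, 's, 'k::field) kspace \<Rightarrow> bool" where
  "variety X \<longleftrightarrow> kscheme X \<and> integral_kscheme X \<and> finite_type X \<and> separated X"

definition irreducible_closed :: "'p topology \<Rightarrow> 'p set \<Rightarrow> bool" where
  "irreducible_closed T Z \<longleftrightarrow> closedin T Z \<and> Z \<noteq> {} \<and>
     (\<forall>A B. closedin T A \<longrightarrow> closedin T B \<longrightarrow> Z \<subseteq> A \<union> B \<longrightarrow> Z \<subseteq> A \<or> Z \<subseteq> B)"

text \<open>Krull dimension; the set of chain lengths is bounded for schemes of finite type.\<close>

definition dimension :: "('p, 's, 'k) kspace \<Rightarrow> nat" where
  "dimension X = Sup {m. \<exists>Z. (\<forall>i\<le>m. irreducible_closed (sp X) (Z i)) \<and> (\<forall>i<m. Z i \<subset> Z (Suc i))}"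

definition closed_point :: "('p, 's, 'k) kspace \<Rightarrow> 'p \<Rightarrow> bool" where
  "closed_point X x \<longleftrightarrow> x \<in> topspace (sp X) \<and> closedin (sp X) {x}"

text \<open>\<open>coords X V I n b f c\<close>: \<open>f\<close> is congruent modulo \<open>I\<close> to \<open>c\<^sub>0 b\<^sub>0 + \<dots> + c\<^sub>n\<^sub>-\<^sub>1 b\<^sub>n\<^sub>-\<^sub>1\<close>.\<close>

definition coords ::
  "('p, 's, 'k::field) kspace \<Rightarrow> 'p set \<Rightarrow> 's set \<Rightarrow> nat \<Rightarrow> (nat \<Rightarrow> 's) \<Rightarrow> 's \<Rightarrow> (nat \<Rightarrow> 'k) \<Rightarrow> bool" where
  "coords X V I n b f c \<longleftrightarrow> (\<forall>i\<ge>n. c i = 0) \<and>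
     f \<ominus>\<^bsub>sec X V\<^esub> (\<Oplus>\<^bsub>sec X V\<^esub>i\<in>{..<n}. cst X V (c i) \<otimes>\<^bsub>sec X V\<^esub> b i) \<in> I"

text \<open>The classes of \<open>b\<^sub>0, \<dots>, b\<^sub>n\<^sub>-\<^sub>1\<close> form a basis of the vector space \<open>J / I\<close>.\<close>

definition basis_mod ::
  "('p, 's, 'k::field) kspace \<Rightarrow> 'p set \<Rightarrow> 's set \<Rightarrow> 's set \<Rightarrow> nat \<Rightarrow> (nat \<Rightarrow> 's) \<Rightarrow> bool" where
  "basis_mod X V J I n b \<longleftrightarrow> (\<forall>i<n. b i \<in> J) \<and> (\<forall>f\<in>J. \<exists>!c. coords X V I n b f c)"

text \<open>
  Smoothness of a closed point of a variety over an algebraically closed field: the Zariski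
  cotangent space has dimension \<open>dim X\<close>. It is computed on an affine neighbourhood, where the
  ideal \<open>m\<close> of the point is maximal, so that \<open>m / m\<^sup>2\<close> does not change under localization.
\<close>

definition smooth_point :: "('p, 's, 'k::field) kspace \<Rightarrow> 'p \<Rightarrow> bool" where
  "smooth_point X x \<longleftrightarrow> closed_point X x \<and>
     (\<exists>V b. affine_open X V \<and> x \<in> V \<and>
        basis_mod X V (vanishing_at X V x)
          (ideal_prod (sec X V) (vanishing_at X V x) (vanishing_at X V x)) (dimension X) b)"

section \<open>Closed subschemes\<close>

text \<open>
  A closed subscheme is its quasi-coherent sheaf of ideals. The value on non-open sets is fixed
  so that equality of subschemes is equality of functions.
\<close>

definition closed_subscheme :: "('p, 's, 'k) kspace \<Rightarrow> ('p set \<Rightarrow> 's set) \<Rightarrow> bool" where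
  "closed_subscheme X I \<longleftrightarrow>
     (\<forall>U. \<not> openin (sp X) U \<longrightarrow> I U = {}) \<and>
     (\<forall>U. openin (sp X) U \<longrightarrow> ideal (I U) (sec X U)) \<and>
     (\<forall>U V. openin (sp X) U \<longrightarrow> openin (sp X) V \<longrightarrow> V \<subseteq> U \<longrightarrow> res X U V ` I U \<subseteq> I V) \<and>
     (\<forall>\<U>. (\<forall>V\<in>\<U>. openin (sp X) V) \<longrightarrow>
        (\<forall>f\<in>carrier (sec X (\<Union>\<U>)). (\<forall>V\<in>\<U>. res X (\<Union>\<U>) V f \<in> I V) \<longrightarrow> f \<in> I (\<Union>\<U>))) \<and>
     (\<forall>U. affine_open X U \<longrightarrow> (\<forall>f\<in>carrier (sec X U). \<forall>g\<in>I (nonvan X U f).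
        \<exists>m::nat. \<exists>h\<in>I U.
          g \<otimes>\<^bsub>sec X (nonvan X U f)\<^esub> res X U (nonvan X U f) f [^]\<^bsub>sec X (nonvan X U f)\<^esub> m
            = res X U (nonvan X U f) h))"

definition supported_in :: "('p, 's, 'k) kspace \<Rightarrow> 'p set \<Rightarrow> ('p set \<Rightarrow> 's set) \<Rightarrow> bool" where
  "supported_in X V I \<longleftrightarrow> (\<forall>x\<in>topspace (sp X) - V.
     \<exists>W. openin (sp X) W \<and> x \<in> W \<and> I W = carrier (sec X W))"

text \<open>The reduced closed subscheme \<open>{x}\<close>, for a closed point \<open>x\<close>.\<close>

definition point_ideal :: "('p, 's, 'k) kspace \<Rightarrow> 'p \<Rightarrow> 'p set \<Rightarrow> 's set" where
  "point_ideal X x U = (if openin (sp X) U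
     then {f \<in> carrier (sec X U). x \<in> U \<longrightarrow> f \<in> vanishing_at X U x} else {})"

section \<open>Iterated Frobenius and F-purity\<close>

text \<open>
  A local section of \<open>O\<^sub>X\<close> to the power \<open>1/p\<^sup>e\<close> is represented by its \<open>p\<^sup>e\<close>-th power, which
  determines it because the section rings are domains. So \<open>X\<^sub>e\<close> has the space, section rings and
  restriction maps of \<open>X\<close>; the inclusion of \<open>O\<^sub>X\<close> becomes the \<open>p\<^sup>e\<close>-power map \<open>frob\<close>, the
  comorphism of \<open>F\<^sub>e\<close>; and the constants are embedded through it.
\<close>

definition frob :: "nat \<Rightarrow> ('p, 's, 'k) kspace \<Rightarrow> nat \<Rightarrow> 'p set \<Rightarrow> 's \<Rightarrow> 's" where
  "frob p X e U f = f [^]\<^bsub>sec X U\<^esub> (p ^ e)"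

definition frob_root :: "nat \<Rightarrow> ('p, 's, 'k) kspace \<Rightarrow> nat \<Rightarrow> ('p, 's, 'k) kspace" where
  "frob_root p X e = X\<lparr>cst := (\<lambda>U c. frob p X e U (cst X U c))\<rparr>"

text \<open>Locally there is an \<open>O\<^sub>X\<close>-linear retraction \<open>\<sigma>\<close> of the comorphism of \<open>F\<^sub>1\<close>.\<close>

definition F_pure :: "nat \<Rightarrow> ('p, 's, 'k) kspace \<Rightarrow> bool" where
  "F_pure p X \<longleftrightarrow> (\<forall>x\<in>topspace (sp X). \<exists>U. openin (sp X) U \<and> x \<in> U \<and> (\<exists>\<sigma>.
     (\<forall>W. openin (sp X) W \<longrightarrow> W \<subseteq> U \<longrightarrow>
        (\<forall>g\<in>carrier (sec X W). \<sigma> W g \<in> carrier (sec X W)) \<and>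
        (\<forall>g\<in>carrier (sec X W). \<forall>h\<in>carrier (sec X W).
           \<sigma> W (g \<oplus>\<^bsub>sec X W\<^esub> h) = \<sigma> W g \<oplus>\<^bsub>sec X W\<^esub> \<sigma> W h) \<and>
        (\<forall>f\<in>carrier (sec X W). \<forall>g\<in>carrier (sec X W).
           \<sigma> W (frob p X 1 W f \<otimes>\<^bsub>sec X W\<^esub> g) = f \<otimes>\<^bsub>sec X W\<^esub> \<sigma> W g) \<and>
        (\<forall>f\<in>carrier (sec X W). \<sigma> W (frob p X 1 W f) = f)) \<and>
     (\<forall>W V. openin (sp X) W \<longrightarrow> openin (sp X) V \<longrightarrow> V \<subseteq> W \<longrightarrow> W \<subseteq> U \<longrightarrow>
        (\<forall>g\<in>carrier (sec X W). res X W V (\<sigma> W g) = \<sigma> V (res X W V g)))))"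

text \<open>
  The scheme-theoretic fibre of \<open>F\<^sub>e\<close> over a closed point \<open>x\<close>: the ideal sheaf on \<open>X\<^sub>e\<close> generated by
  the image of the ideal sheaf of \<open>x\<close>, that is, the sheaf associated with the presheaf of
  generated ideals.
\<close>

definition frob_fiber :: "nat \<Rightarrow> ('p, 's, 'k) kspace \<Rightarrow> nat \<Rightarrow> 'p \<Rightarrow> 'p set \<Rightarrow> 's set" where
  "frob_fiber p X e x U = (if openin (sp X) U
     then {g \<in> carrier (sec X U). \<forall>y\<in>U. \<exists>W. openin (sp X) W \<and> y \<in> W \<and> W \<subseteq> U \<and>
             res X U W g \<in> genideal (sec X W) (frob p X e W ` point_ideal X x W)}
     else {})"

text \<open>The scheme-theoretic image under \<open>F\<^sub>e\<close> of the closed subscheme \<open>I\<close> of \<open>X\<^sub>e\<close>.\<close>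

definition frob_image :: "nat \<Rightarrow> ('p, 's, 'k) kspace \<Rightarrow> nat \<Rightarrow> ('p set \<Rightarrow> 's set) \<Rightarrow> 'p set \<Rightarrow> 's set" where
  "frob_image p X e I U = (if openin (sp X) U
     then {f \<in> carrier (sec X U). frob p X e U f \<in> I U} else {})"

section \<open>Reduced spaces of closed points\<close>

text \<open>
  A reduced scheme locally of finite type over an algebraically closed field is determined by its
  closed points with the Zariski topology and the sheaf of regular functions, viewed as functions
  with values in the field; morphisms are the continuous maps that pull regular functions back to
  regular functions. The F-blowups are described in this way. Only the values on \<open>W\<close> of the
  members of \<open>regular H W\<close> matter.
\<close>

record ('z, 'k) fspace =
  ztop :: "'z topology"
  regular :: "'z set \<Rightarrow> ('z \<Rightarrow> 'k) set"

definition fspace_morphism :: "('z, 'k) fspace \<Rightarrow> ('w, 'k) fspace \<Rightarrow> ('z \<Rightarrow> 'w) \<Rightarrow> bool" where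
  "fspace_morphism A B \<phi> \<longleftrightarrow> continuous_map (ztop A) (ztop B) \<phi> \<and>
     (\<forall>W s. openin (ztop B) W \<longrightarrow> s \<in> regular B W \<longrightarrow>
        s \<circ> \<phi> \<in> regular A {z \<in> topspace (ztop A). \<phi> z \<in> W})"

text \<open>The closure of a set of closed points, with its reduced structure.\<close>

definition reduced_closure :: "('z, 'k) fspace \<Rightarrow> 'z set \<Rightarrow> ('z, 'k) fspace" where
  "reduced_closure H S =
     \<lparr>ztop = subtopology (ztop H) (ztop H closure_of S),
      regular = (\<lambda>W. {s. \<forall>z\<in>W. \<exists>U t. openin (ztop H) U \<and> z \<in> U \<and> t \<in> regular H U \<and>
                       (\<forall>w\<in>U \<inter> W. s w = t w)})\<rparr>"

section \<open>The Hilbert scheme of points\<close>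

text \<open>
  The reduced Hilbert scheme of \<open>0\<close>-dimensional subschemes of length \<open>n\<close> of \<open>Y\<close>, through its
  standard affine charts. For \<open>V\<close> affine with section ring \<open>A\<close> and \<open>b\<^sub>0, \<dots>, b\<^sub>n\<^sub>-\<^sub>1\<close> in \<open>A\<close>, the chart
  consists of the subschemes \<open>Z\<close> contained in \<open>V\<close> such that the \<open>b\<^sub>i\<close> form a basis of the
  coordinate ring \<open>A / I\<^sub>Z\<close>. It represents the functor of quotients of \<open>A \<otimes> B\<close> that are free over
  \<open>B\<close> with basis the \<open>b\<^sub>i\<close>; its coordinate ring is generated by the coefficients, for \<open>f\<close> in \<open>A\<close>,
  in the expansion of \<open>f\<close> with respect to the universal basis. Only subschemes contained in some
  affine open set occur. This is all of them if \<open>Y\<close> is quasi-projective, and it always includes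
  those supported at one point.
\<close>

definition hilb_chart ::
  "('p, 's, 'k::field) kspace \<Rightarrow> nat \<Rightarrow> 'p set \<Rightarrow> (nat \<Rightarrow> 's) \<Rightarrow> ('p set \<Rightarrow> 's set) set" where
  "hilb_chart Y n V b = {I. closed_subscheme Y I \<and> supported_in Y V I \<and>
     basis_mod Y V (carrier (sec Y V)) (I V) n b}"

inductive_set chart_functions ::
  "('p, 's, 'k::field) kspace \<Rightarrow> nat \<Rightarrow> 'p set \<Rightarrow> (nat \<Rightarrow> 's) \<Rightarrow> (('p set \<Rightarrow> 's set) \<Rightarrow> 'k) set"
  for Y n V b where
  const: "(\<lambda>I. c) \<in> chart_functions Y n V b"
| coeff: "f \<in> carrier (sec Y V) \<Longrightarrow> i < n \<Longrightarrow>
    (\<lambda>I. (THE c. coords Y V (I V) n b f c) i) \<in> chart_functions Y n V b"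
| add: "g \<in> chart_functions Y n V b \<Longrightarrow> h \<in> chart_functions Y n V b \<Longrightarrow>
    (\<lambda>I. g I + h I) \<in> chart_functions Y n V b"
| mult: "g \<in> chart_functions Y n V b \<Longrightarrow> h \<in> chart_functions Y n V b \<Longrightarrow>
    (\<lambda>I. g I * h I) \<in> chart_functions Y n V b"

definition hilb_red :: "('p, 's, 'k::field) kspace \<Rightarrow> nat \<Rightarrow> ('p set \<Rightarrow> 's set, 'k) fspace" where
  "hilb_red Y n =
     \<lparr>ztop = topology_generated_by
        {{I \<in> hilb_chart Y n V b. h I \<noteq> 0} | V b h.
           affine_open Y V \<and> h \<in> chart_functions Y n V b},
      regular = (\<lambda>W. {s. \<forall>I\<in>W. \<exists>V b g h. affine_open Y V \<and> I \<in> hilb_chart Y n V b \<and>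
         g \<in> chart_functions Y n V b \<and> h \<in> chart_functions Y n V b \<and> h I \<noteq> 0 \<and>
         (\<forall>J\<in>W \<inter> hilb_chart Y n V b. h J \<noteq> 0 \<longrightarrow> s J = g J / h J)})\<rparr>"

section \<open>F-blowups\<close>

definition F_blowup ::
  "nat \<Rightarrow> ('p, 's, 'k::field) kspace \<Rightarrow> nat \<Rightarrow> ('p set \<Rightarrow> 's set, 'k) fspace" where
  "F_blowup p X e = reduced_closure (hilb_red (frob_root p X e) (p ^ (e * dimension X)))
     {frob_fiber p X e x | x. smooth_point X x}"

text \<open>\<open>\<pi>\<^sub>e\<close>: the closed point whose reduced subscheme is the scheme-theoretic image under \<open>F\<^sub>e\<close>.\<close>

definition F_blowup_proj :: "nat \<Rightarrow> ('p, 's, 'k) kspace \<Rightarrow> nat \<Rightarrow> ('p set \<Rightarrow> 's set) \<Rightarrow> 'p" where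
  "F_blowup_proj p X e I = (THE x. closed_point X x \<and> frob_image p X e I = point_ideal X x)"

definition smooth_part :: "nat \<Rightarrow> ('p, 's, 'k::field) kspace \<Rightarrow> nat \<Rightarrow> ('p set \<Rightarrow> 's set) set" where
  "smooth_part p X e =
     {I \<in> topspace (ztop (F_blowup p X e)). smooth_point X (F_blowup_proj p X e I)}"

text \<open>The natural birational map, as a map on the part of the domain over the smooth locus.\<close>

definition F_blowup_map ::
  "nat \<Rightarrow> ('p, 's, 'k::field) kspace \<Rightarrow> nat \<Rightarrow> ('p set \<Rightarrow> 's set) \<Rightarrow> ('p set \<Rightarrow> 's set)" where
  "F_blowup_map p X e =
     the_inv_into (smooth_part p X e) (F_blowup_proj p X e) \<circ> F_blowup_proj p X (e + 1)"

end

theory Submission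
  imports Defs "HOL-Library.Function_Algebras" "HOL-Algebra.QuotRing"
begin

text \<open>
  The morphism sends the ideal sheaf \<open>J\<close> of a subscheme of \<open>X\<^sub>e\<^sub>+\<^sub>1\<close> to its scheme-theoretic image
  \<open>{f. f ^ p \<in> J}\<close> in \<open>X\<^sub>e\<close>. What has to be shown is that near each point of the F-blowup this map is given
  by the coordinate functions of the Hilbert scheme charts. A local splitting \<open>\<sigma>\<close> of Frobenius gives the
  \<open>k\<close>-linear idempotent \<open>\<epsilon> y = (\<sigma> y) ^ p\<close> onto the \<open>p\<close>-th powers. It maps the ideal of a Frobenius fibre to
  itself, and as this is a closed condition on \<open>J\<close>, it does so for all points of the F-blowup. Hence \<open>O / J\<close>
  has a basis consisting of \<open>p\<close>-th powers \<open>b\<^sub>i ^ p\<close> with \<open>b\<^sub>i\<close> a basis modulo the image of \<open>J\<close>, completed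
  by elements killed by \<open>\<epsilon>\<close>. In the chart defined by such a basis, applying \<open>\<epsilon>\<close> to the expansion of \<open>f ^ p\<close> modulo
  \<open>J\<close> shows that the coordinates of \<open>f ^ p\<close> are the coordinates of \<open>f\<close> modulo the image of \<open>J\<close>. The
  number of the \<open>b\<^sub>i\<close> is therefore locally constant, and it is computed at a smooth point by counting
  monomials in local parameters.
\<close>

text \<open>A splitting exists only on small open sets, whereas a chart lives on an affine set
  \<open>V\<close> given in advance. Shrinking to the locus \<open>D\<close> where some
  \<open>h\<close> is nonzero brings in denominators, but \<open>h ^ (p ^ (e + 1))\<close> is a
  nonzero constant modulo every \<open>J\<close> supported in \<open>D\<close>. So powers of
  \<open>h\<close> with exponent divisible by \<open>p ^ (e + 1)\<close> act on \<open>O / J\<close>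
  as scalars, and being \<open>p\<close>-th powers they pass through \<open>\<epsilon>\<close>. That
  \<open>p ^ (e + 1)\<close>-th powers are constant modulo \<open>J\<close> is itself a closed
  condition, the vanishing of 2 x 2 minors of coordinates, inherited from the fibres. It also makes
  \<open>J\<close> a single thickened point with residue field \<open>k\<close>; for the fibres
  themselves the residue field comes from their finite length. The length of the image of
  \<open>J\<close> over a singular point has no direct formula, so charts of unknown length
  \<open>r\<close> are carried along until a smooth fibre nearby decides \<open>r\<close>. There the
  monomials give only an upper bound for lengths. At level \<open>e + 1\<close> the length is known
  because the fibre lies in a chart; this makes the monomials independent, and independence descends
  to level \<open>e\<close>.\<close>

section \<open>Additivity of Frobenius in a commutative ring\<close>

lemma (in cring) binomial:
  assumes [simp]: "x \<in> carrier R" "y \<in> carrier R"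
  shows "(x \<oplus> y) [^] (n::nat) = (\<Oplus>k\<in>{..n}. add_pow R (n choose k) (x [^] k \<otimes> y [^] (n - k)))"
proof (induction n)
  case (Suc n)
  let ?m = "\<lambda>k. x [^] Suc k \<otimes> y [^] (n - k)"
  have "(x \<oplus> y) [^] Suc n = (\<Oplus>k\<in>{..n}. add_pow R (n choose k) (x [^] k \<otimes> y [^] (n - k))) \<otimes> x
      \<oplus> (\<Oplus>k\<in>{..n}. add_pow R (n choose k) (x [^] k \<otimes> y [^] (n - k))) \<otimes> y"
    by (simp add: Suc r_distr)
  also have "(\<Oplus>k\<in>{..n}. add_pow R (n choose k) (x [^] k \<otimes> y [^] (n - k))) \<otimes> x
      = (\<Oplus>k\<in>{..n}. add_pow R (n choose k) (?m k))"
    by (subst finsum_ldistr) (auto intro!: finsum_cong' simp: add_pow_ldistr add_pow_rdistr m_ac)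
  also have "(\<Oplus>k\<in>{..n}. add_pow R (n choose k) (x [^] k \<otimes> y [^] (n - k))) \<otimes> y
      = (\<Oplus>k\<in>{..n}. add_pow R (n choose k) (x [^] k \<otimes> y [^] (Suc n - k)))"
    by (subst finsum_ldistr) (auto intro!: finsum_cong' simp: add_pow_ldistr add_pow_rdistr m_ac Suc_diff_le)
  \<comment> \<open>The added term has coefficient \<open>n choose Suc n = 0\<close>. Splitting off
    \<open>k = 0\<close> afterwards shifts the index, so that the two sums match term by term for
    Pascal's rule.\<close>
  also have "\<dots> = (\<Oplus>k\<in>{..Suc n}. add_pow R (n choose k) (x [^] k \<otimes> y [^] (Suc n - k)))"
    by (simp add: binomial_eq_0)
  also have "\<dots> = (\<Oplus>k\<in>{..n}. add_pow R (n choose Suc k) (?m k)) \<oplus> y [^] Suc n"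
    by (subst finsum_Suc2) auto
  finally have "(x \<oplus> y) [^] Suc n =
      (\<Oplus>k\<in>{..n}. add_pow R (n choose k) (?m k)) \<oplus> (\<Oplus>k\<in>{..n}. add_pow R (n choose Suc k) (?m k)) \<oplus> y [^] Suc n"
    by (simp add: a_assoc del: nat_pow_Suc)
  also have "(\<Oplus>k\<in>{..n}. add_pow R (n choose k) (?m k)) \<oplus> (\<Oplus>k\<in>{..n}. add_pow R (n choose Suc k) (?m k))
      = (\<Oplus>k\<in>{..n}. add_pow R (Suc n choose Suc k) (?m k))"
    by (subst finsum_addf [symmetric])
      (auto intro!: finsum_cong' simp: add.nat_pow_mult add.commute simp del: nat_pow_Suc)
  also have "\<dots> \<oplus> y [^] Suc n =
      (\<Oplus>k\<in>{..Suc n}. add_pow R (Suc n choose k) (x [^] k \<otimes> y [^] (Suc n - k)))"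
    by (subst finsum_Suc2) auto
  finally show ?case .
qed simp

lemma (in cring) frobenius_add:
  fixes p :: nat
  assumes "prime p" "add_pow R (p) \<one> = \<zero>" and [simp]: "x \<in> carrier R" "y \<in> carrier R"
  shows "(x \<oplus> y) [^] p ^ e = x [^] p ^ e \<oplus> y [^] p ^ e"
proof (induction e)
  case (Suc e)
  have kill: "add_pow R (p * m) z = \<zero>" if "z \<in> carrier R" for m z
  proof -
    have "add_pow R (p * m) z = add_pow R (m) (add_pow R p \<one> \<otimes> z)"
      using that by (simp add: add_pow_ldistr add.nat_pow_pow)
    then show ?thesis
      using that assms(2) by simp
  qed
  have step: "(a \<oplus> b) [^] p = a [^] p \<oplus> b [^] p" if [simp]: "a \<in> carrier R" "b \<in> carrier R" for a b
  proof -
    \<comment> \<open>The indices strictly between 0 and \<open>p\<close> are exactly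
      \<open>Suc k\<close> with \<open>k \<le> r\<close>. Their binomial coefficients are divisible
      by \<open>p\<close>, so only the two end terms survive.\<close>
    obtain r where r: "p = Suc (Suc r)"
      using prime_ge_2_nat [OF \<open>prime p\<close>] by (metis Suc_nat_number_of_add add_2_eq_Suc le_Suc_ex)
    let ?g = "\<lambda>k. add_pow R (p choose k) (a [^] k \<otimes> b [^] (p - k))"
    have zero: "?g k = \<zero>" if "0 < k" "k < p" for k
    proof -
      have "p dvd (p choose k)"
        using assms(1) that by (intro dvd_choose_prime) auto
      then show ?thesis by (auto elim!: dvdE simp: kill)
    qed
    have "(\<Oplus>k\<in>{..r}. ?g (Suc k)) = (\<Oplus>k\<in>{..r}. \<zero>)"
      using r by (intro finsum_cong' zero) auto
    moreover have "(a \<oplus> b) [^] p = (\<Oplus>k\<in>{..Suc (Suc r)}. ?g k)"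
      using binomial [of a b p] r by simp
    moreover have "\<dots> = ?g (Suc (Suc r)) \<oplus> ((\<Oplus>k\<in>{..r}. ?g (Suc k)) \<oplus> ?g 0)"
      by (subst finsum_Suc, simp, subst finsum_Suc2, simp_all)
    ultimately show ?thesis
      by (simp add: r [symmetric] del: nat_pow_Suc)
  qed
  have "z [^] p ^ Suc e = (z [^] p ^ e) [^] p" if "z \<in> carrier R" for z
    using that by (simp add: nat_pow_pow mult.commute)
  then show ?case
    by (simp add: Suc step)
qed simp

section \<open>Families of vectors and coordinate spaces\<close>

locale vector_families = vector_space
begin

text \<open>Independence of an indexed family, so that a repetition counts as a relation. Chart
  bases are tuples, and independence of the set of entries would not see a repeated entry.\<close>

definition fam_indep :: "'i set \<Rightarrow> ('i \<Rightarrow> 'b) \<Rightarrow> bool" where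
  "fam_indep I u \<longleftrightarrow> (\<forall>c. (\<Sum>i\<in>I. c i *s u i) = 0 \<longrightarrow> (\<forall>i\<in>I. c i = 0))"

definition fam_basis :: "'b set \<Rightarrow> 'i set \<Rightarrow> ('i \<Rightarrow> 'b) \<Rightarrow> bool" where
  "fam_basis S I u \<longleftrightarrow> u ` I \<subseteq> S \<and> S \<subseteq> span (u ` I) \<and> fam_indep I u"

lemma fam_indepD:
  "fam_indep I u \<Longrightarrow> (\<Sum>i\<in>I. c i *s u i) = 0 \<Longrightarrow> i \<in> I \<Longrightarrow> c i = 0"
  by (simp add: fam_indep_def)

lemma span_fam:
  assumes "finite I"
  shows "v \<in> span (u ` I) \<longleftrightarrow> (\<exists>c. v = (\<Sum>i\<in>I. c i *s u i))"
proof
  assume "v \<in> span (u ` I)"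
  then show "\<exists>c. v = (\<Sum>i\<in>I. c i *s u i)"
  proof (induction rule: span_induct_alt)
    case base
    show ?case by (rule exI [of _ "\<lambda>_. 0"]) simp
  next
    case (step c x y)
    then obtain i d where i: "i \<in> I" "x = u i" and y: "y = (\<Sum>i\<in>I. d i *s u i)"
      by blast
    have "(\<Sum>j\<in>I. (d j + (if j = i then c else 0)) *s u j)
        = y + (\<Sum>j\<in>I. (if j = i then c *s u j else 0))"
      unfolding y sum.distrib [symmetric]
      by (intro sum.cong) (auto simp: scale_left_distrib)
    also have "\<dots> = c *s x + y"
      using i assms by (simp add: sum.delta add.commute)
    finally show ?case by metis
  qed
next
  assume "\<exists>c. v = (\<Sum>i\<in>I. c i *s u i)"
  then show "v \<in> span (u ` I)"
    by (auto intro: span_sum span_scale span_base)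
qed

lemma fam_indep_iff:
  assumes "finite I"
  shows "fam_indep I u \<longleftrightarrow> inj_on u I \<and> independent (u ` I)"
proof
  assume u: "fam_indep I u"
  have inj: "inj_on u I"
  proof (rule inj_onI, rule ccontr)
    fix i j assume ij: "i \<in> I" "j \<in> I" "u i = u j" "i \<noteq> j"
    \<comment> \<open>A repetition \<open>u i = u j\<close> gives the relation with coefficient 1 at
      \<open>i\<close> and -1 at \<open>j\<close>.\<close>
    have "(\<Sum>l\<in>I. ((if l = i then 1 else 0) - (if l = j then 1 else 0)) *s u l)
        = (\<Sum>l\<in>I. (if l = i then u l else 0)) - (\<Sum>l\<in>I. (if l = j then u l else 0))"
      unfolding sum_subtractf [symmetric] by (intro sum.cong) (auto simp: scale_left_diff_distrib)
    also have "\<dots> = 0"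
      using ij assms by (simp add: sum.delta)
    finally show False
      using u ij(1,4) unfolding fam_indep_def by fastforce
  qed
  moreover have "independent (u ` I)"
  proof (rule independent_if_scalars_zero)
    fix f x assume "(\<Sum>x\<in>u ` I. f x *s x) = 0" "x \<in> u ` I"
    then show "f x = 0"
      using u unfolding fam_indep_def by (auto simp: sum.reindex [OF inj] o_def)
  qed (use assms in simp)
  ultimately show "inj_on u I \<and> independent (u ` I)" ..
next
  assume *: "inj_on u I \<and> independent (u ` I)"
  show "fam_indep I u"
    unfolding fam_indep_def
  proof (intro allI impI ballI)
    fix c i assume c: "(\<Sum>i\<in>I. c i *s u i) = 0" and i: "i \<in> I"
    have "(\<Sum>v\<in>u ` I. c (the_inv_into I u v) *s v) = 0"
      using * c by (simp add: sum.reindex the_inv_into_f_f cong: sum.cong)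
    then have "c (the_inv_into I u (u i)) = 0"
      using * i assms by (intro independentD [of "u ` I" "u ` I"]) auto
    then show "c i = 0" using * i by (simp add: the_inv_into_f_f)
  qed
qed

lemma fam_basis_card:
  assumes "fam_basis S I u" "fam_basis S J w" "finite I" "finite J"
  shows "card I = card J"
proof -
  have "card (u ` I) = dim S" "card (w ` J) = dim S"
    using assms by (auto simp: fam_basis_def fam_indep_iff intro!: basis_card_eq_dim)
  then show ?thesis
    using assms by (simp add: fam_basis_def fam_indep_iff card_image)
qed

lemma fam_basis_coords:
  assumes "fam_basis S I u" "finite I" "v \<in> S"
  shows "\<exists>c. v = (\<Sum>i\<in>I. c i *s u i)"
  using assms span_fam [of I v u] by (auto simp: fam_basis_def)

text \<open>A maximal independent subset of the family still spans, so it has as many elements as a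
  basis; as the family has at most that many members, nothing was repeated or discarded. This turns
  a count of monomials into their independence.\<close>

lemma spanning_fam_basis:
  assumes "fam_basis S I u" "finite I" "finite J" "w ` J \<subseteq> S" "S \<subseteq> span (w ` J)" "card J \<le> card I"
  shows "fam_basis S J w"
proof -
  have dim: "dim S = card I"
    using assms(1,2) basis_card_eq_dim [of "u ` I" S]
    by (auto simp: fam_basis_def fam_indep_iff card_image)
  obtain B where B: "B \<subseteq> w ` J" "independent B" "w ` J \<subseteq> span B"
    using maximal_independent_subset by blast
  have "S \<subseteq> span B"
    using assms(5) B(3) by (metis span_minimal subspace_span subset_trans)
  then have "card B = card I"
    using B assms(4) basis_card_eq_dim [of B S] dim by auto
  then have "card J \<le> card B" "finite (w ` J)"
    using assms by auto
  moreover have "card B \<le> card (w ` J)"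
    using B(1) assms(3) by (intro card_mono) auto
  moreover have "card (w ` J) \<le> card J"
    using assms(3) by (rule card_image_le)
  ultimately have "card B = card (w ` J)" "card (w ` J) = card J"
    by linarith+
  then have "B = w ` J" "card (w ` J) = card J"
    using card_subset_eq [OF \<open>finite (w ` J)\<close> B(1)] by auto
  then show ?thesis
    using assms B by (auto simp: fam_basis_def fam_indep_iff eq_card_imp_inj_on)
qed

lemma fam_indep_card_le:
  assumes "fam_basis S I u" "finite I" "finite J" "w ` J \<subseteq> S" "fam_indep J w"
  shows "card J \<le> card I"
proof -
  have "w ` J \<subseteq> span (u ` I)"
    using assms by (auto simp: fam_basis_def)
  then have "card (w ` J) \<le> card (u ` I)"
    using assms independent_span_bound [of "u ` I" "w ` J"] by (auto simp: fam_indep_iff)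
  then show ?thesis
    using assms by (auto simp: fam_basis_def fam_indep_iff card_image)
qed

text \<open>Steinitz exchange with prescribed sources: \<open>u\<close> is kept as the initial
  segment and every further vector comes from \<open>T\<close>. With \<open>p\<close>-th powers for
  \<open>u\<close> and elements killed by \<epsilon> for \<open>T\<close> it produces the adapted
  basis of a chart.\<close>

lemma fam_basis_extend:
  assumes S: "fam_basis S {..<n} e" and u: "fam_indep {..<r} u" "u ` {..<r} \<subseteq> S"
    and T: "T \<subseteq> S" "S \<subseteq> span (u ` {..<r} \<union> T)"
  shows "r \<le> n \<and> (\<exists>w. fam_basis S {..<n::nat} w \<and> (\<forall>i<r. w i = u i) \<and> (\<forall>i<n. r \<le> i \<longrightarrow> w i \<in> T))"
proof -
  have u': "inj_on u {..<r}" "independent (u ` {..<r})"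
    using u(1) by (auto simp: fam_indep_iff)
  obtain B where B: "u ` {..<r} \<subseteq> B" "B \<subseteq> u ` {..<r} \<union> T" "independent B" "u ` {..<r} \<union> T \<subseteq> span B"
    using maximal_independent_subset_extend [OF Un_upper1 u'(2), of T] by blast
  have SB: "S \<subseteq> span B"
    using T(2) B(4) by (metis span_minimal subspace_span subset_trans)
  have BS: "B \<subseteq> S"
    using B(2) u(2) T(1) by blast
  have card: "card B = n"
    using S B(3) SB BS basis_card_eq_dim [of B S] basis_card_eq_dim [of "e ` {..<n}" S]
    by (auto simp: fam_basis_def fam_indep_iff card_image)
  have "B \<subseteq> span (e ` {..<n})"
    using BS S by (auto simp: fam_basis_def)
  then have fin: "finite B"
    using independent_span_bound [of "e ` {..<n}" B] B(3) by auto
  have card_u: "card (u ` {..<r}) = r"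
    using u'(1) by (simp add: card_image)
  then have rn: "r \<le> n"
    using card_mono [OF fin B(1)] card by simp
  \<comment> \<open>The count lets the remaining elements of \<open>B\<close> be numbered from
    \<open>r\<close> to \<open>n - 1\<close>, directly after the entries of
    \<open>u\<close>.\<close>
  have "card (B - u ` {..<r}) = card {r..<n}"
    using card card_u B(1) fin by (simp add: card_Diff_subset)
  then obtain f where f: "bij_betw f {r..<n} (B - u ` {..<r})"
    using fin by (metis finite_Diff finite_atLeastLessThan finite_same_card_bij)
  define w where "w i = (if i < r then u i else f i)" for i
  have im: "w ` {..<n} = B"
  proof -
    have "{..<n} = {..<r} \<union> {r..<n}" using rn by auto
    then have "w ` {..<n} = w ` {..<r} \<union> w ` {r..<n}" by auto
    also have "\<dots> = u ` {..<r} \<union> f ` {r..<n}"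
      by (auto simp: w_def)
    finally show ?thesis
      using f B(1) by (auto simp: bij_betw_def)
  qed
  then have "inj_on w {..<n}"
    using card by (intro eq_card_imp_inj_on) auto
  then have "fam_basis S {..<n} w"
    using im B(3) SB BS by (auto simp: fam_basis_def fam_indep_iff)
  moreover have "w i \<in> T" if "i < n" "r \<le> i" for i
  proof -
    have "f i \<in> B - u ` {..<r}"
      using bij_betwE [OF f] that by simp
    then show ?thesis using B(2) that by (auto simp: w_def)
  qed
  ultimately show ?thesis
    using rn by (auto simp: w_def)
qed

lemma subspace_has_fam_basis:
  assumes "fam_basis S {..<n::nat} e" "subspace V" "V \<subseteq> S"
  obtains r and u :: "nat \<Rightarrow> 'b" where "fam_basis V {..<r} u"
proof -
  obtain B where B: "B \<subseteq> V" "independent B" "V \<subseteq> span B"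
    using maximal_independent_subset by blast
  have "B \<subseteq> span (e ` {..<n})"
    using B(1) assms by (auto simp: fam_basis_def)
  then have fin: "finite B"
    using independent_span_bound [of "e ` {..<n}" B, OF _ B(2)] by simp
  then obtain u where "bij_betw u {..<card B} B"
    using ex_bij_betw_nat_finite [of B] by (auto simp: lessThan_atLeast0)
  then have "fam_basis V {..<card B} u"
    using B by (auto simp: fam_basis_def fam_indep_iff bij_betw_def)
  then show ?thesis by (rule that)
qed

end

definition coord_scale :: "'k \<Rightarrow> (nat \<Rightarrow> 'k::field) \<Rightarrow> nat \<Rightarrow> 'k" where
  "coord_scale c v = (\<lambda>i. c * v i)"

text \<open>The space k^n as sequences padded with zeros, so that all dimensions share one type. The
  padding matches the clause of \<open>coords\<close> that forces the coefficients from index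
  \<open>n\<close> on to be zero.\<close>

definition coord_space :: "nat \<Rightarrow> (nat \<Rightarrow> 'k::field) set" where
  "coord_space n = {v. \<forall>i\<ge>n. v i = 0}"

definition unit_coord :: "nat \<Rightarrow> nat \<Rightarrow> 'k::field" where
  "unit_coord i = (\<lambda>j. if j = i then 1 else 0)"

global_interpretation cs: vector_families "coord_scale :: 'k \<Rightarrow> (nat \<Rightarrow> 'k::field) \<Rightarrow> nat \<Rightarrow> 'k"
  by unfold_locales (auto simp: coord_scale_def algebra_simps)

lemma ex1_imp_eq: "\<exists>!x. P x \<Longrightarrow> P a \<Longrightarrow> P b \<Longrightarrow> a = b"
  by blast

lemma sum_unit_coord:
  "(\<Sum>i<n. coord_scale (c i) (unit_coord i)) = (\<lambda>i. if i < n then c i else 0)"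
  by (induction n) (auto simp: coord_scale_def unit_coord_def fun_eq_iff less_Suc_eq)

lemma coord_space_basis: "cs.fam_basis (coord_space n) {..<n} unit_coord"
proof -
  have "v \<in> cs.span (unit_coord ` {..<n})" if "v \<in> coord_space n" for v :: "nat \<Rightarrow> 'a"
  proof -
    have "v = (\<Sum>i<n. coord_scale (v i) (unit_coord i))"
      using that by (auto simp: sum_unit_coord coord_space_def fun_eq_iff)
    then show ?thesis by (auto simp: cs.span_fam)
  qed
  moreover have "cs.fam_indep {..<n} (unit_coord :: nat \<Rightarrow> nat \<Rightarrow> 'a)"
    unfolding cs.fam_indep_def by (auto simp: sum_unit_coord fun_eq_iff split: if_splits)
  ultimately show ?thesis
    by (auto simp: cs.fam_basis_def coord_space_def unit_coord_def)
qed

text \<open>Charts describe a basis by unique existence of coordinates; this passes to span and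
  independence, where dimension theory applies. Independence is uniqueness of the coordinates of the
  vector 0.\<close>

lemma fam_basis_iff_ex1_coords:
  assumes V: "cs.subspace V"
  shows "cs.fam_basis V {..<m::nat} u \<longleftrightarrow> (\<forall>i<m. u i \<in> V) \<and>
    (\<forall>v\<in>V. \<exists>!c. (\<forall>i\<ge>m. c i = 0) \<and> v = (\<Sum>i<m. coord_scale (c i) (u i)))"
proof (intro iffI conjI ballI)
  assume b: "cs.fam_basis V {..<m} u"
  then show "\<forall>i<m. u i \<in> V" by (auto simp: cs.fam_basis_def)
  fix v assume "v \<in> V"
  then obtain c where c: "v = (\<Sum>i<m. coord_scale (c i) (u i))"
    using cs.fam_basis_coords [OF b finite_lessThan] by blast
  let ?c = "\<lambda>i. if i < m then c i else 0"
  show "\<exists>!c. (\<forall>i\<ge>m. c i = 0) \<and> v = (\<Sum>i<m. coord_scale (c i) (u i))"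
  proof (rule ex1I [of _ ?c])
    show "(\<forall>i\<ge>m. ?c i = 0) \<and> v = (\<Sum>i<m. coord_scale (?c i) (u i))"
      by (simp add: c)
    fix d assume d: "(\<forall>i\<ge>m. d i = 0) \<and> v = (\<Sum>i<m. coord_scale (d i) (u i))"
    then have "(\<Sum>i<m. coord_scale (d i - c i) (u i)) = 0"
      using c by (simp add: cs.scale_left_diff_distrib sum_subtractf)
    then have "d i - c i = 0" if "i < m" for i
      using b that cs.fam_indepD [of "{..<m}" u "\<lambda>i. d i - c i" i]
      by (simp add: cs.fam_basis_def)
    then show "d = ?c"
      using d by (auto simp: fun_eq_iff not_less)
  qed
next
  assume *: "(\<forall>i<m. u i \<in> V) \<and>
    (\<forall>v\<in>V. \<exists>!c. (\<forall>i\<ge>m. c i = 0) \<and> v = (\<Sum>i<m. coord_scale (c i) (u i)))"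
  have "V \<subseteq> cs.span (u ` {..<m})"
  proof
    fix v assume "v \<in> V"
    then have "\<exists>!c. (\<forall>i\<ge>m. c i = 0) \<and> v = (\<Sum>i<m. coord_scale (c i) (u i))"
      using * by blast
    then show "v \<in> cs.span (u ` {..<m})"
      unfolding cs.span_fam [OF finite_lessThan] by blast
  qed
  moreover have "cs.fam_indep {..<m} u"
    unfolding cs.fam_indep_def
  proof (intro allI impI)
    fix c assume c: "(\<Sum>i<m. coord_scale (c i) (u i)) = 0"
    let ?c = "\<lambda>i. if i < m then c i else 0"
    have "0 \<in> V" using V by (simp add: cs.subspace_0)
    define P where "P d \<longleftrightarrow> (\<forall>i\<ge>m. d i = 0) \<and> 0 = (\<Sum>i<m. coord_scale (d i) (u i))" for d
    have "\<exists>!c. P c"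
      using * \<open>0 \<in> V\<close> unfolding P_def by blast
    moreover have "P ?c" "P (\<lambda>_. 0)"
      by (simp_all add: c P_def)
    ultimately have eq: "?c = (\<lambda>_. 0)" by (rule ex1_imp_eq [of P])
    show "\<forall>i\<in>{..<m}. c i = 0"
    proof
      fix i assume "i \<in> {..<m}"
      then show "c i = 0" using fun_cong [OF eq, of i] by simp
    qed
  qed
  ultimately show "cs.fam_basis V {..<m} u"
    using * by (auto simp: cs.fam_basis_def)
qed

section \<open>Varieties in characteristic p\<close>

text \<open>Stands in for equality in the quotient ring. Membership in the carrier is built in, so
  that chains of congruences bring their own side conditions.\<close>

definition cg :: "('a, 'b) ring_scheme \<Rightarrow> 'a set \<Rightarrow> 'a \<Rightarrow> 'a \<Rightarrow> bool" where
  "cg R I a b \<longleftrightarrow> a \<in> carrier R \<and> b \<in> carrier R \<and> a \<ominus>\<^bsub>R\<^esub> b \<in> I"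

context ideal
begin

lemma cg_carrier: "cg R I a b \<Longrightarrow> a \<in> carrier R" "cg R I a b \<Longrightarrow> b \<in> carrier R"
  by (auto simp: cg_def)

lemma cg_refl: "a \<in> carrier R \<Longrightarrow> cg R I a a"
  by (auto simp: cg_def a_minus_def r_neg)

lemma cg_sym:
  assumes "cg R I a b" shows "cg R I b a"
proof -
  have "b \<ominus> a = \<ominus> (a \<ominus> b)"
    using assms by (simp add: cg_def a_minus_def minus_add a_comm)
  then show ?thesis
    using assms by (auto simp: cg_def a_inv_closed)
qed

lemma cg_trans:
  assumes "cg R I a b" "cg R I b c" shows "cg R I a c"
proof -
  have [simp]: "a \<in> carrier R" "b \<in> carrier R" "c \<in> carrier R"
    using assms by (auto simp: cg_def)
  have "a \<ominus> c = (a \<ominus> b) \<oplus> (b \<ominus> c)"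
    by (simp add: a_minus_def a_assoc [symmetric]) (simp add: a_assoc l_neg)
  then show ?thesis
    using assms by (auto simp: cg_def intro: a_closed)
qed

lemma cg_add:
  assumes "cg R I a b" "cg R I c d" shows "cg R I (a \<oplus> c) (b \<oplus> d)"
proof -
  have [simp]: "a \<in> carrier R" "b \<in> carrier R" "c \<in> carrier R" "d \<in> carrier R"
    using assms by (auto simp: cg_def)
  have "(a \<oplus> c) \<ominus> (b \<oplus> d) = (a \<ominus> b) \<oplus> (c \<ominus> d)"
    by (simp add: a_minus_def minus_add a_ac)
  then show ?thesis
    using assms by (auto simp: cg_def intro: a_closed)
qed

lemma cg_mult:
  assumes "cg R I a b" "cg R I c d" shows "cg R I (a \<otimes> c) (b \<otimes> d)"
proof -
  have [simp]: "a \<in> carrier R" "b \<in> carrier R" "c \<in> carrier R" "d \<in> carrier R"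
    using assms by (auto simp: cg_def)
  have "(a \<otimes> c) \<ominus> (b \<otimes> d) = a \<otimes> (c \<ominus> d) \<oplus> (a \<ominus> b) \<otimes> d"
    by (simp add: a_minus_def l_distr r_distr r_minus l_minus a_assoc [symmetric])
       (simp add: a_assoc l_neg)
  moreover have "a \<otimes> (c \<ominus> d) \<in> I" "(a \<ominus> b) \<otimes> d \<in> I"
    using assms by (auto simp: cg_def intro: I_l_closed I_r_closed)
  ultimately show ?thesis
    by (simp add: cg_def a_closed)
qed

lemma cg_pow: "cg R I a b \<Longrightarrow> cg R I (a [^] (n::nat)) (b [^] n)"
  by (induction n) (auto intro: cg_mult cg_refl)

lemma cg_minus:
  assumes "cg R I a b" "cg R I c d" shows "cg R I (a \<ominus> c) (b \<ominus> d)"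
proof -
  have *: "a \<in> carrier R" "b \<in> carrier R" "c \<in> carrier R" "d \<in> carrier R"
    using assms by (auto simp: cg_def)
  have "cg R I (a \<oplus> \<ominus> \<one> \<otimes> c) (b \<oplus> \<ominus> \<one> \<otimes> d)"
    by (intro cg_add cg_mult assms cg_refl) simp
  then show ?thesis
    using * by (simp add: a_minus_def l_minus)
qed

lemma mem_iff_cg_zero: "a \<in> carrier R \<Longrightarrow> a \<in> I \<longleftrightarrow> cg R I a \<zero>"
  by (simp add: cg_def a_minus_def)

lemma cg_mem: "cg R I a b \<Longrightarrow> a \<in> I \<longleftrightarrow> b \<in> I"
  by (meson cg_carrier cg_sym cg_trans mem_iff_cg_zero)

end

lemma (in cring) Units_factor:
  assumes "a \<otimes> b \<in> Units R" "a \<in> carrier R" "b \<in> carrier R"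
  shows "a \<in> Units R"
proof -
  have "a \<otimes> (b \<otimes> inv (a \<otimes> b)) = \<one>"
    using assms by (simp add: m_assoc [symmetric])
  moreover have "b \<otimes> inv (a \<otimes> b) \<in> carrier R"
    using assms by simp
  ultimately show ?thesis
    using assms(2) m_comm unfolding Units_def by fastforce
qed

locale char_p_variety =
  fixes X :: "('p, 's, 'k::alg_closed_field) kspace" and p :: nat
  assumes char: "CHAR('k) = p" and p_pos: "p > 0" and variety: "variety X"
begin

abbreviation (input) opn :: "'p set \<Rightarrow> bool" where "opn U \<equiv> openin (sp X) U"
abbreviation (input) \<O> :: "'p set \<Rightarrow> 's ring" where "\<O> U \<equiv> sec X U"

section \<open>Section rings, restriction maps and constants\<close>

lemma prime_p: "prime p"
  using char p_pos prime_CHAR_semidom [where 'a = 'k] by simp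

lemma ringed: "ringed_kspace X"
  using variety by (simp add: variety_def kscheme_def)

lemma cringO: "opn U \<Longrightarrow> cring (\<O> U)"
  using ringed by (simp add: ringed_kspace_def)

lemma ringO: "opn U \<Longrightarrow> ring (\<O> U)"
  using cringO cring_def by blast

lemma res_hom: "opn U \<Longrightarrow> opn V \<Longrightarrow> V \<subseteq> U \<Longrightarrow> res X U V \<in> ring_hom (\<O> U) (\<O> V)"
  using ringed by (simp add: ringed_kspace_def)

lemma res_ring_hom:
  assumes "opn U" "opn V" "V \<subseteq> U"
  shows "ring_hom_cring (\<O> U) (\<O> V) (res X U V)"
proof -
  interpret U: cring "\<O> U" using assms(1) by (rule cringO)
  interpret V: cring "\<O> V" using assms(2) by (rule cringO)
  show ?thesis
    by unfold_locales (rule res_hom [OF assms])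
qed

context
  fixes U V assumes UV [simp]: "opn U" "opn V" "V \<subseteq> U"
begin

interpretation h: ring_hom_cring "\<O> U" "\<O> V" "res X U V"
  by (rule res_ring_hom) fact+

lemma res_closed [simp]: "f \<in> carrier (\<O> U) \<Longrightarrow> res X U V f \<in> carrier (\<O> V)"
  by simp
lemma res_add [simp]: "f \<in> carrier (\<O> U) \<Longrightarrow> g \<in> carrier (\<O> U) \<Longrightarrow>
    res X U V (f \<oplus>\<^bsub>\<O> U\<^esub> g) = res X U V f \<oplus>\<^bsub>\<O> V\<^esub> res X U V g"
  by simp
lemma res_mult [simp]: "f \<in> carrier (\<O> U) \<Longrightarrow> g \<in> carrier (\<O> U) \<Longrightarrow>
    res X U V (f \<otimes>\<^bsub>\<O> U\<^esub> g) = res X U V f \<otimes>\<^bsub>\<O> V\<^esub> res X U V g"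
  by simp
lemma res_one [simp]: "res X U V \<one>\<^bsub>\<O> U\<^esub> = \<one>\<^bsub>\<O> V\<^esub>"
  by simp
lemma res_zero [simp]: "res X U V \<zero>\<^bsub>\<O> U\<^esub> = \<zero>\<^bsub>\<O> V\<^esub>"
  by simp
lemma res_neg [simp]: "f \<in> carrier (\<O> U) \<Longrightarrow>
    res X U V (\<ominus>\<^bsub>\<O> U\<^esub> f) = \<ominus>\<^bsub>\<O> V\<^esub> res X U V f"
  by simp
lemma res_minus [simp]: "f \<in> carrier (\<O> U) \<Longrightarrow> g \<in> carrier (\<O> U) \<Longrightarrow>
    res X U V (f \<ominus>\<^bsub>\<O> U\<^esub> g) = res X U V f \<ominus>\<^bsub>\<O> V\<^esub> res X U V g"
  by (simp add: a_minus_def)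
lemma res_pow [simp]: "f \<in> carrier (\<O> U) \<Longrightarrow>
    res X U V (f [^]\<^bsub>\<O> U\<^esub> (n::nat)) = res X U V f [^]\<^bsub>\<O> V\<^esub> n"
  by simp
lemma res_Units: "f \<in> Units (\<O> U) \<Longrightarrow> res X U V f \<in> Units (\<O> V)"
  unfolding Units_def
proof safe
  fix g assume "f \<in> carrier (\<O> U)" "g \<in> carrier (\<O> U)"
    "g \<otimes>\<^bsub>\<O> U\<^esub> f = \<one>\<^bsub>\<O> U\<^esub>" "f \<otimes>\<^bsub>\<O> U\<^esub> g = \<one>\<^bsub>\<O> U\<^esub>"
  then show "\<exists>g\<in>carrier (\<O> V). g \<otimes>\<^bsub>\<O> V\<^esub> res X U V f = \<one>\<^bsub>\<O> V\<^esub> \<and>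
      res X U V f \<otimes>\<^bsub>\<O> V\<^esub> g = \<one>\<^bsub>\<O> V\<^esub>"
    by (metis h.hom_closed h.hom_mult h.hom_one)
qed simp
lemma res_cst [simp]: "res X U V (cst X U c) = cst X V c"
  using ringed UV by (simp add: ringed_kspace_def)

end

lemma res_id [simp]: "opn U \<Longrightarrow> f \<in> carrier (\<O> U) \<Longrightarrow> res X U U f = f"
  using ringed by (simp add: ringed_kspace_def)

lemma res_res [simp]:
  "opn U \<Longrightarrow> opn V \<Longrightarrow> opn W \<Longrightarrow> W \<subseteq> V \<Longrightarrow> V \<subseteq> U \<Longrightarrow> f \<in> carrier (\<O> U) \<Longrightarrow>
    res X V W (res X U V f) = res X U W f"
  using ringed by (simp add: ringed_kspace_def)

lemma k_cring: "cring (k_ring :: 'k ring)"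
proof (rule cringI)
  show "abelian_group (k_ring :: 'k ring)"
  proof (rule abelian_groupI)
    show "\<exists>y\<in>carrier (k_ring :: 'k ring). y \<oplus>\<^bsub>k_ring\<^esub> x = \<zero>\<^bsub>k_ring\<^esub>" for x :: 'k
      by (rule bexI [of _ "- x"]) (auto simp: k_ring_def)
  qed (auto simp: k_ring_def)
  show "Group.comm_monoid (k_ring :: 'k ring)"
    by (rule comm_monoidI) (auto simp: k_ring_def)
qed (auto simp: k_ring_def algebra_simps)

lemma cst_hom: "opn U \<Longrightarrow> cst X U \<in> ring_hom k_ring (\<O> U)"
  using ringed by (simp add: ringed_kspace_def)

context
  fixes U assumes U [simp]: "opn U"
begin

interpretation R: cring "\<O> U" by (rule cringO) fact
interpretation k: cring "k_ring :: 'k ring" by (rule k_cring)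
interpretation h: ring_hom_cring "k_ring :: 'k ring" "\<O> U" "cst X U"
  by unfold_locales (rule cst_hom [OF U])

lemma cst_closed [simp]: "cst X U c \<in> carrier (\<O> U)"
  using h.hom_closed [of c] by (simp add: k_ring_def)
lemma cst_zero: "cst X U 0 = \<zero>\<^bsub>\<O> U\<^esub>"
  using h.hom_zero by (simp add: k_ring_def)
lemma cst_one: "cst X U 1 = \<one>\<^bsub>\<O> U\<^esub>"
  using h.hom_one by (simp add: k_ring_def)
lemma cst_add: "cst X U (c + d) = cst X U c \<oplus>\<^bsub>\<O> U\<^esub> cst X U d"
  using h.hom_add [of c d] by (simp add: k_ring_def)
lemma cst_mult: "cst X U (c * d) = cst X U c \<otimes>\<^bsub>\<O> U\<^esub> cst X U d"
  using h.hom_mult [of c d] by (simp add: k_ring_def)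
lemma cst_neg: "cst X U (- c) = \<ominus>\<^bsub>\<O> U\<^esub> cst X U c"
proof -
  have "cst X U (- c) \<oplus>\<^bsub>\<O> U\<^esub> cst X U c = \<zero>\<^bsub>\<O> U\<^esub>"
    by (simp add: cst_add [symmetric] cst_zero)
  then show ?thesis by (simp add: R.minus_equality)
qed
lemma cst_pow: "cst X U (c ^ n) = cst X U c [^]\<^bsub>\<O> U\<^esub> n"
  by (induction n) (auto simp: cst_one cst_mult R.m_comm)
lemma cst_Units: "c \<noteq> 0 \<Longrightarrow> cst X U c \<in> Units (\<O> U)"
  unfolding Units_def
  by (auto intro!: bexI [of _ "cst X U (inverse c)"] simp: cst_mult [symmetric] cst_one)
lemma p_zero: "add_pow (\<O> U) p \<one>\<^bsub>\<O> U\<^esub> = \<zero>\<^bsub>\<O> U\<^esub>"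
proof -
  have "add_pow (\<O> U) n \<one>\<^bsub>\<O> U\<^esub> = cst X U (of_nat n)" for n :: nat
    by (induction n) (auto simp: cst_add cst_zero cst_one R.a_comm)
  then show ?thesis
    using char of_nat_CHAR [where 'a = 'k] by (simp add: cst_zero)
qed
lemma frob_add:
  "f \<in> carrier (\<O> U) \<Longrightarrow> g \<in> carrier (\<O> U) \<Longrightarrow>
    (f \<oplus>\<^bsub>\<O> U\<^esub> g) [^]\<^bsub>\<O> U\<^esub> (p ^ e) = f [^]\<^bsub>\<O> U\<^esub> (p ^ e) \<oplus>\<^bsub>\<O> U\<^esub> g [^]\<^bsub>\<O> U\<^esub> (p ^ e)"
  by (rule R.frobenius_add [OF prime_p p_zero])
lemma frob_mult:
  "f \<in> carrier (\<O> U) \<Longrightarrow> g \<in> carrier (\<O> U) \<Longrightarrow>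
    (f \<otimes>\<^bsub>\<O> U\<^esub> g) [^]\<^bsub>\<O> U\<^esub> (n::nat) = f [^]\<^bsub>\<O> U\<^esub> n \<otimes>\<^bsub>\<O> U\<^esub> g [^]\<^bsub>\<O> U\<^esub> n"
  by (rule R.nat_pow_distrib)
lemma frob_zero: "\<zero>\<^bsub>\<O> U\<^esub> [^]\<^bsub>\<O> U\<^esub> (p ^ e) = \<zero>\<^bsub>\<O> U\<^esub>"
  using p_pos by (intro R.nat_pow_zero) simp
lemma frob_neg:
  assumes [simp]: "f \<in> carrier (\<O> U)"
  shows "(\<ominus>\<^bsub>\<O> U\<^esub> f) [^]\<^bsub>\<O> U\<^esub> (p ^ e) = \<ominus>\<^bsub>\<O> U\<^esub> (f [^]\<^bsub>\<O> U\<^esub> (p ^ e))"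
proof -
  have "(\<ominus>\<^bsub>\<O> U\<^esub> f) [^]\<^bsub>\<O> U\<^esub> (p ^ e) \<oplus>\<^bsub>\<O> U\<^esub> f [^]\<^bsub>\<O> U\<^esub> (p ^ e) = \<zero>\<^bsub>\<O> U\<^esub>"
    by (simp add: frob_add [symmetric] R.l_neg frob_zero)
  then show ?thesis by (simp add: R.minus_equality)
qed
lemma frob_minus:
  assumes [simp]: "f \<in> carrier (\<O> U)" "g \<in> carrier (\<O> U)"
  shows "(f \<ominus>\<^bsub>\<O> U\<^esub> g) [^]\<^bsub>\<O> U\<^esub> (p ^ e) = f [^]\<^bsub>\<O> U\<^esub> (p ^ e) \<ominus>\<^bsub>\<O> U\<^esub> g [^]\<^bsub>\<O> U\<^esub> (p ^ e)"
  by (simp add: a_minus_def frob_add frob_neg)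

end

section \<open>Nonvanishing loci and the prime ideals of points\<close>

lemma nonvanI:
  "opn W \<Longrightarrow> x \<in> W \<Longrightarrow> W \<subseteq> U \<Longrightarrow> res X U W f \<in> Units (\<O> W) \<Longrightarrow> x \<in> nonvan X U f"
  unfolding nonvan_def by blast

lemma nonvan_subset: "nonvan X U f \<subseteq> U"
  by (auto simp: nonvan_def)

lemma open_nonvan: "opn (nonvan X U f)"
proof (subst openin_subopen, safe)
  fix x assume "x \<in> nonvan X U f"
  then show "\<exists>T. opn T \<and> x \<in> T \<and> T \<subseteq> nonvan X U f"
    by (force simp: nonvan_def)
qed

lemma nonvan_res:
  assumes [simp]: "opn U" "opn W" "W \<subseteq> U" "f \<in> carrier (\<O> U)"
  shows "nonvan X W (res X U W f) = nonvan X U f \<inter> W"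
proof safe
  fix x assume "x \<in> nonvan X W (res X U W f)"
  then obtain T where T: "opn T" "x \<in> T" "T \<subseteq> W" "res X W T (res X U W f) \<in> Units (\<O> T)"
    by (auto simp: nonvan_def)
  moreover have "T \<subseteq> U"
    using assms(3) T(3) by blast
  moreover have "res X U T f \<in> Units (\<O> T)"
    using T assms(3) by simp
  ultimately show "x \<in> nonvan X U f"
    using T(1,2) unfolding nonvan_def by blast
  show "x \<in> W" using T by auto
next
  fix x assume x: "x \<in> nonvan X U f" "x \<in> W"
  then obtain T where T [simp]: "opn T" "T \<subseteq> U" and T': "x \<in> T"  "res X U T f \<in> Units (\<O> T)"
    by (auto simp: nonvan_def)
  have [simp]: "opn (T \<inter> W)" "T \<inter> W \<subseteq> U"
    using T(2) by (simp_all add: openin_Int le_infI1)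
  have "res X T (T \<inter> W) (res X U T f) \<in> Units (\<O> (T \<inter> W))"
    by (rule res_Units) (use T' in auto)
  then have "res X W (T \<inter> W) (res X U W f) \<in> Units (\<O> (T \<inter> W))"
    by simp
  then show "x \<in> nonvan X W (res X U W f)"
    using x T' by (intro nonvanI [of "T \<inter> W"]) simp_all
qed

lemma nonvan_mult:
  assumes [simp]: "opn U" "f \<in> carrier (\<O> U)" "g \<in> carrier (\<O> U)"
  shows "nonvan X U (f \<otimes>\<^bsub>\<O> U\<^esub> g) = nonvan X U f \<inter> nonvan X U g"
proof (intro equalityI subsetI IntI)
  fix x assume "x \<in> nonvan X U (f \<otimes>\<^bsub>\<O> U\<^esub> g)"
  then obtain T where T [simp]: "opn T" "T \<subseteq> U" "x \<in> T"
    and u: "res X U T f \<otimes>\<^bsub>\<O> T\<^esub> res X U T g \<in> Units (\<O> T)"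
    by (auto simp: nonvan_def)
  interpret T: cring "\<O> T" by (rule cringO) simp
  have "res X U T f \<in> Units (\<O> T)" "res X U T g \<in> Units (\<O> T)"
    using u T.Units_factor [of "res X U T f" "res X U T g"]
      T.Units_factor [of "res X U T g" "res X U T f"] by (auto simp: T.m_comm)
  then show "x \<in> nonvan X U f" "x \<in> nonvan X U g"
    unfolding nonvan_def using T by blast+
next
  fix x assume x: "x \<in> nonvan X U f \<inter> nonvan X U g"
  then obtain T where T [simp]: "opn T" "T \<subseteq> U" "x \<in> T" and f: "res X U T f \<in> Units (\<O> T)"
    by (auto simp: nonvan_def)
  obtain W where W [simp]: "opn W" "W \<subseteq> U" "x \<in> W" and g: "res X U W g \<in> Units (\<O> W)"
    using x by (auto simp: nonvan_def)
  let ?S = "T \<inter> W"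
  have [simp]: "opn ?S" "?S \<subseteq> U" by (simp_all add: openin_Int le_infI1)
  interpret S: cring "\<O> ?S" by (rule cringO) simp
  have "res X T ?S (res X U T f) \<in> Units (\<O> ?S)"
    by (rule res_Units [OF _ _ _ f]) simp_all
  moreover have "res X W ?S (res X U W g) \<in> Units (\<O> ?S)"
    by (rule res_Units [OF _ _ _ g]) simp_all
  ultimately have "res X U ?S (f \<otimes>\<^bsub>\<O> U\<^esub> g) \<in> Units (\<O> ?S)"
    by simp
  then show "x \<in> nonvan X U (f \<otimes>\<^bsub>\<O> U\<^esub> g)"
    by (intro nonvanI [of ?S]) simp_all
qed

lemma nonvan_Units:
  assumes "opn U" "f \<in> Units (\<O> U)"
  shows "nonvan X U f = U"
  using assms nonvan_subset by (force simp: nonvan_def Units_def intro!: exI [of _ U])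

lemma nonvan_one: "opn U \<Longrightarrow> nonvan X U \<one>\<^bsub>\<O> U\<^esub> = U"
  by (intro nonvan_Units monoid.Units_one_closed) (auto intro: ringO ring.is_monoid)

lemma nonvan_cst: "opn U \<Longrightarrow> c \<noteq> 0 \<Longrightarrow> nonvan X U (cst X U c) = U"
  by (intro nonvan_Units cst_Units)

lemma nonvan_pow:
  assumes [simp]: "opn U" "f \<in> carrier (\<O> U)"
  shows "nonvan X U f \<subseteq> nonvan X U (f [^]\<^bsub>\<O> U\<^esub> (n::nat))"
    "n > 0 \<Longrightarrow> nonvan X U (f [^]\<^bsub>\<O> U\<^esub> (n::nat)) = nonvan X U f"
proof -
  interpret U: cring "\<O> U" by (rule cringO) simp
  show *: "nonvan X U f \<subseteq> nonvan X U (f [^]\<^bsub>\<O> U\<^esub> n)" for n :: nat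
    by (induction n) (auto simp: nonvan_one nonvan_mult subsetD [OF nonvan_subset])
  show "n > 0 \<Longrightarrow> nonvan X U (f [^]\<^bsub>\<O> U\<^esub> (n::nat)) = nonvan X U f"
    using * by (cases n) (auto simp: nonvan_mult)
qed

lemma affine_open_opn: "affine_open X V \<Longrightarrow> opn V"
  by (simp add: affine_open_def)

lemma affine_basis:
  "affine_open X V \<Longrightarrow> opn W \<Longrightarrow> W \<subseteq> V \<Longrightarrow> x \<in> W \<Longrightarrow>
    \<exists>h\<in>carrier (\<O> V). x \<in> nonvan X V h \<and> nonvan X V h \<subseteq> W"
  by (simp add: affine_open_def)

lemma affine_num:
  "affine_open X V \<Longrightarrow> h \<in> carrier (\<O> V) \<Longrightarrow> D = nonvan X V h \<Longrightarrow> g \<in> carrier (\<O> D) \<Longrightarrow>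
    \<exists>m::nat. \<exists>a\<in>carrier (\<O> V). g \<otimes>\<^bsub>\<O> D\<^esub> res X V D h [^]\<^bsub>\<O> D\<^esub> m = res X V D a"
  by (simp add: affine_open_def)

lemma affine_kill:
  "affine_open X V \<Longrightarrow> h \<in> carrier (\<O> V) \<Longrightarrow> a \<in> carrier (\<O> V) \<Longrightarrow> D = nonvan X V h \<Longrightarrow>
    res X V D a = \<zero>\<^bsub>\<O> D\<^esub> \<Longrightarrow> \<exists>m::nat. h [^]\<^bsub>\<O> V\<^esub> m \<otimes>\<^bsub>\<O> V\<^esub> a = \<zero>\<^bsub>\<O> V\<^esub>"
  by (simp add: affine_open_def)

lemma affine_bij: "affine_open X V \<Longrightarrow> bij_betw (vanishing_at X V) V {P. primeideal P (\<O> V)}"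
  by (simp add: affine_open_def)

lemma affine_prime:
  "affine_open X V \<Longrightarrow> x \<in> V \<Longrightarrow> primeideal (vanishing_at X V x) (\<O> V)"
  using bij_betwE [OF affine_bij] by simp

lemma affine_point:
  "affine_open X V \<Longrightarrow> primeideal P (\<O> V) \<Longrightarrow> \<exists>x\<in>V. vanishing_at X V x = P"
  using bij_betw_imp_surj_on [OF affine_bij] by (metis imageE mem_Collect_eq)

lemma affine_point_inj:
  "affine_open X V \<Longrightarrow> x \<in> V \<Longrightarrow> y \<in> V \<Longrightarrow> vanishing_at X V x = vanishing_at X V y \<Longrightarrow> x = y"
  using bij_betw_imp_inj_on [OF affine_bij] by (rule inj_onD)

lemma ex_affine: "x \<in> topspace (sp X) \<Longrightarrow> \<exists>V. affine_open X V \<and> x \<in> V"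
  using variety by (simp add: variety_def kscheme_def)

text \<open>Near a point of the affine set \<open>V\<close> every section is a quotient
  \<open>a / h ^ m\<close> of sections over \<open>V\<close>, on a principal open set. Statements
  about arbitrary open sets are reduced in this way to the section ring of an affine one.\<close>

lemma local_fraction:
  assumes U: "opn U" "x \<in> U" "f \<in> carrier (\<O> U)" and V: "affine_open X V" "x \<in> V"
  obtains h a D and m :: nat where "h \<in> carrier (\<O> V)" "a \<in> carrier (\<O> V)" "D = nonvan X V h"
    "h \<notin> vanishing_at X V x" "x \<in> D" "D \<subseteq> U" "D \<subseteq> V" "opn D" "res X U D f \<otimes>\<^bsub>\<O> D\<^esub> res X V D h [^]\<^bsub>\<O> D\<^esub> m = res X V D a"
proof -
  have "opn (U \<inter> V)" "x \<in> U \<inter> V"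
    using U V by (auto simp: affine_open_opn openin_Int)
  then obtain h where h: "h \<in> carrier (\<O> V)" "x \<in> nonvan X V h" "nonvan X V h \<subseteq> U \<inter> V"
    using affine_basis [OF V(1), of "U \<inter> V" x] by blast
  define D where "D = nonvan X V h"
  have D: "opn D" "D \<subseteq> U" "D \<subseteq> V" using h(3) by (auto simp: D_def open_nonvan)
  have "res X U D f \<in> carrier (\<O> D)"
    using U D by simp
  then show thesis
    using affine_num [OF V(1) h(1) D_def] that [OF h(1) _ D_def] D h(2)
    by (auto simp: D_def [symmetric] vanishing_at_def)
qed

lemma vanishing_carrier: "vanishing_at X U x \<subseteq> carrier (\<O> U)"
  by (auto simp: vanishing_at_def)

lemma vanishing_res:
  assumes "opn U" "opn W" "W \<subseteq> U" "x \<in> W" "f \<in> carrier (\<O> U)"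
  shows "res X U W f \<in> vanishing_at X W x \<longleftrightarrow> f \<in> vanishing_at X U x"
  using assms by (simp add: vanishing_at_def nonvan_res)

lemma vanishing_mult:
  assumes "opn U" "f \<in> carrier (\<O> U)" "g \<in> carrier (\<O> U)"
  shows "f \<otimes>\<^bsub>\<O> U\<^esub> g \<in> vanishing_at X U x \<longleftrightarrow> f \<in> vanishing_at X U x \<or> g \<in> vanishing_at X U x"
proof -
  interpret U: cring "\<O> U" by (rule cringO) fact
  show ?thesis using assms by (simp add: vanishing_at_def nonvan_mult)
qed

lemma vanishing_pow:
  assumes "opn U" "f \<in> carrier (\<O> U)" "n > 0"
  shows "f [^]\<^bsub>\<O> U\<^esub> (n::nat) \<in> vanishing_at X U x \<longleftrightarrow> f \<in> vanishing_at X U x"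
proof -
  interpret U: cring "\<O> U" by (rule cringO) fact
  show ?thesis using assms by (simp add: vanishing_at_def nonvan_pow)
qed

lemma not_vanishing_pow:
  assumes "opn U" "f \<in> carrier (\<O> U)" "f \<notin> vanishing_at X U x"
  shows "f [^]\<^bsub>\<O> U\<^esub> (n::nat) \<notin> vanishing_at X U x"
proof -
  interpret U: cring "\<O> U" by (rule cringO) fact
  show ?thesis using assms nonvan_pow(1) [OF assms(1,2), of n] by (auto simp: vanishing_at_def)
qed

lemma vanishing_cst:
  assumes "opn U" "x \<in> U"
  shows "cst X U c \<in> vanishing_at X U x \<longleftrightarrow> c = 0"
proof (cases "c = 0")
  case True
  \<comment> \<open>The section 0 could be a unit only over the zero ring; the proper ideal
    belonging to \<open>x\<close> in an affine neighbourhood rules this out.\<close>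
  obtain V where V: "affine_open X V" "x \<in> V"
    using ex_affine [of x] assms openin_subset by blast
  let ?W = "U \<inter> V"
  have W [simp]: "opn U" "opn V" "opn ?W" "?W \<subseteq> U" "?W \<subseteq> V"
    using assms V by (auto simp: affine_open_opn openin_Int)
  interpret P: primeideal "vanishing_at X V x" "\<O> V" by (rule affine_prime [OF V])
  have "cst X V 0 \<in> vanishing_at X V x"
    using P.zero_closed by (simp add: cst_zero)
  then have "res X V ?W (cst X V 0) \<in> vanishing_at X ?W x"
    using assms V by (subst vanishing_res) simp_all
  then have "res X U ?W (cst X U 0) \<in> vanishing_at X ?W x"
    by simp
  then show ?thesis
    using True assms V by (subst (asm) vanishing_res) simp_all
next
  case False
  then show ?thesis using assms by (simp add: vanishing_at_def nonvan_cst)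
qed

text \<open>Over an affine set the sections vanishing at \<open>x\<close> form an ideal by
  definition. For general \<open>U\<close>, if \<open>f = a / h ^ m\<close> and
  \<open>g = b / h ^ n\<close> near \<open>x\<close>, then \<open>(f + g) * h ^ (m + n)\<close> is
  the restriction of a section over \<open>V\<close> that vanishes at \<open>x\<close>, and
  \<open>h\<close> can be cancelled because it does not vanish there.\<close>

lemma vanishing_add:
  assumes U [simp]: "opn U" "x \<in> U" and f: "f \<in> vanishing_at X U x" and g: "g \<in> vanishing_at X U x"
  shows "f \<oplus>\<^bsub>\<O> U\<^esub> g \<in> vanishing_at X U x"
proof -
  have [simp]: "f \<in> carrier (\<O> U)" "g \<in> carrier (\<O> U)"
    using f g by (auto simp: vanishing_at_def)
  obtain V where V: "affine_open X V" and [simp]: "x \<in> V"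
    using ex_affine [of x] U openin_subset by blast
  have [simp]: "opn V" using V by (rule affine_open_opn)
  obtain h a D and m :: nat where h [simp]: "h \<in> carrier (\<O> V)" "a \<in> carrier (\<O> V)"
    and D: "D = nonvan X V h" and nv: "h \<notin> vanishing_at X V x" and D' [simp]: "x \<in> D" "D \<subseteq> U" "D \<subseteq> V" "opn D"
    and a: "res X U D f \<otimes>\<^bsub>\<O> D\<^esub> res X V D h [^]\<^bsub>\<O> D\<^esub> m = res X V D a"
    by (rule local_fraction [of U x f V]) (use V in auto)
  interpret U: cring "\<O> U" by (rule cringO) simp
  interpret V: cring "\<O> V" by (rule cringO) simp
  interpret D: cring "\<O> D" by (rule cringO) simp
  interpret P: primeideal "vanishing_at X V x" "\<O> V" by (rule affine_prime [OF V]) simp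
  have "res X U D g \<in> carrier (\<O> D)"
    by simp
  then obtain n :: nat and b where b: "res X U D g \<otimes>\<^bsub>\<O> D\<^esub> res X V D h [^]\<^bsub>\<O> D\<^esub> n = res X V D b"
    and [simp]: "b \<in> carrier (\<O> V)"
    using affine_num [OF V h(1) D] by blast
  let ?h = "res X V D h" and ?f = "res X U D f" and ?g = "res X U D g"
  have "res X V D a \<in> vanishing_at X D x" "res X V D b \<in> vanishing_at X D x"
    unfolding a [symmetric] b [symmetric] using f g
    by (subst vanishing_mult; simp add: vanishing_res)+
  then have "a \<in> vanishing_at X V x" "b \<in> vanishing_at X V x"
    by (simp_all add: vanishing_res)
  then have "a \<otimes>\<^bsub>\<O> V\<^esub> h [^]\<^bsub>\<O> V\<^esub> n \<oplus>\<^bsub>\<O> V\<^esub> b \<otimes>\<^bsub>\<O> V\<^esub> h [^]\<^bsub>\<O> V\<^esub> m \<in> vanishing_at X V x"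
    by (intro P.a_closed P.I_r_closed) simp_all
  then have "res X V D (a \<otimes>\<^bsub>\<O> V\<^esub> h [^]\<^bsub>\<O> V\<^esub> n \<oplus>\<^bsub>\<O> V\<^esub> b \<otimes>\<^bsub>\<O> V\<^esub> h [^]\<^bsub>\<O> V\<^esub> m) \<in> vanishing_at X D x"
    by (subst vanishing_res) simp_all
  also have "res X V D (a \<otimes>\<^bsub>\<O> V\<^esub> h [^]\<^bsub>\<O> V\<^esub> n \<oplus>\<^bsub>\<O> V\<^esub> b \<otimes>\<^bsub>\<O> V\<^esub> h [^]\<^bsub>\<O> V\<^esub> m)
      = (?f \<otimes>\<^bsub>\<O> D\<^esub> ?h [^]\<^bsub>\<O> D\<^esub> m) \<otimes>\<^bsub>\<O> D\<^esub> ?h [^]\<^bsub>\<O> D\<^esub> n \<oplus>\<^bsub>\<O> D\<^esub> (?g \<otimes>\<^bsub>\<O> D\<^esub> ?h [^]\<^bsub>\<O> D\<^esub> n) \<otimes>\<^bsub>\<O> D\<^esub> ?h [^]\<^bsub>\<O> D\<^esub> m"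
    by (simp add: a b)
  also have "\<dots> = (?f \<oplus>\<^bsub>\<O> D\<^esub> ?g) \<otimes>\<^bsub>\<O> D\<^esub> ?h [^]\<^bsub>\<O> D\<^esub> (m + n)"
    by (simp add: D.l_distr D.m_assoc D.nat_pow_mult add.commute)
  finally have "?f \<oplus>\<^bsub>\<O> D\<^esub> ?g \<in> vanishing_at X D x \<or>
      ?h [^]\<^bsub>\<O> D\<^esub> (m + n) \<in> vanishing_at X D x"
    by (subst (asm) vanishing_mult) simp_all
  moreover have "?h \<notin> vanishing_at X D x"
    using nv by (simp add: vanishing_res)
  then have "?h [^]\<^bsub>\<O> D\<^esub> (m + n) \<notin> vanishing_at X D x"
    by (intro not_vanishing_pow) simp_all
  ultimately have "res X U D (f \<oplus>\<^bsub>\<O> U\<^esub> g) \<in> vanishing_at X D x"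
    by simp
  then show ?thesis
    by (subst (asm) vanishing_res) simp_all
qed

lemma vanishing_prime:
  assumes U [simp]: "opn U" "x \<in> U"
  shows "primeideal (vanishing_at X U x) (\<O> U)"
proof -
  interpret U: cring "\<O> U" by (rule cringO) simp
  have mult: "a \<otimes>\<^bsub>\<O> U\<^esub> b \<in> vanishing_at X U x"
    if "a \<in> vanishing_at X U x" "b \<in> carrier (\<O> U)" for a b
    using that vanishing_carrier by (subst vanishing_mult) auto
  have one: "\<one>\<^bsub>\<O> U\<^esub> \<notin> vanishing_at X U x"
    using vanishing_cst [OF U, of 1] by (simp add: cst_one)
  have "ideal (vanishing_at X U x) (\<O> U)"
  proof (rule idealI)
    show "subgroup (vanishing_at X U x) (add_monoid (\<O> U))"
    proof (rule U.add.subgroupI)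
      show "vanishing_at X U x \<noteq> {}"
        using vanishing_cst [OF U, of 0] by blast
      fix a assume a: "a \<in> vanishing_at X U x"
      then have "a \<otimes>\<^bsub>\<O> U\<^esub> \<ominus>\<^bsub>\<O> U\<^esub> \<one>\<^bsub>\<O> U\<^esub> \<in> vanishing_at X U x"
        by (rule mult) simp
      then show "\<ominus>\<^bsub>\<O> U\<^esub> a \<in> vanishing_at X U x"
        using a vanishing_carrier by (auto simp: U.r_minus subset_iff)
    qed (auto simp: vanishing_add vanishing_carrier)
  next
    fix a b assume *: "a \<in> vanishing_at X U x" "b \<in> carrier (\<O> U)"
    then show "a \<otimes>\<^bsub>\<O> U\<^esub> b \<in> vanishing_at X U x" by (rule mult)
    then show "b \<otimes>\<^bsub>\<O> U\<^esub> a \<in> vanishing_at X U x"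
      using * vanishing_carrier by (subst U.m_comm) auto
  qed (rule U.ring_axioms)
  then show ?thesis
  proof (rule primeidealI)
    show "carrier (\<O> U) \<noteq> vanishing_at X U x"
      using one U.one_closed by blast
  qed (auto simp: vanishing_mult U.cring_axioms)
qed

text \<open>The residue field at \<open>x\<close> is \<open>k\<close>. For closed points of a
  variety this is the Nullstellensatz; here it is derived from the finite length of a subscheme
  supported at \<open>x\<close> (\<open>finite_quotient_residue\<close>).\<close>

definition rational_point :: "'p \<Rightarrow> bool" where
  "rational_point x \<longleftrightarrow> x \<in> topspace (sp X) \<and> (\<forall>U f. opn U \<longrightarrow> x \<in> U \<longrightarrow> f \<in> carrier (\<O> U) \<longrightarrow>
     (\<exists>c. cg (\<O> U) (vanishing_at X U x) f (cst X U c)))"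

lemma rational_pointI:
  assumes V: "affine_open X V" "x \<in> V"
    and rat: "\<And>f. f \<in> carrier (\<O> V) \<Longrightarrow> \<exists>c. cg (\<O> V) (vanishing_at X V x) f (cst X V c)"
  shows "rational_point x"
  unfolding rational_point_def
proof (intro conjI allI impI)
  note [simp] = affine_open_opn [OF V(1)] V(2)
  show "x \<in> topspace (sp X)"
    using openin_subset [of "sp X" V] by auto
  fix U f assume [simp]: "opn U" "x \<in> U" "f \<in> carrier (\<O> U)"
  obtain h a D and m :: nat where h [simp]: "h \<in> carrier (\<O> V)" "a \<in> carrier (\<O> V)"
    and D: "D = nonvan X V h" and nv: "h \<notin> vanishing_at X V x" and D' [simp]: "x \<in> D" "D \<subseteq> U" "D \<subseteq> V" "opn D"
    and a: "res X U D f \<otimes>\<^bsub>\<O> D\<^esub> res X V D h [^]\<^bsub>\<O> D\<^esub> m = res X V D a"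
    by (rule local_fraction [of U x f V]) (use V in auto)
  interpret U: cring "\<O> U" by (rule cringO) simp
  interpret V: cring "\<O> V" by (rule cringO) simp
  interpret D: cring "\<O> D" by (rule cringO) simp
  interpret P: primeideal "vanishing_at X V x" "\<O> V" by (rule affine_prime [OF V])
  obtain \<alpha> \<beta> where \<alpha>: "cg (\<O> V) (vanishing_at X V x) a (cst X V \<alpha>)"
    and \<beta>: "cg (\<O> V) (vanishing_at X V x) h (cst X V \<beta>)"
    using rat h by blast
  have "\<beta> \<noteq> 0"
    using nv P.cg_mem [OF \<beta>] by (simp add: vanishing_cst)
  \<comment> \<open>The value at \<open>x\<close> of the fraction \<open>a / h ^ m\<close> that
    represents \<open>f\<close>.\<close>
  define c where "c = \<alpha> / \<beta> ^ m"
  have "cg (\<O> V) (vanishing_at X V x) (cst X V c \<otimes>\<^bsub>\<O> V\<^esub> h [^]\<^bsub>\<O> V\<^esub> m) (cst X V c \<otimes>\<^bsub>\<O> V\<^esub> cst X V \<beta> [^]\<^bsub>\<O> V\<^esub> m)"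
    by (intro P.cg_mult P.cg_pow \<beta> P.cg_refl) simp
  also have "cst X V c \<otimes>\<^bsub>\<O> V\<^esub> cst X V \<beta> [^]\<^bsub>\<O> V\<^esub> m = cst X V \<alpha>"
    using \<open>\<beta> \<noteq> 0\<close> by (simp add: c_def cst_pow [symmetric] cst_mult [symmetric])
  finally have "cg (\<O> V) (vanishing_at X V x) a (cst X V c \<otimes>\<^bsub>\<O> V\<^esub> h [^]\<^bsub>\<O> V\<^esub> m)"
    using \<alpha> P.cg_sym P.cg_trans by blast
  then have "a \<ominus>\<^bsub>\<O> V\<^esub> cst X V c \<otimes>\<^bsub>\<O> V\<^esub> h [^]\<^bsub>\<O> V\<^esub> m \<in> vanishing_at X V x"
    by (simp add: cg_def)
  then have "res X V D (a \<ominus>\<^bsub>\<O> V\<^esub> cst X V c \<otimes>\<^bsub>\<O> V\<^esub> h [^]\<^bsub>\<O> V\<^esub> m) \<in> vanishing_at X D x"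
    by (subst vanishing_res) simp_all
  also have "res X V D (a \<ominus>\<^bsub>\<O> V\<^esub> cst X V c \<otimes>\<^bsub>\<O> V\<^esub> h [^]\<^bsub>\<O> V\<^esub> m)
      = res X U D f \<otimes>\<^bsub>\<O> D\<^esub> res X V D h [^]\<^bsub>\<O> D\<^esub> m \<ominus>\<^bsub>\<O> D\<^esub> cst X D c \<otimes>\<^bsub>\<O> D\<^esub> res X V D h [^]\<^bsub>\<O> D\<^esub> m"
    by (simp add: a)
  also have "\<dots> = res X U D (f \<ominus>\<^bsub>\<O> U\<^esub> cst X U c) \<otimes>\<^bsub>\<O> D\<^esub> res X V D h [^]\<^bsub>\<O> D\<^esub> m"
    by (simp add: a_minus_def D.l_distr D.l_minus)
  finally have "res X U D (f \<ominus>\<^bsub>\<O> U\<^esub> cst X U c) \<in> vanishing_at X D x \<or>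
      res X V D h [^]\<^bsub>\<O> D\<^esub> m \<in> vanishing_at X D x"
    by (subst (asm) vanishing_mult) simp_all
  moreover have "res X V D h [^]\<^bsub>\<O> D\<^esub> m \<notin> vanishing_at X D x"
    using nv by (intro not_vanishing_pow) (simp_all add: vanishing_res)
  ultimately have "f \<ominus>\<^bsub>\<O> U\<^esub> cst X U c \<in> vanishing_at X U x"
    by (subst (asm) vanishing_res) simp_all
  then show "\<exists>c. cg (\<O> U) (vanishing_at X U x) f (cst X U c)"
    by (auto simp: cg_def)
qed

section \<open>Ideal sheaves of fat points\<close>

text \<open>The sheaf conditions of \<open>closed_subscheme\<close> on their own. Frobenius fibres,
  being defined as associated sheaves, satisfy these directly, while their quasi-coherence comes
  from membership in a chart.\<close>

definition ideal_sheaf :: "('p set \<Rightarrow> 's set) \<Rightarrow> bool" where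
  "ideal_sheaf J \<longleftrightarrow> (\<forall>U. opn U \<longrightarrow> ideal (J U) (\<O> U)) \<and>
     (\<forall>U V. opn U \<longrightarrow> opn V \<longrightarrow> V \<subseteq> U \<longrightarrow> res X U V ` J U \<subseteq> J V) \<and>
     (\<forall>\<U>. (\<forall>V\<in>\<U>. opn V) \<longrightarrow>
        (\<forall>f\<in>carrier (\<O> (\<Union>\<U>)). (\<forall>V\<in>\<U>. res X (\<Union>\<U>) V f \<in> J V) \<longrightarrow> f \<in> J (\<Union>\<U>)))"

lemma closed_subscheme_iff:
  "closed_subscheme X J \<longleftrightarrow> (\<forall>U. \<not> opn U \<longrightarrow> J U = {}) \<and> ideal_sheaf J \<and>
     (\<forall>U. affine_open X U \<longrightarrow> (\<forall>f\<in>carrier (\<O> U). \<forall>g\<in>J (nonvan X U f).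
        \<exists>m::nat. \<exists>h\<in>J U. g \<otimes>\<^bsub>\<O> (nonvan X U f)\<^esub> res X U (nonvan X U f) f [^]\<^bsub>\<O> (nonvan X U f)\<^esub> m
            = res X U (nonvan X U f) h))"
  by (simp only: closed_subscheme_def ideal_sheaf_def conj_assoc)

lemma closed_subscheme_ideal_sheaf: "closed_subscheme X J \<Longrightarrow> ideal_sheaf J"
  by (simp add: closed_subscheme_def ideal_sheaf_def)

lemma closed_subscheme_frac:
  "closed_subscheme X J \<Longrightarrow> affine_open X U \<Longrightarrow> f \<in> carrier (\<O> U) \<Longrightarrow> D = nonvan X U f \<Longrightarrow> g \<in> J D \<Longrightarrow>
    \<exists>m::nat. \<exists>h\<in>J U. g \<otimes>\<^bsub>\<O> D\<^esub> res X U D f [^]\<^bsub>\<O> D\<^esub> m = res X U D h"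
  by (simp add: closed_subscheme_def)

lemma sheaf_ideal: "ideal_sheaf J \<Longrightarrow> opn U \<Longrightarrow> ideal (J U) (\<O> U)"
  by (simp add: ideal_sheaf_def)

lemma sheaf_res: "ideal_sheaf J \<Longrightarrow> opn U \<Longrightarrow> opn V \<Longrightarrow> V \<subseteq> U \<Longrightarrow> f \<in> J U \<Longrightarrow> res X U V f \<in> J V"
  unfolding ideal_sheaf_def by blast

lemma sheaf_carrier: "ideal_sheaf J \<Longrightarrow> opn U \<Longrightarrow> J U \<subseteq> carrier (\<O> U)"
  using additive_subgroup.a_subset ideal.axioms(1) sheaf_ideal by blast

lemma sheaf_glue:
  assumes J: "ideal_sheaf J" and U: "opn U" and f: "f \<in> carrier (\<O> U)"
    and loc: "\<And>y. y \<in> U \<Longrightarrow> \<exists>W. opn W \<and> y \<in> W \<and> W \<subseteq> U \<and> res X U W f \<in> J W"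
  shows "f \<in> J U"
proof -
  define \<U> where "\<U> = {W. opn W \<and> W \<subseteq> U \<and> res X U W f \<in> J W}"
  have "\<Union>\<U> = U" using loc by (fastforce simp: \<U>_def)
  moreover have "\<forall>V\<in>\<U>. opn V" "\<forall>V\<in>\<U>. res X U V f \<in> J V"
    by (auto simp: \<U>_def)
  ultimately show ?thesis
    using J f unfolding ideal_sheaf_def by metis
qed

lemma sheaf_carrier_res:
  assumes J: "ideal_sheaf J" and "opn U" "opn W" "W \<subseteq> U" "J U = carrier (\<O> U)"
  shows "J W = carrier (\<O> W)"
proof -
  interpret U: cring "\<O> U" by (rule cringO) fact
  have "res X U W \<one>\<^bsub>\<O> U\<^esub> \<in> J W"
    using assms by (intro sheaf_res [OF J]) auto
  then show ?thesis
    using assms by (intro ideal.one_imp_carrier sheaf_ideal) auto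
qed

lemma sheaf_Units:
  assumes J: "ideal_sheaf J" and "opn W" "f \<in> Units (\<O> W)" "f \<in> J W"
  shows "J W = carrier (\<O> W)"
proof -
  interpret W: cring "\<O> W" by (rule cringO) fact
  interpret I: ideal "J W" "\<O> W" by (rule sheaf_ideal) fact+
  have "f \<otimes>\<^bsub>\<O> W\<^esub> inv\<^bsub>\<O> W\<^esub> f \<in> J W"
    using assms by (intro I.I_r_closed) auto
  then show ?thesis
    using assms by (intro I.one_imp_carrier) simp
qed

lemma cg_res:
  assumes J: "ideal_sheaf J" and [simp]: "opn U" "opn W" "W \<subseteq> U" and f: "cg (\<O> U) (J U) f g"
  shows "cg (\<O> W) (J W) (res X U W f) (res X U W g)"
  using f sheaf_res [OF J, of U W "f \<ominus>\<^bsub>\<O> U\<^esub> g"] by (simp add: cg_def)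

text \<open>
  The last clause is closed in \<open>J\<close> and makes the \<open>p ^ e\<close>-th power of every section constant modulo \<open>J\<close>.
  So inverting a section that does not vanish at \<open>x\<close> amounts to dividing by a scalar.
\<close>

definition fat_point :: "nat \<Rightarrow> 'p \<Rightarrow> ('p set \<Rightarrow> 's set) \<Rightarrow> bool" where
  "fat_point e x J \<longleftrightarrow> ideal_sheaf J \<and> rational_point x \<and>
     (\<forall>y\<in>topspace (sp X) - {x}. \<exists>W. opn W \<and> y \<in> W \<and> J W = carrier (\<O> W)) \<and>
     (\<forall>U. opn U \<longrightarrow> x \<in> U \<longrightarrow> J U \<subseteq> vanishing_at X U x) \<and>
     (\<forall>U. opn U \<longrightarrow> x \<in> U \<longrightarrow> (\<forall>f\<in>vanishing_at X U x. f [^]\<^bsub>\<O> U\<^esub> (p ^ e) \<in> J U))"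

lemma fat_sheaf: "fat_point e x J \<Longrightarrow> ideal_sheaf J"
  and fat_rational: "fat_point e x J \<Longrightarrow> rational_point x"
  and fat_vanishing: "fat_point e x J \<Longrightarrow> opn U \<Longrightarrow> x \<in> U \<Longrightarrow> f \<in> J U \<Longrightarrow> f \<in> vanishing_at X U x"
  and fat_pow: "fat_point e x J \<Longrightarrow> opn U \<Longrightarrow> x \<in> U \<Longrightarrow> f \<in> vanishing_at X U x \<Longrightarrow>
    f [^]\<^bsub>\<O> U\<^esub> (p ^ e) \<in> J U"
  by (auto simp: fat_point_def)

text \<open>Recovers the ideal of the support from \<open>J\<close>. Whether \<open>h\<close>
  vanishes at the support thus becomes the question whether \<open>h ^ (p ^ e)\<close> lies in
  \<open>J\<close>, which chart coordinates can detect without reference to the point.\<close>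

lemma fat_pow_iff:
  assumes J: "fat_point e x J" and U: "opn U" "x \<in> U" "f \<in> carrier (\<O> U)"
  shows "f [^]\<^bsub>\<O> U\<^esub> (p ^ e) \<in> J U \<longleftrightarrow> f \<in> vanishing_at X U x"
  using fat_pow [OF J U(1,2), of f] fat_vanishing [OF J U(1,2), of "f [^]\<^bsub>\<O> U\<^esub> (p ^ e)"]
    vanishing_pow [OF U(1,3), of "p ^ e" x] p_pos by auto

lemma fat_other:
  assumes "fat_point e x J" "y \<noteq> x" "opn U" "y \<in> U"
  shows "\<exists>T. opn T \<and> y \<in> T \<and> J T = carrier (\<O> T)"
proof -
  have "y \<in> topspace (sp X) - {x}"
    using assms openin_subset by blast
  then show ?thesis
    using assms(1) unfolding fat_point_def by blast
qed

lemma fat_glue: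
  assumes J: "fat_point e x J" and U [simp]: "opn U" "opn W" "W \<subseteq> U" and "x \<in> W \<or> x \<notin> U"
    and f: "f \<in> carrier (\<O> U)" "res X U W f \<in> J W"
  shows "f \<in> J U"
proof (rule sheaf_glue [OF fat_sheaf [OF J]])
  fix y assume y: "y \<in> U"
  show "\<exists>W. opn W \<and> y \<in> W \<and> W \<subseteq> U \<and> res X U W f \<in> J W"
  proof (cases "y = x")
    case True
    then show ?thesis using assms(5) f y U by blast
  next
    case False
    then obtain T where T: "opn T" "y \<in> T" "J T = carrier (\<O> T)"
      using fat_other [OF J False U(1) y] by blast
    have "J (T \<inter> U) = carrier (\<O> (T \<inter> U))"
      by (rule sheaf_carrier_res [OF fat_sheaf [OF J] T(1) _ _ T(3)]) (simp_all add: openin_Int T)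
    then have "res X U (T \<inter> U) f \<in> J (T \<inter> U)"
      using T f by (simp add: openin_Int)
    then show ?thesis using T y by (intro exI [of _ "T \<inter> U"]) (simp add: openin_Int)
  qed
qed (use f in simp_all)

lemma fat_off:
  assumes J: "fat_point e x J" and U: "opn U" "x \<notin> U"
  shows "J U = carrier (\<O> U)"
proof -
  have e [simp]: "opn {}" by simp
  have "\<one>\<^bsub>\<O> U\<^esub> \<in> J U"
  proof (rule sheaf_glue [OF fat_sheaf [OF J] U(1)])
    show "\<one>\<^bsub>\<O> U\<^esub> \<in> carrier (\<O> U)"
      using U by (simp add: ring.ring_simprules ringO)
    fix y assume y: "y \<in> U"
    then obtain T where T: "opn T" "y \<in> T" "J T = carrier (\<O> T)"
      using fat_other [OF J _ U(1) y] U(2) y by blast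
    have "J (T \<inter> U) = carrier (\<O> (T \<inter> U))"
      by (rule sheaf_carrier_res [OF fat_sheaf [OF J] T(1) _ _ T(3)]) (simp_all add: openin_Int T U)
    then have "res X U (T \<inter> U) \<one>\<^bsub>\<O> U\<^esub> \<in> J (T \<inter> U)"
      using T U by (simp add: openin_Int ring.ring_simprules ringO)
    then show "\<exists>W. opn W \<and> y \<in> W \<and> W \<subseteq> U \<and> res X U W \<one>\<^bsub>\<O> U\<^esub> \<in> J W"
      using T U y by (intro exI [of _ "T \<inter> U"]) (simp add: openin_Int)
  qed
  then show ?thesis
    using fat_sheaf [OF J] U(1) by (intro ideal.one_imp_carrier sheaf_ideal)
qed

text \<open>Away from \<open>x\<close> the ideal is everything, so membership in \<open>J\<close> is
  decided near \<open>x\<close>. Hence the quotient of sections by \<open>J\<close> embeds into the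
  one over any smaller neighbourhood of \<open>x\<close>; \<open>fat_surj\<close> is the matching
  surjectivity.\<close>

lemma fat_res_iff:
  assumes J: "fat_point e x J" and U: "opn U" "opn W" "W \<subseteq> U" "x \<in> W" "f \<in> carrier (\<O> U)"
  shows "res X U W f \<in> J W \<longleftrightarrow> f \<in> J U"
  using fat_glue [OF J] sheaf_res [OF fat_sheaf [OF J]] U by blast

lemma fat_cg_res_iff:
  assumes J: "fat_point e x J" and [simp]: "opn U" "opn W" "W \<subseteq> U" "x \<in> W" "f \<in> carrier (\<O> U)" "g \<in> carrier (\<O> U)"
  shows "cg (\<O> W) (J W) (res X U W f) (res X U W g) \<longleftrightarrow> cg (\<O> U) (J U) f g"
proof -
  interpret U: cring "\<O> U" by (rule cringO) simp
  show ?thesis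
    using fat_res_iff [OF J, of U W "f \<ominus>\<^bsub>\<O> U\<^esub> g"] by (simp add: cg_def)
qed

text \<open>If \<open>c\<close> is the value of \<open>f\<close> at \<open>x\<close>, then
  \<open>f - c\<close> vanishes there, so its \<open>p ^ e\<close>-th power is in \<open>J\<close>;
  additivity of Frobenius splits that power.\<close>

lemma fat_pow_const:
  assumes J: "fat_point e x J" and [simp]: "opn U" "x \<in> U" and f [simp]: "f \<in> carrier (\<O> U)"
  shows "\<exists>c. cg (\<O> U) (J U) (f [^]\<^bsub>\<O> U\<^esub> (p ^ e)) (cst X U (c ^ (p ^ e))) \<and>
    (f \<in> vanishing_at X U x \<longleftrightarrow> c = 0)"
proof -
  interpret U: cring "\<O> U" by (rule cringO) simp
  interpret P: primeideal "vanishing_at X U x" "\<O> U" by (rule vanishing_prime) simp_all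
  obtain c where c: "cg (\<O> U) (vanishing_at X U x) f (cst X U c)"
    using fat_rational [OF J] f \<open>opn U\<close> \<open>x \<in> U\<close> unfolding rational_point_def by blast
  then have "(f \<ominus>\<^bsub>\<O> U\<^esub> cst X U c) [^]\<^bsub>\<O> U\<^esub> (p ^ e) \<in> J U"
    by (intro fat_pow [OF J]) (simp_all add: cg_def)
  then have "cg (\<O> U) (J U) (f [^]\<^bsub>\<O> U\<^esub> (p ^ e)) (cst X U (c ^ (p ^ e)))"
    by (simp add: cg_def frob_minus cst_pow)
  moreover have "f \<in> vanishing_at X U x \<longleftrightarrow> c = 0"
    using P.cg_mem [OF c] by (simp add: vanishing_cst)
  ultimately show ?thesis by blast
qed

text \<open>The inverse is explicit: with \<open>q = p ^ e\<close> and \<open>f ^ q\<close>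
  congruent to \<open>c ^ q\<close> for a nonzero \<open>c\<close>, it is
  \<open>f ^ (q - 1) / c ^ q\<close>.\<close>

lemma fat_inverse:
  assumes J: "fat_point e x J" and [simp]: "opn U" "x \<in> U" and f [simp]: "f \<in> carrier (\<O> U)"
    and nv: "f \<notin> vanishing_at X U x"
  shows "\<exists>g\<in>carrier (\<O> U). cg (\<O> U) (J U) (f \<otimes>\<^bsub>\<O> U\<^esub> g) \<one>\<^bsub>\<O> U\<^esub>"
proof -
  interpret U: cring "\<O> U" by (rule cringO) simp
  interpret I: ideal "J U" "\<O> U" by (rule sheaf_ideal [OF fat_sheaf [OF J]]) simp
  obtain c where c: "cg (\<O> U) (J U) (f [^]\<^bsub>\<O> U\<^esub> (p ^ e)) (cst X U (c ^ (p ^ e)))" "c \<noteq> 0"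
    using fat_pow_const [OF J, of U f] nv by auto
  obtain r where r: "p ^ e = Suc r" using p_pos by (metis not0_implies_Suc power_not_zero neq0_conv)
  define g where "g = f [^]\<^bsub>\<O> U\<^esub> r \<otimes>\<^bsub>\<O> U\<^esub> cst X U (inverse (c ^ (p ^ e)))"
  have "cg (\<O> U) (J U) (f [^]\<^bsub>\<O> U\<^esub> (p ^ e) \<otimes>\<^bsub>\<O> U\<^esub> cst X U (inverse (c ^ (p ^ e))))
      (cst X U (c ^ (p ^ e)) \<otimes>\<^bsub>\<O> U\<^esub> cst X U (inverse (c ^ (p ^ e))))"
    by (intro I.cg_mult c I.cg_refl) simp
  moreover have "f [^]\<^bsub>\<O> U\<^esub> (p ^ e) \<otimes>\<^bsub>\<O> U\<^esub> cst X U (inverse (c ^ (p ^ e))) = f \<otimes>\<^bsub>\<O> U\<^esub> g"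
    by (simp add: g_def r U.m_ac del: power_Suc)
  moreover have "cst X U (c ^ (p ^ e)) \<otimes>\<^bsub>\<O> U\<^esub> cst X U (inverse (c ^ (p ^ e))) = \<one>\<^bsub>\<O> U\<^esub>"
    using c(2) by (simp add: cst_mult [symmetric] cst_one)
  ultimately show ?thesis
    by (intro bexI [of _ g]) (simp_all add: g_def)
qed

text \<open>A section over \<open>W\<close> is \<open>a / h ^ m\<close> near \<open>x\<close>, and
  modulo \<open>J\<close> division by \<open>h\<close> is multiplication by an inverse that already
  exists over \<open>V\<close>.\<close>

lemma fat_surj:
  assumes J: "fat_point e x J" and V: "affine_open X V" and W [simp]: "opn W" "x \<in> W" "W \<subseteq> V"
    and g [simp]: "g \<in> carrier (\<O> W)"
  shows "\<exists>a\<in>carrier (\<O> V). cg (\<O> W) (J W) g (res X V W a)"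
proof -
  have [simp]: "opn V" "x \<in> V" using affine_open_opn [OF V] W(2,3) by blast+
  obtain h a D and m :: nat where h [simp]: "h \<in> carrier (\<O> V)" "a \<in> carrier (\<O> V)"
    and D: "D = nonvan X V h" and nv: "h \<notin> vanishing_at X V x"
    and D' [simp]: "x \<in> D" "D \<subseteq> W" "D \<subseteq> V" "opn D"
    and a: "res X W D g \<otimes>\<^bsub>\<O> D\<^esub> res X V D h [^]\<^bsub>\<O> D\<^esub> m = res X V D a"
    by (rule local_fraction [of W x g V]) (use V in auto)
  interpret V: cring "\<O> V" by (rule cringO) simp
  interpret D: cring "\<O> D" by (rule cringO) simp
  interpret W: cring "\<O> W" by (rule cringO) simp
  interpret I: ideal "J D" "\<O> D" by (rule sheaf_ideal [OF fat_sheaf [OF J]]) simp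
  obtain i where i [simp]: "i \<in> carrier (\<O> V)" and inv: "cg (\<O> V) (J V) (h \<otimes>\<^bsub>\<O> V\<^esub> i) \<one>\<^bsub>\<O> V\<^esub>"
    using fat_inverse [OF J, of V h] nv by auto
  let ?a = "i [^]\<^bsub>\<O> V\<^esub> m \<otimes>\<^bsub>\<O> V\<^esub> a" and ?h = "res X V D h" and ?i = "res X V D i" and ?g = "res X W D g"
  have "cg (\<O> D) (J D) (?h \<otimes>\<^bsub>\<O> D\<^esub> ?i) \<one>\<^bsub>\<O> D\<^esub>"
    using cg_res [OF fat_sheaf [OF J], of V D, OF _ _ _ inv] by simp
  then have "cg (\<O> D) (J D) (?g \<otimes>\<^bsub>\<O> D\<^esub> (?h \<otimes>\<^bsub>\<O> D\<^esub> ?i) [^]\<^bsub>\<O> D\<^esub> m) (?g \<otimes>\<^bsub>\<O> D\<^esub> \<one>\<^bsub>\<O> D\<^esub> [^]\<^bsub>\<O> D\<^esub> m)"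
    by (intro I.cg_mult I.cg_pow I.cg_refl) simp_all
  moreover have "?g \<otimes>\<^bsub>\<O> D\<^esub> (?h \<otimes>\<^bsub>\<O> D\<^esub> ?i) [^]\<^bsub>\<O> D\<^esub> m = (?g \<otimes>\<^bsub>\<O> D\<^esub> ?h [^]\<^bsub>\<O> D\<^esub> m) \<otimes>\<^bsub>\<O> D\<^esub> ?i [^]\<^bsub>\<O> D\<^esub> m"
    by (simp add: D.nat_pow_distrib D.m_assoc)
  ultimately have "cg (\<O> D) (J D) (res X V D ?a) ?g"
    unfolding a by (simp add: D.m_comm)
  then have "cg (\<O> D) (J D) (res X W D (res X V W ?a)) ?g"
    by simp
  then have "cg (\<O> W) (J W) (res X V W ?a) g"
    by (subst (asm) fat_cg_res_iff [OF J]) simp_all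
  then have "cg (\<O> W) (J W) g (res X V W ?a)"
    by (rule ideal.cg_sym [OF sheaf_ideal [OF fat_sheaf [OF J] W(1)]])
  then show ?thesis by (intro bexI [of _ ?a]) simp_all
qed

section \<open>Frobenius roots and images\<close>

lemma frob_root_simps [simp]:
  "sp (frob_root p X e) = sp X" "sec (frob_root p X e) = sec X" "res (frob_root p X e) = res X"
  by (simp_all add: frob_root_def)

lemma frob_root_nonvan [simp]: "nonvan (frob_root p X e) = nonvan X"
  by (intro ext) (simp add: nonvan_def)

text \<open>Passing from \<open>X\<close> to the root of level \<open>e\<close> changes only the
  embedding of constants, so notions that do not mention constants are unaffected.\<close>

lemma frob_root_invariant [simp]:
  "vanishing_at (frob_root p X e) = vanishing_at X"
  "affine_open (frob_root p X e) = affine_open X"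
  "closed_subscheme (frob_root p X e) = closed_subscheme X"
  "supported_in (frob_root p X e) = supported_in X"
proof -
  show *: "vanishing_at (frob_root p X e) = vanishing_at X"
    by (intro ext) (simp add: vanishing_at_def)
  show **: "affine_open (frob_root p X e) = affine_open X"
    by (intro ext) (simp only: affine_open_def frob_root_simps frob_root_nonvan *)
  show "closed_subscheme (frob_root p X e) = closed_subscheme X"
    by (intro ext) (simp only: closed_subscheme_def frob_root_simps frob_root_nonvan **)
  show "supported_in (frob_root p X e) = supported_in X"
    by (intro ext) (simp only: supported_in_def frob_root_simps)
qed

lemma cst_frob_root: "opn U \<Longrightarrow> cst (frob_root p X e) U c = cst X U (c ^ (p ^ e))"
  by (simp add: frob_root_def frob_def cst_pow)

lemma mem_frob_image: "opn U \<Longrightarrow> f \<in> frob_image p X e J U \<longleftrightarrow> f \<in> carrier (\<O> U) \<and> f [^]\<^bsub>\<O> U\<^esub> (p ^ e) \<in> J U"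
  by (simp add: frob_image_def frob_def)

lemma frob_image_sheaf:
  assumes J: "ideal_sheaf J"
  shows "ideal_sheaf (frob_image p X e J)"
  unfolding ideal_sheaf_def
proof (intro conjI allI impI ballI)
  fix U assume [simp]: "opn U"
  interpret U: cring "\<O> U" by (rule cringO) simp
  interpret I: ideal "J U" "\<O> U" by (rule sheaf_ideal [OF J]) simp
  show "ideal (frob_image p X e J U) (\<O> U)"
  proof (rule idealI)
    show "subgroup (frob_image p X e J U) (add_monoid (\<O> U))"
    proof (rule U.add.subgroupI)
      have "\<zero>\<^bsub>\<O> U\<^esub> \<in> frob_image p X e J U"
        by (simp add: mem_frob_image frob_zero)
      then show "frob_image p X e J U \<noteq> {}" by blast
    qed (auto simp: mem_frob_image frob_neg frob_add)
  qed (auto simp: mem_frob_image frob_mult U.ring_axioms intro: I.I_l_closed I.I_r_closed)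
next
  fix U V assume [simp]: "opn U" "opn V" "V \<subseteq> U"
  show "res X U V ` frob_image p X e J U \<subseteq> frob_image p X e J V"
  proof safe
    fix f assume f: "f \<in> frob_image p X e J U"
    then show "res X U V f \<in> frob_image p X e J V"
      using sheaf_res [OF J, of U V "f [^]\<^bsub>\<O> U\<^esub> (p ^ e)"] by (simp add: mem_frob_image)
  qed
next
  fix \<U> f assume *: "\<forall>V\<in>\<U>. opn V" "f \<in> carrier (\<O> (\<Union>\<U>))"
    "\<forall>V\<in>\<U>. res X (\<Union>\<U>) V f \<in> frob_image p X e J V"
  have [simp]: "opn (\<Union>\<U>)" using * by auto
  interpret U: cring "\<O> (\<Union>\<U>)" by (rule cringO) simp
  have "f [^]\<^bsub>\<O> (\<Union>\<U>)\<^esub> (p ^ e) \<in> J (\<Union>\<U>)"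
  proof (rule sheaf_glue [OF J])
    fix y assume "y \<in> \<Union>\<U>"
    then obtain V where V: "V \<in> \<U>" "y \<in> V" by blast
    then have "V \<subseteq> \<Union>\<U>" by blast
    then show "\<exists>W. opn W \<and> y \<in> W \<and> W \<subseteq> \<Union>\<U> \<and> res X (\<Union>\<U>) W (f [^]\<^bsub>\<O> (\<Union>\<U>)\<^esub> (p ^ e)) \<in> J W"
      using V * by (intro exI [of _ V]) (simp add: mem_frob_image)
  qed (use * in simp_all)
  then show "f \<in> frob_image p X e J (\<Union>\<U>)"
    using * by (simp add: mem_frob_image)
qed

text \<open>The issue is quasi-coherence. For \<open>g\<close> over \<open>D\<close> with
  \<open>g ^ q\<close> in \<open>J\<close>, some \<open>g * f ^ n\<close> extends to
  \<open>U\<close> and some \<open>g ^ q * f ^ m\<close> extends into \<open>J U\<close>. The two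
  extensions have to be reconciled, which costs one more power of \<open>f\<close> that must itself
  be absorbed into a \<open>q\<close>-th power.\<close>

lemma frob_image_closed_subscheme:
  assumes J: "closed_subscheme X J"
  shows "closed_subscheme X (frob_image p X e J)"
proof -
  let ?q = "p ^ e"
  have "\<exists>m::nat. \<exists>h\<in>frob_image p X e J U. g \<otimes>\<^bsub>\<O> D\<^esub> res X U D f [^]\<^bsub>\<O> D\<^esub> m = res X U D h"
    if U: "affine_open X U" and f: "f \<in> carrier (\<O> U)" and D: "D = nonvan X U f"
      and g: "g \<in> frob_image p X e J D" for U f g D
  proof -
    have [simp]: "opn U" "opn D" "D \<subseteq> U" "f \<in> carrier (\<O> U)"
      using U f by (auto simp: affine_open_opn D open_nonvan intro: subsetD [OF nonvan_subset])
    interpret U: cring "\<O> U" by (rule cringO) simp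
    interpret D: cring "\<O> D" by (rule cringO) simp
    interpret I: ideal "J U" "\<O> U" by (rule sheaf_ideal [OF closed_subscheme_ideal_sheaf [OF J]]) simp
    have g' [simp]: "g \<in> carrier (\<O> D)" "g [^]\<^bsub>\<O> D\<^esub> ?q \<in> J D"
      using g by (auto simp: mem_frob_image)
    obtain m :: nat and h where h: "h \<in> J U" and
      gh: "g [^]\<^bsub>\<O> D\<^esub> ?q \<otimes>\<^bsub>\<O> D\<^esub> res X U D f [^]\<^bsub>\<O> D\<^esub> m = res X U D h"
      using closed_subscheme_frac [OF J U f D g'(2)] by blast
    have [simp]: "h \<in> carrier (\<O> U)" using h I.a_subset by blast
    obtain n :: nat and a where [simp]: "a \<in> carrier (\<O> U)"
      and a: "g \<otimes>\<^bsub>\<O> D\<^esub> res X U D f [^]\<^bsub>\<O> D\<^esub> n = res X U D a"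
      using affine_num [OF U f D g'(1)] by blast
    define F where "F = res X U D f"
    have [simp]: "F \<in> carrier (\<O> D)" by (simp add: F_def)
    obtain r where r: "?q = Suc r"
      using p_pos by (metis not0_implies_Suc power_not_zero neq0_conv)
    have "m \<le> ?q * (n + m)" by (simp add: r)
    then have "m + (?q * (n + m) - m) = ?q * (n + m)" by simp
    then have eq: "F [^]\<^bsub>\<O> D\<^esub> m \<otimes>\<^bsub>\<O> D\<^esub> F [^]\<^bsub>\<O> D\<^esub> (?q * (n + m) - m) = F [^]\<^bsub>\<O> D\<^esub> (?q * (n + m))"
      by (simp add: D.nat_pow_mult)
    \<comment> \<open>\<open>?b\<close> extends \<open>g * f ^ (n + m)\<close> and
      \<open>?c\<close>, which lies in \<open>J U\<close>, extends the \<open>q\<close>-th power of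
      that. So \<open>?b ^ q\<close> and \<open>?c\<close> agree over \<open>D\<close>, and over
      \<open>U\<close> after multiplication by some \<open>f ^ l\<close>.\<close>
    let ?b = "a \<otimes>\<^bsub>\<O> U\<^esub> f [^]\<^bsub>\<O> U\<^esub> m" and ?c = "h \<otimes>\<^bsub>\<O> U\<^esub> f [^]\<^bsub>\<O> U\<^esub> (?q * (n + m) - m)"
    have b: "res X U D ?b = g \<otimes>\<^bsub>\<O> D\<^esub> F [^]\<^bsub>\<O> D\<^esub> (n + m)"
      by (simp add: a [symmetric] F_def D.m_assoc D.nat_pow_mult)
    have c: "res X U D ?c = g [^]\<^bsub>\<O> D\<^esub> ?q \<otimes>\<^bsub>\<O> D\<^esub> F [^]\<^bsub>\<O> D\<^esub> (?q * (n + m))"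
      by (simp add: gh [symmetric] D.m_assoc eq F_def [symmetric])
    have "res X U D (?b [^]\<^bsub>\<O> U\<^esub> ?q) = res X U D ?b [^]\<^bsub>\<O> D\<^esub> ?q"
      by (rule res_pow) simp_all
    also have "\<dots> = res X U D ?c"
      unfolding b c by (simp add: frob_mult D.nat_pow_pow mult.commute)
    finally have "res X U D (?b [^]\<^bsub>\<O> U\<^esub> ?q) = res X U D ?c" .
    then have "res X U D (?b [^]\<^bsub>\<O> U\<^esub> ?q \<ominus>\<^bsub>\<O> U\<^esub> ?c) = \<zero>\<^bsub>\<O> D\<^esub>"
      by (subst res_minus) (simp_all add: c a_minus_def D.r_neg del: res_mult res_pow)
    then obtain l :: nat where l: "f [^]\<^bsub>\<O> U\<^esub> l \<otimes>\<^bsub>\<O> U\<^esub> (?b [^]\<^bsub>\<O> U\<^esub> ?q \<ominus>\<^bsub>\<O> U\<^esub> ?c) = \<zero>\<^bsub>\<O> U\<^esub>"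
      using affine_kill [OF U f _ D] by (metis \<open>a \<in> carrier (\<O> U)\<close> \<open>f \<in> carrier (\<O> U)\<close>
          \<open>h \<in> carrier (\<O> U)\<close> U.m_closed U.minus_closed U.nat_pow_closed)
    let ?d = "?b \<otimes>\<^bsub>\<O> U\<^esub> f [^]\<^bsub>\<O> U\<^esub> l"
    have "f [^]\<^bsub>\<O> U\<^esub> l \<otimes>\<^bsub>\<O> U\<^esub> ?b [^]\<^bsub>\<O> U\<^esub> ?q \<ominus>\<^bsub>\<O> U\<^esub> f [^]\<^bsub>\<O> U\<^esub> l \<otimes>\<^bsub>\<O> U\<^esub> ?c = \<zero>\<^bsub>\<O> U\<^esub>"
      using l by (simp add: a_minus_def U.r_distr U.r_minus)
    moreover have "f [^]\<^bsub>\<O> U\<^esub> l \<otimes>\<^bsub>\<O> U\<^esub> ?c \<in> J U"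
      using h by (intro I.I_l_closed I.I_r_closed) simp_all
    ultimately have "f [^]\<^bsub>\<O> U\<^esub> l \<otimes>\<^bsub>\<O> U\<^esub> ?b [^]\<^bsub>\<O> U\<^esub> ?q \<in> J U"
      by (metis U.r_right_minus_eq \<open>a \<in> carrier (\<O> U)\<close> \<open>f \<in> carrier (\<O> U)\<close>
          \<open>h \<in> carrier (\<O> U)\<close> U.m_closed U.nat_pow_closed)
    \<comment> \<open>As \<open>q = r + 1\<close>, the factor \<open>f ^ (l * r)\<close> completes
      \<open>f ^ l\<close> to \<open>(f ^ l) ^ q\<close>, which moves the correction inside the
      \<open>q\<close>-th power.\<close>
    then have "f [^]\<^bsub>\<O> U\<^esub> (l * r) \<otimes>\<^bsub>\<O> U\<^esub> (f [^]\<^bsub>\<O> U\<^esub> l \<otimes>\<^bsub>\<O> U\<^esub> ?b [^]\<^bsub>\<O> U\<^esub> ?q) \<in> J U"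
      by (rule I.I_l_closed) simp_all
    also have "f [^]\<^bsub>\<O> U\<^esub> (l * r) \<otimes>\<^bsub>\<O> U\<^esub> (f [^]\<^bsub>\<O> U\<^esub> l \<otimes>\<^bsub>\<O> U\<^esub> ?b [^]\<^bsub>\<O> U\<^esub> ?q) = ?d [^]\<^bsub>\<O> U\<^esub> ?q"
    proof -
      have "f [^]\<^bsub>\<O> U\<^esub> (l * r) \<otimes>\<^bsub>\<O> U\<^esub> (f [^]\<^bsub>\<O> U\<^esub> l \<otimes>\<^bsub>\<O> U\<^esub> ?b [^]\<^bsub>\<O> U\<^esub> ?q)
          = f [^]\<^bsub>\<O> U\<^esub> (l * ?q) \<otimes>\<^bsub>\<O> U\<^esub> ?b [^]\<^bsub>\<O> U\<^esub> ?q"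
        by (simp add: r U.m_assoc [symmetric] U.nat_pow_mult add.commute del: U.nat_pow_Suc)
      also have "\<dots> = (f [^]\<^bsub>\<O> U\<^esub> l) [^]\<^bsub>\<O> U\<^esub> ?q \<otimes>\<^bsub>\<O> U\<^esub> ?b [^]\<^bsub>\<O> U\<^esub> ?q"
        by (simp add: U.nat_pow_pow)
      also have "\<dots> = ?d [^]\<^bsub>\<O> U\<^esub> ?q"
        by (subst U.nat_pow_distrib [symmetric]) (simp_all add: U.m_comm)
      finally show ?thesis .
    qed
    finally have "?d \<in> frob_image p X e J U"
      by (simp add: mem_frob_image)
    moreover have "g \<otimes>\<^bsub>\<O> D\<^esub> res X U D f [^]\<^bsub>\<O> D\<^esub> (n + m + l) = res X U D ?d"
      using b by (simp add: F_def [symmetric] D.m_assoc D.nat_pow_mult)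
    ultimately show ?thesis by blast
  qed
  moreover have "\<forall>U. \<not> opn U \<longrightarrow> frob_image p X e J U = {}"
    by (simp add: frob_image_def)
  ultimately show ?thesis
    using frob_image_sheaf [OF closed_subscheme_ideal_sheaf [OF J], of e]
    by (simp add: closed_subscheme_iff)
qed

lemma frob_image_fat:
  assumes J: "fat_point (e + 1) x J"
  shows "fat_point e x (frob_image p X 1 J)"
  unfolding fat_point_def
proof (intro conjI ballI allI impI subsetI)
  show "ideal_sheaf (frob_image p X 1 J)" "rational_point x"
    using J frob_image_sheaf by (auto simp: fat_point_def)
  fix y assume "y \<in> topspace (sp X) - {x}"
  then obtain W where W: "opn W" "y \<in> W" "J W = carrier (\<O> W)"
    using fat_other [OF J _ openin_topspace] by blast
  interpret W: cring "\<O> W" by (rule cringO) fact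
  show "\<exists>W. opn W \<and> y \<in> W \<and> frob_image p X 1 J W = carrier (\<O> W)"
    by (intro exI [of _ W] conjI W(1,2) Set.set_eqI) (auto simp add: mem_frob_image W)
next
  fix U f assume *: "opn U" "x \<in> U" "f \<in> frob_image p X 1 J U"
  then have "f [^]\<^bsub>\<O> U\<^esub> (p ^ 1) \<in> vanishing_at X U x"
    using fat_vanishing [OF J, of U "f [^]\<^bsub>\<O> U\<^esub> (p ^ 1)"] by (simp add: mem_frob_image)
  then show "f \<in> vanishing_at X U x"
    using * p_pos vanishing_pow [of U f "p ^ 1" x] by (simp add: mem_frob_image)
next
  fix U f assume *: "opn U" "x \<in> U" "f \<in> vanishing_at X U x"
  interpret U: cring "\<O> U" by (rule cringO) fact
  have "f \<in> carrier (\<O> U)" using * vanishing_carrier by blast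
  then show "f [^]\<^bsub>\<O> U\<^esub> (p ^ e) \<in> frob_image p X 1 J U"
    using * fat_pow [OF J *] by (simp add: mem_frob_image U.nat_pow_pow mult.commute)
qed

text \<open>By \<open>fat_pow_iff\<close> near \<open>x\<close>, and because both ideals are
  everything off \<open>x\<close>. So the projection of an F-blowup sends a fat point to its
  support.\<close>

lemma fat_frob_image:
  assumes J: "fat_point e x J"
  shows "frob_image p X e J = point_ideal X x"
proof
  fix U
  show "frob_image p X e J U = point_ideal X x U"
  proof (cases "opn U")
    case True
    interpret U: cring "\<O> U" by (rule cringO) fact
    show ?thesis
    proof (cases "x \<in> U")
      case True
      show ?thesis
        using True \<open>opn U\<close> fat_pow_iff [OF J \<open>opn U\<close> True]
        by (intro Set.set_eqI) (auto simp add: mem_frob_image point_ideal_def)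
    next
      case False
      then have "J U = carrier (\<O> U)"
        using fat_off [OF J] \<open>opn U\<close> by blast
      then show ?thesis
        using False \<open>opn U\<close> by (intro Set.set_eqI) (auto simp add: mem_frob_image point_ideal_def)
    qed
  qed (simp add: frob_image_def point_ideal_def)
qed

lemma fat_closed_point:
  assumes J: "fat_point e x J"
  shows "closed_point X x"
proof -
  have x: "x \<in> topspace (sp X)" using J by (simp add: fat_point_def rational_point_def)
  have "opn (topspace (sp X) - {x})"
  proof (subst openin_subopen, intro ballI)
    fix y assume "y \<in> topspace (sp X) - {x}"
    then obtain W where W: "opn W" "y \<in> W" "J W = carrier (\<O> W)"
      using fat_other [OF J _ openin_topspace] by blast
    interpret W: cring "\<O> W" by (rule cringO) fact
    have "x \<notin> W"
    proof
      assume "x \<in> W"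
      then have "cst X W 1 \<in> vanishing_at X W x"
        using W fat_vanishing [OF J, of W] by simp
      then show False using W \<open>x \<in> W\<close> by (simp add: vanishing_cst)
    qed
    then show "\<exists>T. opn T \<and> y \<in> T \<and> T \<subseteq> topspace (sp X) - {x}"
      using W openin_subset [of "sp X" W] by blast
  qed
  then show ?thesis
    using x by (simp add: closed_point_def closedin_def)
qed

lemma point_ideal_inj:
  assumes x: "x \<in> topspace (sp X)" and y: "y \<in> topspace (sp X)" and eq: "point_ideal X x = point_ideal X y"
  shows "x = y"
proof -
  obtain V where V: "affine_open X V" "x \<in> V" using ex_affine [OF x] by blast
  have [simp]: "opn V" using V(1) by (rule affine_open_opn)
  have "\<one>\<^bsub>\<O> V\<^esub> \<in> carrier (\<O> V)" by (simp add: ring.ring_simprules ringO)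
  moreover have "\<one>\<^bsub>\<O> V\<^esub> \<notin> vanishing_at X V x"
    using V vanishing_cst [of V x 1] by (simp add: cst_one)
  ultimately have "y \<in> V"
    using fun_cong [OF eq, of V] V by (auto simp: point_ideal_def)
  then have "vanishing_at X V x = vanishing_at X V y"
    using fun_cong [OF eq, of V] V vanishing_carrier by (auto simp: point_ideal_def set_eq_iff subset_iff)
  then show ?thesis using affine_point_inj V \<open>y \<in> V\<close> by blast
qed

lemma fat_proj:
  assumes J: "fat_point e x J"
  shows "F_blowup_proj p X e J = x"
  unfolding F_blowup_proj_def
proof (rule the_equality)
  show "closed_point X x \<and> frob_image p X e J = point_ideal X x"
    using J by (simp add: fat_frob_image fat_closed_point)
  fix y assume "closed_point X y \<and> frob_image p X e J = point_ideal X y"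
  then show "y = x"
    using J fat_closed_point [OF J] by (intro point_ideal_inj) (auto simp: fat_frob_image closed_point_def)
qed

section \<open>Coordinates modulo an ideal\<close>

text \<open>The scalar \<open>c\<close> acts on the root of level \<open>e\<close> as
  \<open>c ^ (p ^ e)\<close>. With coefficients written as such powers, additivity in
  \<open>c\<close> is additivity of Frobenius.\<close>

definition lincomb :: "nat \<Rightarrow> 'p set \<Rightarrow> nat \<Rightarrow> (nat \<Rightarrow> 's) \<Rightarrow> (nat \<Rightarrow> 'k) \<Rightarrow> 's" where
  "lincomb e U n b c = (\<Oplus>\<^bsub>\<O> U\<^esub>i\<in>{..<n}. cst X U (c i ^ (p ^ e)) \<otimes>\<^bsub>\<O> U\<^esub> b i)"

lemma coords_lincomb:
  assumes [simp]: "opn U" and b: "\<forall>i<n. b i \<in> carrier (\<O> U)"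
  shows "coords (frob_root p X e) U I n b f c \<longleftrightarrow>
    (\<forall>i\<ge>n. c i = 0) \<and> f \<ominus>\<^bsub>\<O> U\<^esub> lincomb e U n b c \<in> I"
  unfolding coords_def lincomb_def by (simp add: cst_frob_root)

context
  fixes U assumes U [simp]: "opn U"
begin

interpretation U: cring "\<O> U" by (rule cringO) fact

lemma lincomb_0 [simp]: "lincomb e U 0 b c = \<zero>\<^bsub>\<O> U\<^esub>"
  by (simp add: lincomb_def)

lemma lincomb_Suc:
  assumes "\<forall>i<Suc n. b i \<in> carrier (\<O> U)"
  shows "lincomb e U (Suc n) b c = cst X U (c n ^ (p ^ e)) \<otimes>\<^bsub>\<O> U\<^esub> b n \<oplus>\<^bsub>\<O> U\<^esub> lincomb e U n b c"
  unfolding lincomb_def lessThan_Suc using assms by (subst U.finsum_insert) auto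

lemma lincomb_closed [simp]:
  assumes "\<forall>i<n. b i \<in> carrier (\<O> U)"
  shows "lincomb e U n b c \<in> carrier (\<O> U)"
  unfolding lincomb_def using assms by (intro U.finsum_closed) auto

lemma lincomb_cong:
  "(\<And>i. i < n \<Longrightarrow> b i = b' i) \<Longrightarrow> \<forall>i<n. b' i \<in> carrier (\<O> U) \<Longrightarrow> lincomb e U n b c = lincomb e U n b' c"
  by (induction n) (simp_all add: lincomb_Suc)

lemma lincomb_add:
  assumes "\<forall>i<n. b i \<in> carrier (\<O> U)"
  shows "lincomb e U n b (\<lambda>i. c i + d i) = lincomb e U n b c \<oplus>\<^bsub>\<O> U\<^esub> lincomb e U n b d"
  using assms
proof (induction n)
  case (Suc n)
  then have [simp]: "b n \<in> carrier (\<O> U)" "\<forall>i<n. b i \<in> carrier (\<O> U)" by auto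
  have "cst X U ((c n + d n) ^ (p ^ e)) = cst X U (c n ^ (p ^ e)) \<oplus>\<^bsub>\<O> U\<^esub> cst X U (d n ^ (p ^ e))"
    by (simp add: cst_pow cst_add frob_add)
  then show ?case
    using Suc by (simp add: lincomb_Suc U.l_distr U.a_ac)
qed simp

lemma lincomb_scale:
  assumes "\<forall>i<n. b i \<in> carrier (\<O> U)"
  shows "lincomb e U n b (\<lambda>i. a * c i) = cst X U (a ^ (p ^ e)) \<otimes>\<^bsub>\<O> U\<^esub> lincomb e U n b c"
  using assms
proof (induction n)
  case (Suc n)
  then have [simp]: "b n \<in> carrier (\<O> U)" "\<forall>i<n. b i \<in> carrier (\<O> U)" by auto
  show ?case
    using Suc by (simp add: lincomb_Suc U.r_distr power_mult_distrib cst_mult U.m_assoc)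
qed simp

lemma lincomb_zero:
  assumes "\<forall>i<n. b i \<in> carrier (\<O> U)"
  shows "lincomb e U n b (\<lambda>i. 0) = \<zero>\<^bsub>\<O> U\<^esub>"
  using assms
proof (induction n)
  case (Suc n)
  then have "b n \<in> carrier (\<O> U)" "\<forall>i<n. b i \<in> carrier (\<O> U)" by auto
  then show ?case
    using Suc p_pos by (simp add: lincomb_Suc cst_zero zero_power)
qed simp

text \<open>The same coefficients serve at both levels. Through this identity coordinates modulo the
  image of \<open>J\<close> become coordinates modulo \<open>J\<close>.\<close>

lemma lincomb_frob:
  assumes "\<forall>i<n. b i \<in> carrier (\<O> U)"
  shows "lincomb e U n b c [^]\<^bsub>\<O> U\<^esub> p = lincomb (e + 1) U n (\<lambda>i. b i [^]\<^bsub>\<O> U\<^esub> p) c"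
  using assms
proof (induction n)
  case 0
  show ?case using frob_zero [OF U, of 1] by simp
next
  case (Suc n)
  then have [simp]: "b n \<in> carrier (\<O> U)" "\<forall>i<n. b i \<in> carrier (\<O> U)" by auto
  have "lincomb e U (Suc n) b c [^]\<^bsub>\<O> U\<^esub> p
      = (cst X U (c n ^ (p ^ e)) \<otimes>\<^bsub>\<O> U\<^esub> b n) [^]\<^bsub>\<O> U\<^esub> p \<oplus>\<^bsub>\<O> U\<^esub> lincomb e U n b c [^]\<^bsub>\<O> U\<^esub> p"
    using frob_add [OF U, of "cst X U (c n ^ (p ^ e)) \<otimes>\<^bsub>\<O> U\<^esub> b n" "lincomb e U n b c" 1] Suc
    by (simp add: lincomb_Suc)
  also have "(cst X U (c n ^ (p ^ e)) \<otimes>\<^bsub>\<O> U\<^esub> b n) [^]\<^bsub>\<O> U\<^esub> p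
      = cst X U (c n ^ (p ^ (e + 1))) \<otimes>\<^bsub>\<O> U\<^esub> b n [^]\<^bsub>\<O> U\<^esub> p"
    by (simp add: frob_mult cst_pow [symmetric] power_mult [symmetric] mult.commute)
  finally show ?case
    using Suc by (simp add: lincomb_Suc)
qed

end

lemma res_lincomb:
  assumes b: "\<forall>i<n. b i \<in> carrier (\<O> U)" and [simp]: "opn U" "opn W" "W \<subseteq> U"
  shows "res X U W (lincomb e U n b c) = lincomb e W n (\<lambda>i. res X U W (b i)) c"
  using b
proof (induction n)
  case (Suc n)
  then have [simp]: "b n \<in> carrier (\<O> U)" "\<forall>i<n. b i \<in> carrier (\<O> U)" by auto
  interpret U: cring "\<O> U" by (rule cringO) simp
  interpret W: cring "\<O> W" by (rule cringO) simp
  show ?case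
    using Suc by (simp add: lincomb_Suc)
qed simp

text \<open>
  The quotient of the sections over \<open>U\<close> by \<open>I\<close>, a vector space over \<open>k\<close> via \<open>X\<^sub>e\<close>, is represented by the image
  of a linear map \<open>\<kappa>\<close> with kernel \<open>I\<close>; so linear algebra takes place in the single type \<open>nat \<Rightarrow> 'k\<close>.
\<close>

definition kmap :: "nat \<Rightarrow> 'p set \<Rightarrow> 's set \<Rightarrow> ('s \<Rightarrow> nat \<Rightarrow> 'k) \<Rightarrow> bool" where
  "kmap e U I \<kappa> \<longleftrightarrow>
     (\<forall>f\<in>carrier (\<O> U). \<forall>g\<in>carrier (\<O> U). \<kappa> (f \<oplus>\<^bsub>\<O> U\<^esub> g) = \<kappa> f + \<kappa> g) \<and>
     (\<forall>c. \<forall>f\<in>carrier (\<O> U). \<kappa> (cst X U (c ^ (p ^ e)) \<otimes>\<^bsub>\<O> U\<^esub> f) = coord_scale c (\<kappa> f)) \<and>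
     (\<forall>f\<in>carrier (\<O> U). \<kappa> f = 0 \<longleftrightarrow> f \<in> I)"

context
  fixes e U I \<kappa> assumes U [simp]: "opn U" and \<kappa>: "kmap e U I \<kappa>"
begin

interpretation U: cring "\<O> U" by (rule cringO) fact

lemma kmap_add: "f \<in> carrier (\<O> U) \<Longrightarrow> g \<in> carrier (\<O> U) \<Longrightarrow> \<kappa> (f \<oplus>\<^bsub>\<O> U\<^esub> g) = \<kappa> f + \<kappa> g"
  and kmap_scale: "f \<in> carrier (\<O> U) \<Longrightarrow> \<kappa> (cst X U (c ^ (p ^ e)) \<otimes>\<^bsub>\<O> U\<^esub> f) = coord_scale c (\<kappa> f)"
  and kmap_ker: "f \<in> carrier (\<O> U) \<Longrightarrow> \<kappa> f = 0 \<longleftrightarrow> f \<in> I"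
  using \<kappa> by (auto simp: kmap_def)

lemma kmap_zero: "\<kappa> \<zero>\<^bsub>\<O> U\<^esub> = 0"
  using kmap_add [of "\<zero>\<^bsub>\<O> U\<^esub>" "\<zero>\<^bsub>\<O> U\<^esub>"] by simp

lemma kmap_minus:
  assumes [simp]: "f \<in> carrier (\<O> U)" "g \<in> carrier (\<O> U)"
  shows "\<kappa> (f \<ominus>\<^bsub>\<O> U\<^esub> g) = \<kappa> f - \<kappa> g"
proof -
  have "f = (f \<ominus>\<^bsub>\<O> U\<^esub> g) \<oplus>\<^bsub>\<O> U\<^esub> g"
    by (simp add: a_minus_def U.a_assoc U.l_neg)
  then have "\<kappa> f = \<kappa> (f \<ominus>\<^bsub>\<O> U\<^esub> g) + \<kappa> g"
    by (metis assms U.minus_closed kmap_add)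
  then show ?thesis by simp
qed

lemma kmap_cg_iff:
  "f \<in> carrier (\<O> U) \<Longrightarrow> g \<in> carrier (\<O> U) \<Longrightarrow> cg (\<O> U) I f g \<longleftrightarrow> \<kappa> f = \<kappa> g"
  using kmap_ker [of "f \<ominus>\<^bsub>\<O> U\<^esub> g"] by (simp add: cg_def kmap_minus)

lemma kmap_lincomb:
  assumes "\<forall>i<n. b i \<in> carrier (\<O> U)"
  shows "\<kappa> (lincomb e U n b c) = (\<Sum>i<n. coord_scale (c i) (\<kappa> (b i)))"
  using assms
  by (induction n) (simp_all add: kmap_zero lincomb_Suc kmap_add kmap_scale add.commute)

lemma kmap_coords:
  assumes "\<forall>i<n. b i \<in> carrier (\<O> U)" "f \<in> carrier (\<O> U)"
  shows "coords (frob_root p X e) U I n b f c \<longleftrightarrow>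
    (\<forall>i\<ge>n. c i = 0) \<and> \<kappa> f = (\<Sum>i<n. coord_scale (c i) (\<kappa> (b i)))"
  using assms kmap_ker [of "f \<ominus>\<^bsub>\<O> U\<^esub> lincomb e U n b c"]
  by (simp add: coords_lincomb kmap_minus kmap_lincomb)

lemma kmap_subspace: "cs.subspace (\<kappa> ` carrier (\<O> U))"
  unfolding cs.subspace_def
proof (intro conjI ballI allI)
  show "0 \<in> \<kappa> ` carrier (\<O> U)"
    using kmap_zero U.zero_closed by (metis imageI)
  show "x + y \<in> \<kappa> ` carrier (\<O> U)" if "x \<in> \<kappa> ` carrier (\<O> U)" "y \<in> \<kappa> ` carrier (\<O> U)" for x y
    using that by (auto simp: kmap_add [symmetric])
  show "coord_scale c x \<in> \<kappa> ` carrier (\<O> U)" if "x \<in> \<kappa> ` carrier (\<O> U)" for c x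
    using that by (auto simp: kmap_scale [symmetric])
qed

lemma kmap_basis_mod:
  assumes b: "\<forall>i<m. b i \<in> carrier (\<O> U)"
  shows "basis_mod (frob_root p X e) U (carrier (\<O> U)) I m b \<longleftrightarrow>
    cs.fam_basis (\<kappa> ` carrier (\<O> U)) {..<m} (\<lambda>i. \<kappa> (b i))"
proof -
  have "\<forall>i<m. \<kappa> (b i) \<in> \<kappa> ` carrier (\<O> U)"
    using b by blast
  moreover have "coords (frob_root p X e) U I m b f =
      (\<lambda>c. (\<forall>i\<ge>m. c i = 0) \<and> \<kappa> f = (\<Sum>i<m. coord_scale (c i) (\<kappa> (b i))))" if "f \<in> carrier (\<O> U)" for f
    using b that by (intro ext) (simp add: kmap_coords)
  ultimately show ?thesis
    using b unfolding fam_basis_iff_ex1_coords [OF kmap_subspace] basis_mod_def by simp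
qed

end

text \<open>The map takes coordinates with respect to \<open>b\<close>; it is linear with kernel
  \<open>I\<close> because coordinates are unique.\<close>

lemma basis_mod_ex_kmap:
  assumes U [simp]: "opn U" and I: "ideal I (\<O> U)"
    and b: "basis_mod (frob_root p X e) U (carrier (\<O> U)) I n b"
  obtains \<kappa> where "kmap e U I \<kappa>" "\<kappa> ` carrier (\<O> U) = coord_space n"
    "\<And>f. f \<in> carrier (\<O> U) \<Longrightarrow> coords (frob_root p X e) U I n b f (\<kappa> f)"
proof -
  interpret U: cring "\<O> U" by (rule cringO) fact
  interpret I: ideal I "\<O> U" by fact
  define C where "C f c \<longleftrightarrow> coords (frob_root p X e) U I n b f c" for f c
  have bU: "\<forall>i<n. b i \<in> carrier (\<O> U)"
    using b by (simp add: basis_mod_def)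
  have C: "C f c \<longleftrightarrow> (\<forall>i\<ge>n. c i = 0) \<and> cg (\<O> U) I f (lincomb e U n b c)"
    if "f \<in> carrier (\<O> U)" for f c
    using that bU by (simp add: C_def coords_lincomb cg_def)
  have ex1: "\<exists>!c. C f c" if "f \<in> carrier (\<O> U)" for f
    using b that by (simp add: C_def basis_mod_def)
  define \<kappa> where "\<kappa> f = (THE c. C f c)" for f
  have \<kappa>: "C f (\<kappa> f)" if "f \<in> carrier (\<O> U)" for f
    unfolding \<kappa>_def by (rule theI' [OF ex1 [OF that]])
  have eq: "\<kappa> f = c" if "f \<in> carrier (\<O> U)" "C f c" for f c
    using ex1_imp_eq [of "C f"] ex1 \<kappa> that by blast
  have "kmap e U I \<kappa>"
    unfolding kmap_def
  proof (intro conjI ballI allI)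
    fix f g assume [simp]: "f \<in> carrier (\<O> U)" "g \<in> carrier (\<O> U)"
    have "C (f \<oplus>\<^bsub>\<O> U\<^esub> g) (\<lambda>i. \<kappa> f i + \<kappa> g i)"
      using \<kappa> [of f] \<kappa> [of g] bU by (simp add: C lincomb_add I.cg_add)
    then show "\<kappa> (f \<oplus>\<^bsub>\<O> U\<^esub> g) = \<kappa> f + \<kappa> g"
      by (subst eq [of _ "\<lambda>i. \<kappa> f i + \<kappa> g i"]) (auto simp: fun_eq_iff)
  next
    fix c f assume [simp]: "f \<in> carrier (\<O> U)"
    have "C (cst X U (c ^ (p ^ e)) \<otimes>\<^bsub>\<O> U\<^esub> f) (\<lambda>i. c * \<kappa> f i)"
      using \<kappa> [of f] bU by (simp add: C lincomb_scale I.cg_mult I.cg_refl)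
    then show "\<kappa> (cst X U (c ^ (p ^ e)) \<otimes>\<^bsub>\<O> U\<^esub> f) = coord_scale c (\<kappa> f)"
      by (subst eq [of _ "\<lambda>i. c * \<kappa> f i"]) (auto simp: fun_eq_iff coord_scale_def)
  next
    fix f assume [simp]: "f \<in> carrier (\<O> U)"
    have zero: "lincomb e U n b (0 :: nat \<Rightarrow> 'k) = \<zero>\<^bsub>\<O> U\<^esub>"
      using bU by (simp add: zero_fun_def lincomb_zero)
    show "\<kappa> f = 0 \<longleftrightarrow> f \<in> I"
    proof
      assume "\<kappa> f = 0"
      then have "C f 0" using \<kappa> [of f] by simp
      then show "f \<in> I" by (simp add: C zero I.mem_iff_cg_zero)
    next
      assume "f \<in> I"
      then have "C f 0" by (simp add: C zero I.mem_iff_cg_zero)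
      then show "\<kappa> f = 0" by (intro eq) simp_all
    qed
  qed
  moreover have "\<kappa> ` carrier (\<O> U) = coord_space n"
  proof (intro equalityI subsetI)
    fix v assume "v \<in> \<kappa> ` carrier (\<O> U)"
    then show "v \<in> coord_space n" using \<kappa> C by (auto simp: coord_space_def)
  next
    fix v :: "nat \<Rightarrow> 'k" assume "v \<in> coord_space n"
    then have "C (lincomb e U n b v) v"
      using bU by (simp add: C coord_space_def I.cg_refl)
    then show "v \<in> \<kappa> ` carrier (\<O> U)"
      using eq [of "lincomb e U n b v" v] bU by (metis U image_eqI lincomb_closed)
  qed
  ultimately show thesis
    using \<kappa> unfolding C_def by (rule that)
qed

lemma fat_in_chart:
  assumes J: "fat_point e x J" and V: "opn V" and sup: "supported_in X V J"
  shows "x \<in> V"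
proof (rule ccontr)
  assume "x \<notin> V"
  moreover have "x \<in> topspace (sp X)"
    using fat_rational [OF J] by (simp add: rational_point_def)
  ultimately obtain W where W: "opn W" "x \<in> W" "J W = carrier (\<O> W)"
    using sup by (auto simp: supported_in_def)
  then have "cst X W 1 \<in> vanishing_at X W x"
    using fat_vanishing [OF J, of W] by simp
  then show False using W by (simp add: vanishing_cst)
qed

text \<open>A chart yields coordinates only over its own \<open>V\<close>. Since the quotient by
  \<open>J\<close> is the same near \<open>x\<close> for all neighbourhoods, the map is transported
  to every \<open>U\<close>, compatibly with restriction; over affine \<open>U\<close> it keeps its
  full image, by \<open>fat_surj\<close> applied to \<open>U\<close>. Monomials can then be examined
  on an affine set unrelated to the chart.\<close>

lemma fat_kmap:
  assumes J: "fat_point e x J" and V: "affine_open X V" "x \<in> V"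
    and b: "basis_mod (frob_root p X e) V (carrier (\<O> V)) (J V) n b"
  obtains \<kappa> where "\<And>U. opn U \<Longrightarrow> x \<in> U \<Longrightarrow> kmap e U (J U) (\<kappa> U)"
    "\<And>U W f. opn U \<Longrightarrow> opn W \<Longrightarrow> x \<in> W \<Longrightarrow> W \<subseteq> U \<Longrightarrow> f \<in> carrier (\<O> U) \<Longrightarrow> \<kappa> W (res X U W f) = \<kappa> U f"
    "\<And>U. affine_open X U \<Longrightarrow> x \<in> U \<Longrightarrow> \<kappa> U ` carrier (\<O> U) = coord_space n"
proof -
  have [simp]: "opn V" "x \<in> V" using V affine_open_opn by auto
  have ideal: "ideal (J U) (\<O> U)" if "opn U" for U
    using that by (rule sheaf_ideal [OF fat_sheaf [OF J]])
  obtain \<kappa>0 where \<kappa>0: "kmap e V (J V) \<kappa>0" and im: "\<kappa>0 ` carrier (\<O> V) = coord_space n"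
    by (rule basis_mod_ex_kmap [OF \<open>opn V\<close> ideal [OF \<open>opn V\<close>] b])
  \<comment> \<open>\<open>a\<close> over \<open>V\<close> and \<open>f\<close> over
    \<open>U\<close> agree modulo \<open>J\<close> on the overlap. Such an \<open>a\<close> exists
    by \<open>fat_surj\<close> and is unique modulo \<open>J V\<close>.\<close>
  define R where "R U f a \<longleftrightarrow> a \<in> carrier (\<O> V) \<and>
    cg (\<O> (U \<inter> V)) (J (U \<inter> V)) (res X U (U \<inter> V) f) (res X V (U \<inter> V) a)" for U f a
  define \<kappa> where "\<kappa> U f = \<kappa>0 (SOME a. R U f a)" for U f
  have ex: "\<exists>a. R U f a" if "opn U" "x \<in> U" "f \<in> carrier (\<O> U)" for U f
    using fat_surj [OF J V(1), of "U \<inter> V" "res X U (U \<inter> V) f"] that by (auto simp: R_def openin_Int)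
  have eq: "\<kappa> U f = \<kappa>0 a" if U: "opn U" "x \<in> U" and f: "R U f a" for U f a
  proof -
    have W [simp]: "opn (U \<inter> V)" using U by (simp add: openin_Int)
    define s where "s = (SOME a. R U f a)"
    have R: "R U f s" unfolding s_def using someI [of "R U f", OF f] .
    then have "cg (\<O> (U \<inter> V)) (J (U \<inter> V)) (res X V (U \<inter> V) s) (res X V (U \<inter> V) a)"
      using f ideal.cg_sym [OF ideal [OF W]] ideal.cg_trans [OF ideal [OF W]] unfolding R_def by blast
    then have "cg (\<O> V) (J V) s a"
      using R f U by (subst (asm) fat_cg_res_iff [OF J]) (auto simp: R_def)
    then have "\<kappa>0 s = \<kappa>0 a"
      using R f kmap_cg_iff [OF _ \<kappa>0] by (simp add: R_def)
    then show ?thesis by (simp add: \<kappa>_def s_def)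
  qed
  have km: "kmap e U (J U) (\<kappa> U)" if U [simp]: "opn U" "x \<in> U" for U
    unfolding kmap_def
  proof (intro conjI ballI allI)
    let ?W = "U \<inter> V"
    have W [simp]: "opn ?W" by (simp add: openin_Int)
    interpret V: cring "\<O> V" by (rule cringO) simp
    interpret I: ideal "J ?W" "\<O> ?W" by (rule ideal) simp
    fix f g assume [simp]: "f \<in> carrier (\<O> U)" "g \<in> carrier (\<O> U)"
    obtain a a' where a: "R U f a" "R U g a'" using ex [of U] by fastforce
    then have [simp]: "a \<in> carrier (\<O> V)" "a' \<in> carrier (\<O> V)" by (auto simp: R_def)
    have "R U (f \<oplus>\<^bsub>\<O> U\<^esub> g) (a \<oplus>\<^bsub>\<O> V\<^esub> a')"
      using a by (simp add: R_def I.cg_add)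
    then show "\<kappa> U (f \<oplus>\<^bsub>\<O> U\<^esub> g) = \<kappa> U f + \<kappa> U g"
      using a kmap_add [OF _ \<kappa>0] by (simp add: eq)
  next
    let ?W = "U \<inter> V"
    have W [simp]: "opn ?W" by (simp add: openin_Int)
    interpret V: cring "\<O> V" by (rule cringO) simp
    interpret I: ideal "J ?W" "\<O> ?W" by (rule ideal) simp
    fix c f assume [simp]: "f \<in> carrier (\<O> U)"
    obtain a where a: "R U f a" using ex [of U] by fastforce
    then have [simp]: "a \<in> carrier (\<O> V)" by (auto simp: R_def)
    have "R U (cst X U (c ^ (p ^ e)) \<otimes>\<^bsub>\<O> U\<^esub> f) (cst X V (c ^ (p ^ e)) \<otimes>\<^bsub>\<O> V\<^esub> a)"
      using a by (simp add: R_def I.cg_mult I.cg_refl)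
    then show "\<kappa> U (cst X U (c ^ (p ^ e)) \<otimes>\<^bsub>\<O> U\<^esub> f) = coord_scale c (\<kappa> U f)"
      using a kmap_scale [OF _ \<kappa>0] by (simp add: eq)
  next
    let ?W = "U \<inter> V"
    have W [simp]: "opn ?W" by (simp add: openin_Int)
    interpret I: ideal "J ?W" "\<O> ?W" by (rule ideal) simp
    fix f assume [simp]: "f \<in> carrier (\<O> U)"
    obtain a where a: "R U f a" using ex [of U] by fastforce
    then have [simp]: "a \<in> carrier (\<O> V)" by (auto simp: R_def)
    have "\<kappa> U f = 0 \<longleftrightarrow> a \<in> J V"
      using a kmap_ker [OF _ \<kappa>0] by (simp add: eq)
    also have "\<dots> \<longleftrightarrow> res X V ?W a \<in> J ?W"
      by (simp add: fat_res_iff [OF J])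
    also have "\<dots> \<longleftrightarrow> res X U ?W f \<in> J ?W"
      using a I.cg_mem by (auto simp: R_def)
    also have "\<dots> \<longleftrightarrow> f \<in> J U"
      by (simp add: fat_res_iff [OF J])
    finally show "\<kappa> U f = 0 \<longleftrightarrow> f \<in> J U" .
  qed
  have restr: "\<kappa> W (res X U W f) = \<kappa> U f"
    if [simp]: "opn U" "opn W" "x \<in> W" "W \<subseteq> U" "f \<in> carrier (\<O> U)" for U W f
  proof -
    have UV [simp]: "opn (U \<inter> V)" "opn (W \<inter> V)" "W \<inter> V \<subseteq> U \<inter> V" "W \<inter> V \<subseteq> U"
      using that(4) by (blast intro: that openin_Int \<open>opn V\<close>)+
    have [simp]: "x \<in> U" using that(3,4) by blast
    obtain a where a: "R U f a" using ex [of U] by fastforce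
    then have [simp]: "a \<in> carrier (\<O> V)" by (auto simp: R_def)
    have "R W (res X U W f) a"
      using cg_res [OF fat_sheaf [OF J], of "U \<inter> V" "W \<inter> V" "res X U (U \<inter> V) f" "res X V (U \<inter> V) a"] a
      by (simp add: R_def)
    then show ?thesis using a by (simp add: eq)
  qed
  have "\<kappa> U ` carrier (\<O> U) = coord_space n" if U: "affine_open X U" "x \<in> U" for U
  proof (intro equalityI subsetI)
    have [simp]: "opn U" "x \<in> U" "opn (U \<inter> V)" using U affine_open_opn by (auto simp: openin_Int)
    show "v \<in> coord_space n" if v: "v \<in> \<kappa> U ` carrier (\<O> U)" for v
    proof -
      obtain f where f: "f \<in> carrier (\<O> U)" "v = \<kappa> U f" using v by blast
      obtain a where "R U f a" using ex [of U f] f by auto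
      then show ?thesis using f im by (auto simp: eq R_def)
    qed
    show "v \<in> \<kappa> U ` carrier (\<O> U)" if v: "v \<in> coord_space n" for v
    proof -
      obtain a where a: "a \<in> carrier (\<O> V)" "v = \<kappa>0 a" using v im by blast
      then obtain f where f: "f \<in> carrier (\<O> U)"
        "cg (\<O> (U \<inter> V)) (J (U \<inter> V)) (res X V (U \<inter> V) a) (res X U (U \<inter> V) f)"
        using fat_surj [OF J U(1), of "U \<inter> V" "res X V (U \<inter> V) a"] by auto
      have "R U f a"
        using f a ideal.cg_sym [OF ideal] by (simp add: R_def)
      then have "v = \<kappa> U f" using a by (simp add: eq)
      then show ?thesis using f(1) by blast
    qed
  qed
  with km restr show thesis by (rule that)
qed

text \<open>The point comes from the ideal \<open>M\<close> of sections over \<open>V\<close> whose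
  \<open>p ^ e\<close>-th power is in \<open>J V\<close>. By \<open>rat\<close> every section is
  constant modulo \<open>M\<close>, so \<open>M\<close> is prime, and on an affine set a prime is a
  point.\<close>

lemma fat_pointI:
  assumes J: "ideal_sheaf J" and V: "affine_open X V" and sup: "supported_in X V J"
    and one: "\<one>\<^bsub>\<O> V\<^esub> \<notin> J V"
    and rat: "\<And>f. f \<in> carrier (\<O> V) \<Longrightarrow> \<exists>c. (f \<ominus>\<^bsub>\<O> V\<^esub> cst X V c) [^]\<^bsub>\<O> V\<^esub> (p ^ e) \<in> J V"
  obtains x where "x \<in> V" "fat_point e x J"
proof -
  have V' [simp]: "opn V" using V by (rule affine_open_opn)
  interpret V: cring "\<O> V" by (rule cringO) simp
  define M where "M = frob_image p X e J V"
  have M: "f \<in> M \<longleftrightarrow> f \<in> carrier (\<O> V) \<and> f [^]\<^bsub>\<O> V\<^esub> (p ^ e) \<in> J V" for f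
    by (simp add: M_def mem_frob_image)
  interpret M: ideal M "\<O> V"
    unfolding M_def by (rule sheaf_ideal [OF frob_image_sheaf [OF J]]) simp
  have cst_M: "c = 0" if "cst X V c \<in> M" for c
  proof (rule ccontr)
    assume "c \<noteq> 0"
    then have "cst X V (inverse c) \<otimes>\<^bsub>\<O> V\<^esub> cst X V c = \<one>\<^bsub>\<O> V\<^esub>"
      by (simp add: cst_mult [symmetric] cst_one)
    moreover have "cst X V (inverse c) \<otimes>\<^bsub>\<O> V\<^esub> cst X V c \<in> M"
      using that by (intro M.I_l_closed) simp_all
    ultimately show False
      using one by (simp add: M)
  qed
  have ratM: "\<exists>c. cg (\<O> V) M f (cst X V c)" if "f \<in> carrier (\<O> V)" for f
    using rat [OF that] that by (auto simp: cg_def M)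
  have "primeideal M (\<O> V)"
  proof (rule primeidealI)
    show "carrier (\<O> V) \<noteq> M"
      using one by (auto simp: M set_eq_iff intro!: exI [of _ "\<one>\<^bsub>\<O> V\<^esub>"])
    fix f g assume f: "f \<in> carrier (\<O> V)" and g: "g \<in> carrier (\<O> V)" and fg: "f \<otimes>\<^bsub>\<O> V\<^esub> g \<in> M"
    obtain c d where c: "cg (\<O> V) M f (cst X V c)" and d: "cg (\<O> V) M g (cst X V d)"
      using ratM f g by blast
    have "cst X V (c * d) \<in> M"
      using M.cg_mem [OF M.cg_mult [OF c d]] fg by (simp add: cst_mult)
    then have "c = 0 \<or> d = 0"
      using cst_M by fastforce
    moreover have "cst X V 0 \<in> M"
      by (simp add: cst_zero M.zero_closed)
    ultimately show "f \<in> M \<or> g \<in> M"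
      using M.cg_mem [OF c] M.cg_mem [OF d] by auto
  qed (rule M.is_ideal, rule V.cring_axioms)
  then obtain x where x [simp]: "x \<in> V" and Mx: "vanishing_at X V x = M"
    using affine_point [OF V] by blast
  have rational: "rational_point x"
    using ratM by (intro rational_pointI [OF V x]) (simp add: Mx)
  have away: "\<exists>W. opn W \<and> y \<in> W \<and> J W = carrier (\<O> W)" if y: "y \<in> topspace (sp X) - {x}" for y
  proof (cases "y \<in> V")
    case False
    then show ?thesis using sup y by (auto simp: supported_in_def)
  next
    case True
    interpret P: primeideal "vanishing_at X V y" "\<O> V" by (rule affine_prime [OF V True])
    \<comment> \<open>Containment would be equality: a section vanishing at \<open>y\<close> is
      congruent modulo \<open>M\<close> to a constant, which must then vanish at \<open>y\<close>
      and hence be 0. A member of \<open>M\<close> that is a unit near \<open>y\<close> puts a unit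
      into \<open>J\<close> there.\<close>
    have "\<not> M \<subseteq> vanishing_at X V y"
    proof
      assume sub: "M \<subseteq> vanishing_at X V y"
      have "f \<in> M" if f: "f \<in> vanishing_at X V y" for f
      proof -
        have fV: "f \<in> carrier (\<O> V)" using f vanishing_carrier by blast
        then obtain c where c: "cg (\<O> V) M f (cst X V c)" using ratM by blast
        then have "cg (\<O> V) (vanishing_at X V y) f (cst X V c)" using sub by (auto simp: cg_def)
        then have "c = 0" using P.cg_mem f True by (auto simp: vanishing_cst)
        then show "f \<in> M" using c M.mem_iff_cg_zero fV by (simp add: cst_zero)
      qed
      then have "vanishing_at X V x = vanishing_at X V y" using sub Mx by blast
      then show False using affine_point_inj [OF V x True] y by simp
    qed
    then obtain f where f: "f \<in> M" "f \<notin> vanishing_at X V y" by blast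
    then have fV: "f \<in> carrier (\<O> V)" by (simp add: M)
    with f(2) have "y \<in> nonvan X V f" unfolding vanishing_at_def by blast
    then obtain W where W: "opn W" "y \<in> W" "W \<subseteq> V" and u: "res X V W f \<in> Units (\<O> W)"
      by (auto simp: nonvan_def)
    interpret W: cring "\<O> W" by (rule cringO) fact
    have "res X V W (f [^]\<^bsub>\<O> V\<^esub> (p ^ e)) \<in> J W"
      using f(1) W by (intro sheaf_res [OF J]) (simp_all add: M)
    then have "res X V W f [^]\<^bsub>\<O> W\<^esub> (p ^ e) \<in> J W"
      using W fV by simp
    moreover have "res X V W f [^]\<^bsub>\<O> W\<^esub> (p ^ e) \<in> Units (\<O> W)"
      using u by (rule W.Units_pow_closed)
    ultimately have "J W = carrier (\<O> W)"
      using sheaf_Units [OF J W(1)] by blast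
    then show ?thesis using W by blast
  qed
  \<comment> \<open>Otherwise \<open>J\<close> would be everything near \<open>x\<close> as well as
    near all other points, and gluing would put 1 into \<open>J V\<close>.\<close>
  have vanish: "f \<in> vanishing_at X U x" if U: "opn U" "x \<in> U" and f: "f \<in> J U" for U f
  proof (rule ccontr)
    assume "f \<notin> vanishing_at X U x"
    then have "x \<in> nonvan X U f"
      using f sheaf_carrier [OF J U(1)] by (auto simp: vanishing_at_def)
    then obtain T where T: "opn T" "x \<in> T" "T \<subseteq> U" and u: "res X U T f \<in> Units (\<O> T)"
      by (auto simp: nonvan_def)
    have "res X U T f \<in> J T"
      using T U f by (intro sheaf_res [OF J])
    then have JT: "J T = carrier (\<O> T)"
      using T u by (intro sheaf_Units [OF J])
    have "\<one>\<^bsub>\<O> V\<^esub> \<in> J V"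
    proof (rule sheaf_glue [OF J])
      fix y assume y: "y \<in> V"
      have "\<exists>W. opn W \<and> y \<in> W \<and> J W = carrier (\<O> W)"
        using T JT away [of y] y openin_subset [OF V'] by (cases "y = x") auto
      then obtain W where W: "opn W" "y \<in> W" "J W = carrier (\<O> W)" by blast
      have "J (W \<inter> V) = carrier (\<O> (W \<inter> V))"
        by (rule sheaf_carrier_res [OF J W(1) _ _ W(3)]) (simp_all add: W openin_Int)
      moreover have "res X V (W \<inter> V) \<one>\<^bsub>\<O> V\<^esub> \<in> carrier (\<O> (W \<inter> V))"
        using W by (simp only: res_closed V.one_closed openin_Int V' Int_lower2)
      ultimately show "\<exists>W. opn W \<and> y \<in> W \<and> W \<subseteq> V \<and> res X V W \<one>\<^bsub>\<O> V\<^esub> \<in> J W"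
        using W y by (intro exI [of _ "W \<inter> V"]) (simp only: openin_Int V', simp)
    qed simp_all
    then show False using one by blast
  qed
  have pow: "f [^]\<^bsub>\<O> U\<^esub> (p ^ e) \<in> J U" if U [simp]: "opn U" "x \<in> U" and f: "f \<in> vanishing_at X U x" for U f
  proof (rule sheaf_glue [OF J])
    interpret U: cring "\<O> U" by (rule cringO) simp
    have fU [simp]: "f \<in> carrier (\<O> U)" using f vanishing_carrier by blast
    show "f [^]\<^bsub>\<O> U\<^esub> (p ^ e) \<in> carrier (\<O> U)" by simp
    fix y assume y: "y \<in> U"
    show "\<exists>W. opn W \<and> y \<in> W \<and> W \<subseteq> U \<and> res X U W (f [^]\<^bsub>\<O> U\<^esub> (p ^ e)) \<in> J W"
    proof (cases "y = x")
      case False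
      then obtain W where W: "opn W" "y \<in> W" "J W = carrier (\<O> W)"
        using away [of y] y openin_subset [OF U(1)] by auto
      have "J (W \<inter> U) = carrier (\<O> (W \<inter> U))"
        by (rule sheaf_carrier_res [OF J W(1) _ _ W(3)]) (simp_all add: W openin_Int)
      moreover have "res X U (W \<inter> U) (f [^]\<^bsub>\<O> U\<^esub> (p ^ e)) \<in> carrier (\<O> (W \<inter> U))"
        using W by (intro res_closed) (simp_all add: openin_Int)
      ultimately show ?thesis
        using W y by (intro exI [of _ "W \<inter> U"]) (simp only: openin_Int U, simp)
    next
      case True
      \<comment> \<open>Near \<open>x\<close> the section \<open>f\<close> is
        \<open>a / h ^ m\<close> with \<open>a\<close> in \<open>M\<close>, and
        \<open>p ^ e\<close>-th powers of members of \<open>M\<close> lie in \<open>J\<close>. On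
        the smaller \<open>W\<close> the denominator is a unit and can be removed.\<close>
      obtain h a D and m :: nat where h [simp]: "h \<in> carrier (\<O> V)" "a \<in> carrier (\<O> V)"
        and D: "D = nonvan X V h" and nv: "h \<notin> vanishing_at X V x"
        and D' [simp]: "x \<in> D" "D \<subseteq> U" "D \<subseteq> V" "opn D"
        and a: "res X U D f \<otimes>\<^bsub>\<O> D\<^esub> res X V D h [^]\<^bsub>\<O> D\<^esub> m = res X V D a"
        by (rule local_fraction [of U x f V]) (use V in auto)
      have "res X V D h \<notin> vanishing_at X D x" using nv by (simp add: vanishing_res)
      then have "x \<in> nonvan X D (res X V D h)"
        by (simp add: vanishing_at_def)
      then obtain W where W [simp]: "opn W" "x \<in> W" "W \<subseteq> D" and u: "res X D W (res X V D h) \<in> Units (\<O> W)"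
        by (auto simp: nonvan_def)
      have [simp]: "W \<subseteq> U" "W \<subseteq> V" using W(3) D'(2,3) by blast+
      interpret D: cring "\<O> D" by (rule cringO) simp
      interpret W: cring "\<O> W" by (rule cringO) simp
      interpret I: ideal "J W" "\<O> W" by (rule sheaf_ideal [OF J]) simp
      have u: "res X V W h \<in> Units (\<O> W)" using u by simp
      have a: "res X U W f \<otimes>\<^bsub>\<O> W\<^esub> res X V W h [^]\<^bsub>\<O> W\<^esub> m = res X V W a"
        using arg_cong [OF a, of "res X D W"] by simp
      have "res X V W a \<in> vanishing_at X W x"
        unfolding a [symmetric] using f by (subst vanishing_mult) (simp_all add: vanishing_res)
      then have "a \<in> M" by (simp add: vanishing_res Mx)
      then have "res X V W (a [^]\<^bsub>\<O> V\<^esub> (p ^ e)) \<in> J W"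
        by (intro sheaf_res [OF J]) (simp_all add: M)
      then have "res X V W a [^]\<^bsub>\<O> W\<^esub> (p ^ e) \<in> J W" by simp
      then have "res X U W f [^]\<^bsub>\<O> W\<^esub> (p ^ e) \<otimes>\<^bsub>\<O> W\<^esub> (res X V W h [^]\<^bsub>\<O> W\<^esub> m) [^]\<^bsub>\<O> W\<^esub> (p ^ e) \<in> J W"
        unfolding a [symmetric] by (simp add: frob_mult)
      moreover define k where "k = (res X V W h [^]\<^bsub>\<O> W\<^esub> m) [^]\<^bsub>\<O> W\<^esub> (p ^ e)"
      have k: "k \<in> Units (\<O> W)" using u by (simp add: k_def W.Units_pow_closed)
      ultimately have "(res X U W f [^]\<^bsub>\<O> W\<^esub> (p ^ e) \<otimes>\<^bsub>\<O> W\<^esub> k) \<otimes>\<^bsub>\<O> W\<^esub> inv\<^bsub>\<O> W\<^esub> k \<in> J W"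
        unfolding k_def [symmetric] by (intro I.I_r_closed [of "_ \<otimes>\<^bsub>\<O> W\<^esub> _"]) simp_all
      moreover have "(y \<otimes>\<^bsub>\<O> W\<^esub> k) \<otimes>\<^bsub>\<O> W\<^esub> inv\<^bsub>\<O> W\<^esub> k = y" if "y \<in> carrier (\<O> W)" for y
        using k that W.Units_closed [OF k] by (simp add: W.m_assoc)
      ultimately have "res X U W f [^]\<^bsub>\<O> W\<^esub> (p ^ e) \<in> J W"
        by simp
      then show ?thesis
        using True by (intro exI [of _ W]) simp
    qed
  qed (use U in simp_all)
  have "fat_point e x J"
    unfolding fat_point_def using J rational away vanish pow by blast
  with x show thesis by (rule that)
qed

section \<open>Polynomial relations and residue fields of finite quotients\<close>

context
  fixes U :: "'p set" and e :: nat assumes U [simp]: "opn U"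
begin

interpretation U: cring "\<O> U" by (rule cringO) fact

text \<open>Evaluation at \<open>f\<close> by the Horner scheme, with coefficients acting as the
  scalars of the root of level \<open>e\<close> do, through \<open>p ^ e\<close>-th powers.\<close>

definition evp :: "'s \<Rightarrow> 'k poly \<Rightarrow> 's" where
  "evp f P = fold_coeffs (\<lambda>a r. cst X U (a ^ (p ^ e)) \<oplus>\<^bsub>\<O> U\<^esub> f \<otimes>\<^bsub>\<O> U\<^esub> r) P \<zero>\<^bsub>\<O> U\<^esub>"

context
  fixes f assumes f [simp]: "f \<in> carrier (\<O> U)"
begin

lemma evp_0 [simp]: "evp f 0 = \<zero>\<^bsub>\<O> U\<^esub>"
  by (simp add: evp_def)

lemma evp_pCons: "evp f (pCons a P) = cst X U (a ^ (p ^ e)) \<oplus>\<^bsub>\<O> U\<^esub> f \<otimes>\<^bsub>\<O> U\<^esub> evp f P"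
  using p_pos by (cases "a = 0 \<and> P = 0") (auto simp: evp_def cst_zero zero_power)

lemma evp_closed [simp]: "evp f P \<in> carrier (\<O> U)"
  by (induction P) (simp_all add: evp_pCons)

lemma evp_add: "evp f (P + Q) = evp f P \<oplus>\<^bsub>\<O> U\<^esub> evp f Q"
proof (induction P Q rule: poly_induct2)
  case (pCons a P b Q)
  have "cst X U ((a + b) ^ (p ^ e)) = cst X U (a ^ (p ^ e)) \<oplus>\<^bsub>\<O> U\<^esub> cst X U (b ^ (p ^ e))"
    by (simp add: cst_pow cst_add frob_add)
  then show ?case using pCons by (simp add: evp_pCons U.r_distr U.a_ac)
qed simp

lemma evp_smult: "evp f (smult c P) = cst X U (c ^ (p ^ e)) \<otimes>\<^bsub>\<O> U\<^esub> evp f P"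
proof (induction P)
  case (pCons a P)
  then show ?case
    by (simp add: evp_pCons U.r_distr power_mult_distrib cst_mult U.m_lcomm)
qed simp

lemma evp_monom: "evp f (monom c i) = cst X U (c ^ (p ^ e)) \<otimes>\<^bsub>\<O> U\<^esub> f [^]\<^bsub>\<O> U\<^esub> i"
  using p_pos by (induction i) (simp_all add: monom_0 monom_Suc evp_pCons cst_zero zero_power U.m_ac)

lemma evp_sum: "evp f (\<Sum>i<(m::nat). g i) = (\<Oplus>\<^bsub>\<O> U\<^esub>i\<in>{..<m}. evp f (g i))"
  by (induction m) (simp_all add: evp_add lessThan_Suc U.a_comm)

text \<open>Over an algebraically closed field \<open>Q\<close> splits off a linear factor, so a
  prime containing \<open>Q(f)\<close> contains \<open>f\<close> minus a constant or the value of a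
  polynomial of smaller degree.\<close>

lemma evp_root:
  assumes P: "primeideal P (\<O> U)" and cstP: "\<And>c. cst X U c \<in> P \<Longrightarrow> c = 0"
  shows "Q \<noteq> 0 \<Longrightarrow> evp f Q \<in> P \<Longrightarrow> \<exists>c. cg (\<O> U) P f (cst X U c)"
proof (induction "degree Q" arbitrary: Q)
  case 0
  then obtain a where "Q = [:a:]" "a \<noteq> 0" by (metis degree_eq_zeroE pCons_0_0)
  then show ?case using 0 cstP [of "a ^ (p ^ e)"] by (simp add: evp_pCons)
next
  case (Suc d)
  then obtain z where "poly Q z = 0" using alg_closed_imp_poly_has_root [of Q] by auto
  then obtain R where R: "Q = [:- z, 1:] * R" by (auto simp: poly_eq_0_iff_dvd dvd_def)
  then have "R \<noteq> 0" using Suc by auto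
  have Q: "Q = pCons 0 R + smult (- z) R" by (simp add: R)
  have "evp f Q = evp f (pCons 0 R) \<oplus>\<^bsub>\<O> U\<^esub> evp f (smult (- z) R)"
    unfolding Q by (rule evp_add)
  also have "\<dots> = (f \<oplus>\<^bsub>\<O> U\<^esub> cst X U ((- z) ^ (p ^ e))) \<otimes>\<^bsub>\<O> U\<^esub> evp f R"
    using p_pos unfolding evp_smult by (simp add: evp_pCons cst_zero zero_power U.l_distr)
  finally have "f \<oplus>\<^bsub>\<O> U\<^esub> cst X U ((- z) ^ (p ^ e)) \<in> P \<or> evp f R \<in> P"
    using Suc.prems primeideal.I_prime [OF P] by simp
  then show ?case
  proof
    assume "f \<oplus>\<^bsub>\<O> U\<^esub> cst X U ((- z) ^ (p ^ e)) \<in> P"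
    then have "cg (\<O> U) P f (cst X U (- ((- z) ^ (p ^ e))))"
      by (simp add: cg_def cst_neg a_minus_def del: power_minus_mult)
    then show ?thesis by blast
  next
    assume "evp f R \<in> P"
    moreover have "d = degree R"
      using Suc(2) degree_mult_eq [of "[:- z, 1:]" R] \<open>R \<noteq> 0\<close> by (simp only: R [symmetric]) simp
    ultimately show ?thesis using Suc.hyps(1) \<open>R \<noteq> 0\<close> by blast
  qed
qed

end
end

text \<open>The powers \<open>f ^ 0, ..., f ^ n\<close> are dependent in an
  \<open>n\<close>-dimensional quotient, so \<open>f\<close> is a root of a nonzero polynomial
  modulo \<open>P\<close>. This takes the place of the Nullstellensatz.\<close>

lemma finite_quotient_residue:
  assumes U [simp]: "opn U" and \<kappa>: "kmap e U I \<kappa>" and im: "\<kappa> ` carrier (\<O> U) \<subseteq> coord_space n"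
    and P: "primeideal P (\<O> U)" "I \<subseteq> P" and cstP: "\<And>c. cst X U c \<in> P \<Longrightarrow> c = 0"
    and f [simp]: "f \<in> carrier (\<O> U)"
  shows "\<exists>c. cg (\<O> U) P f (cst X U c)"
proof -
  interpret U: cring "\<O> U" by (rule cringO) fact
  let ?v = "\<lambda>i::nat. \<kappa> (f [^]\<^bsub>\<O> U\<^esub> i)"
  have "?v ` {..<Suc n} \<subseteq> coord_space n"
    using im U.nat_pow_closed [OF f] by blast
  then have "\<not> cs.fam_indep {..<Suc n} ?v"
    using cs.fam_indep_card_le [OF coord_space_basis [of n], of "{..<Suc n}" ?v] by auto
  then obtain c i where c: "(\<Sum>i<Suc n. coord_scale (c i) (?v i)) = 0" and i: "i < Suc n" "c i \<noteq> 0"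
    unfolding cs.fam_indep_def by blast
  define Q where "Q = (\<Sum>i<Suc n. monom (c i) i)"
  have "coeff Q i = (\<Sum>j<Suc n. if j = i then c j else 0)"
    unfolding Q_def coeff_sum by (intro sum.cong) (auto simp: coeff_monom)
  also have "\<dots> = c i"
    using i(1) by (simp add: sum.delta del: sum.lessThan_Suc)
  finally have "Q \<noteq> 0" using i(2) by auto
  have "evp U e f Q = lincomb e U (Suc n) (\<lambda>i. f [^]\<^bsub>\<O> U\<^esub> i) c"
    unfolding Q_def lincomb_def by (subst evp_sum) (simp_all add: evp_monom)
  then have "\<kappa> (evp U e f Q) = 0"
    using kmap_lincomb [OF U \<kappa>, of "Suc n" "\<lambda>i. f [^]\<^bsub>\<O> U\<^esub> i" c] c by simp
  then have "evp U e f Q \<in> P"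
    using P(2) kmap_ker [OF U \<kappa>, of "evp U e f Q"] by auto
  then show ?thesis
    using evp_root [OF U f P(1) cstP \<open>Q \<noteq> 0\<close>] by blast
qed

section \<open>Fibres of Frobenius and charts of the Hilbert scheme\<close>

lemma point_ideal_carrier: "point_ideal X x U \<subseteq> carrier (\<O> U)"
  by (auto simp: point_ideal_def)

lemma mem_point_ideal:
  "opn U \<Longrightarrow> f \<in> point_ideal X x U \<longleftrightarrow> f \<in> carrier (\<O> U) \<and> (x \<in> U \<longrightarrow> f \<in> vanishing_at X U x)"
  by (simp add: point_ideal_def)

lemma point_ideal_res:
  "opn U \<Longrightarrow> opn W \<Longrightarrow> W \<subseteq> U \<Longrightarrow> f \<in> point_ideal X x U \<Longrightarrow> res X U W f \<in> point_ideal X x W"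
  by (auto simp: mem_point_ideal vanishing_res)

text \<open>The presheaf whose associated sheaf is \<open>frob_fiber\<close>. Arguments with
  generators are carried out here and then localized point by point.\<close>

definition fiber_gen :: "nat \<Rightarrow> 'p \<Rightarrow> 'p set \<Rightarrow> 's set" where
  "fiber_gen e x W = genideal (\<O> W) (frob p X e W ` point_ideal X x W)"

lemma frob_closed: "opn W \<Longrightarrow> f \<in> carrier (\<O> W) \<Longrightarrow> frob p X e W f \<in> carrier (\<O> W)"
  by (simp add: frob_def monoid.nat_pow_closed ring.is_monoid ringO)

lemma fiber_gens_carrier: "opn W \<Longrightarrow> frob p X e W ` point_ideal X x W \<subseteq> carrier (\<O> W)"
  using point_ideal_carrier frob_closed by blast

lemma fiber_gen_ideal: "opn W \<Longrightarrow> ideal (fiber_gen e x W) (\<O> W)"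
  unfolding fiber_gen_def by (intro ring.genideal_ideal ringO fiber_gens_carrier)

lemma fiber_gen_self: "opn W \<Longrightarrow> f \<in> point_ideal X x W \<Longrightarrow> f [^]\<^bsub>\<O> W\<^esub> (p ^ e) \<in> fiber_gen e x W"
  using ring.genideal_self [OF ringO [of W] fiber_gens_carrier [of W e x]]
  by (auto simp: fiber_gen_def frob_def)

lemma fiber_gen_minimal:
  assumes "opn W" "ideal I (\<O> W)" "\<And>f. f \<in> point_ideal X x W \<Longrightarrow> f [^]\<^bsub>\<O> W\<^esub> (p ^ e) \<in> I"
  shows "fiber_gen e x W \<subseteq> I"
  unfolding fiber_gen_def using assms
  by (intro ring.genideal_minimal ringO) (auto simp: frob_def)

lemma fiber_gen_res:
  assumes [simp]: "opn U" "opn W" "W \<subseteq> U" and f: "f \<in> fiber_gen e x U"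
  shows "res X U W f \<in> fiber_gen e x W"
proof -
  interpret h: ring_hom_cring "\<O> U" "\<O> W" "res X U W" by (rule res_ring_hom) simp_all
  have "fiber_gen e x U \<subseteq> {r \<in> carrier (\<O> U). res X U W r \<in> fiber_gen e x W}"
  proof (rule fiber_gen_minimal)
    show "ideal {r \<in> carrier (\<O> U). res X U W r \<in> fiber_gen e x W} (\<O> U)"
      by (rule h.ring.ideal_vimage) (rule fiber_gen_ideal, simp)
    fix f assume f: "f \<in> point_ideal X x U"
    then have "f \<in> carrier (\<O> U)" using point_ideal_carrier by blast
    moreover have "res X U W f [^]\<^bsub>\<O> W\<^esub> (p ^ e) \<in> fiber_gen e x W"
      by (intro fiber_gen_self point_ideal_res f) simp_all
    ultimately show "f [^]\<^bsub>\<O> U\<^esub> (p ^ e) \<in> {r \<in> carrier (\<O> U). res X U W r \<in> fiber_gen e x W}"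
      by simp
  qed simp
  then show ?thesis using f by blast
qed

lemma mem_fiber:
  assumes [simp]: "opn U"
  shows "g \<in> frob_fiber p X e x U \<longleftrightarrow> g \<in> carrier (\<O> U) \<and>
    (\<forall>y\<in>U. \<exists>W. opn W \<and> y \<in> W \<and> W \<subseteq> U \<and> res X U W g \<in> fiber_gen e x W)"
  by (simp add: frob_fiber_def fiber_gen_def)

lemma fiberE:
  assumes "g \<in> frob_fiber p X e x U" "opn U" "y \<in> U"
  obtains W where "opn W" "y \<in> W" "W \<subseteq> U" "res X U W g \<in> fiber_gen e x W"
  using assms(1,3) that unfolding mem_fiber [OF assms(2)] by blast

lemma fiberI:
  assumes "opn U" "g \<in> carrier (\<O> U)" "g \<in> fiber_gen e x U"
  shows "g \<in> frob_fiber p X e x U"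
  using assms by (auto simp: mem_fiber intro!: exI [of _ U])

lemma fiber_pair:
  assumes U: "opn U" and f: "f \<in> frob_fiber p X e x U" and g: "g \<in> frob_fiber p X e x U" and y: "y \<in> U"
  shows "\<exists>W. opn W \<and> y \<in> W \<and> W \<subseteq> U \<and> res X U W f \<in> fiber_gen e x W \<and> res X U W g \<in> fiber_gen e x W"
proof -
  obtain A where A: "opn A" "y \<in> A" "A \<subseteq> U" "res X U A f \<in> fiber_gen e x A"
    using f y U by (auto simp: mem_fiber)
  obtain B where B: "opn B" "y \<in> B" "B \<subseteq> U" "res X U B g \<in> fiber_gen e x B"
    using g y U by (auto simp: mem_fiber)
  have W: "opn (A \<inter> B)" "A \<inter> B \<subseteq> A" "A \<inter> B \<subseteq> B" "A \<inter> B \<subseteq> U"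
    using A B by (auto simp: openin_Int)
  have "f \<in> carrier (\<O> U)" "g \<in> carrier (\<O> U)"
    using f g U by (auto simp: mem_fiber)
  then have "res X U (A \<inter> B) f \<in> fiber_gen e x (A \<inter> B)" "res X U (A \<inter> B) g \<in> fiber_gen e x (A \<inter> B)"
    using fiber_gen_res [OF A(1) W(1,2) A(4)] fiber_gen_res [OF B(1) W(1,3) B(4)] A B W U by simp_all
  then show ?thesis using A B W by blast
qed

lemma fiber_res:
  assumes [simp]: "opn U" "opn V" and VU: "V \<subseteq> U" and f: "f \<in> frob_fiber p X e x U"
  shows "res X U V f \<in> frob_fiber p X e x V"
  unfolding mem_fiber [OF assms(2)]
proof (intro conjI ballI)
  have [simp]: "f \<in> carrier (\<O> U)" using f by (simp add: mem_fiber)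
  show "res X U V f \<in> carrier (\<O> V)" using VU by simp
  fix y assume y: "y \<in> V"
  then obtain W where W [simp]: "opn W" "y \<in> W" "W \<subseteq> U" "res X U W f \<in> fiber_gen e x W"
    using fiberE [OF f assms(1), of y] VU by blast
  have WV: "opn (W \<inter> V)" "W \<inter> V \<subseteq> W" "W \<inter> V \<subseteq> V" by (auto simp: openin_Int)
  have "res X W (W \<inter> V) (res X U W f) \<in> fiber_gen e x (W \<inter> V)"
    by (rule fiber_gen_res [OF W(1) WV(1,2) W(4)])
  then have "res X V (W \<inter> V) (res X U V f) \<in> fiber_gen e x (W \<inter> V)"
    using WV VU by simp
  then show "\<exists>W. opn W \<and> y \<in> W \<and> W \<subseteq> V \<and> res X V W (res X U V f) \<in> fiber_gen e x W"
    using WV W(2) y by blast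
qed

lemma fiber_sheaf: "ideal_sheaf (frob_fiber p X e x)"
  unfolding ideal_sheaf_def
proof (intro conjI allI impI ballI)
  fix U assume U [simp]: "opn U"
  interpret U: cring "\<O> U" by (rule cringO) simp
  let ?F = "frob_fiber p X e x U"
  have sub: "f \<in> carrier (\<O> U)" if "f \<in> ?F" for f
    using that by (simp add: mem_fiber)
  have mult: "f \<otimes>\<^bsub>\<O> U\<^esub> g \<in> ?F" if f: "f \<in> ?F" and g: "g \<in> carrier (\<O> U)" for f g
    unfolding mem_fiber [OF U]
  proof (intro conjI ballI)
    show "f \<otimes>\<^bsub>\<O> U\<^esub> g \<in> carrier (\<O> U)" using f g sub by simp
    fix y assume "y \<in> U"
    then obtain W where W: "opn W" "y \<in> W" "W \<subseteq> U" "res X U W f \<in> fiber_gen e x W"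
      using f by (auto simp: mem_fiber)
    interpret I: ideal "fiber_gen e x W" "\<O> W" by (rule fiber_gen_ideal) fact
    have "res X U W (f \<otimes>\<^bsub>\<O> U\<^esub> g) \<in> fiber_gen e x W"
      using W f g sub by (simp add: I.I_r_closed)
    then show "\<exists>W. opn W \<and> y \<in> W \<and> W \<subseteq> U \<and> res X U W (f \<otimes>\<^bsub>\<O> U\<^esub> g) \<in> fiber_gen e x W"
      using W by blast
  qed
  show "ideal ?F (\<O> U)"
  proof (rule idealI)
    show "subgroup ?F (add_monoid (\<O> U))"
    proof (rule U.add.subgroupI)
      have "\<zero>\<^bsub>\<O> U\<^esub> \<in> fiber_gen e x U"
        by (intro additive_subgroup.zero_closed ideal.axioms(1) fiber_gen_ideal U)
      then show "?F \<noteq> {}" using fiberI [OF U, of "\<zero>\<^bsub>\<O> U\<^esub>"] by auto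
      show "\<ominus>\<^bsub>\<O> U\<^esub> f \<in> ?F" if "f \<in> ?F" for f
        using mult [OF that, of "\<ominus>\<^bsub>\<O> U\<^esub> \<one>\<^bsub>\<O> U\<^esub>"] sub [OF that] by (simp add: U.r_minus)
      show "f \<oplus>\<^bsub>\<O> U\<^esub> g \<in> ?F" if f: "f \<in> ?F" and g: "g \<in> ?F" for f g
        unfolding mem_fiber [OF U]
      proof (intro conjI ballI)
        show "f \<oplus>\<^bsub>\<O> U\<^esub> g \<in> carrier (\<O> U)" using f g sub by simp
        fix y assume "y \<in> U"
        then obtain W where W: "opn W" "y \<in> W" "W \<subseteq> U" "res X U W f \<in> fiber_gen e x W" "res X U W g \<in> fiber_gen e x W"
          using fiber_pair [OF U f g] by blast
        interpret I: ideal "fiber_gen e x W" "\<O> W" by (rule fiber_gen_ideal) fact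
        have "res X U W (f \<oplus>\<^bsub>\<O> U\<^esub> g) \<in> fiber_gen e x W"
          using W f g sub by (simp add: I.a_closed)
        then show "\<exists>W. opn W \<and> y \<in> W \<and> W \<subseteq> U \<and> res X U W (f \<oplus>\<^bsub>\<O> U\<^esub> g) \<in> fiber_gen e x W"
          using W by blast
      qed
    qed (auto dest: sub)
    fix f g assume f: "f \<in> ?F" and g: "g \<in> carrier (\<O> U)"
    then show "f \<otimes>\<^bsub>\<O> U\<^esub> g \<in> ?F" by (rule mult)
    then show "g \<otimes>\<^bsub>\<O> U\<^esub> f \<in> ?F" using f g sub by (simp add: U.m_comm)
  qed (rule U.ring_axioms)
next
  fix U V assume "opn U" "opn V" "V \<subseteq> U"
  then show "res X U V ` frob_fiber p X e x U \<subseteq> frob_fiber p X e x V"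
    using fiber_res by blast
next
  fix \<U> f assume o: "\<forall>V\<in>\<U>. opn V" and f: "f \<in> carrier (\<O> (\<Union>\<U>))"
    and loc: "\<forall>V\<in>\<U>. res X (\<Union>\<U>) V f \<in> frob_fiber p X e x V"
  have U: "opn (\<Union>\<U>)" using o by auto
  show "f \<in> frob_fiber p X e x (\<Union>\<U>)"
    unfolding mem_fiber [OF U]
  proof (intro conjI ballI f)
    fix y assume "y \<in> \<Union>\<U>"
    then obtain V where V: "V \<in> \<U>" "y \<in> V" by blast
    then have VU: "opn V" "V \<subseteq> \<Union>\<U>" using o by auto
    have fV: "res X (\<Union>\<U>) V f \<in> frob_fiber p X e x V"
      using loc V(1) by blast
    obtain W where W: "opn W" "y \<in> W" "W \<subseteq> V" "res X V W (res X (\<Union>\<U>) V f) \<in> fiber_gen e x W"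
      by (rule fiberE [OF fV VU(1) V(2)])
    have "W \<subseteq> \<Union>\<U>" using W(3) VU(2) by (rule subset_trans)
    moreover have "res X (\<Union>\<U>) W f \<in> fiber_gen e x W"
      using W VU U f by simp
    ultimately show "\<exists>W. opn W \<and> y \<in> W \<and> W \<subseteq> \<Union>\<U> \<and> res X (\<Union>\<U>) W f \<in> fiber_gen e x W"
      using W by blast
  qed
qed

lemma fiber_gen_vanishing:
  assumes "opn W" "x \<in> W"
  shows "fiber_gen e x W \<subseteq> vanishing_at X W x"
proof (rule fiber_gen_minimal [OF assms(1)])
  interpret P: primeideal "vanishing_at X W x" "\<O> W" by (rule vanishing_prime) fact+
  show "ideal (vanishing_at X W x) (\<O> W)" by (rule P.is_ideal)
  show "f [^]\<^bsub>\<O> W\<^esub> (p ^ e) \<in> vanishing_at X W x" if "f \<in> point_ideal X x W" for f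
    using that assms p_pos by (subst vanishing_pow) (auto simp: mem_point_ideal)
qed

lemma fiber_vanishing:
  assumes U: "opn U" "x \<in> U" and f: "f \<in> frob_fiber p X e x U"
  shows "f \<in> vanishing_at X U x"
proof -
  have fU: "f \<in> carrier (\<O> U)" using f U by (simp add: mem_fiber)
  obtain W where W: "opn W" "x \<in> W" "W \<subseteq> U" "res X U W f \<in> fiber_gen e x W"
    using f U by (auto simp: mem_fiber)
  then have "res X U W f \<in> vanishing_at X W x"
    using fiber_gen_vanishing by blast
  then show ?thesis using W U fU by (simp add: vanishing_res)
qed

lemma fiber_fat:
  assumes x: "closed_point X x" "rational_point x"
  shows "fat_point e x (frob_fiber p X e x)"
  unfolding fat_point_def
proof (intro conjI allI impI ballI subsetI)
  fix y assume y: "y \<in> topspace (sp X) - {x}"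
  let ?W = "topspace (sp X) - {x}"
  have W [simp]: "opn ?W" using x by (auto simp: closed_point_def closedin_def)
  interpret W: cring "\<O> ?W" by (rule cringO) simp
  \<comment> \<open>On the complement of \<open>x\<close> the ideal of \<open>x\<close> is
    everything, so the power of 1 is a generator of the fibre ideal.\<close>
  have "\<one>\<^bsub>\<O> ?W\<^esub> [^]\<^bsub>\<O> ?W\<^esub> (p ^ e) \<in> fiber_gen e x ?W"
    by (rule fiber_gen_self) (simp_all add: mem_point_ideal)
  then have "\<one>\<^bsub>\<O> ?W\<^esub> \<in> frob_fiber p X e x ?W"
    by (intro fiberI) simp_all
  then have "frob_fiber p X e x ?W = carrier (\<O> ?W)"
    by (intro ideal.one_imp_carrier sheaf_ideal [OF fiber_sheaf] W)
  then show "\<exists>W. opn W \<and> y \<in> W \<and> frob_fiber p X e x W = carrier (\<O> W)"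
    using W y by blast
next
  fix U f assume *: "opn U" "x \<in> U" "f \<in> vanishing_at X U x"
  interpret U: cring "\<O> U" by (rule cringO) fact
  have "f \<in> carrier (\<O> U)" using * vanishing_carrier by blast
  then show "f [^]\<^bsub>\<O> U\<^esub> (p ^ e) \<in> frob_fiber p X e x U"
    using * by (intro fiberI fiber_gen_self) (simp_all add: mem_point_ideal)
qed (use x fiber_sheaf fiber_vanishing in auto)

text \<open>The fibre is cut out by the \<open>p ^ e\<close>-th powers of sections vanishing at
  \<open>x\<close>, and these lie in every fat point. So every fat point at \<open>x\<close> is a
  subscheme of the fibre over \<open>x\<close>.\<close>

lemma fiber_minimal:
  assumes J: "fat_point e x J"
  shows "frob_fiber p X e x U \<subseteq> J U"
proof (cases "opn U")
  case True
  show ?thesis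
  proof
    fix f assume f: "f \<in> frob_fiber p X e x U"
    show "f \<in> J U"
    proof (rule sheaf_glue [OF fat_sheaf [OF J] True])
      show "f \<in> carrier (\<O> U)" using f True by (simp add: mem_fiber)
      fix y assume "y \<in> U"
      then obtain W where W: "opn W" "y \<in> W" "W \<subseteq> U" "res X U W f \<in> fiber_gen e x W"
        using f True by (auto simp: mem_fiber)
      have "fiber_gen e x W \<subseteq> J W"
      proof (rule fiber_gen_minimal [OF W(1) sheaf_ideal [OF fat_sheaf [OF J] W(1)]])
        interpret W: cring "\<O> W" by (rule cringO) fact
        fix f assume f: "f \<in> point_ideal X x W"
        show "f [^]\<^bsub>\<O> W\<^esub> (p ^ e) \<in> J W"
        proof (cases "x \<in> W")
          case True
          then show ?thesis using f W fat_pow [OF J] by (simp add: mem_point_ideal)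
        next
          case False
          then show ?thesis using f W fat_off [OF J] by (simp add: mem_point_ideal)
        qed
      qed
      then show "\<exists>W. opn W \<and> y \<in> W \<and> W \<subseteq> U \<and> res X U W f \<in> J W"
        using W by blast
    qed
  qed
qed (simp add: frob_fiber_def)

section \<open>Chart coordinates and density of the Frobenius fibres\<close>

lemma mem_chart:
  "J \<in> hilb_chart (frob_root p X e) n V b \<longleftrightarrow> closed_subscheme X J \<and> supported_in X V J \<and>
    basis_mod (frob_root p X e) V (carrier (\<O> V)) (J V) n b"
  by (simp add: hilb_chart_def)

definition crd :: "nat \<Rightarrow> nat \<Rightarrow> 'p set \<Rightarrow> (nat \<Rightarrow> 's) \<Rightarrow> ('p set \<Rightarrow> 's set) \<Rightarrow> 's \<Rightarrow> nat \<Rightarrow> 'k" where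
  "crd e n V b J f = (THE c. coords (frob_root p X e) V (J V) n b f c)"

lemma chart_kmap:
  assumes V: "opn V" and J: "J \<in> hilb_chart (frob_root p X e) n V b"
  shows "kmap e V (J V) (crd e n V b J)" "crd e n V b J ` carrier (\<O> V) = coord_space n"
    "\<forall>i<n. b i \<in> carrier (\<O> V)"
    "\<And>f. f \<in> carrier (\<O> V) \<Longrightarrow> coords (frob_root p X e) V (J V) n b f (crd e n V b J f)"
proof -
  have ideal: "ideal (J V) (\<O> V)"
    using J V by (intro sheaf_ideal closed_subscheme_ideal_sheaf) (simp_all add: mem_chart)
  have bm: "basis_mod (frob_root p X e) V (carrier (\<O> V)) (J V) n b"
    using J by (simp add: mem_chart)
  obtain \<kappa> where \<kappa>: "kmap e V (J V) \<kappa>" "\<kappa> ` carrier (\<O> V) = coord_space n"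
    "\<And>f. f \<in> carrier (\<O> V) \<Longrightarrow> coords (frob_root p X e) V (J V) n b f (\<kappa> f)"
    by (rule basis_mod_ex_kmap [OF V ideal bm]) (rule that)
  have eq: "crd e n V b J f = \<kappa> f" if f: "f \<in> carrier (\<O> V)" for f
    unfolding crd_def
  proof (rule the1_equality)
    show "\<exists>!c. coords (frob_root p X e) V (J V) n b f c"
      using bm f by (simp add: basis_mod_def)
  qed (rule \<kappa>(3) [OF f])
  interpret V: cring "\<O> V" by (rule cringO [OF V])
  show "kmap e V (J V) (crd e n V b J)"
    using \<kappa>(1) V unfolding kmap_def by (simp add: eq)
  show "crd e n V b J ` carrier (\<O> V) = coord_space n"
    using \<kappa>(2) eq by (metis (no_types, lifting) image_cong)
  show "\<And>f. f \<in> carrier (\<O> V) \<Longrightarrow> coords (frob_root p X e) V (J V) n b f (crd e n V b J f)"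
    using \<kappa>(3) eq by simp
  show "\<forall>i<n. b i \<in> carrier (\<O> V)"
    using bm by (simp add: basis_mod_def)
qed

lemma crd_chart_function:
  "f \<in> carrier (\<O> V) \<Longrightarrow> i < n \<Longrightarrow> (\<lambda>J. crd e n V b J f i) \<in> chart_functions (frob_root p X e) n V b"
  unfolding crd_def by (rule chart_functions.coeff) simp

lemma chart_function_diff:
  assumes "g \<in> chart_functions Y n V b" "h \<in> chart_functions Y n V b"
  shows "(\<lambda>J. g J - h J) \<in> chart_functions Y n V b"
proof -
  have "(\<lambda>J. g J + (- 1) * h J) \<in> chart_functions Y n V b"
    by (intro chart_functions.add chart_functions.mult [OF chart_functions.const] assms)
  then show ?thesis by simp
qed

lemma chart_function_sum:
  "(\<And>i. i < (m::nat) \<Longrightarrow> g i \<in> chart_functions Y n V b) \<Longrightarrow> (\<lambda>J. \<Sum>i<m. g i J) \<in> chart_functions Y n V b"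
  using chart_functions.const [of 0 Y n V b]
  by (induction m) (auto intro: chart_functions.add)

text \<open>Membership in a chart says that the fibre has finite length, and this forces the residue
  field at \<open>x\<close> to be \<open>k\<close>.\<close>

lemma fiber_rational:
  assumes x: "closed_point X x" and V: "affine_open X V"
    and J: "frob_fiber p X e x \<in> hilb_chart (frob_root p X e) n V b"
  shows "x \<in> V \<and> rational_point x"
proof -
  have o [simp]: "opn V" using V by (rule affine_open_opn)
  have xV: "x \<in> V"
  proof (rule ccontr)
    assume "x \<notin> V"
    moreover have "x \<in> topspace (sp X)" using x by (simp add: closed_point_def)
    ultimately obtain W where W: "opn W" "x \<in> W" "frob_fiber p X e x W = carrier (\<O> W)"
      using J by (auto simp: mem_chart supported_in_def)
    then have "cst X W 1 \<in> vanishing_at X W x"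
      using fiber_vanishing [OF W(1,2), of "cst X W 1" e] by simp
    then show False using W by (simp add: vanishing_cst)
  qed
  moreover have "rational_point x"
  proof (rule rational_pointI [OF V xV])
    fix f assume f: "f \<in> carrier (\<O> V)"
    show "\<exists>c. cg (\<O> V) (vanishing_at X V x) f (cst X V c)"
    proof (rule finite_quotient_residue [OF o chart_kmap(1) [OF o J]])
      show "crd e n V b (frob_fiber p X e x) ` carrier (\<O> V) \<subseteq> coord_space n"
        using chart_kmap(2) [OF o J] by simp
      show "primeideal (vanishing_at X V x) (\<O> V)" by (rule affine_prime [OF V xV])
      show "frob_fiber p X e x V \<subseteq> vanishing_at X V x"
        using fiber_vanishing [OF o xV] by blast
      show "c = 0" if "cst X V c \<in> vanishing_at X V x" for c
        using that xV by (simp add: vanishing_cst)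
    qed (rule f)
  qed
  ultimately show ?thesis ..
qed

abbreviation (input) len :: "nat \<Rightarrow> nat" where "len e \<equiv> p ^ (e * dimension X)"

definition FB :: "nat \<Rightarrow> ('p set \<Rightarrow> 's set) set" where
  "FB e = topspace (ztop (F_blowup p X e))"

definition Hilb :: "nat \<Rightarrow> ('p set \<Rightarrow> 's set) topology" where
  "Hilb e = ztop (hilb_red (frob_root p X e) (len e))"

definition smooth_fibers :: "nat \<Rightarrow> ('p set \<Rightarrow> 's set) set" where
  "smooth_fibers e = {frob_fiber p X e x | x. smooth_point X x}"

lemma FB_iff: "J \<in> FB e \<longleftrightarrow> J \<in> Hilb e closure_of smooth_fibers e"
  using closure_of_subset_topspace [of "Hilb e" "smooth_fibers e"]
  by (auto simp: FB_def F_blowup_def reduced_closure_def Hilb_def smooth_fibers_def)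

lemma ztop_F_blowup: "ztop (F_blowup p X e) = subtopology (Hilb e) (FB e)"
proof -
  have "FB e = Hilb e closure_of smooth_fibers e" using FB_iff by blast
  then show ?thesis
    by (simp add: F_blowup_def reduced_closure_def Hilb_def smooth_fibers_def)
qed

lemma open_chart_nonzero:
  assumes "affine_open X V" "h \<in> chart_functions (frob_root p X e) (len e) V b"
  shows "openin (Hilb e) {J \<in> hilb_chart (frob_root p X e) (len e) V b. h J \<noteq> 0}"
  unfolding Hilb_def hilb_red_def using assms
  by (auto intro!: topology_generated_by_Basis)

lemma FB_chart:
  assumes "J \<in> FB e"
  shows "\<exists>V b. affine_open X V \<and> J \<in> hilb_chart (frob_root p X e) (len e) V b"
proof -
  have "J \<in> topspace (Hilb e)"
    using assms unfolding FB_iff by (rule subsetD [OF closure_of_subset_topspace])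
  then show ?thesis
    unfolding Hilb_def hilb_red_def by (auto simp: topology_generated_by_topspace)
qed

lemma FB_meets:
  assumes "J \<in> FB e" "openin (Hilb e) T" "J \<in> T"
  shows "\<exists>x. smooth_point X x \<and> frob_fiber p X e x \<in> T \<and> frob_fiber p X e x \<in> FB e"
proof -
  obtain y where y: "y \<in> smooth_fibers e" "y \<in> T"
    using assms unfolding FB_iff in_closure_of by blast
  moreover have "y \<in> topspace (Hilb e)" using assms(2) y(2) openin_subset by blast
  ultimately have "y \<in> FB e"
    using closure_of_subset_Int [of "Hilb e" "smooth_fibers e"] by (auto simp: FB_iff)
  then show ?thesis using y by (auto simp: smooth_fibers_def)
qed

text \<open>The form in which closed conditions are transferred. If an identity of chart functions
  failed at \<open>J\<close>, the difference of its sides would serve as \<open>h\<close> and the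
  identity would fail at a Frobenius fibre over a smooth point of \<open>V\<close>.\<close>

lemma FB_density:
  assumes J: "J \<in> FB e" and V: "affine_open X V" and ch: "J \<in> hilb_chart (frob_root p X e) (len e) V b"
    and h: "h \<in> chart_functions (frob_root p X e) (len e) V b" "h J \<noteq> 0"
  shows "\<exists>x. smooth_point X x \<and> frob_fiber p X e x \<in> hilb_chart (frob_root p X e) (len e) V b \<and>
    frob_fiber p X e x \<in> FB e \<and> x \<in> V \<and> fat_point e x (frob_fiber p X e x) \<and> h (frob_fiber p X e x) \<noteq> 0"
proof -
  obtain x where x: "smooth_point X x" "frob_fiber p X e x \<in> hilb_chart (frob_root p X e) (len e) V b"
    "frob_fiber p X e x \<in> FB e" "h (frob_fiber p X e x) \<noteq> 0"
    using FB_meets [OF J open_chart_nonzero [OF V h(1)]] ch h(2) by auto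
  have "closed_point X x" using x(1) by (simp add: smooth_point_def)
  then show ?thesis
    using x fiber_rational [OF _ V x(2)] fiber_fat by blast
qed

text \<open>That \<open>f ^ (p ^ e)\<close> is constant modulo \<open>J\<close> means that its
  coordinate vector is proportional to that of 1, so that the 2 x 2 minors of the two vectors
  vanish. These minors are chart functions and vanish at the fibres.\<close>

lemma FB_fat:
  assumes J: "J \<in> FB e" and V: "affine_open X V" and ch: "J \<in> hilb_chart (frob_root p X e) (len e) V b"
  obtains x where "x \<in> V" "fat_point e x J"
proof -
  let ?n = "len e" and ?Y = "frob_root p X e"
  have o [simp]: "opn V" using V by (rule affine_open_opn)
  interpret V: cring "\<O> V" by (rule cringO) simp
  let ?c = "\<lambda>J. crd e ?n V b J"
  have one: "\<one>\<^bsub>\<O> V\<^esub> \<notin> J V"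
  proof
    assume "\<one>\<^bsub>\<O> V\<^esub> \<in> J V"
    then have "J V = carrier (\<O> V)"
      using ch by (intro ideal.one_imp_carrier sheaf_ideal [OF closed_subscheme_ideal_sheaf]) (simp_all add: mem_chart)
    then have "?c J ` carrier (\<O> V) \<subseteq> {0}"
      using kmap_ker [OF o chart_kmap(1) [OF o ch]] by auto
    \<comment> \<open>The length is a power of \<open>p\<close>, hence positive, so the coordinate
      space contains a nonzero vector.\<close>
    moreover have "(unit_coord 0 :: nat \<Rightarrow> 'k) \<in> coord_space ?n"
      using p_pos by (auto simp: unit_coord_def coord_space_def)
    ultimately have "(unit_coord 0 :: nat \<Rightarrow> 'k) \<in> {0}"
      using chart_kmap(2) [OF o ch] by blast
    then have "(unit_coord 0 0 :: 'k) = 0" by simp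
    then show False by (simp add: unit_coord_def)
  qed
  have rat: "\<exists>c. (f \<ominus>\<^bsub>\<O> V\<^esub> cst X V c) [^]\<^bsub>\<O> V\<^esub> (p ^ e) \<in> J V" if f [simp]: "f \<in> carrier (\<O> V)" for f
  proof -
    let ?q = "f [^]\<^bsub>\<O> V\<^esub> (p ^ e)"
    \<comment> \<open>At a fibre in the chart \<open>f ^ (p ^ e)\<close> is constant by
      \<open>fat_pow_const\<close>, so the minor, a chart function, cannot be nonzero at
      \<open>J\<close>.\<close>
    have minor: "?c J ?q i * ?c J \<one>\<^bsub>\<O> V\<^esub> j = ?c J ?q j * ?c J \<one>\<^bsub>\<O> V\<^esub> i" if ij: "i < ?n" "j < ?n" for i j
    proof (rule ccontr)
      define h where "h J = ?c J ?q i * ?c J \<one>\<^bsub>\<O> V\<^esub> j - ?c J ?q j * ?c J \<one>\<^bsub>\<O> V\<^esub> i" for J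
      assume "\<not> ?thesis"
      then have "h J \<noteq> 0" by (simp add: h_def)
      moreover have "h \<in> chart_functions ?Y ?n V b"
        unfolding h_def using ij
        by (intro chart_function_diff chart_functions.mult crd_chart_function) simp_all
      ultimately obtain x where x: "frob_fiber p X e x \<in> hilb_chart ?Y ?n V b" "x \<in> V"
        "fat_point e x (frob_fiber p X e x)" "h (frob_fiber p X e x) \<noteq> 0"
        using FB_density [OF J V ch] by blast
      let ?J = "frob_fiber p X e x"
      obtain c where c: "cg (\<O> V) (?J V) ?q (cst X V (c ^ (p ^ e)))"
        using fat_pow_const [OF x(3) o x(2) f] by blast
      have "?c ?J ?q = ?c ?J (cst X V (c ^ (p ^ e)) \<otimes>\<^bsub>\<O> V\<^esub> \<one>\<^bsub>\<O> V\<^esub>)"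
        using c kmap_cg_iff [OF o chart_kmap(1) [OF o x(1)]] by simp
      also have "\<dots> = coord_scale c (?c ?J \<one>\<^bsub>\<O> V\<^esub>)"
        by (rule kmap_scale [OF o chart_kmap(1) [OF o x(1)]]) simp
      finally show False using x(4) by (simp add: h_def coord_scale_def)
    qed
    have supp: "?c J g i = 0" if "g \<in> carrier (\<O> V)" "i \<ge> ?n" for g i
      using chart_kmap(2) [OF o ch] that by (auto simp: coord_space_def)
    have "?c J \<one>\<^bsub>\<O> V\<^esub> \<noteq> 0"
      using one kmap_ker [OF o chart_kmap(1) [OF o ch]] by simp
    then obtain j where j: "?c J \<one>\<^bsub>\<O> V\<^esub> j \<noteq> 0" by (auto simp: fun_eq_iff)
    then have jn: "j < ?n" using supp [of "\<one>\<^bsub>\<O> V\<^esub>" j] by (meson V.one_closed not_le)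
    \<comment> \<open>The factor of proportionality is read off at an index where the coordinates of
      1 do not vanish; one exists because 1 is not in \<open>J V\<close>.\<close>
    define c where "c = ?c J ?q j / ?c J \<one>\<^bsub>\<O> V\<^esub> j"
    have "?c J ?q i = c * ?c J \<one>\<^bsub>\<O> V\<^esub> i" for i
    proof (cases "i < ?n")
      case True
      then show ?thesis using minor [OF True jn] j by (simp add: c_def field_simps)
    next
      case False
      then show ?thesis using supp by simp
    qed
    then have "?c J ?q = coord_scale c (?c J \<one>\<^bsub>\<O> V\<^esub>)"
      by (simp add: coord_scale_def fun_eq_iff)
    also have "\<dots> = ?c J (cst X V (c ^ (p ^ e)) \<otimes>\<^bsub>\<O> V\<^esub> \<one>\<^bsub>\<O> V\<^esub>)"
      by (rule kmap_scale [OF o chart_kmap(1) [OF o ch], symmetric]) simp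
    finally have "cg (\<O> V) (J V) ?q (cst X V (c ^ (p ^ e)))"
      using kmap_cg_iff [OF o chart_kmap(1) [OF o ch]] by simp
    then have "(f \<ominus>\<^bsub>\<O> V\<^esub> cst X V c) [^]\<^bsub>\<O> V\<^esub> (p ^ e) \<in> J V"
      by (simp add: cg_def frob_minus cst_pow)
    then show ?thesis by blast
  qed
  obtain x where "x \<in> V" "fat_point e x J"
    by (rule fat_pointI [where J = J, OF closed_subscheme_ideal_sheaf V _ one rat]) (use ch in \<open>auto simp: mem_chart\<close>)
  then show thesis by (rule that)
qed

end

section \<open>Splittings of Frobenius\<close>

locale F_pure_variety = char_p_variety X p
  for X :: "('p, 's, 'k::alg_closed_field) kspace" and p +
  assumes F_pure: "F_pure p X"
begin

text \<open>A section stands here for its \<open>p\<close>-th root, so linearity of a retraction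
  from roots to sections reads \<open>\<tau> (f ^ p * g) = f * \<tau> g\<close>.\<close>

definition frob_retraction :: "'p set \<Rightarrow> ('s \<Rightarrow> 's) \<Rightarrow> bool" where
  "frob_retraction W \<tau> \<longleftrightarrow>
     (\<forall>g\<in>carrier (\<O> W). \<tau> g \<in> carrier (\<O> W)) \<and>
     (\<forall>g\<in>carrier (\<O> W). \<forall>h\<in>carrier (\<O> W). \<tau> (g \<oplus>\<^bsub>\<O> W\<^esub> h) = \<tau> g \<oplus>\<^bsub>\<O> W\<^esub> \<tau> h) \<and>
     (\<forall>f\<in>carrier (\<O> W). \<forall>g\<in>carrier (\<O> W). \<tau> (f [^]\<^bsub>\<O> W\<^esub> p \<otimes>\<^bsub>\<O> W\<^esub> g) = f \<otimes>\<^bsub>\<O> W\<^esub> \<tau> g) \<and>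
     (\<forall>f\<in>carrier (\<O> W). \<tau> (f [^]\<^bsub>\<O> W\<^esub> p) = f)"

definition splitting :: "'p set \<Rightarrow> ('p set \<Rightarrow> 's \<Rightarrow> 's) \<Rightarrow> bool" where
  "splitting U \<sigma> \<longleftrightarrow> opn U \<and>
     (\<forall>W. opn W \<longrightarrow> W \<subseteq> U \<longrightarrow> frob_retraction W (\<sigma> W)) \<and>
     (\<forall>W V. opn W \<longrightarrow> opn V \<longrightarrow> V \<subseteq> W \<longrightarrow> W \<subseteq> U \<longrightarrow>
        (\<forall>g\<in>carrier (\<O> W). res X W V (\<sigma> W g) = \<sigma> V (res X W V g)))"

lemma ex_splitting:
  assumes "x \<in> topspace (sp X)"
  shows "\<exists>U \<sigma>. splitting U \<sigma> \<and> x \<in> U"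
proof -
  have frob1: "frob p X 1 = (\<lambda>W f. f [^]\<^bsub>\<O> W\<^esub> p)"
    by (intro ext) (simp add: frob_def)
  show ?thesis
    using bspec [OF F_pure [unfolded F_pure_def frob1] assms]
    unfolding splitting_def frob_retraction_def
    by (elim exE conjE) (intro exI conjI, assumption+)
qed

definition eps :: "('p set \<Rightarrow> 's \<Rightarrow> 's) \<Rightarrow> 'p set \<Rightarrow> 's \<Rightarrow> 's" where
  "eps \<sigma> W y = \<sigma> W y [^]\<^bsub>\<O> W\<^esub> p"

context
  fixes U \<sigma> W assumes sp: "splitting U \<sigma>" and W [simp]: "opn W" and WU: "W \<subseteq> U"
begin

interpretation W: cring "\<O> W" by (rule cringO) fact

lemma split_closed [simp]: "g \<in> carrier (\<O> W) \<Longrightarrow> \<sigma> W g \<in> carrier (\<O> W)"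
  and split_add: "g \<in> carrier (\<O> W) \<Longrightarrow> h \<in> carrier (\<O> W) \<Longrightarrow> \<sigma> W (g \<oplus>\<^bsub>\<O> W\<^esub> h) = \<sigma> W g \<oplus>\<^bsub>\<O> W\<^esub> \<sigma> W h"
  and split_lin: "f \<in> carrier (\<O> W) \<Longrightarrow> g \<in> carrier (\<O> W) \<Longrightarrow>
    \<sigma> W (f [^]\<^bsub>\<O> W\<^esub> p \<otimes>\<^bsub>\<O> W\<^esub> g) = f \<otimes>\<^bsub>\<O> W\<^esub> \<sigma> W g"
  and split_frob: "f \<in> carrier (\<O> W) \<Longrightarrow> \<sigma> W (f [^]\<^bsub>\<O> W\<^esub> p) = f"
  and split_res: "opn V \<Longrightarrow> V \<subseteq> W \<Longrightarrow> g \<in> carrier (\<O> W) \<Longrightarrow> res X W V (\<sigma> W g) = \<sigma> V (res X W V g)"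
proof -
  have "frob_retraction W (\<sigma> W)"
    using sp W WU unfolding splitting_def by blast
  then show "g \<in> carrier (\<O> W) \<Longrightarrow> \<sigma> W g \<in> carrier (\<O> W)"
    "g \<in> carrier (\<O> W) \<Longrightarrow> h \<in> carrier (\<O> W) \<Longrightarrow> \<sigma> W (g \<oplus>\<^bsub>\<O> W\<^esub> h) = \<sigma> W g \<oplus>\<^bsub>\<O> W\<^esub> \<sigma> W h"
    "f \<in> carrier (\<O> W) \<Longrightarrow> g \<in> carrier (\<O> W) \<Longrightarrow>
      \<sigma> W (f [^]\<^bsub>\<O> W\<^esub> p \<otimes>\<^bsub>\<O> W\<^esub> g) = f \<otimes>\<^bsub>\<O> W\<^esub> \<sigma> W g"
    "f \<in> carrier (\<O> W) \<Longrightarrow> \<sigma> W (f [^]\<^bsub>\<O> W\<^esub> p) = f"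
    by (simp_all add: frob_retraction_def)
  show "opn V \<Longrightarrow> V \<subseteq> W \<Longrightarrow> g \<in> carrier (\<O> W) \<Longrightarrow> res X W V (\<sigma> W g) = \<sigma> V (res X W V g)"
    using sp W WU unfolding splitting_def by blast
qed

lemma split_zero: "\<sigma> W \<zero>\<^bsub>\<O> W\<^esub> = \<zero>\<^bsub>\<O> W\<^esub>"
  using split_frob [of "\<zero>\<^bsub>\<O> W\<^esub>"] p_pos by (simp add: W.nat_pow_zero)

lemma eps_closed [simp]: "g \<in> carrier (\<O> W) \<Longrightarrow> eps \<sigma> W g \<in> carrier (\<O> W)"
  by (simp add: eps_def)

lemma eps_add:
  "f \<in> carrier (\<O> W) \<Longrightarrow> g \<in> carrier (\<O> W) \<Longrightarrow>
    eps \<sigma> W (f \<oplus>\<^bsub>\<O> W\<^esub> g) = eps \<sigma> W f \<oplus>\<^bsub>\<O> W\<^esub> eps \<sigma> W g"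
  using frob_add [OF W, of "\<sigma> W f" "\<sigma> W g" 1] by (simp add: eps_def split_add)

lemma eps_lin:
  "f \<in> carrier (\<O> W) \<Longrightarrow> g \<in> carrier (\<O> W) \<Longrightarrow>
    eps \<sigma> W (f [^]\<^bsub>\<O> W\<^esub> p \<otimes>\<^bsub>\<O> W\<^esub> g) = f [^]\<^bsub>\<O> W\<^esub> p \<otimes>\<^bsub>\<O> W\<^esub> eps \<sigma> W g"
  by (simp add: eps_def split_lin frob_mult)

lemma eps_frob: "f \<in> carrier (\<O> W) \<Longrightarrow> eps \<sigma> W (f [^]\<^bsub>\<O> W\<^esub> p) = f [^]\<^bsub>\<O> W\<^esub> p"
  by (simp add: eps_def split_frob)

lemma eps_zero: "eps \<sigma> W \<zero>\<^bsub>\<O> W\<^esub> = \<zero>\<^bsub>\<O> W\<^esub>"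
  using p_pos by (simp add: eps_def split_zero W.nat_pow_zero)

lemma eps_neg:
  assumes [simp]: "f \<in> carrier (\<O> W)"
  shows "eps \<sigma> W (\<ominus>\<^bsub>\<O> W\<^esub> f) = \<ominus>\<^bsub>\<O> W\<^esub> eps \<sigma> W f"
proof -
  have "eps \<sigma> W (\<ominus>\<^bsub>\<O> W\<^esub> f) \<oplus>\<^bsub>\<O> W\<^esub> eps \<sigma> W f = \<zero>\<^bsub>\<O> W\<^esub>"
    by (simp add: eps_add [symmetric] W.l_neg eps_zero)
  then show ?thesis by (simp add: W.minus_equality)
qed

lemma eps_minus:
  "f \<in> carrier (\<O> W) \<Longrightarrow> g \<in> carrier (\<O> W) \<Longrightarrow>
    eps \<sigma> W (f \<ominus>\<^bsub>\<O> W\<^esub> g) = eps \<sigma> W f \<ominus>\<^bsub>\<O> W\<^esub> eps \<sigma> W g"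
  by (simp add: a_minus_def eps_add eps_neg)

text \<open>Coefficients at level \<open>e + 1\<close> are \<open>p\<close>-th powers of those at
  level \<open>e\<close>, and \<epsilon> is linear over \<open>p\<close>-th powers.\<close>

lemma eps_lincomb:
  assumes "\<forall>i<n. b i \<in> carrier (\<O> W)"
  shows "eps \<sigma> W (lincomb (e + 1) W n b c) = lincomb (e + 1) W n (\<lambda>i. eps \<sigma> W (b i)) c"
  using assms
proof (induction n)
  case 0
  show ?case by (simp add: eps_zero)
next
  case (Suc n)
  then have [simp]: "b n \<in> carrier (\<O> W)" "\<forall>i<n. b i \<in> carrier (\<O> W)" by auto
  have "cst X W (c n ^ (p ^ (e + 1))) = cst X W (c n ^ (p ^ e)) [^]\<^bsub>\<O> W\<^esub> p"
    by (simp add: cst_pow [symmetric] power_mult [symmetric] mult.commute)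
  then have "eps \<sigma> W (cst X W (c n ^ (p ^ (e + 1))) \<otimes>\<^bsub>\<O> W\<^esub> b n)
      = cst X W (c n ^ (p ^ (e + 1))) \<otimes>\<^bsub>\<O> W\<^esub> eps \<sigma> W (b n)"
    by (simp add: eps_lin)
  then show ?case
    using Suc by (simp add: lincomb_Suc eps_add)
qed

text \<open>A multiple \<open>r * f ^ (p ^ (e + 1))\<close> of a generator is a \<open>p\<close>-th
  power times \<open>r\<close>, and \<sigma> sends it to \<open>f ^ (p ^ e) * \<sigma> r\<close>:
  one Frobenius is stripped off.\<close>

lemma split_fiber_gen:
  assumes y: "y \<in> fiber_gen (e + 1) x W"
  shows "\<sigma> W y \<in> fiber_gen e x W"
proof -
  interpret I: ideal "fiber_gen e x W" "\<O> W" by (rule fiber_gen_ideal) simp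
  \<comment> \<open>\<sigma> is linear over \<open>p\<close>-th powers only, so the preimage of an
    ideal need not be an ideal. Asking for all multiples \<open>r * y\<close> repairs this.\<close>
  let ?K = "{y \<in> carrier (\<O> W). \<forall>r\<in>carrier (\<O> W). \<sigma> W (r \<otimes>\<^bsub>\<O> W\<^esub> y) \<in> fiber_gen e x W}"
  have mult: "y \<otimes>\<^bsub>\<O> W\<^esub> s \<in> ?K" if "y \<in> ?K" "s \<in> carrier (\<O> W)" for y s
  proof -
    have "\<sigma> W (r \<otimes>\<^bsub>\<O> W\<^esub> (y \<otimes>\<^bsub>\<O> W\<^esub> s)) \<in> fiber_gen e x W" if "r \<in> carrier (\<O> W)" for r
    proof -
      have "r \<otimes>\<^bsub>\<O> W\<^esub> (y \<otimes>\<^bsub>\<O> W\<^esub> s) = (r \<otimes>\<^bsub>\<O> W\<^esub> s) \<otimes>\<^bsub>\<O> W\<^esub> y"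
        using that \<open>y \<in> ?K\<close> \<open>s \<in> carrier (\<O> W)\<close> by (simp add: W.m_ac)
      then show ?thesis using that \<open>y \<in> ?K\<close> \<open>s \<in> carrier (\<O> W)\<close> by simp
    qed
    then show ?thesis using that by simp
  qed
  have "ideal ?K (\<O> W)"
  proof (rule idealI)
    show "subgroup ?K (add_monoid (\<O> W))"
    proof (rule W.add.subgroupI)
      have "\<zero>\<^bsub>\<O> W\<^esub> \<in> ?K" by (simp add: split_zero I.zero_closed)
      then show "?K \<noteq> {}" by blast
      show "\<ominus>\<^bsub>\<O> W\<^esub> y \<in> ?K" if "y \<in> ?K" for y
        using mult [OF that, of "\<ominus>\<^bsub>\<O> W\<^esub> \<one>\<^bsub>\<O> W\<^esub>"] that by (simp add: W.r_minus)
    qed (auto simp: W.r_distr split_add I.a_closed)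
    fix y s assume y: "y \<in> ?K" and s: "s \<in> carrier (\<O> W)"
    then show "y \<otimes>\<^bsub>\<O> W\<^esub> s \<in> ?K" by (rule mult)
    then show "s \<otimes>\<^bsub>\<O> W\<^esub> y \<in> ?K" using y s W.m_comm [of y s] by simp
  qed (rule W.ring_axioms)
  moreover have "f [^]\<^bsub>\<O> W\<^esub> (p ^ (e + 1)) \<in> ?K" if f: "f \<in> point_ideal X x W" for f
  proof -
    have fW [simp]: "f \<in> carrier (\<O> W)" using f point_ideal_carrier by blast
    have "\<sigma> W (r \<otimes>\<^bsub>\<O> W\<^esub> f [^]\<^bsub>\<O> W\<^esub> (p ^ (e + 1))) \<in> fiber_gen e x W" if [simp]: "r \<in> carrier (\<O> W)" for r
    proof -
      have "r \<otimes>\<^bsub>\<O> W\<^esub> f [^]\<^bsub>\<O> W\<^esub> (p ^ (e + 1)) = (f [^]\<^bsub>\<O> W\<^esub> (p ^ e)) [^]\<^bsub>\<O> W\<^esub> p \<otimes>\<^bsub>\<O> W\<^esub> r"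
        by (simp add: W.nat_pow_pow W.m_comm mult.commute)
      then show ?thesis
        using fiber_gen_self [OF W f, of e] by (simp add: split_lin I.I_r_closed)
    qed
    then show ?thesis by simp
  qed
  ultimately have "fiber_gen (e + 1) x W \<subseteq> ?K"
    by (rule fiber_gen_minimal [OF W])
  then have "y \<in> ?K" using y by blast
  then have "\<sigma> W (\<one>\<^bsub>\<O> W\<^esub> \<otimes>\<^bsub>\<O> W\<^esub> y) \<in> fiber_gen e x W" "y \<in> carrier (\<O> W)"
    by blast+
  then show ?thesis by simp
qed

end

lemma eps_res:
  assumes sp: "splitting U \<sigma>" and [simp]: "opn W" "opn V" "V \<subseteq> W" and WU: "W \<subseteq> U" and g: "g \<in> carrier (\<O> W)"
  shows "res X W V (eps \<sigma> W g) = eps \<sigma> V (res X W V g)"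
  using split_closed [OF sp _ WU, of g] split_res [OF sp _ WU, of V g] g by (simp add: eps_def)

lemma frob_fiber_gen:
  assumes [simp]: "opn W" and y: "y \<in> fiber_gen e x W"
  shows "y [^]\<^bsub>\<O> W\<^esub> p \<in> fiber_gen (e + 1) x W"
proof -
  interpret W: cring "\<O> W" by (rule cringO) simp
  interpret I: ideal "fiber_gen (e + 1) x W" "\<O> W" by (rule fiber_gen_ideal) simp
  let ?K = "{y \<in> carrier (\<O> W). y [^]\<^bsub>\<O> W\<^esub> p \<in> fiber_gen (e + 1) x W}"
  have "ideal ?K (\<O> W)"
  proof (rule idealI)
    show "subgroup ?K (add_monoid (\<O> W))"
    proof (rule W.add.subgroupI)
      have "\<zero>\<^bsub>\<O> W\<^esub> \<in> ?K" using p_pos I.zero_closed by (simp add: W.nat_pow_zero)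
      then show "?K \<noteq> {}" by blast
    qed (use frob_add [of W _ _ 1] frob_neg [of W _ 1] I.a_closed I.a_inv_closed in auto)
  qed (use I.I_l_closed I.I_r_closed in \<open>auto simp: frob_mult W.ring_axioms\<close>)
  moreover have "f [^]\<^bsub>\<O> W\<^esub> (p ^ e) \<in> ?K" if f: "f \<in> point_ideal X x W" for f
  proof -
    have "f \<in> carrier (\<O> W)" using f point_ideal_carrier by blast
    then show ?thesis
      using fiber_gen_self [OF assms(1) f, of "e + 1"] by (simp add: W.nat_pow_pow mult.commute)
  qed
  ultimately have "fiber_gen e x W \<subseteq> ?K"
    by (rule fiber_gen_minimal [OF assms(1)])
  then show ?thesis using y by blast
qed

text \<open>The inclusion of the image in the lower fibre rests on purity: if \<open>f ^ p\<close>
  is in the upper fibre ideal, then locally \<open>f = \<sigma> (f ^ p)\<close> is in the lower one.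
  So fibres map to fibres, over singular points too.\<close>

lemma frob_image_fiber: "frob_image p X 1 (frob_fiber p X (e + 1) x) = frob_fiber p X e x"
proof (rule ext, rule Set.set_eqI)
  fix U f
  show "f \<in> frob_image p X 1 (frob_fiber p X (e + 1) x) U \<longleftrightarrow> f \<in> frob_fiber p X e x U"
  proof (cases "opn U")
    case U [simp]: True
    interpret U: cring "\<O> U" by (rule cringO) simp
    show ?thesis
    proof
      assume "f \<in> frob_image p X 1 (frob_fiber p X (e + 1) x) U"
      then have f [simp]: "f \<in> carrier (\<O> U)" and fp: "f [^]\<^bsub>\<O> U\<^esub> p \<in> frob_fiber p X (e + 1) x U"
        by (auto simp: mem_frob_image)
      show "f \<in> frob_fiber p X e x U"
        unfolding mem_fiber [OF U]
      proof (intro conjI ballI f)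
        fix y assume y: "y \<in> U"
        obtain W where W: "opn W" "y \<in> W" "W \<subseteq> U" "res X U W (f [^]\<^bsub>\<O> U\<^esub> p) \<in> fiber_gen (e + 1) x W"
          by (rule fiberE [OF fp U y])
        have "y \<in> topspace (sp X)" using y openin_subset [OF U] by blast
        then obtain T \<sigma> where T: "splitting T \<sigma>" "y \<in> T" using ex_splitting by blast
        then have "opn T" by (simp add: splitting_def)
        let ?S = "W \<inter> T"
        have S: "opn ?S" "?S \<subseteq> W" "?S \<subseteq> T" "?S \<subseteq> U"
          using W \<open>opn T\<close> by (auto simp: openin_Int)
        have "res X W ?S (res X U W (f [^]\<^bsub>\<O> U\<^esub> p)) \<in> fiber_gen (e + 1) x ?S"
          by (rule fiber_gen_res [OF W(1) S(1,2) W(4)])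
        then have "res X U ?S f [^]\<^bsub>\<O> ?S\<^esub> p \<in> fiber_gen (e + 1) x ?S"
          using W S by simp
        then have "\<sigma> ?S (res X U ?S f [^]\<^bsub>\<O> ?S\<^esub> p) \<in> fiber_gen e x ?S"
          by (rule split_fiber_gen [OF T(1) S(1,3)])
        then have "res X U ?S f \<in> fiber_gen e x ?S"
          using S by (simp add: split_frob [OF T(1) S(1,3)])
        then show "\<exists>W. opn W \<and> y \<in> W \<and> W \<subseteq> U \<and> res X U W f \<in> fiber_gen e x W"
          using S W(2) T(2) by blast
      qed
    next
      assume f: "f \<in> frob_fiber p X e x U"
      then have fU [simp]: "f \<in> carrier (\<O> U)" by (simp add: mem_fiber)
      have "f [^]\<^bsub>\<O> U\<^esub> p \<in> frob_fiber p X (e + 1) x U"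
        unfolding mem_fiber [OF U]
      proof (intro conjI ballI)
        fix y assume y: "y \<in> U"
        obtain W where W: "opn W" "y \<in> W" "W \<subseteq> U" "res X U W f \<in> fiber_gen e x W"
          by (rule fiberE [OF f U y])
        then have "res X U W (f [^]\<^bsub>\<O> U\<^esub> p) \<in> fiber_gen (e + 1) x W"
          using frob_fiber_gen [OF W(1,4)] by simp
        then show "\<exists>W. opn W \<and> y \<in> W \<and> W \<subseteq> U \<and> res X U W (f [^]\<^bsub>\<O> U\<^esub> p) \<in> fiber_gen (e + 1) x W"
          using W by blast
      qed simp
      then show "f \<in> frob_image p X 1 (frob_fiber p X (e + 1) x) U"
        by (simp add: mem_frob_image)
    qed
  qed (simp add: frob_image_def frob_fiber_def)
qed

text \<open>\<sigma> lowers the level of the fibre by one, and the \<open>p\<close>-th power raises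
  it again by \<open>frob_image_fiber\<close>.\<close>

lemma eps_fiber:
  assumes sp: "splitting U \<sigma>" and W [simp]: "opn W" and WU: "W \<subseteq> U"
    and y: "y \<in> frob_fiber p X (e + 1) x W"
  shows "eps \<sigma> W y \<in> frob_fiber p X (e + 1) x W"
proof -
  have yW: "y \<in> carrier (\<O> W)" using y by (simp add: mem_fiber)
  have "\<sigma> W y \<in> frob_fiber p X e x W"
    unfolding mem_fiber [OF W]
  proof (intro conjI ballI)
    show "\<sigma> W y \<in> carrier (\<O> W)" using yW by (rule split_closed [OF sp W WU])
    fix z assume z: "z \<in> W"
    obtain T where T: "opn T" "z \<in> T" "T \<subseteq> W" "res X W T y \<in> fiber_gen (e + 1) x T"
      by (rule fiberE [OF y W z])
    then have "res X W T (\<sigma> W y) \<in> fiber_gen e x T"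
      using split_fiber_gen [OF sp T(1) _ T(4)] WU yW by (simp add: split_res [OF sp W WU])
    then show "\<exists>T. opn T \<and> z \<in> T \<and> T \<subseteq> W \<and> res X W T (\<sigma> W y) \<in> fiber_gen e x T"
      using T by blast
  qed
  then have "\<sigma> W y \<in> frob_image p X 1 (frob_fiber p X (e + 1) x) W"
    unfolding frob_image_fiber .
  then show ?thesis
    by (simp add: mem_frob_image eps_def)
qed

end

section \<open>Common denominators and cancellation at a fat point\<close>

lemma sum_fun_apply: "(\<Sum>i\<in>I. f i) x = (\<Sum>i\<in>I. f i x)" for f :: "'i \<Rightarrow> 'a \<Rightarrow> 'b::comm_monoid_add"
  by (induction I rule: infinite_finite_induct) auto

context char_p_variety
begin

text \<open>Having every large exponent lets several sections share one power of \<open>h\<close>,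
  with an exponent divisible by a power of \<open>p\<close>.\<close>

lemma affine_num_all:
  assumes V: "affine_open X V" and h [simp]: "h \<in> carrier (\<O> V)" and D: "D = nonvan X V h"
    and g [simp]: "g \<in> carrier (\<O> D)"
  shows "\<exists>m0::nat. \<forall>m\<ge>m0. \<exists>a\<in>carrier (\<O> V). g \<otimes>\<^bsub>\<O> D\<^esub> res X V D h [^]\<^bsub>\<O> D\<^esub> m = res X V D a"
proof -
  have [simp]: "opn V" "opn D" "D \<subseteq> V"
    using V by (simp_all add: affine_open_opn D open_nonvan nonvan_subset)
  interpret V: cring "\<O> V" by (rule cringO) simp
  interpret D: cring "\<O> D" by (rule cringO) simp
  obtain m0 :: nat and a where a [simp]: "a \<in> carrier (\<O> V)"
    and eq: "g \<otimes>\<^bsub>\<O> D\<^esub> res X V D h [^]\<^bsub>\<O> D\<^esub> m0 = res X V D a"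
    using affine_num [OF V h D g] by blast
  have "\<exists>a\<in>carrier (\<O> V). g \<otimes>\<^bsub>\<O> D\<^esub> res X V D h [^]\<^bsub>\<O> D\<^esub> m = res X V D a" if "m \<ge> m0" for m
  proof
    have "g \<otimes>\<^bsub>\<O> D\<^esub> res X V D h [^]\<^bsub>\<O> D\<^esub> m
        = (g \<otimes>\<^bsub>\<O> D\<^esub> res X V D h [^]\<^bsub>\<O> D\<^esub> m0) \<otimes>\<^bsub>\<O> D\<^esub> res X V D h [^]\<^bsub>\<O> D\<^esub> (m - m0)"
      using that by (simp add: D.m_assoc D.nat_pow_mult)
    then show "g \<otimes>\<^bsub>\<O> D\<^esub> res X V D h [^]\<^bsub>\<O> D\<^esub> m = res X V D (a \<otimes>\<^bsub>\<O> V\<^esub> h [^]\<^bsub>\<O> V\<^esub> (m - m0))"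
      by (simp add: eq)
  qed simp
  then show ?thesis by blast
qed

lemma affine_num_family:
  assumes V: "affine_open X V" and h: "h \<in> carrier (\<O> V)" and D: "D = nonvan X V h"
    and g: "\<forall>i<n::nat. g i \<in> carrier (\<O> D)"
  shows "\<exists>m0::nat. \<forall>m\<ge>m0. \<forall>i<n. \<exists>a\<in>carrier (\<O> V).
    g i \<otimes>\<^bsub>\<O> D\<^esub> res X V D h [^]\<^bsub>\<O> D\<^esub> m = res X V D a"
  using g
proof (induction n)
  case (Suc n)
  then obtain m0 :: nat where m0: "\<forall>m\<ge>m0. \<forall>i<n. \<exists>a\<in>carrier (\<O> V).
      g i \<otimes>\<^bsub>\<O> D\<^esub> res X V D h [^]\<^bsub>\<O> D\<^esub> m = res X V D a" by auto
  have "g n \<in> carrier (\<O> D)" using Suc.prems by simp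
  then obtain m1 :: nat where m1: "\<forall>m\<ge>m1. \<exists>a\<in>carrier (\<O> V).
      g n \<otimes>\<^bsub>\<O> D\<^esub> res X V D h [^]\<^bsub>\<O> D\<^esub> m = res X V D a"
    using affine_num_all [OF V h D] by blast
  show ?case
    using m0 m1 by (intro exI [of _ "max m0 m1"]) (auto simp: less_Suc_eq)
qed simp

lemma lincomb_mult:
  assumes [simp]: "opn U" and b: "\<forall>i<n. b i \<in> carrier (\<O> U)" and s [simp]: "s \<in> carrier (\<O> U)"
  shows "lincomb e U n b c \<otimes>\<^bsub>\<O> U\<^esub> s = lincomb e U n (\<lambda>i. b i \<otimes>\<^bsub>\<O> U\<^esub> s) c"
  using b
proof (induction n)
  case 0
  interpret U: cring "\<O> U" by (rule cringO) simp
  show ?case by simp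
next
  case (Suc n)
  interpret U: cring "\<O> U" by (rule cringO) simp
  have [simp]: "b n \<in> carrier (\<O> U)" "\<forall>i<n. b i \<in> carrier (\<O> U)" using Suc.prems by auto
  show ?case
    using Suc by (simp add: lincomb_Suc U.l_distr U.m_assoc)
qed

lemma lincomb_truncate:
  assumes [simp]: "opn U" and b: "\<forall>i<n. b i \<in> carrier (\<O> U)" and "r \<le> n"
    and z: "\<And>i. r \<le> i \<Longrightarrow> i < n \<Longrightarrow> c i = 0 \<or> b i = \<zero>\<^bsub>\<O> U\<^esub>"
  shows "lincomb e U n b c = lincomb e U r b c"
  using \<open>r \<le> n\<close> b z
proof (induction rule: dec_induct)
  case (step m)
  interpret U: cring "\<O> U" by (rule cringO) simp
  have [simp]: "b m \<in> carrier (\<O> U)" "\<forall>i<m. b i \<in> carrier (\<O> U)" using step.prems by auto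
  have "c m = 0 \<or> b m = \<zero>\<^bsub>\<O> U\<^esub>" using step by simp
  then have "cst X U (c m ^ (p ^ e)) \<otimes>\<^bsub>\<O> U\<^esub> b m = \<zero>\<^bsub>\<O> U\<^esub>"
    using p_pos by (auto simp: zero_power cst_zero)
  then show ?case
    using step by (simp add: lincomb_Suc)
qed simp

lemma fat_cancel:
  assumes J: "fat_point e x J" and U [simp]: "opn U" "x \<in> U" and h [simp]: "h \<in> carrier (\<O> U)"
    and nv: "h \<notin> vanishing_at X U x" and y [simp]: "y \<in> carrier (\<O> U)"
  shows "y \<otimes>\<^bsub>\<O> U\<^esub> h \<in> J U \<longleftrightarrow> y \<in> J U"
proof
  interpret U: cring "\<O> U" by (rule cringO) simp
  interpret I: ideal "J U" "\<O> U" by (rule sheaf_ideal [OF fat_sheaf [OF J]]) simp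
  obtain i where i [simp]: "i \<in> carrier (\<O> U)" and inv: "cg (\<O> U) (J U) (h \<otimes>\<^bsub>\<O> U\<^esub> i) \<one>\<^bsub>\<O> U\<^esub>"
    using fat_inverse [OF J U h nv] by blast
  show "y \<in> J U \<Longrightarrow> y \<otimes>\<^bsub>\<O> U\<^esub> h \<in> J U" by (rule I.I_r_closed) simp_all
  assume "y \<otimes>\<^bsub>\<O> U\<^esub> h \<in> J U"
  then have "(y \<otimes>\<^bsub>\<O> U\<^esub> h) \<otimes>\<^bsub>\<O> U\<^esub> i \<in> J U" by (rule I.I_r_closed) simp
  then have "y \<otimes>\<^bsub>\<O> U\<^esub> (h \<otimes>\<^bsub>\<O> U\<^esub> i) \<in> J U" by (simp add: U.m_assoc)
  moreover have "cg (\<O> U) (J U) (y \<otimes>\<^bsub>\<O> U\<^esub> (h \<otimes>\<^bsub>\<O> U\<^esub> i)) (y \<otimes>\<^bsub>\<O> U\<^esub> \<one>\<^bsub>\<O> U\<^esub>)"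
    by (intro I.cg_mult I.cg_refl inv) simp
  ultimately show "y \<in> J U" using I.cg_mem by fastforce
qed

lemma fat_supported:
  assumes J: "fat_point e x J" and V: "x \<in> V"
  shows "supported_in X V J"
  unfolding supported_in_def
proof
  fix y assume y: "y \<in> topspace (sp X) - V"
  then have "y \<noteq> x" using V by blast
  then show "\<exists>W. opn W \<and> y \<in> W \<and> J W = carrier (\<O> W)"
    using y by (intro fat_other [OF J _ openin_topspace]) simp_all
qed

lemma chart_coords_nonzero:
  assumes V: "opn V" and J: "J \<in> hilb_chart (frob_root p X e) n V b"
    and f: "f \<in> carrier (\<O> V)" "f \<notin> J V"
  shows "\<exists>j<n. crd e n V b J f j \<noteq> 0"
proof (rule ccontr)
  assume "\<not> ?thesis"
  moreover have "crd e n V b J f j = 0" if "j \<ge> n" for j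
    using chart_kmap(2) [OF V J] f that by (auto simp: coord_space_def)
  ultimately have "crd e n V b J f = 0"
    by (auto simp: fun_eq_iff) (meson not_le)
  then show False
    using kmap_ker [OF V chart_kmap(1) [OF V J]] f by simp
qed

lemma chart_crd_expand:
  assumes V: "opn V" and J: "J \<in> hilb_chart (frob_root p X e) n V b" and f: "f \<in> carrier (\<O> V)"
  shows "f \<ominus>\<^bsub>\<O> V\<^esub> lincomb e V n b (crd e n V b J f) \<in> J V"
  using chart_kmap(4) [OF V J f] chart_kmap(3) [OF V J] V by (simp add: coords_lincomb)

end

section \<open>Invariance of the ideals in the F-blowup under the idempotent\<close>

context F_pure_variety
begin

text \<open>
  For \<open>J'\<close> near \<open>J\<close>, subtracting from \<open>y\<close> its expansion in a chart basis modulo \<open>J'\<close> gives an element of \<open>J'\<close>, and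
  the coordinates of its image under \<open>\<epsilon>\<close> are chart functions after clearing denominators. One that is nonzero at \<open>J\<close>
  would be nonzero at a Frobenius fibre over a smooth point, in contradiction to \<open>eps_fiber\<close>.
\<close>

lemma FB_eps:
  assumes J: "J \<in> FB (e + 1)" and fat: "fat_point (e + 1) x J"
    and sp: "splitting U \<sigma>" and W [simp]: "opn W" "x \<in> W" and WU: "W \<subseteq> U" and y: "y \<in> J W"
  shows "eps \<sigma> W y \<in> J W"
proof -
  let ?q = "p ^ (e + 1)" and ?n = "len (e + 1)" and ?Y = "frob_root p X (e + 1)"
  obtain V b where V: "affine_open X V" and ch: "J \<in> hilb_chart ?Y ?n V b"
    using FB_chart [OF J] by blast
  have oV [simp]: "opn V" using V by (rule affine_open_opn)
  have xV [simp]: "x \<in> V" using fat_in_chart [OF fat oV] ch by (simp add: mem_chart)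
  have "opn (W \<inter> V)" "x \<in> W \<inter> V" by (simp_all add: openin_Int)
  then obtain h where h [simp]: "h \<in> carrier (\<O> V)" and xh: "x \<in> nonvan X V h" "nonvan X V h \<subseteq> W \<inter> V"
    using affine_basis [OF V, of "W \<inter> V" x] by blast
  define D where "D = nonvan X V h"
  have D [simp]: "opn D" "x \<in> D" "D \<subseteq> W" "D \<subseteq> V"
    using xh by (auto simp: D_def open_nonvan)
  have DU: "D \<subseteq> U" using D(3) WU by (rule subset_trans)
  interpret V: cring "\<O> V" by (rule cringO) simp
  interpret W: cring "\<O> W" by (rule cringO) simp
  interpret D: cring "\<O> D" by (rule cringO) simp
  interpret I: ideal "J V" "\<O> V" by (rule sheaf_ideal [OF fat_sheaf [OF fat]]) simp
  have yW [simp]: "y \<in> carrier (\<O> W)"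
    using y sheaf_carrier [OF fat_sheaf [OF fat] W(1)] by blast
  have bV: "\<forall>i<?n. b i \<in> carrier (\<O> V)" by (rule chart_kmap(3) [OF oV ch])
  define y0 where "y0 = res X W D y"
  have y0 [simp]: "y0 \<in> carrier (\<O> D)" by (simp add: y0_def)
  have y0J: "y0 \<in> J D" unfolding y0_def using y by (intro sheaf_res [OF fat_sheaf [OF fat]]) simp_all
  note [simp] = eps_closed [OF sp D(1) DU]
  have "\<forall>i<?n. eps \<sigma> D (res X V D (b i)) \<in> carrier (\<O> D)"
    using bV by simp
  from affine_num_family [OF V h D_def this]
  obtain m0 :: nat where m0: "\<forall>m\<ge>m0. \<forall>i<?n. \<exists>a\<in>carrier (\<O> V).
      eps \<sigma> D (res X V D (b i)) \<otimes>\<^bsub>\<O> D\<^esub> res X V D h [^]\<^bsub>\<O> D\<^esub> m = res X V D a"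
    by blast
  obtain m1 :: nat where m1: "\<And>m. m \<ge> m1 \<Longrightarrow> \<exists>a\<in>carrier (\<O> V).
      y0 \<otimes>\<^bsub>\<O> D\<^esub> res X V D h [^]\<^bsub>\<O> D\<^esub> m = res X V D a"
    using affine_num_all [OF V h D_def y0] by blast
  obtain m2 :: nat where m2: "\<And>m. m \<ge> m2 \<Longrightarrow> \<exists>a\<in>carrier (\<O> V).
      eps \<sigma> D y0 \<otimes>\<^bsub>\<O> D\<^esub> res X V D h [^]\<^bsub>\<O> D\<^esub> m = res X V D a"
    using affine_num_all [OF V h D_def, of "eps \<sigma> D y0"] by auto
  \<comment> \<open>\<open>?q * t\<close> exceeds all three bounds and is divisible by
    \<open>p\<close>. So a single \<open>H\<close> clears all denominators, and as a
    \<open>p\<close>-th power it can be pulled out of \<epsilon>.\<close>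
  define t where "t = m0 + m1 + m2"
  have t: "t \<le> ?q * t" using p_pos by simp
  have "m0 \<le> t" "m1 \<le> t" "m2 \<le> t" by (simp_all add: t_def)
  then have ge: "?q * t \<ge> m0" "?q * t \<ge> m1" "?q * t \<ge> m2" using t by (blast intro: order_trans)+
  define H where "H = res X V D h [^]\<^bsub>\<O> D\<^esub> (?q * t)"
  have H [simp]: "H \<in> carrier (\<O> D)" by (simp add: H_def)
  have "\<forall>i. \<exists>a. i < ?n \<longrightarrow> a \<in> carrier (\<O> V) \<and> eps \<sigma> D (res X V D (b i)) \<otimes>\<^bsub>\<O> D\<^esub> H = res X V D a"
    using m0 ge(1) unfolding H_def by blast
  then obtain \<beta> where \<beta>: "\<And>i. i < ?n \<Longrightarrow> \<beta> i \<in> carrier (\<O> V)"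
    "\<And>i. i < ?n \<Longrightarrow> eps \<sigma> D (res X V D (b i)) \<otimes>\<^bsub>\<O> D\<^esub> H = res X V D (\<beta> i)"
    by metis
  obtain a where a [simp]: "a \<in> carrier (\<O> V)" and a': "y0 \<otimes>\<^bsub>\<O> D\<^esub> H = res X V D a"
    using m1 [OF ge(2)] unfolding H_def by blast
  obtain z where z [simp]: "z \<in> carrier (\<O> V)" and z': "eps \<sigma> D y0 \<otimes>\<^bsub>\<O> D\<^esub> H = res X V D z"
    using m2 [OF ge(3)] unfolding H_def by blast
  have Hp: "H = (res X V D h [^]\<^bsub>\<O> D\<^esub> (p ^ e * t)) [^]\<^bsub>\<O> D\<^esub> p"
    unfolding H_def by (simp add: D.nat_pow_pow mult_ac)
  have "eps \<sigma> D (y0 \<otimes>\<^bsub>\<O> D\<^esub> H) = eps \<sigma> D y0 \<otimes>\<^bsub>\<O> D\<^esub> H"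
    using eps_lin [OF sp D(1) DU, of "res X V D h [^]\<^bsub>\<O> D\<^esub> (p ^ e * t)" y0] H
    by (simp add: Hp [symmetric] D.m_comm)
  then have epsa: "eps \<sigma> D (res X V D a) = res X V D z"
    by (simp add: a' z')
  \<comment> \<open>This carries two factors \<open>H\<close>: one cleared the denominator of
    \<open>y0\<close>, the other matches the \<open>\<beta> i\<close>, which are the
    \<epsilon>-images of the chart basis multiplied by \<open>H\<close>.\<close>
  define z1 where "z1 = z \<otimes>\<^bsub>\<O> V\<^esub> h [^]\<^bsub>\<O> V\<^esub> (?q * t)"
  have z1 [simp]: "z1 \<in> carrier (\<O> V)" by (simp add: z1_def)
  have z1D: "res X V D z1 = eps \<sigma> D (res X V D a) \<otimes>\<^bsub>\<O> D\<^esub> H"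
    by (simp add: z1_def epsa H_def)
  let ?c = "\<lambda>J. crd (e + 1) ?n V b J"
  have rel: "?c J' z1 l = (\<Sum>i<?n. ?c J' a i * ?c J' (\<beta> i) l)"
    if J': "J' = frob_fiber p X (e + 1) x'" "J' \<in> hilb_chart ?Y ?n V b" "fat_point (e + 1) x' J'" "x' \<in> D"
    for J' x' l
  proof -
    let ?a = "?c J' a"
    have bD: "\<forall>i<?n. res X V D (b i) \<in> carrier (\<O> D)" using bV by simp
    interpret ID: ideal "J' D" "\<O> D" by (rule sheaf_ideal [OF fat_sheaf [OF J'(3)]]) simp
    have "res X V D (a \<ominus>\<^bsub>\<O> V\<^esub> lincomb (e + 1) V ?n b ?a) \<in> J' D"
      using chart_crd_expand [OF oV J'(2) a] by (intro sheaf_res [OF fat_sheaf [OF J'(3)]]) simp_all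
    then have "res X V D a \<ominus>\<^bsub>\<O> D\<^esub> lincomb (e + 1) D ?n (\<lambda>i. res X V D (b i)) ?a \<in> J' D"
      using bV by (simp add: res_lincomb)
    then have "eps \<sigma> D (res X V D a \<ominus>\<^bsub>\<O> D\<^esub> lincomb (e + 1) D ?n (\<lambda>i. res X V D (b i)) ?a) \<in> J' D"
      unfolding J'(1) by (rule eps_fiber [OF sp D(1) DU])
    also have "eps \<sigma> D (res X V D a \<ominus>\<^bsub>\<O> D\<^esub> lincomb (e + 1) D ?n (\<lambda>i. res X V D (b i)) ?a)
        = eps \<sigma> D (res X V D a) \<ominus>\<^bsub>\<O> D\<^esub> eps \<sigma> D (lincomb (e + 1) D ?n (\<lambda>i. res X V D (b i)) ?a)"
      using bD by (intro eps_minus [OF sp D(1) DU]) simp_all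
    also have "eps \<sigma> D (lincomb (e + 1) D ?n (\<lambda>i. res X V D (b i)) ?a) = lincomb (e + 1) D ?n (\<lambda>i. eps \<sigma> D (res X V D (b i))) ?a"
      by (rule eps_lincomb [OF sp D(1) DU bD])
    finally have "eps \<sigma> D (res X V D a) \<ominus>\<^bsub>\<O> D\<^esub> lincomb (e + 1) D ?n (\<lambda>i. eps \<sigma> D (res X V D (b i))) ?a \<in> J' D" .
    then have "(eps \<sigma> D (res X V D a) \<ominus>\<^bsub>\<O> D\<^esub> lincomb (e + 1) D ?n (\<lambda>i. eps \<sigma> D (res X V D (b i))) ?a) \<otimes>\<^bsub>\<O> D\<^esub> H \<in> J' D"
      by (rule ID.I_r_closed) simp
    then have "eps \<sigma> D (res X V D a) \<otimes>\<^bsub>\<O> D\<^esub> H \<ominus>\<^bsub>\<O> D\<^esub> lincomb (e + 1) D ?n (\<lambda>i. eps \<sigma> D (res X V D (b i))) ?a \<otimes>\<^bsub>\<O> D\<^esub> H \<in> J' D"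
      using bV by (simp add: a_minus_def D.l_distr D.l_minus)
    also have "lincomb (e + 1) D ?n (\<lambda>i. eps \<sigma> D (res X V D (b i))) ?a \<otimes>\<^bsub>\<O> D\<^esub> H
        = lincomb (e + 1) D ?n (\<lambda>i. eps \<sigma> D (res X V D (b i)) \<otimes>\<^bsub>\<O> D\<^esub> H) ?a"
      using bV by (intro lincomb_mult) simp_all
    also have "\<dots> = lincomb (e + 1) D ?n (\<lambda>i. res X V D (\<beta> i)) ?a"
      using \<beta> by (intro lincomb_cong) simp_all
    also have "\<dots> = res X V D (lincomb (e + 1) V ?n \<beta> ?a)"
      using \<beta> by (simp add: res_lincomb)
    finally have "res X V D (z1 \<ominus>\<^bsub>\<O> V\<^esub> lincomb (e + 1) V ?n \<beta> ?a) \<in> J' D"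
      using \<beta> by (simp add: z1D)
    then have "z1 \<ominus>\<^bsub>\<O> V\<^esub> lincomb (e + 1) V ?n \<beta> ?a \<in> J' V"
      using \<beta> J'(4) by (subst (asm) fat_res_iff [OF J'(3)]) simp_all
    then have "cg (\<O> V) (J' V) z1 (lincomb (e + 1) V ?n \<beta> ?a)"
      using \<beta> by (simp add: cg_def)
    then have "?c J' z1 = (\<Sum>i<?n. coord_scale (?a i) (?c J' (\<beta> i)))"
      using \<beta> kmap_cg_iff [OF oV chart_kmap(1) [OF oV J'(2)]] kmap_lincomb [OF oV chart_kmap(1) [OF oV J'(2)]]
      by simp
    then show ?thesis by (simp add: sum_fun_apply coord_scale_def)
  qed
  have hnv: "h \<notin> vanishing_at X V x" using xh by (simp add: vanishing_at_def)
  then have hq: "h [^]\<^bsub>\<O> V\<^esub> ?q \<notin> J V"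
    by (subst fat_pow_iff [OF fat]) simp_all
  then obtain j where j: "j < ?n" "?c J (h [^]\<^bsub>\<O> V\<^esub> ?q) j \<noteq> 0"
    using chart_coords_nonzero [OF oV ch, of "h [^]\<^bsub>\<O> V\<^esub> ?q"] by auto
  have relJ: "?c J z1 l = (\<Sum>i<?n. ?c J a i * ?c J (\<beta> i) l)" if l: "l < ?n" for l
  proof (rule ccontr)
    assume ne: "\<not> ?thesis"
    \<comment> \<open>The second factor keeps the fibre found by density over a point of
      \<open>D\<close>: if \<open>h\<close> vanished at that point, \<open>h ^ ?q\<close> would be
      in the fibre ideal and all its coordinates would be 0.\<close>
    define u where "u J = (?c J z1 l - (\<Sum>i<?n. ?c J a i * ?c J (\<beta> i) l)) * ?c J (h [^]\<^bsub>\<O> V\<^esub> ?q) j" for J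
    have "u \<in> chart_functions ?Y ?n V b"
      unfolding u_def using l j \<beta>
      by (intro chart_functions.mult chart_function_diff chart_function_sum crd_chart_function) simp_all
    moreover have "u J \<noteq> 0" using ne j by (simp add: u_def)
    ultimately obtain x' where x': "frob_fiber p X (e + 1) x' \<in> hilb_chart ?Y ?n V b" "x' \<in> V"
      "fat_point (e + 1) x' (frob_fiber p X (e + 1) x')" "u (frob_fiber p X (e + 1) x') \<noteq> 0"
      using FB_density [OF J V ch] by blast
    let ?J = "frob_fiber p X (e + 1) x'"
    have "h [^]\<^bsub>\<O> V\<^esub> ?q \<notin> ?J V"
    proof
      assume "h [^]\<^bsub>\<O> V\<^esub> ?q \<in> ?J V"
      then have "?c ?J (h [^]\<^bsub>\<O> V\<^esub> ?q) = 0"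
        using kmap_ker [OF oV chart_kmap(1) [OF oV x'(1)]] by simp
      then show False using x'(4) by (simp add: u_def)
    qed
    then have "h \<notin> vanishing_at X V x'"
      using fat_pow_iff [OF x'(3) oV x'(2) h] by simp
    then have "x' \<in> D" by (simp add: D_def vanishing_at_def)
    then show False
      using rel [OF refl x'(1,3), of l] x'(4) by (simp add: u_def)
  qed
  have "res X V D a \<in> J D"
    unfolding a' [symmetric] using y0J
    by (intro ideal.I_r_closed [OF sheaf_ideal [OF fat_sheaf [OF fat]]]) simp_all
  then have "a \<in> J V" by (simp add: fat_res_iff [OF fat])
  then have ca: "?c J a = 0" using kmap_ker [OF oV chart_kmap(1) [OF oV ch]] by simp
  \<comment> \<open>Modulo \<open>J\<close> itself \<open>a\<close> is 0, so the right side of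
    \<open>relJ\<close> vanishes. Cancelling the two factors \<open>H\<close> then leaves
    \<open>\<epsilon> y0\<close> in \<open>J D\<close>.\<close>
  have "z1 \<in> J V"
  proof (rule ccontr)
    assume "z1 \<notin> J V"
    then obtain l where "l < ?n" "?c J z1 l \<noteq> 0"
      using chart_coords_nonzero [OF oV ch z1] by blast
    then show False using relJ ca by simp
  qed
  then have "res X V D z1 \<in> J D"
    by (intro sheaf_res [OF fat_sheaf [OF fat]]) simp_all
  then have "eps \<sigma> D y0 \<otimes>\<^bsub>\<O> D\<^esub> H \<otimes>\<^bsub>\<O> D\<^esub> H \<in> J D"
    by (simp add: z1D epsa z')
  moreover have "H \<notin> vanishing_at X D x"
    unfolding H_def using hnv by (intro not_vanishing_pow) (simp_all add: vanishing_res)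
  ultimately have "eps \<sigma> D y0 \<in> J D"
    by (simp add: fat_cancel [OF fat])
  then have "res X W D (eps \<sigma> W y) \<in> J D"
    by (simp add: eps_res [OF sp W(1) D(1,3) WU] y0_def)
  then show ?thesis
    by (subst (asm) fat_res_iff [OF fat]) (simp_all add: eps_closed [OF sp W(1) WU])
qed

end

section \<open>Charts adapted to a splitting\<close>

declare One_nat_def [simp del]

context char_p_variety
begin

text \<open>\<open>h ^ (p ^ e)\<close> is congruent to some \<open>c ^ (p ^ e)\<close> with nonzero
  \<open>c\<close>, and multiplication by the latter is the scalar \<open>c\<close> of the root of
  level \<open>e\<close>.\<close>

lemma fat_pow_scalar:
  assumes J: "fat_point e x J" and U [simp]: "opn U" "x \<in> U" and h [simp]: "h \<in> carrier (\<O> U)"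
    and nv: "h \<notin> vanishing_at X U x" and \<kappa>: "kmap e U (J U) \<kappa>"
  shows "\<exists>c. c \<noteq> 0 \<and> (\<forall>g\<in>carrier (\<O> U). \<kappa> (g \<otimes>\<^bsub>\<O> U\<^esub> h [^]\<^bsub>\<O> U\<^esub> (p ^ e * t)) = coord_scale c (\<kappa> g))"
proof -
  interpret U: cring "\<O> U" by (rule cringO) simp
  interpret I: ideal "J U" "\<O> U" by (rule sheaf_ideal [OF fat_sheaf [OF J]]) simp
  obtain c where c: "cg (\<O> U) (J U) (h [^]\<^bsub>\<O> U\<^esub> (p ^ e)) (cst X U (c ^ (p ^ e)))" "c \<noteq> 0"
    using fat_pow_const [OF J U h] nv by blast
  have "cg (\<O> U) (J U) ((h [^]\<^bsub>\<O> U\<^esub> (p ^ e)) [^]\<^bsub>\<O> U\<^esub> t) (cst X U (c ^ (p ^ e)) [^]\<^bsub>\<O> U\<^esub> t)"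
    by (rule I.cg_pow [OF c(1)])
  then have hc: "cg (\<O> U) (J U) (h [^]\<^bsub>\<O> U\<^esub> (p ^ e * t)) (cst X U ((c ^ t) ^ (p ^ e)))"
    by (simp add: U.nat_pow_pow cst_pow [symmetric] power_mult [symmetric] mult.commute)
  have "\<kappa> (g \<otimes>\<^bsub>\<O> U\<^esub> h [^]\<^bsub>\<O> U\<^esub> (p ^ e * t)) = coord_scale (c ^ t) (\<kappa> g)" if [simp]: "g \<in> carrier (\<O> U)" for g
  proof -
    have "cg (\<O> U) (J U) (g \<otimes>\<^bsub>\<O> U\<^esub> h [^]\<^bsub>\<O> U\<^esub> (p ^ e * t)) (g \<otimes>\<^bsub>\<O> U\<^esub> cst X U ((c ^ t) ^ (p ^ e)))"
      by (intro I.cg_mult I.cg_refl hc) simp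
    then have "\<kappa> (g \<otimes>\<^bsub>\<O> U\<^esub> h [^]\<^bsub>\<O> U\<^esub> (p ^ e * t)) = \<kappa> (cst X U ((c ^ t) ^ (p ^ e)) \<otimes>\<^bsub>\<O> U\<^esub> g)"
      by (simp add: kmap_cg_iff [OF _ \<kappa>] U.m_comm)
    then show ?thesis by (simp only: kmap_scale [OF U(1) \<kappa> that])
  qed
  then show ?thesis using c(2) by (intro exI [of _ "c ^ t"]) simp
qed

end

context F_pure_variety
begin

lemma frob_image_1: "opn U \<Longrightarrow> f \<in> frob_image p X 1 J U \<longleftrightarrow> f \<in> carrier (\<O> U) \<and> f [^]\<^bsub>\<O> U\<^esub> p \<in> J U"
  by (simp add: mem_frob_image)

lemma frob_minus_1:
  "opn U \<Longrightarrow> f \<in> carrier (\<O> U) \<Longrightarrow> g \<in> carrier (\<O> U) \<Longrightarrow>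
    (f \<ominus>\<^bsub>\<O> U\<^esub> g) [^]\<^bsub>\<O> U\<^esub> p = f [^]\<^bsub>\<O> U\<^esub> p \<ominus>\<^bsub>\<O> U\<^esub> g [^]\<^bsub>\<O> U\<^esub> p"
  using frob_minus [of U f g 1] by simp

text \<open>
  For every \<open>g\<close> there are \<open>m\<close>, \<open>s\<close> and \<open>z\<close> with \<open>g * h ^ (p ^ (e + 1) * m) = s ^ p + z\<close> and \<open>\<epsilon> z = 0\<close>, and the power of \<open>h\<close> is
  a nonzero scalar modulo \<open>J\<close>. So \<open>p\<close>-th powers and elements killed by \<open>\<epsilon>\<close> span.
\<close>

lemma adapted_basis:
  assumes J: "J \<in> FB (e + 1)" and fat: "fat_point (e + 1) x J" and V: "affine_open X V" and xV [simp]: "x \<in> V"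
    and bb: "basis_mod (frob_root p X e) V (carrier (\<O> V)) (frob_image p X 1 J V) r bb"
  obtains h D U \<sigma> bn where "splitting U \<sigma>" "h \<in> carrier (\<O> V)" "D = nonvan X V h" "x \<in> D" "D \<subseteq> U"
    "r \<le> len (e + 1)" "\<And>i. i < r \<Longrightarrow> bn i = bb i [^]\<^bsub>\<O> V\<^esub> p"
    "\<And>i. r \<le> i \<Longrightarrow> i < len (e + 1) \<Longrightarrow> eps \<sigma> D (res X V D (bn i)) = \<zero>\<^bsub>\<O> D\<^esub>"
    "J \<in> hilb_chart (frob_root p X (e + 1)) (len (e + 1)) V bn"
proof -
  let ?q = "p ^ (e + 1)" and ?n = "len (e + 1)"
  let ?pb = "\<lambda>i. bb i [^]\<^bsub>\<O> V\<^esub> p" and ?I = "frob_image p X 1 J V"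
  have oV [simp]: "opn V" using V by (rule affine_open_opn)
  interpret V: cring "\<O> V" by (rule cringO) simp
  obtain V0 b0 where V0: "affine_open X V0" and ch0: "J \<in> hilb_chart (frob_root p X (e + 1)) ?n V0 b0"
    using FB_chart [OF J] by blast
  have "x \<in> V0" using fat_in_chart [OF fat affine_open_opn [OF V0]] ch0 by (simp add: mem_chart)
  moreover have "basis_mod (frob_root p X (e + 1)) V0 (carrier (\<O> V0)) (J V0) ?n b0"
    using ch0 by (simp add: mem_chart)
  ultimately obtain K where K: "\<And>U. opn U \<Longrightarrow> x \<in> U \<Longrightarrow> kmap (e + 1) U (J U) (K U)"
    "\<And>U. affine_open X U \<Longrightarrow> x \<in> U \<Longrightarrow> K U ` carrier (\<O> U) = coord_space ?n"
    using fat_kmap [OF fat V0] by metis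
  define \<kappa> where "\<kappa> = K V"
  have \<kappa>: "kmap (e + 1) V (J V) \<kappa>" and im: "\<kappa> ` carrier (\<O> V) = coord_space ?n"
    using K(1) [OF oV xV] K(2) [OF V xV] by (auto simp: \<kappa>_def)
  have bbV: "\<forall>i<r. bb i \<in> carrier (\<O> V)" using bb by (simp add: basis_mod_def)
  then have pbV: "\<forall>i<r. ?pb i \<in> carrier (\<O> V)" by simp
  have idI: "ideal ?I (\<O> V)"
    by (rule sheaf_ideal [OF frob_image_sheaf [OF fat_sheaf [OF fat]] oV])
  have "x \<in> topspace (sp X)" using fat_rational [OF fat] by (simp add: rational_point_def)
  then obtain U \<sigma> where sp: "splitting U \<sigma>" and xU: "x \<in> U"
    using ex_splitting by blast
  have "opn U" using sp by (simp add: splitting_def)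
  then have "opn (U \<inter> V)" "x \<in> U \<inter> V" using xU by (simp_all add: openin_Int)
  then obtain h where h [simp]: "h \<in> carrier (\<O> V)" and xh: "x \<in> nonvan X V h" "nonvan X V h \<subseteq> U \<inter> V"
    using affine_basis [OF V, of "U \<inter> V" x] by blast
  define D where "D = nonvan X V h"
  have D [simp]: "opn D" "x \<in> D" "D \<subseteq> V" and DU: "D \<subseteq> U"
    using xh by (auto simp: D_def open_nonvan)
  interpret D: cring "\<O> D" by (rule cringO) simp
  note [simp] = eps_closed [OF sp D(1) DU] split_closed [OF sp D(1) DU]
  have hnv: "h \<notin> vanishing_at X V x" using xh by (simp add: vanishing_at_def)
  \<comment> \<open>Being killed by \<epsilon> is imposed over \<open>D\<close>, where \<sigma> is
    available, but the elements are sections over all of \<open>V\<close>, so that they can enter a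
    chart basis there.\<close>
  define T where "T = \<kappa> ` {z \<in> carrier (\<O> V). eps \<sigma> D (res X V D z) = \<zero>\<^bsub>\<O> D\<^esub>}"
  define u where "u i = \<kappa> (?pb i)" for i
  obtain \<kappa>' where \<kappa>': "kmap e V ?I \<kappa>'" "\<kappa>' ` carrier (\<O> V) = coord_space r"
    "\<And>f. f \<in> carrier (\<O> V) \<Longrightarrow> coords (frob_root p X e) V ?I r bb f (\<kappa>' f)"
    by (rule basis_mod_ex_kmap [OF oV idI bb]) (rule that)
  \<comment> \<open>A relation between the \<open>bb i ^ p\<close> modulo \<open>J\<close> is the
    \<open>p\<close>-th power of the same relation between the \<open>bb i\<close> modulo the image
    of \<open>J\<close>, by \<open>lincomb_frob\<close>.\<close>
  have indep: "cs.fam_indep {..<r} u"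
    unfolding cs.fam_indep_def
  proof (intro allI impI)
    fix c assume "(\<Sum>i<r. coord_scale (c i) (u i)) = 0"
    then have "\<kappa> (lincomb (e + 1) V r ?pb c) = 0"
      using pbV by (simp add: kmap_lincomb [OF oV \<kappa>] u_def)
    then have "lincomb (e + 1) V r ?pb c \<in> J V"
      using kmap_ker [OF oV \<kappa>] pbV by simp
    then have "lincomb e V r bb c [^]\<^bsub>\<O> V\<^esub> p \<in> J V"
      by (simp only: lincomb_frob [OF oV bbV])
    then have "lincomb e V r bb c \<in> ?I"
      using bbV by (simp add: frob_image_1)
    then have "\<kappa>' (lincomb e V r bb c) = 0"
      using kmap_ker [OF oV \<kappa>'(1)] bbV by simp
    then have "(\<Sum>i<r. coord_scale (c i) (\<kappa>' (bb i))) = 0"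
      using bbV by (simp add: kmap_lincomb [OF oV \<kappa>'(1)])
    moreover have "cs.fam_indep {..<r} (\<lambda>i. \<kappa>' (bb i))"
      using bb kmap_basis_mod [OF oV \<kappa>'(1) bbV] by (simp add: cs.fam_basis_def)
    ultimately show "\<forall>i\<in>{..<r}. c i = 0"
      unfolding cs.fam_indep_def by blast
  qed
  have uS: "u ` {..<r} \<subseteq> coord_space ?n"
    unfolding im [symmetric] u_def using pbV by blast
  have TS: "T \<subseteq> coord_space ?n"
    unfolding T_def im [symmetric] by blast
  have span: "coord_space ?n \<subseteq> cs.span (u ` {..<r} \<union> T)"
  proof
    fix v :: "nat \<Rightarrow> 'k" assume "v \<in> coord_space ?n"
    then obtain g where g [simp]: "g \<in> carrier (\<O> V)" and v: "v = \<kappa> g"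
      using im by blast
    have "\<sigma> D (res X V D g) \<in> carrier (\<O> D)" by simp
    then obtain m0 :: nat where m0: "\<forall>m\<ge>m0. \<exists>a\<in>carrier (\<O> V).
        \<sigma> D (res X V D g) \<otimes>\<^bsub>\<O> D\<^esub> res X V D h [^]\<^bsub>\<O> D\<^esub> m = res X V D a"
      using affine_num_all [OF V h D_def] by blast
    have "m0 \<le> p ^ e * m0" using p_pos by simp
    then obtain s where s [simp]: "s \<in> carrier (\<O> V)"
      and s': "\<sigma> D (res X V D g) \<otimes>\<^bsub>\<O> D\<^esub> res X V D h [^]\<^bsub>\<O> D\<^esub> (p ^ e * m0) = res X V D s"
      using m0 by blast
    \<comment> \<open>Over \<open>D\<close>, \<open>s\<close> is \<open>\<sigma> g\<close> times
      \<open>h ^ (p ^ e * m0)\<close>, so \<open>s ^ p\<close> is \<epsilon> of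
      \<open>g * h ^ (?q * m0)\<close>. Subtracting it removes exactly the part seen by
      \<epsilon>.\<close>
    define z where "z = g \<otimes>\<^bsub>\<O> V\<^esub> h [^]\<^bsub>\<O> V\<^esub> (?q * m0) \<ominus>\<^bsub>\<O> V\<^esub> s [^]\<^bsub>\<O> V\<^esub> p"
    have z [simp]: "z \<in> carrier (\<O> V)" by (simp add: z_def)
    define G where "G = res X V D h [^]\<^bsub>\<O> D\<^esub> (p ^ e * m0)"
    have G [simp]: "G \<in> carrier (\<O> D)" by (simp add: G_def)
    have Gp: "res X V D h [^]\<^bsub>\<O> D\<^esub> (?q * m0) = G [^]\<^bsub>\<O> D\<^esub> p"
      by (simp add: G_def D.nat_pow_pow power_add mult_ac)
    have sG: "\<sigma> D (res X V D g) \<otimes>\<^bsub>\<O> D\<^esub> G = res X V D s"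
      using s' by (simp add: G_def)
    have "res X V D z = G [^]\<^bsub>\<O> D\<^esub> p \<otimes>\<^bsub>\<O> D\<^esub> res X V D g \<ominus>\<^bsub>\<O> D\<^esub> res X V D s [^]\<^bsub>\<O> D\<^esub> p"
      unfolding z_def using Gp by (simp add: D.m_comm)
    also have "eps \<sigma> D \<dots> = eps \<sigma> D (G [^]\<^bsub>\<O> D\<^esub> p \<otimes>\<^bsub>\<O> D\<^esub> res X V D g) \<ominus>\<^bsub>\<O> D\<^esub> eps \<sigma> D (res X V D s [^]\<^bsub>\<O> D\<^esub> p)"
      by (rule eps_minus [OF sp D(1) DU]) simp_all
    also have "\<dots> = G [^]\<^bsub>\<O> D\<^esub> p \<otimes>\<^bsub>\<O> D\<^esub> eps \<sigma> D (res X V D g) \<ominus>\<^bsub>\<O> D\<^esub> res X V D s [^]\<^bsub>\<O> D\<^esub> p"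
      by (simp add: eps_lin [OF sp D(1) DU] eps_frob [OF sp D(1) DU])
    also have "res X V D s [^]\<^bsub>\<O> D\<^esub> p = G [^]\<^bsub>\<O> D\<^esub> p \<otimes>\<^bsub>\<O> D\<^esub> eps \<sigma> D (res X V D g)"
      unfolding sG [symmetric] eps_def by (simp add: frob_mult D.m_comm)
    finally have "eps \<sigma> D (res X V D z) = \<zero>\<^bsub>\<O> D\<^esub>"
      by (simp add: a_minus_def D.r_neg)
    then have "\<kappa> z \<in> T" using z unfolding T_def by blast
    obtain c where c: "c \<noteq> 0" "\<kappa> (g \<otimes>\<^bsub>\<O> V\<^esub> h [^]\<^bsub>\<O> V\<^esub> (?q * m0)) = coord_scale c (\<kappa> g)"
      using fat_pow_scalar [OF fat oV xV h hnv \<kappa>, of m0] g by blast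
    have "s \<ominus>\<^bsub>\<O> V\<^esub> lincomb e V r bb (\<kappa>' s) \<in> ?I"
      using \<kappa>'(3) [OF s] bbV by (simp add: coords_lincomb)
    then have "s [^]\<^bsub>\<O> V\<^esub> p \<ominus>\<^bsub>\<O> V\<^esub> lincomb e V r bb (\<kappa>' s) [^]\<^bsub>\<O> V\<^esub> p \<in> J V"
      using bbV by (simp add: frob_image_1 frob_minus_1)
    then have "cg (\<O> V) (J V) (s [^]\<^bsub>\<O> V\<^esub> p) (lincomb e V r bb (\<kappa>' s) [^]\<^bsub>\<O> V\<^esub> p)"
      using bbV by (simp add: cg_def)
    then have "cg (\<O> V) (J V) (s [^]\<^bsub>\<O> V\<^esub> p) (lincomb (e + 1) V r ?pb (\<kappa>' s))"
      by (simp only: lincomb_frob [OF oV bbV])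
    then have "\<kappa> (s [^]\<^bsub>\<O> V\<^esub> p) = (\<Sum>i<r. coord_scale (\<kappa>' s i) (u i))"
      using pbV kmap_cg_iff [OF oV \<kappa>] by (simp add: kmap_lincomb [OF oV \<kappa>] u_def)
    then have "\<kappa> (s [^]\<^bsub>\<O> V\<^esub> p) \<in> cs.span (u ` {..<r} \<union> T)"
      by (auto intro!: cs.span_sum cs.span_scale intro: cs.span_base)
    moreover have "\<kappa> z \<in> cs.span (u ` {..<r} \<union> T)"
      using \<open>\<kappa> z \<in> T\<close> by (auto intro: cs.span_base)
    ultimately have "\<kappa> z + \<kappa> (s [^]\<^bsub>\<O> V\<^esub> p) \<in> cs.span (u ` {..<r} \<union> T)"
      by (rule cs.span_add [rotated])
    moreover have "\<kappa> z + \<kappa> (s [^]\<^bsub>\<O> V\<^esub> p) = coord_scale c v"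
      using c(2) unfolding z_def v by (simp add: kmap_minus [OF oV \<kappa>])
    ultimately have "coord_scale (inverse c) (coord_scale c v) \<in> cs.span (u ` {..<r} \<union> T)"
      using cs.span_scale by metis
    then show "v \<in> cs.span (u ` {..<r} \<union> T)"
      using c(1) by simp
  qed
  obtain w where rn: "r \<le> ?n" and w: "cs.fam_basis (coord_space ?n) {..<?n} w"
    and wu: "\<And>i. i < r \<Longrightarrow> w i = u i" and wT: "\<And>i. i < ?n \<Longrightarrow> r \<le> i \<Longrightarrow> w i \<in> T"
    using cs.fam_basis_extend [OF coord_space_basis indep uS TS span] by blast
  have "\<forall>i. \<exists>z. r \<le> i \<longrightarrow> i < ?n \<longrightarrow> z \<in> carrier (\<O> V) \<and> eps \<sigma> D (res X V D z) = \<zero>\<^bsub>\<O> D\<^esub> \<and> w i = \<kappa> z"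
    using wT unfolding T_def by blast
  then obtain zz where zz: "\<And>i. r \<le> i \<Longrightarrow> i < ?n \<Longrightarrow> zz i \<in> carrier (\<O> V)"
    "\<And>i. r \<le> i \<Longrightarrow> i < ?n \<Longrightarrow> eps \<sigma> D (res X V D (zz i)) = \<zero>\<^bsub>\<O> D\<^esub>"
    "\<And>i. r \<le> i \<Longrightarrow> i < ?n \<Longrightarrow> w i = \<kappa> (zz i)"
    by metis
  define bn where "bn i = (if i < r then ?pb i else zz i)" for i
  have bnV: "\<forall>i<?n. bn i \<in> carrier (\<O> V)"
    using pbV zz(1) by (auto simp: bn_def not_less)
  have \<kappa>bn: "\<kappa> (bn i) = w i" if "i < ?n" for i
    using that wu zz(3) [of i] by (auto simp: bn_def u_def not_less)
  then have "(\<lambda>i. \<kappa> (bn i)) ` {..<?n} = w ` {..<?n}"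
    by (intro image_cong) simp_all
  with \<kappa>bn have "cs.fam_basis (coord_space ?n) {..<?n} (\<lambda>i. \<kappa> (bn i))"
    using w by (simp add: cs.fam_basis_def cs.fam_indep_def)
  then have "basis_mod (frob_root p X (e + 1)) V (carrier (\<O> V)) (J V) ?n bn"
    by (simp only: kmap_basis_mod [OF oV \<kappa> bnV] im)
  then have "J \<in> hilb_chart (frob_root p X (e + 1)) ?n V bn"
    using ch0 fat_supported [OF fat xV] by (simp only: mem_chart simp_thms)
  moreover have "bn i = ?pb i" if "i < r" for i using that by (simp add: bn_def)
  moreover have "eps \<sigma> D (res X V D (bn i)) = \<zero>\<^bsub>\<O> D\<^esub>" if "r \<le> i" "i < ?n" for i
    using that zz(2) by (simp add: bn_def)
  ultimately show thesis
    using that [OF sp h D_def D(2) DU rn] by blast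
qed

text \<open>The conditions on \<open>bn\<close> concern sections and not one particular ideal. A
  basis adapted to a single ideal therefore gives coordinates for every \<open>J\<close> of the
  F-blowup that lies in its chart and is supported in \<open>D\<close>.\<close>

lemma adapted_coords:
  assumes J: "J \<in> FB (e + 1)" and fat: "fat_point (e + 1) x J" and V: "affine_open X V"
    and sp: "splitting U \<sigma>" and h: "h \<in> carrier (\<O> V)" and Ddef: "D = nonvan X V h" and xD: "x \<in> D" and DU: "D \<subseteq> U"
    and rn: "r \<le> len (e + 1)" and bbV: "\<forall>i<r. bb i \<in> carrier (\<O> V)"
    and bn1: "\<And>i. i < r \<Longrightarrow> bn i = bb i [^]\<^bsub>\<O> V\<^esub> p"
    and bn2: "\<And>i. r \<le> i \<Longrightarrow> i < len (e + 1) \<Longrightarrow> eps \<sigma> D (res X V D (bn i)) = \<zero>\<^bsub>\<O> D\<^esub>"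
    and ch: "J \<in> hilb_chart (frob_root p X (e + 1)) (len (e + 1)) V bn"
  shows "frob_image p X 1 J \<in> hilb_chart (frob_root p X e) r V bb"
    "g \<in> carrier (\<O> V) \<Longrightarrow> crd e r V bb (frob_image p X 1 J) g = crd (e + 1) (len (e + 1)) V bn J (g [^]\<^bsub>\<O> V\<^esub> p)"
proof -
  let ?n = "len (e + 1)" and ?I = "frob_image p X 1 J V"
  have oV [simp]: "opn V" using V by (rule affine_open_opn)
  have D [simp]: "opn D" "D \<subseteq> V" and xD' [simp]: "x \<in> D"
    using xD by (simp_all add: Ddef open_nonvan nonvan_subset)
  have xV [simp]: "x \<in> V" using D(2) xD by blast
  interpret V: cring "\<O> V" by (rule cringO) simp
  interpret D: cring "\<O> D" by (rule cringO) simp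
  have bnV: "\<forall>i<?n. bn i \<in> carrier (\<O> V)" by (rule chart_kmap(3) [OF oV ch])
  have pbV: "\<forall>i<r. bb i [^]\<^bsub>\<O> V\<^esub> p \<in> carrier (\<O> V)" using bbV by simp
  have bnV': "\<forall>i<r. bn i \<in> carrier (\<O> V)" using bn1 pbV by simp
  have bnD: "\<forall>i<?n. res X V D (bn i) \<in> carrier (\<O> D)" using bnV by simp
  note \<kappa> = chart_kmap(1) [OF oV ch]
  note [simp] = eps_closed [OF sp D(1) DU]
  have pcomb: "lincomb e V r bb c [^]\<^bsub>\<O> V\<^esub> p = lincomb (e + 1) V r bn c" for c
    unfolding lincomb_frob [OF oV bbV] using bn1 pbV by (intro lincomb_cong [symmetric]) simp_all
  have mem: "f \<ominus>\<^bsub>\<O> V\<^esub> lincomb e V r bb c \<in> ?I \<longleftrightarrow> f [^]\<^bsub>\<O> V\<^esub> p \<ominus>\<^bsub>\<O> V\<^esub> lincomb (e + 1) V r bn c \<in> J V"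
    if "f \<in> carrier (\<O> V)" for f c
    using that bbV by (simp add: frob_image_1 frob_minus_1 pcomb)
  have coords_eq: "coords (frob_root p X e) V ?I r bb f c \<longleftrightarrow>
      coords (frob_root p X (e + 1)) V (J V) ?n bn (f [^]\<^bsub>\<O> V\<^esub> p) c" if f [simp]: "f \<in> carrier (\<O> V)" for f c
  proof
    assume c: "coords (frob_root p X e) V ?I r bb f c"
    then have c0: "\<forall>i\<ge>r. c i = 0" and "f \<ominus>\<^bsub>\<O> V\<^esub> lincomb e V r bb c \<in> ?I"
      using bbV by (simp_all add: coords_lincomb)
    then have "f [^]\<^bsub>\<O> V\<^esub> p \<ominus>\<^bsub>\<O> V\<^esub> lincomb (e + 1) V r bn c \<in> J V"
      by (simp only: mem [OF f])
    moreover have "lincomb (e + 1) V ?n bn c = lincomb (e + 1) V r bn c"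
      using c0 by (intro lincomb_truncate bnV rn) simp_all
    ultimately show "coords (frob_root p X (e + 1)) V (J V) ?n bn (f [^]\<^bsub>\<O> V\<^esub> p) c"
      using c0 rn by (simp only: coords_lincomb [OF oV bnV]) (auto intro: order_trans)
  next
    assume c: "coords (frob_root p X (e + 1)) V (J V) ?n bn (f [^]\<^bsub>\<O> V\<^esub> p) c"
    let ?L = "lincomb (e + 1) D ?n (\<lambda>i. res X V D (bn i)) c" and ?f = "res X V D f [^]\<^bsub>\<O> D\<^esub> p"
    have c0: "\<forall>i\<ge>?n. c i = 0" and y: "f [^]\<^bsub>\<O> V\<^esub> p \<ominus>\<^bsub>\<O> V\<^esub> lincomb (e + 1) V ?n bn c \<in> J V"
      using c unfolding coords_lincomb [OF oV bnV] by blast+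
    have "res X V D (f [^]\<^bsub>\<O> V\<^esub> p \<ominus>\<^bsub>\<O> V\<^esub> lincomb (e + 1) V ?n bn c) \<in> J D"
      by (rule sheaf_res [OF fat_sheaf [OF fat] oV D y])
    also have "res X V D (f [^]\<^bsub>\<O> V\<^esub> p \<ominus>\<^bsub>\<O> V\<^esub> lincomb (e + 1) V ?n bn c) = ?f \<ominus>\<^bsub>\<O> D\<^esub> ?L"
      using bnV by (simp add: res_lincomb)
    finally have "eps \<sigma> D (?f \<ominus>\<^bsub>\<O> D\<^esub> ?L) \<in> J D"
      by (rule FB_eps [OF J fat sp D(1) xD DU])
    also have "eps \<sigma> D (?f \<ominus>\<^bsub>\<O> D\<^esub> ?L) = eps \<sigma> D ?f \<ominus>\<^bsub>\<O> D\<^esub> eps \<sigma> D ?L"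
      using bnD by (intro eps_minus [OF sp D(1) DU]) simp_all
    also have "eps \<sigma> D ?f = ?f" by (rule eps_frob [OF sp D(1) DU]) simp
    also have "eps \<sigma> D ?L = lincomb (e + 1) D ?n (\<lambda>i. eps \<sigma> D (res X V D (bn i))) c"
      by (rule eps_lincomb [OF sp D(1) DU bnD])
    also have "\<dots> = lincomb (e + 1) D r (\<lambda>i. eps \<sigma> D (res X V D (bn i))) c"
      using bnD bn2 by (intro lincomb_truncate rn) simp_all
    also have "\<dots> = lincomb (e + 1) D r (\<lambda>i. res X V D (bn i)) c"
      using bn1 bbV by (intro lincomb_cong) (simp_all add: eps_frob [OF sp D(1) DU])
    also have "\<dots> = res X V D (lincomb (e + 1) V r bn c)"
      using bnV' by (simp add: res_lincomb)
    finally have "res X V D (f [^]\<^bsub>\<O> V\<^esub> p \<ominus>\<^bsub>\<O> V\<^esub> lincomb (e + 1) V r bn c) \<in> J D"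
      using bnV' by simp
    then have y': "f [^]\<^bsub>\<O> V\<^esub> p \<ominus>\<^bsub>\<O> V\<^esub> lincomb (e + 1) V r bn c \<in> J V"
      using bnV' by (subst (asm) fat_res_iff [OF fat]) simp_all
    \<comment> \<open>Both \<open>c\<close> and its truncation are coordinates of
      \<open>f ^ p\<close> in the chart, so uniqueness makes the entries from \<open>r\<close> on
      vanish.\<close>
    define d where "d i = (if i < r then c i else 0)" for i
    have "lincomb (e + 1) V ?n bn d = lincomb (e + 1) V r bn d"
      by (intro lincomb_truncate bnV rn) (simp_all add: d_def)
    also have "\<dots> = lincomb (e + 1) V r bn c"
      unfolding lincomb_def by (intro V.finsum_cong') (use bnV' in \<open>auto simp: d_def\<close>)
    finally have "coords (frob_root p X (e + 1)) V (J V) ?n bn (f [^]\<^bsub>\<O> V\<^esub> p) d"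
      using y' rn unfolding coords_lincomb [OF oV bnV] by (simp add: d_def)
    moreover have "\<exists>!c. coords (frob_root p X (e + 1)) V (J V) ?n bn (f [^]\<^bsub>\<O> V\<^esub> p) c"
      using ch unfolding mem_chart basis_mod_def by simp
    ultimately have "d = c" using c by blast
    then have "\<forall>i\<ge>r. c i = 0" by (metis d_def not_le)
    then show "coords (frob_root p X e) V ?I r bb f c"
      unfolding coords_lincomb [OF oV bbV] mem [OF f] using y' by blast
  qed
  have "\<exists>!c. coords (frob_root p X e) V ?I r bb f c" if f: "f \<in> carrier (\<O> V)" for f
    unfolding coords_eq [OF f] using ch f unfolding mem_chart basis_mod_def by simp
  then have "basis_mod (frob_root p X e) V (carrier (\<O> V)) ?I r bb"
    using bbV unfolding basis_mod_def by blast
  moreover have "closed_subscheme X (frob_image p X 1 J)"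
    using ch frob_image_closed_subscheme by (simp add: mem_chart)
  moreover have "supported_in X V (frob_image p X 1 J)"
    by (rule fat_supported [OF frob_image_fat [OF fat] xV])
  ultimately show "frob_image p X 1 J \<in> hilb_chart (frob_root p X e) r V bb"
    by (simp only: mem_chart simp_thms)
  show "crd e r V bb (frob_image p X 1 J) g = crd (e + 1) ?n V bn J (g [^]\<^bsub>\<O> V\<^esub> p)"
    if "g \<in> carrier (\<O> V)"
    unfolding crd_def coords_eq [OF that] ..
qed

end

section \<open>Monomials in local parameters at smooth points\<close>

lemma (in cring) genideal_insert:
  assumes S: "S \<subseteq> carrier R" and y [simp]: "y \<in> carrier R" and v: "v \<in> genideal R (insert y S)"
  shows "v \<in> carrier R \<and> (\<exists>w\<in>carrier R. v \<ominus> w \<otimes> y \<in> genideal R S)"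
proof -
  interpret I: ideal "genideal R S" R by (rule genideal_ideal [OF S])
  let ?K = "{v \<in> carrier R. \<exists>w\<in>carrier R. v \<ominus> w \<otimes> y \<in> genideal R S}"
  have mult: "r \<otimes> v \<in> ?K" if v: "v \<in> ?K" and r [simp]: "r \<in> carrier R" for r v
  proof -
    obtain w where [simp]: "w \<in> carrier R" "v \<in> carrier R" and w: "v \<ominus> w \<otimes> y \<in> genideal R S"
      using v by blast
    have "r \<otimes> (v \<ominus> w \<otimes> y) \<in> genideal R S" using w by (rule I.I_l_closed) simp
    then have "r \<otimes> v \<ominus> (r \<otimes> w) \<otimes> y \<in> genideal R S"
      by (simp add: a_minus_def r_distr r_minus m_assoc)
    then show ?thesis by auto
  qed
  have "ideal ?K R"
  proof (rule idealI)
    show "subgroup ?K (add_monoid R)"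
    proof (rule add.subgroupI)
      have "\<zero> \<ominus> \<zero> \<otimes> y \<in> genideal R S" by (simp add: a_minus_def)
      then have "\<zero> \<in> ?K" by blast
      then show "?K \<noteq> {}" by blast
      show "\<ominus> v \<in> ?K" if "v \<in> ?K" for v
        using mult [OF that, of "\<ominus> \<one>"] that by (simp add: l_minus)
      show "v \<oplus> v' \<in> ?K" if v: "v \<in> ?K" and v': "v' \<in> ?K" for v v'
      proof -
        obtain w where [simp]: "w \<in> carrier R" "v \<in> carrier R" and w: "v \<ominus> w \<otimes> y \<in> genideal R S"
          using v by blast
        obtain w' where [simp]: "w' \<in> carrier R" "v' \<in> carrier R" and w': "v' \<ominus> w' \<otimes> y \<in> genideal R S"
          using v' by blast
        have "(v \<ominus> w \<otimes> y) \<oplus> (v' \<ominus> w' \<otimes> y) \<in> genideal R S"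
          using w w' by (rule I.a_closed)
        moreover have "(v \<ominus> w \<otimes> y) \<oplus> (v' \<ominus> w' \<otimes> y) = (v \<oplus> v') \<ominus> (w \<oplus> w') \<otimes> y"
          by (simp add: a_minus_def l_distr minus_add a_ac)
        ultimately show ?thesis by auto
      qed
    qed auto
    show "r \<otimes> v \<in> ?K" if "v \<in> ?K" "r \<in> carrier R" for v r
      using that by (rule mult)
    then show "v \<otimes> r \<in> ?K" if "v \<in> ?K" "r \<in> carrier R" for v r
      using that m_comm [of v r] by simp
  qed (rule ring_axioms)
  moreover have "insert y S \<subseteq> ?K"
  proof
    fix v assume "v \<in> insert y S"
    then show "v \<in> ?K"
    proof
      assume [simp]: "v = y"
      have "y \<ominus> \<one> \<otimes> y \<in> genideal R S" by (simp add: a_minus_def r_neg)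
      then have "\<exists>w\<in>carrier R. y \<ominus> w \<otimes> y \<in> genideal R S" by (rule bexI) simp
      then show ?thesis by simp
    next
      assume v: "v \<in> S"
      then have [simp]: "v \<in> carrier R" using S by blast
      have "v \<in> genideal R S" using genideal_self [OF S] v by blast
      then have "v \<ominus> \<zero> \<otimes> y \<in> genideal R S" by (simp add: a_minus_def)
      then have "\<exists>w\<in>carrier R. v \<ominus> w \<otimes> y \<in> genideal R S" by (rule bexI) simp
      then show ?thesis by simp
    qed
  qed
  ultimately have "genideal R (insert y S) \<subseteq> ?K" by (rule genideal_minimal)
  then show ?thesis using v by blast
qed

text \<open>
  The hypothesis \<open>inv\<close> replaces the condition that \<open>M\<close> lies in the Jacobson radical modulo \<open>S\<close>.
\<close>

lemma (in cring) nakayama_insert: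
  assumes M: "ideal M R" and S: "S \<subseteq> carrier R" and y: "y \<in> M"
    and inv: "\<And>w. w \<in> M \<Longrightarrow> \<exists>i\<in>carrier R. (\<one> \<ominus> w) \<otimes> i \<ominus> \<one> \<in> genideal R S"
    and gen: "M \<subseteq> genideal R (insert y S)"
    and sq: "\<And>f. f \<in> M \<Longrightarrow> \<exists>z\<in>ideal_prod R M M. f \<ominus> z \<in> genideal R S"
  shows "M \<subseteq> genideal R S"
proof -
  interpret M: ideal M R by fact
  interpret I: ideal "genideal R S" R by (rule genideal_ideal [OF S])
  have MR: "f \<in> carrier R" if "f \<in> M" for f using that M.a_subset by blast
  have y' [simp]: "y \<in> carrier R" using y by (rule MR)
  \<comment> \<open>Only the second factor of a product is expanded in \<open>y\<close>; the first
    one then puts the coefficient of \<open>y\<close> into \<open>M\<close>.\<close>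
  have prod: "z \<in> carrier R \<and> (\<exists>w\<in>M. z \<ominus> w \<otimes> y \<in> genideal R S)" if "z \<in> ideal_prod R M M" for z
    using that
  proof (induction rule: ideal_prod.induct)
    case (prod i j)
    then have [simp]: "i \<in> carrier R" "j \<in> carrier R" by (auto intro: MR)
    obtain w where [simp]: "w \<in> carrier R" and w: "j \<ominus> w \<otimes> y \<in> genideal R S"
      using genideal_insert [OF S y', of j] prod gen by blast
    have "i \<otimes> (j \<ominus> w \<otimes> y) \<in> genideal R S" using w by (rule I.I_l_closed) simp
    then have "i \<otimes> j \<ominus> (i \<otimes> w) \<otimes> y \<in> genideal R S"
      by (simp add: a_minus_def r_distr r_minus m_assoc)
    moreover have "i \<otimes> w \<in> M" using prod(1) by (rule M.I_r_closed) simp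
    ultimately show ?case by auto
  next
    case (sum s1 s2)
    then obtain w w' where w: "w \<in> M" "s1 \<ominus> w \<otimes> y \<in> genideal R S" and w': "w' \<in> M" "s2 \<ominus> w' \<otimes> y \<in> genideal R S"
      by blast
    have [simp]: "w \<in> carrier R" "w' \<in> carrier R" "s1 \<in> carrier R" "s2 \<in> carrier R"
      using w w' sum MR by auto
    have "(s1 \<ominus> w \<otimes> y) \<oplus> (s2 \<ominus> w' \<otimes> y) \<in> genideal R S"
      using w(2) w'(2) by (rule I.a_closed)
    moreover have "(s1 \<ominus> w \<otimes> y) \<oplus> (s2 \<ominus> w' \<otimes> y) = (s1 \<oplus> s2) \<ominus> (w \<oplus> w') \<otimes> y"
      by (simp add: a_minus_def l_distr minus_add a_ac)
    moreover have "w \<oplus> w' \<in> M" using w(1) w'(1) by (rule M.a_closed)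
    ultimately show ?case by auto
  qed
  obtain z where z: "z \<in> ideal_prod R M M" "y \<ominus> z \<in> genideal R S" using sq [OF y] by blast
  obtain w where w: "w \<in> M" "z \<ominus> w \<otimes> y \<in> genideal R S" and [simp]: "z \<in> carrier R" using prod [OF z(1)] by blast
  have [simp]: "w \<in> carrier R" using w(1) by (rule MR)
  obtain i where [simp]: "i \<in> carrier R" and i: "(\<one> \<ominus> w) \<otimes> i \<ominus> \<one> \<in> genideal R S" using inv [OF w(1)] by blast
  have "(y \<ominus> z) \<oplus> (z \<ominus> w \<otimes> y) \<in> genideal R S" using z(2) w(2) by (rule I.a_closed)
  moreover have "(y \<ominus> z) \<oplus> (z \<ominus> w \<otimes> y) = (\<one> \<ominus> w) \<otimes> y"
  proof -
    have "(y \<ominus> z) \<oplus> (z \<ominus> w \<otimes> y) = y \<ominus> w \<otimes> y"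
      by (simp add: a_minus_def a_assoc) (simp add: a_assoc [symmetric] l_neg)
    then show ?thesis by (simp add: a_minus_def l_distr l_minus)
  qed
  ultimately have "(\<one> \<ominus> w) \<otimes> y \<in> genideal R S" by simp
  then have "i \<otimes> ((\<one> \<ominus> w) \<otimes> y) \<in> genideal R S" by (rule I.I_l_closed) simp
  moreover have "y \<otimes> ((\<one> \<ominus> w) \<otimes> i \<ominus> \<one>) \<in> genideal R S" using i by (rule I.I_l_closed) simp
  \<comment> \<open>\<open>(1 - w) * y\<close> lies in the ideal of \<open>S\<close>, and
    \<open>i\<close> inverts \<open>1 - w\<close> modulo it; the difference of the two elements is
    \<open>y\<close> itself.\<close>
  ultimately have "i \<otimes> ((\<one> \<ominus> w) \<otimes> y) \<ominus> y \<otimes> ((\<one> \<ominus> w) \<otimes> i \<ominus> \<one>) \<in> genideal R S"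
    unfolding a_minus_def by (intro I.a_closed I.a_inv_closed)
  moreover have "i \<otimes> ((\<one> \<ominus> w) \<otimes> y) \<ominus> y \<otimes> ((\<one> \<ominus> w) \<otimes> i \<ominus> \<one>) = y"
  proof -
    define s where "s = y \<otimes> ((\<one> \<ominus> w) \<otimes> i)"
    have s [simp]: "s \<in> carrier R" by (simp add: s_def)
    have "i \<otimes> ((\<one> \<ominus> w) \<otimes> y) = s" by (simp add: s_def m_ac)
    moreover have "y \<otimes> ((\<one> \<ominus> w) \<otimes> i \<ominus> \<one>) = s \<ominus> y"
      by (simp add: s_def a_minus_def r_distr r_minus)
    moreover have "s \<ominus> (s \<ominus> y) = y"
      by (simp add: a_minus_def minus_add a_assoc [symmetric] r_neg)
    ultimately show ?thesis by simp
  qed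
  ultimately have "y \<in> genideal R S" by simp
  then have "insert y S \<subseteq> genideal R S" using genideal_self [OF S] by blast
  then have "genideal R (insert y S) \<subseteq> genideal R S"
    by (intro genideal_minimal I.is_ideal)
  then show ?thesis using gen by blast
qed

text \<open>The generators in \<open>F\<close> are discarded one at a time; at each step those still
  present are added to \<open>S\<close>, which preserves the hypotheses because the ideal only
  grows.\<close>

lemma (in cring) nakayama:
  assumes F: "finite F" and M: "ideal M R" and S: "S \<subseteq> carrier R" and FM: "F \<subseteq> M"
    and inv: "\<And>w. w \<in> M \<Longrightarrow> \<exists>i\<in>carrier R. (\<one> \<ominus> w) \<otimes> i \<ominus> \<one> \<in> genideal R S"
    and gen: "M \<subseteq> genideal R (F \<union> S)"
    and sq: "\<And>f. f \<in> M \<Longrightarrow> \<exists>z\<in>ideal_prod R M M. f \<ominus> z \<in> genideal R S"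
  shows "M \<subseteq> genideal R S"
  using F FM gen
proof (induction F rule: finite_induct)
  case (insert y F)
  interpret M: ideal M R by fact
  have FS: "F \<union> S \<subseteq> carrier R" using insert.prems(1) S M.a_subset by blast
  have "S \<subseteq> genideal R (F \<union> S)" using genideal_self [OF FS] by blast
  then have mono: "genideal R S \<subseteq> genideal R (F \<union> S)"
    by (intro genideal_minimal genideal_ideal FS)
  have "M \<subseteq> genideal R (F \<union> S)"
  proof (rule nakayama_insert [OF M FS])
    show "y \<in> M" using insert.prems by blast
    show "M \<subseteq> genideal R (insert y (F \<union> S))" using insert.prems by simp
  qed (use inv sq mono in blast)+
  then show ?case using insert by blast
qed simp

section \<open>Local parameters generate the ideal of a smooth point\<close>

context char_p_variety
begin

text \<open>Finite type provides algebra generators only over the members of some cover. On such a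
  \<open>U\<close> the ideal of \<open>x\<close> is generated by the differences
  \<open>b - b(x)\<close>, and these are moved to \<open>V\<close> modulo \<open>J\<close>, where
  the two section rings have the same quotient.\<close>

lemma rational_closed_fg:
  assumes J: "fat_point e x J" and V: "affine_open X V" and xV [simp]: "x \<in> V"
  shows "\<exists>F. finite F \<and> F \<subseteq> vanishing_at X V x \<and> vanishing_at X V x \<subseteq> genideal (\<O> V) (F \<union> J V)"
proof -
  have oV [simp]: "opn V" using V by (rule affine_open_opn)
  have rat: "rational_point x" by (rule fat_rational [OF J])
  have "x \<in> topspace (sp X)" using rat by (simp add: rational_point_def)
  then obtain U where U: "affine_open X U" and xU [simp]: "x \<in> U"
    and fg: "\<exists>B. finite B \<and> B \<subseteq> carrier (\<O> U) \<and> carrier (\<O> U) = generate_ring (\<O> U) (range (cst X U) \<union> B)"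
    using variety unfolding variety_def finite_type_def by blast
  have oU [simp]: "opn U" using U by (rule affine_open_opn)
  obtain B where B: "finite B" "B \<subseteq> carrier (\<O> U)" "carrier (\<O> U) = generate_ring (\<O> U) (range (cst X U) \<union> B)"
    using fg by blast
  let ?W = "U \<inter> V" and ?m = "vanishing_at X V x"
  have W [simp]: "opn ?W" "x \<in> ?W" "?W \<subseteq> U" "?W \<subseteq> V" by (simp_all add: openin_Int)
  interpret U: cring "\<O> U" by (rule cringO) simp
  interpret V: cring "\<O> V" by (rule cringO) simp
  interpret W: cring "\<O> ?W" by (rule cringO) simp
  interpret MU: primeideal "vanishing_at X U x" "\<O> U" by (rule vanishing_prime) simp_all
  interpret JW: ideal "J ?W" "\<O> ?W" by (rule sheaf_ideal [OF fat_sheaf [OF J]]) simp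
  interpret JV: ideal "J V" "\<O> V" by (rule sheaf_ideal [OF fat_sheaf [OF J]]) simp
  have "\<forall>b. \<exists>c. b \<in> B \<longrightarrow> cg (\<O> U) (vanishing_at X U x) b (cst X U c)"
    using rat B(2) unfolding rational_point_def by (meson oU subsetD xU)
  then obtain v where v: "\<And>b. b \<in> B \<Longrightarrow> b \<ominus>\<^bsub>\<O> U\<^esub> cst X U (v b) \<in> vanishing_at X U x"
    unfolding cg_def by metis
  let ?g = "\<lambda>b. b \<ominus>\<^bsub>\<O> U\<^esub> cst X U (v b)"
  have gU: "?g ` B \<subseteq> carrier (\<O> U)" using v vanishing_carrier by blast
  define N where "N = genideal (\<O> U) (?g ` B)"
  interpret N: ideal N "\<O> U" unfolding N_def by (rule U.genideal_ideal [OF gU])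
  have Nm: "N \<subseteq> vanishing_at X U x"
    unfolding N_def using v by (intro U.genideal_minimal MU.is_ideal) blast
  have NB: "?g b \<in> N" if "b \<in> B" for b
    using U.genideal_self [OF gU] that unfolding N_def by blast
  \<comment> \<open>Modulo all \<open>b - b(x)\<close> every algebra generator is constant, hence so
    is every section over \<open>U\<close>. A section vanishing at \<open>x\<close> is then
    congruent to 0, so \<open>N\<close> is the whole ideal of \<open>x\<close>.\<close>
  have resN: "f \<in> carrier (\<O> U) \<and> (\<exists>c. cg (\<O> U) N f (cst X U c))"
    if "f \<in> generate_ring (\<O> U) (range (cst X U) \<union> B)" for f
    using that
  proof (induction rule: generate_ring.induct)
    case one
    have "cg (\<O> U) N \<one>\<^bsub>\<O> U\<^esub> (cst X U 1)" by (simp add: cst_one N.cg_refl)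
    then show ?case by auto
  next
    case (incl h)
    then show ?case
    proof
      assume "h \<in> range (cst X U)"
      then obtain c where "h = cst X U c" by blast
      then show ?thesis using N.cg_refl [of h] by auto
    next
      assume "h \<in> B"
      then show ?thesis using NB [of h] B(2) by (auto simp: cg_def)
    qed
  next
    case (a_inv h)
    then obtain c where [simp]: "h \<in> carrier (\<O> U)" and c: "cg (\<O> U) N h (cst X U c)" by blast
    have "cg (\<O> U) N (\<zero>\<^bsub>\<O> U\<^esub> \<ominus>\<^bsub>\<O> U\<^esub> h) (\<zero>\<^bsub>\<O> U\<^esub> \<ominus>\<^bsub>\<O> U\<^esub> cst X U c)"
      by (intro N.cg_minus N.cg_refl c) simp
    then have "cg (\<O> U) N (\<ominus>\<^bsub>\<O> U\<^esub> h) (cst X U (- c))"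
      by (simp add: a_minus_def cst_neg)
    then show ?case by auto
  next
    case (eng_add f g)
    then obtain c d where "cg (\<O> U) N f (cst X U c)" "cg (\<O> U) N g (cst X U d)" by blast
    then have "cg (\<O> U) N (f \<oplus>\<^bsub>\<O> U\<^esub> g) (cst X U (c + d))"
      using N.cg_add by (simp add: cst_add)
    then show ?case using eng_add by auto
  next
    case (eng_mult f g)
    then obtain c d where "cg (\<O> U) N f (cst X U c)" "cg (\<O> U) N g (cst X U d)" by blast
    then have "cg (\<O> U) N (f \<otimes>\<^bsub>\<O> U\<^esub> g) (cst X U (c * d))"
      using N.cg_mult by (simp add: cst_mult)
    then show ?case using eng_mult by auto
  qed
  have mN: "f \<in> N" if f: "f \<in> vanishing_at X U x" for f
  proof -
    have fU: "f \<in> carrier (\<O> U)" using f vanishing_carrier by blast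
    then obtain c where c: "cg (\<O> U) N f (cst X U c)" using resN B(3) by blast
    then have "cg (\<O> U) (vanishing_at X U x) f (cst X U c)" using Nm by (auto simp: cg_def)
    then have "c = 0" using MU.cg_mem f by (auto simp: vanishing_cst)
    then show ?thesis using c N.mem_iff_cg_zero fU by (simp add: cst_zero)
  qed
  have tr: "\<exists>a\<in>carrier (\<O> V). cg (\<O> ?W) (J ?W) (res X U ?W f) (res X V ?W a)" if "f \<in> carrier (\<O> U)" for f
    using fat_surj [OF J V W(1,2,4), of "res X U ?W f"] that by simp
  have "\<forall>b. \<exists>a. b \<in> B \<longrightarrow> a \<in> carrier (\<O> V) \<and> cg (\<O> ?W) (J ?W) (res X U ?W (?g b)) (res X V ?W a)"
  proof (intro allI)
    fix b
    show "\<exists>a. b \<in> B \<longrightarrow> a \<in> carrier (\<O> V) \<and> cg (\<O> ?W) (J ?W) (res X U ?W (?g b)) (res X V ?W a)"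
    proof (cases "b \<in> B")
      case True
      then have "?g b \<in> carrier (\<O> U)" using gU by blast
      from tr [OF this] show ?thesis by blast
    qed simp
  qed
  then obtain y where y: "\<And>b. b \<in> B \<Longrightarrow> y b \<in> carrier (\<O> V)"
    "\<And>b. b \<in> B \<Longrightarrow> cg (\<O> ?W) (J ?W) (res X U ?W (?g b)) (res X V ?W (y b))"
    by metis
  have vW: "cg (\<O> ?W) (vanishing_at X ?W x) f g" if "cg (\<O> ?W) (J ?W) f g" for f g
    using that fat_vanishing [OF J W(1,2)] by (auto simp: cg_def)
  interpret MW: primeideal "vanishing_at X ?W x" "\<O> ?W" by (rule vanishing_prime) simp_all
  have ym: "y ` B \<subseteq> ?m"
  proof safe
    fix b assume b: "b \<in> B"
    have "res X U ?W (?g b) \<in> vanishing_at X ?W x"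
      using v [OF b] gU b by (subst vanishing_res) auto
    then have "res X V ?W (y b) \<in> vanishing_at X ?W x"
      using MW.cg_mem [OF vW [OF y(2) [OF b]]] by simp
    then show "y b \<in> ?m" using y(1) [OF b] by (simp add: vanishing_res)
  qed
  let ?S = "y ` B \<union> J V"
  have SV: "?S \<subseteq> carrier (\<O> V)" using y(1) JV.a_subset by blast
  define N' where "N' = genideal (\<O> V) ?S"
  interpret N': ideal N' "\<O> V" unfolding N'_def by (rule V.genideal_ideal [OF SV])
  have SN: "?S \<subseteq> N'" using V.genideal_self [OF SV] unfolding N'_def .
  \<comment> \<open>The sections over \<open>U\<close> that match an element of \<open>N'\<close>
    modulo \<open>J\<close> on the overlap. As an ideal containing all \<open>b - b(x)\<close>, it
    contains every section vanishing at \<open>x\<close>.\<close>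
  define K where "K = {g \<in> carrier (\<O> U). \<exists>f\<in>N'. cg (\<O> ?W) (J ?W) (res X U ?W g) (res X V ?W f)}"
  have N'V: "f \<in> carrier (\<O> V)" if "f \<in> N'" for f using that N'.a_subset by blast
  have Kmult: "r \<otimes>\<^bsub>\<O> U\<^esub> g \<in> K" if g: "g \<in> K" and r [simp]: "r \<in> carrier (\<O> U)" for r g
  proof -
    obtain f where f: "f \<in> N'" "cg (\<O> ?W) (J ?W) (res X U ?W g) (res X V ?W f)" and [simp]: "g \<in> carrier (\<O> U)"
      using g by (auto simp: K_def)
    obtain a where a: "a \<in> carrier (\<O> V)" "cg (\<O> ?W) (J ?W) (res X U ?W r) (res X V ?W a)" using tr [OF r] by blast
    have "cg (\<O> ?W) (J ?W) (res X U ?W r \<otimes>\<^bsub>\<O> ?W\<^esub> res X U ?W g) (res X V ?W a \<otimes>\<^bsub>\<O> ?W\<^esub> res X V ?W f)"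
      by (intro JW.cg_mult a f)
    then have "cg (\<O> ?W) (J ?W) (res X U ?W (r \<otimes>\<^bsub>\<O> U\<^esub> g)) (res X V ?W (a \<otimes>\<^bsub>\<O> V\<^esub> f))"
      using a f N'V by simp
    moreover have "a \<otimes>\<^bsub>\<O> V\<^esub> f \<in> N'" using f(1) a(1) by (rule N'.I_l_closed)
    ultimately show ?thesis by (auto simp: K_def)
  qed
  have "ideal K (\<O> U)"
  proof (rule idealI)
    show "subgroup K (add_monoid (\<O> U))"
    proof (rule U.add.subgroupI)
      have "cg (\<O> ?W) (J ?W) (res X U ?W \<zero>\<^bsub>\<O> U\<^esub>) (res X V ?W \<zero>\<^bsub>\<O> V\<^esub>)"
        using JW.cg_refl by simp
      then have "\<zero>\<^bsub>\<O> U\<^esub> \<in> K" using N'.zero_closed unfolding K_def by blast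
      then show "K \<noteq> {}" by blast
      show "K \<subseteq> carrier (\<O> U)" by (auto simp: K_def)
      show "\<ominus>\<^bsub>\<O> U\<^esub> g \<in> K" if "g \<in> K" for g
      proof -
        have "g \<in> carrier (\<O> U)" using that by (simp add: K_def)
        then show ?thesis
          using Kmult [OF that, of "\<ominus>\<^bsub>\<O> U\<^esub> \<one>\<^bsub>\<O> U\<^esub>"] by (simp add: U.l_minus)
      qed
      show "g \<oplus>\<^bsub>\<O> U\<^esub> g' \<in> K" if g: "g \<in> K" and g': "g' \<in> K" for g g'
      proof -
        obtain f where f: "f \<in> N'" "cg (\<O> ?W) (J ?W) (res X U ?W g) (res X V ?W f)" and [simp]: "g \<in> carrier (\<O> U)"
          using g by (auto simp: K_def)
        obtain f' where f': "f' \<in> N'" "cg (\<O> ?W) (J ?W) (res X U ?W g') (res X V ?W f')" and [simp]: "g' \<in> carrier (\<O> U)"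
          using g' by (auto simp: K_def)
        have "cg (\<O> ?W) (J ?W) (res X U ?W g \<oplus>\<^bsub>\<O> ?W\<^esub> res X U ?W g') (res X V ?W f \<oplus>\<^bsub>\<O> ?W\<^esub> res X V ?W f')"
          by (intro JW.cg_add f f')
        then have "cg (\<O> ?W) (J ?W) (res X U ?W (g \<oplus>\<^bsub>\<O> U\<^esub> g')) (res X V ?W (f \<oplus>\<^bsub>\<O> V\<^esub> f'))"
          using f f' N'V by simp
        moreover have "f \<oplus>\<^bsub>\<O> V\<^esub> f' \<in> N'" using f(1) f'(1) by (rule N'.a_closed)
        ultimately show ?thesis by (auto simp: K_def)
      qed
    qed
    show "r \<otimes>\<^bsub>\<O> U\<^esub> g \<in> K" if "g \<in> K" "r \<in> carrier (\<O> U)" for g r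
      using that by (rule Kmult)
    then show "g \<otimes>\<^bsub>\<O> U\<^esub> r \<in> K" if "g \<in> K" "r \<in> carrier (\<O> U)" for g r
      using that U.m_comm [of g r] by (simp add: K_def)
  qed (rule U.ring_axioms)
  moreover have "?g ` B \<subseteq> K"
  proof safe
    fix b assume b: "b \<in> B"
    then have "y b \<in> N'" "?g b \<in> carrier (\<O> U)" using SN gU by blast+
    then show "?g b \<in> K" using y(2) [OF b] unfolding K_def by blast
  qed
  ultimately have "N \<subseteq> K" unfolding N_def by (rule U.genideal_minimal)
  have "f \<in> N'" if f: "f \<in> ?m" for f
  proof -
    have fV [simp]: "f \<in> carrier (\<O> V)" using f vanishing_carrier by blast
    obtain g where g: "g \<in> carrier (\<O> U)" "cg (\<O> ?W) (J ?W) (res X V ?W f) (res X U ?W g)"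
      using fat_surj [OF J U W(1,2,3), of "res X V ?W f"] by auto
    have "res X V ?W f \<in> vanishing_at X ?W x" using f by (simp add: vanishing_res)
    then have "res X U ?W g \<in> vanishing_at X ?W x" using MW.cg_mem [OF vW [OF g(2)]] by simp
    then have "g \<in> vanishing_at X U x" using g(1) by (simp add: vanishing_res)
    then have "g \<in> K" using mN \<open>N \<subseteq> K\<close> by blast
    then obtain f' where f': "f' \<in> N'" "cg (\<O> ?W) (J ?W) (res X U ?W g) (res X V ?W f')"
      by (auto simp: K_def)
    have "cg (\<O> ?W) (J ?W) (res X V ?W f) (res X V ?W f')" by (rule JW.cg_trans [OF g(2) f'(2)])
    then have "cg (\<O> V) (J V) f f'" using N'V [OF f'(1)] by (subst (asm) fat_cg_res_iff [OF J]) simp_all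
    then have "cg (\<O> V) N' f f'" using SN by (auto simp: cg_def)
    then show ?thesis using N'.cg_mem f'(1) by blast
  qed
  then have "?m \<subseteq> N'" by blast
  then show ?thesis
    using B(1) ym unfolding N'_def by (intro exI [of _ "y ` B"]) simp
qed

lemma lincomb_ideal:
  assumes U: "opn U" and I: "ideal I (\<O> U)" and b: "\<And>i. i < n \<Longrightarrow> b i \<in> I"
  shows "lincomb e U n b c \<in> I"
  using b
proof (induction n)
  interpret I: ideal I "\<O> U" by fact
  interpret U: cring "\<O> U" by (rule cringO [OF U])
  {
    case 0
    show ?case using U I.zero_closed by simp
  next
    case (Suc n)
    have bU: "b i \<in> carrier (\<O> U)" if "i < Suc n" for i
      using Suc.prems [OF that] I.a_subset by blast
    have "cst X U (c n ^ (p ^ e)) \<otimes>\<^bsub>\<O> U\<^esub> b n \<in> I"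
      using Suc.prems [of n] U by (intro I.I_l_closed) simp_all
    moreover have "lincomb e U n b c \<in> I" using Suc by simp
    ultimately show ?case
      using U bU by (simp add: lincomb_Suc I.a_closed)
  }
qed

text \<open>Nakayama's lemma: \<open>t\<close> generates the maximal ideal modulo its square,
  \<open>rational_closed_fg\<close> supplies finite generation modulo \<open>J\<close>, and
  \<open>1 - w\<close> is invertible modulo \<open>J\<close> by \<open>fat_inverse\<close>.\<close>

lemma smooth_generators:
  assumes x: "smooth_point X x" and J: "fat_point e x J" and V: "affine_open X V" and xV [simp]: "x \<in> V"
    and t: "basis_mod X V (vanishing_at X V x)
          (ideal_prod (\<O> V) (vanishing_at X V x) (vanishing_at X V x)) d t"
  shows "vanishing_at X V x \<subseteq> genideal (\<O> V) (t ` {..<d} \<union> J V)"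
proof -
  have oV [simp]: "opn V" using V by (rule affine_open_opn)
  interpret V: cring "\<O> V" by (rule cringO) simp
  interpret M: primeideal "vanishing_at X V x" "\<O> V" by (rule vanishing_prime) simp_all
  interpret JV: ideal "J V" "\<O> V" by (rule sheaf_ideal [OF fat_sheaf [OF J]]) simp
  let ?m = "vanishing_at X V x" and ?S = "t ` {..<d} \<union> J V"
  have tm: "t i \<in> ?m" if "i < d" for i using t that by (simp add: basis_mod_def)
  have tV: "t i \<in> carrier (\<O> V)" if "i < d" for i using tm [OF that] vanishing_carrier by blast
  have SV: "?S \<subseteq> carrier (\<O> V)" using tV JV.a_subset by blast
  note S = V.genideal_self [OF SV]
  interpret G: ideal "genideal (\<O> V) ?S" "\<O> V" by (rule V.genideal_ideal [OF SV])
  obtain F where F: "finite F" "F \<subseteq> ?m" "?m \<subseteq> genideal (\<O> V) (F \<union> J V)"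
    using rational_closed_fg [OF J V xV] by blast
  show ?thesis
  proof (rule V.nakayama [OF F(1) M.is_ideal SV F(2)])
    have FS: "F \<union> ?S \<subseteq> carrier (\<O> V)" using F(2) SV vanishing_carrier by blast
    have "genideal (\<O> V) (F \<union> J V) \<subseteq> genideal (\<O> V) (F \<union> ?S)"
      using V.genideal_self [OF FS] by (intro V.genideal_minimal V.genideal_ideal FS) blast
    then show "?m \<subseteq> genideal (\<O> V) (F \<union> ?S)" using F(3) by blast
  next
    fix w assume w: "w \<in> ?m"
    then have [simp]: "w \<in> carrier (\<O> V)" using vanishing_carrier by blast
    have "\<one>\<^bsub>\<O> V\<^esub> \<ominus>\<^bsub>\<O> V\<^esub> w \<notin> ?m"
    proof
      assume "\<one>\<^bsub>\<O> V\<^esub> \<ominus>\<^bsub>\<O> V\<^esub> w \<in> ?m"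
      then have "(\<one>\<^bsub>\<O> V\<^esub> \<ominus>\<^bsub>\<O> V\<^esub> w) \<oplus>\<^bsub>\<O> V\<^esub> w \<in> ?m" using w by (rule M.a_closed)
      then have "cst X V 1 \<in> ?m" by (simp add: cst_one a_minus_def V.a_assoc V.l_neg)
      then show False by (simp add: vanishing_cst)
    qed
    then show "\<exists>i\<in>carrier (\<O> V). (\<one>\<^bsub>\<O> V\<^esub> \<ominus>\<^bsub>\<O> V\<^esub> w) \<otimes>\<^bsub>\<O> V\<^esub> i \<ominus>\<^bsub>\<O> V\<^esub> \<one>\<^bsub>\<O> V\<^esub> \<in> genideal (\<O> V) ?S"
      using fat_inverse [OF J oV xV, of "\<one>\<^bsub>\<O> V\<^esub> \<ominus>\<^bsub>\<O> V\<^esub> w"] S unfolding cg_def by auto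
  next
    fix f assume f: "f \<in> ?m"
    then have [simp]: "f \<in> carrier (\<O> V)" using vanishing_carrier by blast
    obtain c where "coords X V (ideal_prod (\<O> V) ?m ?m) d t f c"
      using t f unfolding basis_mod_def by blast
    \<comment> \<open>Level 0, because the cotangent space is taken over the constants of
      \<open>X\<close> itself.\<close>
    then have z: "f \<ominus>\<^bsub>\<O> V\<^esub> lincomb 0 V d t c \<in> ideal_prod (\<O> V) ?m ?m"
      by (simp add: coords_def lincomb_def)
    have l: "lincomb 0 V d t c \<in> genideal (\<O> V) ?S"
      using S by (intro lincomb_ideal oV G.is_ideal) blast
    then have [simp]: "lincomb 0 V d t c \<in> carrier (\<O> V)" using G.a_subset by blast
    have "f \<ominus>\<^bsub>\<O> V\<^esub> (f \<ominus>\<^bsub>\<O> V\<^esub> lincomb 0 V d t c) = lincomb 0 V d t c"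
      by (simp add: a_minus_def V.minus_add V.a_assoc [symmetric] V.r_neg)
    then show "\<exists>z\<in>ideal_prod (\<O> V) ?m ?m. f \<ominus>\<^bsub>\<O> V\<^esub> z \<in> genideal (\<O> V) ?S"
      using z l by (intro bexI [of _ "f \<ominus>\<^bsub>\<O> V\<^esub> lincomb 0 V d t c"]) simp_all
  qed
qed

end

lemma (in vector_families) fam_indep_reindex:
  assumes w: "fam_indep J w" and J: "finite J" and I: "finite I" and \<phi>: "inj_on \<phi> I" "\<phi> ` I \<subseteq> J"
  shows "fam_indep I (\<lambda>i. w (\<phi> i))"
proof -
  have w': "inj_on w J" "independent (w ` J)"
    using w J by (simp_all add: fam_indep_iff)
  have "inj_on w (\<phi> ` I)" using w'(1) \<phi>(2) by (rule inj_on_subset)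
  then have "inj_on (w \<circ> \<phi>) I" using \<phi>(1) by (simp add: comp_inj_on)
  moreover have "independent (w ` \<phi> ` I)"
    using w'(2) \<phi>(2) by (meson image_mono independent_mono)
  ultimately show ?thesis
    using I by (simp add: fam_indep_iff image_image o_def)
qed

section \<open>Monomials with exponents below q\<close>

definition explists :: "nat \<Rightarrow> nat \<Rightarrow> nat list set" where
  "explists q d = {a. set a \<subseteq> {..<q} \<and> length a = d}"

lemma finite_explists: "finite (explists q d)"
  unfolding explists_def by (intro finite_lists_length_eq) simp

lemma card_explists: "card (explists q d) = q ^ d"
  unfolding explists_def by (subst card_lists_length_eq) simp_all

context char_p_variety
begin

text \<open>
  The head of the list is the exponent of the variable of highest index.
\<close>

primrec mon :: "'p set \<Rightarrow> (nat \<Rightarrow> 's) \<Rightarrow> nat list \<Rightarrow> 's" where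
  "mon V t [] = \<one>\<^bsub>\<O> V\<^esub>"
| "mon V t (l # a) = t (length a) [^]\<^bsub>\<O> V\<^esub> l \<otimes>\<^bsub>\<O> V\<^esub> mon V t a"

lemma mon_closed:
  assumes V: "opn V" and t: "\<And>i. i < d \<Longrightarrow> t i \<in> carrier (\<O> V)" and "length a \<le> d"
  shows "mon V t a \<in> carrier (\<O> V)"
  using assms(3)
proof (induction a)
  interpret V: cring "\<O> V" by (rule cringO [OF V])
  {
    case Nil
    show ?case by simp
  next
    case (Cons l a)
    then show ?case using t [of "length a"] by simp
  }
qed

lemma mon_frob:
  assumes V: "opn V" and t: "\<And>i. i < d \<Longrightarrow> t i \<in> carrier (\<O> V)" and "length a \<le> d"
  shows "mon V t a [^]\<^bsub>\<O> V\<^esub> m = mon V t (map (times m) a)"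
  using assms(3)
proof (induction a)
  interpret V: cring "\<O> V" by (rule cringO [OF V])
  {
    case Nil
    show ?case by simp
  next
    case (Cons l a)
    then show ?case using t [of "length a"] mon_closed [where d = d and t = t, OF V t, of a]
      by (simp add: V.nat_pow_distrib V.nat_pow_pow mult.commute)
  }
qed

text \<open>
  The sections that are combinations of monomials in \<open>t 0, \<dots>, t (j - 1)\<close> modulo \<open>I\<close> and \<open>t j, \<dots>, t (d - 1)\<close>. As
  \<open>t j ^ q \<in> I\<close>, passing from \<open>j\<close> to \<open>j + 1\<close> only adds the exponents below \<open>q\<close>.
\<close>

inductive_set layer :: "'p set \<Rightarrow> 's set \<Rightarrow> (nat \<Rightarrow> 's) \<Rightarrow> nat \<Rightarrow> nat \<Rightarrow> nat \<Rightarrow> 's set"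
  for V I t d q j where
  ideal: "f \<in> I \<Longrightarrow> f \<in> layer V I t d q j"
| monomial: "a \<in> explists q j \<Longrightarrow> cst X V c \<otimes>\<^bsub>\<O> V\<^esub> mon V t a \<in> layer V I t d q j"
| variable: "j \<le> i \<Longrightarrow> i < d \<Longrightarrow> g \<in> carrier (\<O> V) \<Longrightarrow> t i \<otimes>\<^bsub>\<O> V\<^esub> g \<in> layer V I t d q j"
| sum: "f \<in> layer V I t d q j \<Longrightarrow> g \<in> layer V I t d q j \<Longrightarrow> f \<oplus>\<^bsub>\<O> V\<^esub> g \<in> layer V I t d q j"

context
  fixes V :: "'p set" and I :: "'s set" and t :: "nat \<Rightarrow> 's" and d q :: nat
  assumes V [simp]: "opn V" and I: "ideal I (\<O> V)" and t: "\<And>i. i < d \<Longrightarrow> t i \<in> carrier (\<O> V)"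
    and tq: "\<And>i. i < d \<Longrightarrow> t i [^]\<^bsub>\<O> V\<^esub> q \<in> I"
begin

interpretation V: cring "\<O> V" by (rule cringO) simp
interpretation I: ideal I "\<O> V" by (rule I)

lemma layer_closed: "f \<in> layer V I t d q j \<Longrightarrow> j \<le> d \<Longrightarrow> f \<in> carrier (\<O> V)"
proof (induction rule: layer.induct)
  case (ideal f)
  then show ?case using I.a_subset by blast
next
  case (monomial a c)
  then show ?case using mon_closed [where d = d and t = t, OF V t, of a] by (simp add: explists_def)
next
  case (variable i g)
  then show ?case using t by simp
qed simp

text \<open>Downward induction on \<open>l\<close> puts every multiple of \<open>t j ^ l\<close>
  into the next layer; \<open>l = 0\<close> is the claim. At \<open>l = q\<close> the multiple is in
  \<open>I\<close>. Below that, the cofactor is written in the old layer: its monomials acquire the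
  exponent \<open>l\<close>, and its multiples of \<open>t j\<close> fall under the case
  \<open>Suc l\<close>.\<close>

lemma layer_step:
  assumes j: "j < d" and full: "carrier (\<O> V) \<subseteq> layer V I t d q j"
  shows "carrier (\<O> V) \<subseteq> layer V I t d q (Suc j)"
proof -
  let ?B = "layer V I t d q (Suc j)"
  have tj [simp]: "t j \<in> carrier (\<O> V)" using t j by simp
  have shift: "t j [^]\<^bsub>\<O> V\<^esub> l \<otimes>\<^bsub>\<O> V\<^esub> f \<in> ?B"
    if l: "l < q" and up: "\<And>g. g \<in> carrier (\<O> V) \<Longrightarrow> t j [^]\<^bsub>\<O> V\<^esub> Suc l \<otimes>\<^bsub>\<O> V\<^esub> g \<in> ?B"
      and f: "f \<in> layer V I t d q j" for l f
    using f
  proof (induction rule: layer.induct)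
    case (ideal f)
    then show ?case by (intro layer.ideal I.I_l_closed) simp_all
  next
    case (monomial a c)
    then have a: "length a = j" "mon V t a \<in> carrier (\<O> V)"
      using mon_closed [where d = d and t = t, OF V t, of a] j by (simp_all add: explists_def)
    have "l # a \<in> explists q (Suc j)" using monomial l by (simp add: explists_def)
    then have "cst X V c \<otimes>\<^bsub>\<O> V\<^esub> mon V t (l # a) \<in> ?B" by (rule layer.monomial)
    then show ?case using a by (simp add: V.m_lcomm)
  next
    case (variable i g)
    then have [simp]: "t i \<in> carrier (\<O> V)" "g \<in> carrier (\<O> V)" using t by simp_all
    show ?case
    proof (cases "i = j")
      case True
      then show ?thesis using up [of g] by (simp add: V.m_assoc)
    next
      case False
      then have "t i \<otimes>\<^bsub>\<O> V\<^esub> (t j [^]\<^bsub>\<O> V\<^esub> l \<otimes>\<^bsub>\<O> V\<^esub> g) \<in> ?B"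
        using variable by (intro layer.variable) simp_all
      then show ?thesis by (simp add: V.m_lcomm)
    qed
  next
    case (sum f g)
    then have [simp]: "f \<in> carrier (\<O> V)" "g \<in> carrier (\<O> V)" using layer_closed j by simp_all
    show ?case using layer.sum [OF sum.IH] by (simp add: V.r_distr)
  qed
  have pow: "t j [^]\<^bsub>\<O> V\<^esub> l \<otimes>\<^bsub>\<O> V\<^esub> f \<in> ?B" if "l \<le> q" "f \<in> carrier (\<O> V)" for l f
    using that
  proof (induction l arbitrary: f rule: inc_induct)
    case base
    then show ?case using tq [OF j] by (intro layer.ideal I.I_r_closed)
  next
    case (step l)
    show ?case
    proof (rule shift)
      show "l < q" using step.hyps by simp
      show "t j [^]\<^bsub>\<O> V\<^esub> Suc l \<otimes>\<^bsub>\<O> V\<^esub> g \<in> ?B" if "g \<in> carrier (\<O> V)" for g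
        using that by (rule step.IH)
      show "f \<in> layer V I t d q j" using full step.prems by blast
    qed
  qed
  show ?thesis
    using pow [of 0] by auto
qed

text \<open>Layer 0 contains the constants and the ideal of \<open>t\<close> and \<open>I\<close>,
  so by \<open>gen\<close> it is everything; in layer \<open>d\<close> only \<open>I\<close> and
  monomials are left. \<open>S\<close> is kept general, to be either the preimage of a span or the
  set of sections with an expansion.\<close>

lemma monomials_span:
  assumes gen: "\<And>f. f \<in> carrier (\<O> V) \<Longrightarrow> \<exists>c. f \<ominus>\<^bsub>\<O> V\<^esub> cst X V c \<in> genideal (\<O> V) (t ` {..<d} \<union> I)"
    and IS: "I \<subseteq> S" and mS: "\<And>c a. a \<in> explists q d \<Longrightarrow> cst X V c \<otimes>\<^bsub>\<O> V\<^esub> mon V t a \<in> S"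
    and addS: "\<And>f g. f \<in> S \<Longrightarrow> g \<in> S \<Longrightarrow> f \<oplus>\<^bsub>\<O> V\<^esub> g \<in> S"
  shows "carrier (\<O> V) \<subseteq> S"
proof -
  let ?B = "layer V I t d q 0" and ?G = "t ` {..<d} \<union> I"
  have GV: "?G \<subseteq> carrier (\<O> V)" using t I.a_subset by auto
  let ?K = "{f \<in> carrier (\<O> V). \<forall>g\<in>carrier (\<O> V). g \<otimes>\<^bsub>\<O> V\<^esub> f \<in> ?B}"
  have mult: "r \<otimes>\<^bsub>\<O> V\<^esub> f \<in> ?K" if "f \<in> ?K" "r \<in> carrier (\<O> V)" for f r
  proof -
    have "g \<otimes>\<^bsub>\<O> V\<^esub> (r \<otimes>\<^bsub>\<O> V\<^esub> f) \<in> ?B" if "g \<in> carrier (\<O> V)" for g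
    proof -
      have "(g \<otimes>\<^bsub>\<O> V\<^esub> r) \<otimes>\<^bsub>\<O> V\<^esub> f \<in> ?B" using \<open>f \<in> ?K\<close> \<open>r \<in> carrier (\<O> V)\<close> that by simp
      then show ?thesis using \<open>f \<in> ?K\<close> \<open>r \<in> carrier (\<O> V)\<close> that by (simp add: V.m_assoc)
    qed
    then show ?thesis using that by simp
  qed
  have "ideal ?K (\<O> V)"
  proof (rule idealI)
    show "subgroup ?K (add_monoid (\<O> V))"
    proof (rule V.add.subgroupI)
      have "\<zero>\<^bsub>\<O> V\<^esub> \<in> ?K" using I.zero_closed by (auto intro: layer.ideal)
      then show "?K \<noteq> {}" by blast
      show "\<ominus>\<^bsub>\<O> V\<^esub> f \<in> ?K" if "f \<in> ?K" for f
        using mult [OF that, of "\<ominus>\<^bsub>\<O> V\<^esub> \<one>\<^bsub>\<O> V\<^esub>"] that by (simp add: V.l_minus)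
    qed (auto simp: V.r_distr intro: layer.sum)
    show "r \<otimes>\<^bsub>\<O> V\<^esub> f \<in> ?K" if "f \<in> ?K" "r \<in> carrier (\<O> V)" for f r
      using that by (rule mult)
    then show "f \<otimes>\<^bsub>\<O> V\<^esub> r \<in> ?K" if "f \<in> ?K" "r \<in> carrier (\<O> V)" for f r
      using that V.m_comm [of f r] by simp
  qed (rule V.ring_axioms)
  moreover have "?G \<subseteq> ?K"
  proof
    fix f assume f: "f \<in> ?G"
    then have [simp]: "f \<in> carrier (\<O> V)" using GV by blast
    have "g \<otimes>\<^bsub>\<O> V\<^esub> f \<in> ?B" if [simp]: "g \<in> carrier (\<O> V)" for g
      using f
    proof
      assume "f \<in> I"
      then show ?thesis by (intro layer.ideal I.I_l_closed) simp_all
    next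
      assume "f \<in> t ` {..<d}"
      then obtain i where i: "i < d" "f = t i" by auto
      then have "t i \<otimes>\<^bsub>\<O> V\<^esub> g \<in> ?B" by (intro layer.variable) simp_all
      then show ?thesis using i t by (simp add: V.m_comm)
    qed
    then show "f \<in> ?K" by simp
  qed
  ultimately have GK: "genideal (\<O> V) ?G \<subseteq> ?K" by (rule V.genideal_minimal)
  have "carrier (\<O> V) \<subseteq> ?B"
  proof
    fix f assume f [simp]: "f \<in> carrier (\<O> V)"
    obtain c where "f \<ominus>\<^bsub>\<O> V\<^esub> cst X V c \<in> ?K" using gen [OF f] GK by blast
    then have "\<one>\<^bsub>\<O> V\<^esub> \<otimes>\<^bsub>\<O> V\<^esub> (f \<ominus>\<^bsub>\<O> V\<^esub> cst X V c) \<in> ?B" by blast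
    then have "f \<ominus>\<^bsub>\<O> V\<^esub> cst X V c \<in> ?B" by simp
    moreover have "cst X V c \<otimes>\<^bsub>\<O> V\<^esub> mon V t [] \<in> ?B"
      by (intro layer.monomial) (simp add: explists_def)
    ultimately have "(f \<ominus>\<^bsub>\<O> V\<^esub> cst X V c) \<oplus>\<^bsub>\<O> V\<^esub> cst X V c \<in> ?B"
      using layer.sum by fastforce
    then show "f \<in> ?B" by (simp add: a_minus_def V.a_assoc V.l_neg)
  qed
  then have "j \<le> d \<Longrightarrow> carrier (\<O> V) \<subseteq> layer V I t d q j" for j
  proof (induction j)
    case (Suc j)
    then show ?case by (intro layer_step) simp_all
  qed
  then have "carrier (\<O> V) \<subseteq> layer V I t d q d" by simp
  moreover have "f \<in> S" if "f \<in> layer V I t d q d" for f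
    using that
  proof (induction rule: layer.induct)
    case (ideal f)
    then show ?case using IS by blast
  qed (simp_all add: mS addS)
  ultimately show ?thesis by blast
qed

end

text \<open>\<open>V\<close> and \<open>t\<close> are chosen before \<open>e\<close>, so the
  monomials of consecutive levels are formed from the same parameters and can be compared.\<close>

lemma smooth_span:
  assumes x: "smooth_point X x" "rational_point x"
  obtains V t where "affine_open X V" "x \<in> V" "\<And>i. i < dimension X \<Longrightarrow> t i \<in> carrier (\<O> V)"
    "\<And>e S. frob_fiber p X e x V \<subseteq> S \<Longrightarrow>
      (\<And>c a. a \<in> explists (p ^ e) (dimension X) \<Longrightarrow> cst X V c \<otimes>\<^bsub>\<O> V\<^esub> mon V t a \<in> S) \<Longrightarrow>
      (\<And>f g. f \<in> S \<Longrightarrow> g \<in> S \<Longrightarrow> f \<oplus>\<^bsub>\<O> V\<^esub> g \<in> S) \<Longrightarrow> carrier (\<O> V) \<subseteq> S"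
proof -
  obtain V t where V: "affine_open X V" and xV [simp]: "x \<in> V"
    and t: "basis_mod X V (vanishing_at X V x)
          (ideal_prod (\<O> V) (vanishing_at X V x) (vanishing_at X V x)) (dimension X) t"
    and cl: "closed_point X x"
    using x(1) unfolding smooth_point_def by blast
  have oV [simp]: "opn V" using V by (rule affine_open_opn)
  have tm: "t i \<in> vanishing_at X V x" if "i < dimension X" for i using t that by (simp add: basis_mod_def)
  have tV: "t i \<in> carrier (\<O> V)" if "i < dimension X" for i using tm [OF that] vanishing_carrier by blast
  have sp: "carrier (\<O> V) \<subseteq> S" if FS: "frob_fiber p X e x V \<subseteq> S"
    and mS: "\<And>c a. a \<in> explists (p ^ e) (dimension X) \<Longrightarrow> cst X V c \<otimes>\<^bsub>\<O> V\<^esub> mon V t a \<in> S"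
    and addS: "\<And>f g. f \<in> S \<Longrightarrow> g \<in> S \<Longrightarrow> f \<oplus>\<^bsub>\<O> V\<^esub> g \<in> S" for e S
  proof -
    have J: "fat_point e x (frob_fiber p X e x)" by (rule fiber_fat [OF cl x(2)])
    have gen: "\<exists>c. f \<ominus>\<^bsub>\<O> V\<^esub> cst X V c \<in> genideal (\<O> V) (t ` {..<dimension X} \<union> frob_fiber p X e x V)"
      if f: "f \<in> carrier (\<O> V)" for f
    proof -
      obtain c where "cg (\<O> V) (vanishing_at X V x) f (cst X V c)"
        using x(2) f oV xV unfolding rational_point_def by blast
      then show ?thesis
        using smooth_generators [OF x(1) J V xV t] by (auto simp: cg_def)
    qed
    show ?thesis
      by (rule monomials_span [OF oV sheaf_ideal [OF fiber_sheaf oV] tV _ gen FS mS addS])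
         (use fat_pow [OF J oV xV] tm in auto)
  qed
  show thesis by (rule that [OF V xV tV sp])
qed

lemma kmap_mon_span:
  assumes V [simp]: "opn V" and \<kappa>: "kmap e V I \<kappa>" and t: "\<And>i. i < d \<Longrightarrow> t i \<in> carrier (\<O> V)"
    and F: "F \<subseteq> I" "F \<subseteq> carrier (\<O> V)"
    and span: "\<And>S. F \<subseteq> S \<Longrightarrow>
      (\<And>c a. a \<in> explists (p ^ e) d \<Longrightarrow> cst X V c \<otimes>\<^bsub>\<O> V\<^esub> mon V t a \<in> S) \<Longrightarrow>
      (\<And>f g. f \<in> S \<Longrightarrow> g \<in> S \<Longrightarrow> f \<oplus>\<^bsub>\<O> V\<^esub> g \<in> S) \<Longrightarrow> carrier (\<O> V) \<subseteq> S"
  shows "\<kappa> ` carrier (\<O> V) \<subseteq> cs.span ((\<lambda>a. \<kappa> (mon V t a)) ` explists (p ^ e) d)"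
proof -
  interpret V: cring "\<O> V" by (rule cringO) simp
  let ?sp = "cs.span ((\<lambda>a. \<kappa> (mon V t a)) ` explists (p ^ e) d)"
  have "carrier (\<O> V) \<subseteq> {f \<in> carrier (\<O> V). \<kappa> f \<in> ?sp}"
  proof (rule span)
    show "F \<subseteq> {f \<in> carrier (\<O> V). \<kappa> f \<in> ?sp}"
    proof
      fix f assume "f \<in> F"
      then have f: "f \<in> carrier (\<O> V)" "f \<in> I" using F by auto
      then have "\<kappa> f = 0" using kmap_ker [OF V \<kappa>] by blast
      then show "f \<in> {f \<in> carrier (\<O> V). \<kappa> f \<in> ?sp}" using f by (simp add: cs.span_zero)
    qed
    show "cst X V c \<otimes>\<^bsub>\<O> V\<^esub> mon V t a \<in> {f \<in> carrier (\<O> V). \<kappa> f \<in> ?sp}" if a: "a \<in> explists (p ^ e) d" for c a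
    proof -
      have m: "mon V t a \<in> carrier (\<O> V)"
        using a mon_closed [where d = d and t = t, OF V t, of a] by (simp add: explists_def)
      \<comment> \<open>Passing from scalars of \<open>X\<close> to those of the root of level
        \<open>e\<close> takes a \<open>p ^ e\<close>-th root, which exists as \<open>k\<close> is
        algebraically closed.\<close>
      obtain c' where "c' ^ (p ^ e) = c" using nth_root_exists [of "p ^ e" c] p_pos by auto
      then have "\<kappa> (cst X V c \<otimes>\<^bsub>\<O> V\<^esub> mon V t a) = coord_scale c' (\<kappa> (mon V t a))"
        using kmap_scale [OF V \<kappa> m, of c'] by simp
      moreover have "\<kappa> (mon V t a) \<in> ?sp" using a by (intro cs.span_base) blast
      ultimately show ?thesis using m by (simp add: cs.span_scale)
    qed
    show "f \<oplus>\<^bsub>\<O> V\<^esub> g \<in> {f \<in> carrier (\<O> V). \<kappa> f \<in> ?sp}"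
      if "f \<in> {f \<in> carrier (\<O> V). \<kappa> f \<in> ?sp}" "g \<in> {f \<in> carrier (\<O> V). \<kappa> f \<in> ?sp}" for f g
      using that by (simp add: kmap_add [OF V \<kappa>] cs.span_add)
  qed
  then show ?thesis by blast
qed

end

section \<open>Lengths of fibres and uniqueness over smooth points\<close>

context F_pure_variety
begin

text \<open>
  At level \<open>e + 1\<close> the \<open>p ^ ((e + 1) * dimension X)\<close> monomials span a space of that dimension, so they are independent. The
  \<open>p\<close>-th powers of the monomials at level \<open>e\<close> are among them.
\<close>

lemma smooth_fiber_length:
  assumes x: "smooth_point X x" and V1: "affine_open X V1" and V2: "affine_open X V2"
    and ch1: "frob_fiber p X (e + 1) x \<in> hilb_chart (frob_root p X (e + 1)) (len (e + 1)) V1 b1"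
    and ch0: "frob_fiber p X e x \<in> hilb_chart (frob_root p X e) r V2 b0"
  shows "r = len e"
proof -
  have cl: "closed_point X x" using x by (simp add: smooth_point_def)
  have rat: "rational_point x" and x1: "x \<in> V1" using fiber_rational [OF cl V1 ch1] by auto
  have x2: "x \<in> V2" using fiber_rational [OF cl V2 ch0] by auto
  obtain V t where V: "affine_open X V" "x \<in> V" and t: "\<And>i. i < dimension X \<Longrightarrow> t i \<in> carrier (\<O> V)"
    and span: "\<And>e S. frob_fiber p X e x V \<subseteq> S \<Longrightarrow>
      (\<And>c a. a \<in> explists (p ^ e) (dimension X) \<Longrightarrow> cst X V c \<otimes>\<^bsub>\<O> V\<^esub> mon V t a \<in> S) \<Longrightarrow>
      (\<And>f g. f \<in> S \<Longrightarrow> g \<in> S \<Longrightarrow> f \<oplus>\<^bsub>\<O> V\<^esub> g \<in> S) \<Longrightarrow> carrier (\<O> V) \<subseteq> S"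
    using smooth_span [OF x rat] by metis
  have oV [simp]: "opn V" using V(1) by (rule affine_open_opn)
  interpret V: cring "\<O> V" by (rule cringO) simp
  have sub: "frob_fiber p X e x V \<subseteq> carrier (\<O> V)" for e
    by (rule sheaf_carrier [OF fiber_sheaf oV])
  let ?J1 = "frob_fiber p X (e + 1) x" and ?J0 = "frob_fiber p X e x"
  let ?L1 = "explists (p ^ (e + 1)) (dimension X)" and ?L0 = "explists (p ^ e) (dimension X)"
  have f1: "fat_point (e + 1) x ?J1" and f0: "fat_point e x ?J0"
    using fiber_fat [OF cl rat] by blast+
  have bm: "basis_mod (frob_root p X (e + 1)) V1 (carrier (\<O> V1)) (?J1 V1) (len (e + 1)) b1"
    "basis_mod (frob_root p X e) V2 (carrier (\<O> V2)) (?J0 V2) r b0"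
    using ch1 ch0 by (simp_all only: mem_chart)
  obtain K1 where K1: "\<And>U. opn U \<Longrightarrow> x \<in> U \<Longrightarrow> kmap (e + 1) U (?J1 U) (K1 U)"
    "\<And>U. affine_open X U \<Longrightarrow> x \<in> U \<Longrightarrow> K1 U ` carrier (\<O> U) = coord_space (len (e + 1))"
    using fat_kmap [OF f1 V1 x1 bm(1)] by metis
  obtain K0 where K0: "\<And>U. opn U \<Longrightarrow> x \<in> U \<Longrightarrow> kmap e U (?J0 U) (K0 U)"
    "\<And>U. affine_open X U \<Longrightarrow> x \<in> U \<Longrightarrow> K0 U ` carrier (\<O> U) = coord_space r"
    using fat_kmap [OF f0 V2 x2 bm(2)] by metis
  note \<kappa>1 = K1(1) [OF oV V(2)] and im1 = K1(2) [OF V]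
  note \<kappa>0 = K0(1) [OF oV V(2)] and im0 = K0(2) [OF V]
  have card1: "card ?L1 = len (e + 1)" and card0: "card ?L0 = len e"
    by (simp_all only: card_explists power_mult)
  have monV: "mon V t a \<in> carrier (\<O> V)" if "length a = dimension X" for a
    using mon_closed [where d = "dimension X" and t = t, OF oV t, of a] that by simp
  have L1V: "mon V t a \<in> carrier (\<O> V)" if "a \<in> ?L1" for a using that monV by (simp add: explists_def)
  have L0V: "mon V t a \<in> carrier (\<O> V)" if "a \<in> ?L0" for a using that monV by (simp add: explists_def)
  have "cs.fam_basis (coord_space (len (e + 1))) ?L1 (\<lambda>a. K1 V (mon V t a))"
  proof (rule cs.spanning_fam_basis [OF coord_space_basis])
    show "(\<lambda>a. K1 V (mon V t a)) ` ?L1 \<subseteq> coord_space (len (e + 1))"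
      unfolding im1 [symmetric] using L1V by blast
    show "coord_space (len (e + 1)) \<subseteq> cs.span ((\<lambda>a. K1 V (mon V t a)) ` ?L1)"
      unfolding im1 [symmetric] by (rule kmap_mon_span [OF oV \<kappa>1 t subset_refl sub span])
  qed (simp_all add: finite_explists card1)
  then have ind1: "cs.fam_indep ?L1 (\<lambda>a. K1 V (mon V t a))"
    by (simp add: cs.fam_basis_def)
  obtain en where en: "bij_betw en {..<len e} ?L0"
    using ex_bij_betw_nat_finite [OF finite_explists, of "p ^ e" "dimension X"] card0
    by (auto simp: lessThan_atLeast0)
  let ?b = "\<lambda>i. mon V t (en i)"
  have enL: "en i \<in> ?L0" if "i < len e" for i using bij_betwE [OF en] that by simp
  then have bV: "\<forall>i<len e. ?b i \<in> carrier (\<O> V)" using L0V by blast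
  let ?\<phi> = "\<lambda>i. map (times p) (en i)"
  have \<phi>L: "?\<phi> ` {..<len e} \<subseteq> ?L1"
  proof
    fix a assume "a \<in> ?\<phi> ` {..<len e}"
    then obtain i where i: "i < len e" "a = ?\<phi> i" by auto
    have "p * l < p ^ (e + 1)" if "l < p ^ e" for l using that p_pos by (simp add: power_add)
    then show "a \<in> ?L1" using enL [OF i(1)] i(2) by (auto simp: explists_def)
  qed
  have inj: "inj_on ?\<phi> {..<len e}"
  proof (rule inj_onI)
    fix i j assume ij: "i \<in> {..<len e}" "j \<in> {..<len e}" "?\<phi> i = ?\<phi> j"
    have "inj (times p)" using p_pos by (auto intro: injI)
    then have "en i = en j" using ij(3) by (metis inj_map_eq_map)
    then show "i = j" using bij_betw_imp_inj_on [OF en] ij(1,2) by (auto dest: inj_onD)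
  qed
  have ind2: "cs.fam_indep {..<len e} (\<lambda>i. K1 V (mon V t (?\<phi> i)))"
    using cs.fam_indep_reindex [OF ind1 finite_explists _ inj \<phi>L] by simp
  \<comment> \<open>By \<open>frob_image_fiber\<close> the \<open>p\<close>-th power of a relation
    modulo the lower fibre is a relation with the same coefficients modulo the upper one, between
    monomials already known to be independent.\<close>
  have "cs.fam_indep {..<len e} (\<lambda>i. K0 V (?b i))"
    unfolding cs.fam_indep_def
  proof (intro allI impI)
    fix c assume "(\<Sum>i<len e. coord_scale (c i) (K0 V (?b i))) = 0"
    then have "K0 V (lincomb e V (len e) ?b c) = 0"
      using bV by (simp add: kmap_lincomb [OF oV \<kappa>0])
    then have "lincomb e V (len e) ?b c \<in> ?J0 V"
      using kmap_ker [OF oV \<kappa>0] bV by simp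
    then have "lincomb e V (len e) ?b c \<in> frob_image p X 1 ?J1 V"
      by (simp only: frob_image_fiber)
    then have "lincomb (e + 1) V (len e) (\<lambda>i. ?b i [^]\<^bsub>\<O> V\<^esub> p) c \<in> ?J1 V"
      by (simp only: frob_image_1 [OF oV] lincomb_frob [OF oV bV])
    also have "lincomb (e + 1) V (len e) (\<lambda>i. ?b i [^]\<^bsub>\<O> V\<^esub> p) c = lincomb (e + 1) V (len e) (\<lambda>i. mon V t (?\<phi> i)) c"
      using enL \<phi>L L1V mon_frob [where d = "dimension X" and t = t, OF oV t]
      by (intro lincomb_cong) (auto simp: explists_def)
    finally have "lincomb (e + 1) V (len e) (\<lambda>i. mon V t (?\<phi> i)) c \<in> ?J1 V" .
    moreover have \<phi>V: "\<forall>i<len e. mon V t (?\<phi> i) \<in> carrier (\<O> V)"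
      using \<phi>L L1V by blast
    ultimately have "K1 V (lincomb (e + 1) V (len e) (\<lambda>i. mon V t (?\<phi> i)) c) = 0"
      using kmap_ker [OF oV \<kappa>1] by simp
    then have "(\<Sum>i<len e. coord_scale (c i) (K1 V (mon V t (?\<phi> i)))) = 0"
      using \<phi>V by (simp add: kmap_lincomb [OF oV \<kappa>1])
    then show "\<forall>i\<in>{..<len e}. c i = 0"
      using ind2 unfolding cs.fam_indep_def by blast
  qed
  moreover have "(\<lambda>i. K0 V (?b i)) ` {..<len e} \<subseteq> coord_space r"
    unfolding im0 [symmetric] using bV by blast
  moreover have "coord_space r \<subseteq> cs.span ((\<lambda>i. K0 V (?b i)) ` {..<len e})"
  proof -
    have "(\<lambda>i. K0 V (?b i)) ` {..<len e} = (\<lambda>a. K0 V (mon V t a)) ` ?L0"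
      using bij_betw_imp_surj_on [OF en] by (metis (no_types, lifting) image_cong image_image)
    then show ?thesis
      unfolding im0 [symmetric] using kmap_mon_span [OF oV \<kappa>0 t subset_refl sub span] by simp
  qed
  ultimately have "cs.fam_basis (coord_space r) {..<len e} (\<lambda>i. K0 V (?b i))"
    by (simp add: cs.fam_basis_def)
  then show ?thesis
    using cs.fam_basis_card [OF coord_space_basis, of r "{..<len e}"] by fastforce
qed

lemma lincomb_single:
  assumes V [simp]: "opn V" and b: "\<forall>i<n. b i \<in> carrier (\<O> V)" and i: "i < n"
  shows "lincomb e V n b (\<lambda>j. if j = i then c else 0) = cst X V (c ^ (p ^ e)) \<otimes>\<^bsub>\<O> V\<^esub> b i"
proof -
  interpret V: cring "\<O> V" by (rule cringO) simp
  have "lincomb e V n b (\<lambda>j. if j = i then c else 0) =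
      (\<Oplus>\<^bsub>\<O> V\<^esub>j\<in>{..<n}. if i = j then cst X V (c ^ (p ^ e)) \<otimes>\<^bsub>\<O> V\<^esub> b j else \<zero>\<^bsub>\<O> V\<^esub>)"
    unfolding lincomb_def using b p_pos
    by (intro V.finsum_cong') (auto simp: zero_power cst_zero)
  also have "\<dots> = cst X V (c ^ (p ^ e)) \<otimes>\<^bsub>\<O> V\<^esub> b i"
    using b i by (intro V.add.finprod_singleton) auto
  finally show ?thesis .
qed

text \<open>\<open>J\<close> contains the fibre by \<open>fiber_minimal\<close>, and the monomials
  span modulo the fibre. Their number is the length of \<open>J\<close>, so they are independent
  modulo \<open>J\<close>; expanding an element of \<open>J\<close> modulo the fibre then gives only
  zero coefficients.\<close>

lemma FB_over_smooth:
  assumes J: "J \<in> FB e" and fat: "fat_point e x J" and x: "smooth_point X x"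
  shows "J = frob_fiber p X e x"
proof -
  let ?F = "frob_fiber p X e x" and ?L = "explists (p ^ e) (dimension X)"
  have cl: "closed_point X x" using x by (simp add: smooth_point_def)
  have rat: "rational_point x" by (rule fat_rational [OF fat])
  have fF: "fat_point e x ?F" by (rule fiber_fat [OF cl rat])
  obtain V1 b1 where V1: "affine_open X V1" and ch: "J \<in> hilb_chart (frob_root p X e) (len e) V1 b1"
    using FB_chart [OF J] by blast
  have x1: "x \<in> V1" using fat_in_chart [OF fat affine_open_opn [OF V1]] ch by (simp add: mem_chart)
  have bm: "basis_mod (frob_root p X e) V1 (carrier (\<O> V1)) (J V1) (len e) b1"
    using ch by (simp only: mem_chart)
  obtain K where K: "\<And>U. opn U \<Longrightarrow> x \<in> U \<Longrightarrow> kmap e U (J U) (K U)"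
    "\<And>U. affine_open X U \<Longrightarrow> x \<in> U \<Longrightarrow> K U ` carrier (\<O> U) = coord_space (len e)"
    using fat_kmap [OF fat V1 x1 bm] by metis
  obtain V t where V: "affine_open X V" "x \<in> V" and t: "\<And>i. i < dimension X \<Longrightarrow> t i \<in> carrier (\<O> V)"
    and span: "\<And>e S. frob_fiber p X e x V \<subseteq> S \<Longrightarrow>
      (\<And>c a. a \<in> explists (p ^ e) (dimension X) \<Longrightarrow> cst X V c \<otimes>\<^bsub>\<O> V\<^esub> mon V t a \<in> S) \<Longrightarrow>
      (\<And>f g. f \<in> S \<Longrightarrow> g \<in> S \<Longrightarrow> f \<oplus>\<^bsub>\<O> V\<^esub> g \<in> S) \<Longrightarrow> carrier (\<O> V) \<subseteq> S"
    using smooth_span [OF x rat] by metis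
  have oV [simp]: "opn V" using V(1) by (rule affine_open_opn)
  have xV [simp]: "x \<in> V" by (rule V(2))
  interpret V: cring "\<O> V" by (rule cringO) simp
  interpret FV: ideal "?F V" "\<O> V" by (rule sheaf_ideal [OF fiber_sheaf oV])
  note \<kappa> = K(1) [OF oV V(2)] and im = K(2) [OF V]
  have card: "card ?L = len e" by (simp only: card_explists power_mult)
  have LV: "mon V t a \<in> carrier (\<O> V)" if "a \<in> ?L" for a
    using that mon_closed [where d = "dimension X" and t = t, OF oV t, of a] by (simp add: explists_def)
  obtain en where en: "bij_betw en {..<len e} ?L"
    using ex_bij_betw_nat_finite [OF finite_explists, of "p ^ e" "dimension X"] card
    by (auto simp: lessThan_atLeast0)
  let ?b = "\<lambda>i. mon V t (en i)"
  have bV: "\<forall>i<len e. ?b i \<in> carrier (\<O> V)" using bij_betwE [OF en] LV by simp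
  have "cs.fam_basis (coord_space (len e)) {..<len e} (\<lambda>i. K V (?b i))"
  proof (rule cs.spanning_fam_basis [OF coord_space_basis])
    show "(\<lambda>i. K V (?b i)) ` {..<len e} \<subseteq> coord_space (len e)"
      unfolding im [symmetric] using bV by blast
    have "(\<lambda>i. K V (?b i)) ` {..<len e} = (\<lambda>a. K V (mon V t a)) ` ?L"
      using bij_betw_imp_surj_on [OF en] by (metis (no_types, lifting) image_cong image_image)
    then show "coord_space (len e) \<subseteq> cs.span ((\<lambda>i. K V (?b i)) ` {..<len e})"
      unfolding im [symmetric]
      using kmap_mon_span [OF oV \<kappa> t fiber_minimal [OF fat] FV.a_subset span] by simp
  qed simp_all
  then have indep: "cs.fam_indep {..<len e} (\<lambda>i. K V (?b i))"
    by (simp add: cs.fam_basis_def)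
  have expand: "carrier (\<O> V) \<subseteq> {f \<in> carrier (\<O> V). \<exists>c. cg (\<O> V) (?F V) f (lincomb e V (len e) ?b c)}"
    (is "_ \<subseteq> ?S")
  proof (rule span [of e])
    show "?F V \<subseteq> ?S"
    proof
      fix f assume f: "f \<in> ?F V"
      then have fV: "f \<in> carrier (\<O> V)" using FV.a_subset by blast
      then have "cg (\<O> V) (?F V) f (lincomb e V (len e) ?b (\<lambda>_. 0))"
        using f bV FV.mem_iff_cg_zero [OF fV] by (simp add: lincomb_zero)
      then show "f \<in> ?S" using fV by blast
    qed
    show "cst X V c \<otimes>\<^bsub>\<O> V\<^esub> mon V t a \<in> ?S" if a: "a \<in> ?L" for c a
    proof -
      obtain c' where c': "c' ^ (p ^ e) = c" using nth_root_exists [of "p ^ e" c] p_pos by auto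
      obtain i where i: "i < len e" "a = en i"
        using a bij_betw_imp_surj_on [OF en] by (metis imageE lessThan_iff)
      have "lincomb e V (len e) ?b (\<lambda>j. if j = i then c' else 0) = cst X V c \<otimes>\<^bsub>\<O> V\<^esub> mon V t a"
        using lincomb_single [OF oV bV i(1), of e c'] c' i(2) by simp
      then have "cg (\<O> V) (?F V) (cst X V c \<otimes>\<^bsub>\<O> V\<^esub> mon V t a) (lincomb e V (len e) ?b (\<lambda>j. if j = i then c' else 0))"
        using LV [OF a] by (simp add: FV.cg_refl)
      then show ?thesis using LV [OF a] by auto
    qed
    show "f \<oplus>\<^bsub>\<O> V\<^esub> g \<in> ?S" if f: "f \<in> ?S" and g: "g \<in> ?S" for f g
    proof -
      obtain c d where "cg (\<O> V) (?F V) f (lincomb e V (len e) ?b c)" "cg (\<O> V) (?F V) g (lincomb e V (len e) ?b d)"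
        using f g by blast
      then have "cg (\<O> V) (?F V) (f \<oplus>\<^bsub>\<O> V\<^esub> g) (lincomb e V (len e) ?b (\<lambda>i. c i + d i))"
        using FV.cg_add bV by (simp add: lincomb_add)
      then show ?thesis using f g by auto
    qed
  qed
  have JV: "a \<in> ?F V" if a: "a \<in> J V" for a
  proof -
    have aV: "a \<in> carrier (\<O> V)" using a sheaf_carrier [OF fat_sheaf [OF fat] oV] by blast
    then obtain c where c: "cg (\<O> V) (?F V) a (lincomb e V (len e) ?b c)" using expand by blast
    have "cg (\<O> V) (J V) a (lincomb e V (len e) ?b c)"
      using c fiber_minimal [OF fat, of V] by (auto simp: cg_def)
    then have "K V (lincomb e V (len e) ?b c) = 0"
      using kmap_cg_iff [OF oV \<kappa>] kmap_ker [OF oV \<kappa> aV] a bV aV by simp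
    then have "(\<Sum>i<len e. coord_scale (c i) (K V (?b i))) = 0"
      using bV by (simp add: kmap_lincomb [OF oV \<kappa>])
    then have "c i = 0" if "i < len e" for i
      using cs.fam_indepD [OF indep] that by blast
    then have "lincomb e V (len e) ?b c = lincomb e V 0 ?b c"
      using bV by (intro lincomb_truncate) auto
    then show ?thesis using c FV.mem_iff_cg_zero [OF aV] by simp
  qed
  show ?thesis
  proof (rule ext, rule equalityI)
    fix U
    show "?F U \<subseteq> J U" by (rule fiber_minimal [OF fat])
    show "J U \<subseteq> ?F U"
    proof (cases "opn U")
      case False
      then have "J U = {}" using ch by (simp add: mem_chart closed_subscheme_def)
      then show ?thesis by simp
    next
      case oU [simp]: True
      show ?thesis
      proof
        fix f assume f: "f \<in> J U"
        then have fU [simp]: "f \<in> carrier (\<O> U)" using sheaf_carrier [OF fat_sheaf [OF fat] oU] by blast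
        show "f \<in> ?F U"
        proof (cases "x \<in> U")
          case False
          then show ?thesis using fat_off [OF fF oU] by simp
        next
          case True
          let ?W = "U \<inter> V"
          have W [simp]: "opn ?W" "x \<in> ?W" "?W \<subseteq> U" "?W \<subseteq> V" using True by (simp_all add: openin_Int)
          interpret FW: ideal "?F ?W" "\<O> ?W" by (rule sheaf_ideal [OF fiber_sheaf W(1)])
          interpret JW: ideal "J ?W" "\<O> ?W" by (rule sheaf_ideal [OF fat_sheaf [OF fat] W(1)])
          obtain a where a: "a \<in> carrier (\<O> V)" "cg (\<O> ?W) (?F ?W) (res X U ?W f) (res X V ?W a)"
            using fat_surj [OF fF V(1) W(1,2,4), of "res X U ?W f"] by auto
          have "cg (\<O> ?W) (J ?W) (res X U ?W f) (res X V ?W a)"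
            using a(2) fiber_minimal [OF fat, of ?W] by (auto simp: cg_def)
          then have "res X V ?W a \<in> J ?W"
            using JW.cg_mem sheaf_res [OF fat_sheaf [OF fat] oU W(1,3) f] by blast
          then have "a \<in> J V" using a(1) True by (subst (asm) fat_res_iff [OF fat]) simp_all
          then have "res X V ?W a \<in> ?F ?W"
            by (intro sheaf_res [OF fiber_sheaf] JV) simp_all
          then have "res X U ?W f \<in> ?F ?W" using FW.cg_mem [OF a(2)] by blast
          then show ?thesis using True by (subst (asm) fat_res_iff [OF fF]) simp_all
        qed
      qed
    qed
  qed
qed

section \<open>The morphism between F-blowups\<close>

text \<open>The coordinates of \<open>g ^ p\<close> modulo \<open>J\<close> form a linear map in
  \<open>g\<close> whose kernel is the image of \<open>J\<close>, so the quotient by the image is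
  finite-dimensional. The dimension \<open>r\<close> is left open until
  \<open>frob_image_length\<close>.\<close>

lemma frob_image_ex_chart:
  assumes J: "J \<in> hilb_chart (frob_root p X (e + 1)) n V b" and fat: "fat_point (e + 1) x J"
    and V: "opn V" and xV: "x \<in> V"
  shows "\<exists>r bb. frob_image p X 1 J \<in> hilb_chart (frob_root p X e) r V bb"
proof -
  note oV [simp] = V
  interpret V: cring "\<O> V" by (rule cringO) simp
  let ?I = "frob_image p X 1 J V"
  note \<kappa> = chart_kmap(1) [OF oV J]
  define \<kappa>' where "\<kappa>' g = crd (e + 1) n V b J (g [^]\<^bsub>\<O> V\<^esub> p)" for g
  have \<kappa>': "kmap e V ?I \<kappa>'"
    unfolding kmap_def
  proof (intro conjI ballI allI)
    fix f g assume "f \<in> carrier (\<O> V)" "g \<in> carrier (\<O> V)"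
    then show "\<kappa>' (f \<oplus>\<^bsub>\<O> V\<^esub> g) = \<kappa>' f + \<kappa>' g"
      using frob_add [OF oV, of f g 1] kmap_add [OF oV \<kappa>] by (simp add: \<kappa>'_def)
  next
    fix c f assume f: "f \<in> carrier (\<O> V)"
    have "(cst X V (c ^ (p ^ e)) \<otimes>\<^bsub>\<O> V\<^esub> f) [^]\<^bsub>\<O> V\<^esub> p
        = cst X V (c ^ (p ^ (e + 1))) \<otimes>\<^bsub>\<O> V\<^esub> f [^]\<^bsub>\<O> V\<^esub> p"
      using f by (simp add: frob_mult cst_pow [symmetric] power_mult [symmetric] power_add)
    then show "\<kappa>' (cst X V (c ^ (p ^ e)) \<otimes>\<^bsub>\<O> V\<^esub> f) = coord_scale c (\<kappa>' f)"
      using f kmap_scale [OF oV \<kappa>] by (simp add: \<kappa>'_def)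
  next
    fix f assume "f \<in> carrier (\<O> V)"
    then show "\<kappa>' f = 0 \<longleftrightarrow> f \<in> ?I"
      using kmap_ker [OF oV \<kappa>] by (simp add: \<kappa>'_def frob_image_1)
  qed
  have "\<kappa>' ` carrier (\<O> V) \<subseteq> coord_space n"
    unfolding chart_kmap(2) [OF oV J, symmetric] \<kappa>'_def by (intro image_subsetI imageI) simp
  then obtain r and u :: "nat \<Rightarrow> nat \<Rightarrow> 'k" where u: "cs.fam_basis (\<kappa>' ` carrier (\<O> V)) {..<r} u"
    by (rule cs.subspace_has_fam_basis [OF coord_space_basis kmap_subspace [OF oV \<kappa>']])
  have "\<forall>i. \<exists>g. i < r \<longrightarrow> g \<in> carrier (\<O> V) \<and> u i = \<kappa>' g"
    using u unfolding cs.fam_basis_def by blast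
  then obtain bb where bb: "\<And>i. i < r \<Longrightarrow> bb i \<in> carrier (\<O> V)" "\<And>i. i < r \<Longrightarrow> u i = \<kappa>' (bb i)"
    by metis
  have "(\<lambda>i. \<kappa>' (bb i)) ` {..<r} = u ` {..<r}"
    using bb(2) by (intro image_cong) simp_all
  then have "cs.fam_basis (\<kappa>' ` carrier (\<O> V)) {..<r} (\<lambda>i. \<kappa>' (bb i))"
    using u bb(2) by (simp add: cs.fam_basis_def cs.fam_indep_def)
  moreover have "\<forall>i<r. bb i \<in> carrier (\<O> V)" using bb(1) by blast
  ultimately have "basis_mod (frob_root p X e) V (carrier (\<O> V)) ?I r bb"
    by (simp only: kmap_basis_mod [OF oV \<kappa>'])
  moreover have "closed_subscheme X (frob_image p X 1 J)"
    using J frob_image_closed_subscheme by (simp only: mem_chart)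
  moreover have "supported_in X V (frob_image p X 1 J)"
    by (rule fat_supported [OF frob_image_fat [OF fat] xV])
  ultimately show ?thesis unfolding mem_chart by blast
qed

text \<open>The local form of the morphism. Around a given \<open>J\<close> the adapted chart and
  the nonvanishing of one chart function \<open>u\<close> describe a neighbourhood on which the
  image stays in its chart, with the same \<open>r\<close>, and chart functions pull back to chart
  functions.\<close>

lemma frob_image_local:
  assumes J: "J \<in> FB (e + 1)" and V: "affine_open X V"
    and ch: "frob_image p X 1 J \<in> hilb_chart (frob_root p X e) r V bb"
  obtains bn u where "J \<in> hilb_chart (frob_root p X (e + 1)) (len (e + 1)) V bn"
    "u \<in> chart_functions (frob_root p X (e + 1)) (len (e + 1)) V bn" "u J \<noteq> 0"
    "\<And>J'. J' \<in> FB (e + 1) \<Longrightarrow> J' \<in> hilb_chart (frob_root p X (e + 1)) (len (e + 1)) V bn \<Longrightarrow> u J' \<noteq> 0 \<Longrightarrow>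
      frob_image p X 1 J' \<in> hilb_chart (frob_root p X e) r V bb"
    "\<And>h. h \<in> chart_functions (frob_root p X e) r V bb \<Longrightarrow>
      \<exists>h'\<in>chart_functions (frob_root p X (e + 1)) (len (e + 1)) V bn. \<forall>J'\<in>FB (e + 1).
        J' \<in> hilb_chart (frob_root p X (e + 1)) (len (e + 1)) V bn \<longrightarrow> u J' \<noteq> 0 \<longrightarrow> h (frob_image p X 1 J') = h' J'"
proof -
  let ?Y = "frob_root p X (e + 1)" and ?n = "len (e + 1)" and ?q = "p ^ (e + 1)"
  have oV [simp]: "opn V" using V by (rule affine_open_opn)
  interpret V: cring "\<O> V" by (rule cringO) simp
  obtain V0 b0 where "affine_open X V0" "J \<in> hilb_chart ?Y ?n V0 b0"
    using FB_chart [OF J] by blast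
  then obtain x where fat: "fat_point (e + 1) x J" using FB_fat [OF J] by blast
  have "supported_in X V (frob_image p X 1 J)" using ch by (simp only: mem_chart)
  then have xV: "x \<in> V" by (rule fat_in_chart [OF frob_image_fat [OF fat] oV])
  have bb: "basis_mod (frob_root p X e) V (carrier (\<O> V)) (frob_image p X 1 J V) r bb"
    using ch by (simp only: mem_chart)
  then have bbV: "\<forall>i<r. bb i \<in> carrier (\<O> V)" by (simp add: basis_mod_def)
  obtain h D U \<sigma> bn where sp: "splitting U \<sigma>" and h: "h \<in> carrier (\<O> V)" and D: "D = nonvan X V h"
    and xD: "x \<in> D" and DU: "D \<subseteq> U" and rn: "r \<le> ?n" and bn1: "\<And>i. i < r \<Longrightarrow> bn i = bb i [^]\<^bsub>\<O> V\<^esub> p"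
    and bn2: "\<And>i. r \<le> i \<Longrightarrow> i < ?n \<Longrightarrow> eps \<sigma> D (res X V D (bn i)) = \<zero>\<^bsub>\<O> D\<^esub>"
    and chn: "J \<in> hilb_chart ?Y ?n V bn"
    by (rule adapted_basis [OF J fat V xV bb]) (rule that)
  have hq: "h [^]\<^bsub>\<O> V\<^esub> ?q \<in> carrier (\<O> V)" using h by simp
  have "h \<notin> vanishing_at X V x" using xD by (simp add: D vanishing_at_def)
  then have "h [^]\<^bsub>\<O> V\<^esub> ?q \<notin> J V" using fat_pow_iff [OF fat oV xV h] by blast
  then obtain j where j: "j < ?n" "crd (e + 1) ?n V bn J (h [^]\<^bsub>\<O> V\<^esub> ?q) j \<noteq> 0"
    using chart_coords_nonzero [OF oV chn hq] by blast
  \<comment> \<open>Where this coordinate is nonzero, \<open>h ^ ?q\<close> is not in the ideal, so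
    \<open>h\<close> does not vanish at the support. The support then lies in \<open>D\<close>, as
    \<open>adapted_coords\<close> requires.\<close>
  define u where "u J = crd (e + 1) ?n V bn J (h [^]\<^bsub>\<O> V\<^esub> ?q) j" for J
  have u: "u \<in> chart_functions ?Y ?n V bn"
    unfolding u_def using hq j(1) by (rule crd_chart_function)
  have near: "\<exists>x'. fat_point (e + 1) x' J' \<and> x' \<in> D"
    if J': "J' \<in> FB (e + 1)" "J' \<in> hilb_chart ?Y ?n V bn" "u J' \<noteq> 0" for J'
  proof -
    obtain x' where x': "x' \<in> V" "fat_point (e + 1) x' J'" using FB_fat [OF J'(1) V J'(2)] by blast
    have "h [^]\<^bsub>\<O> V\<^esub> ?q \<notin> J' V"
    proof
      assume "h [^]\<^bsub>\<O> V\<^esub> ?q \<in> J' V"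
      then have "crd (e + 1) ?n V bn J' (h [^]\<^bsub>\<O> V\<^esub> ?q) = 0"
        using kmap_ker [OF oV chart_kmap(1) [OF oV J'(2)] hq] by blast
      then show False using J'(3) by (simp add: u_def)
    qed
    then have "h \<notin> vanishing_at X V x'" using fat_pow_iff [OF x'(2) oV x'(1) h] by blast
    then show ?thesis using x'(2) h by (auto simp: D vanishing_at_def)
  qed
  have chart: "frob_image p X 1 J' \<in> hilb_chart (frob_root p X e) r V bb"
    and coord: "g \<in> carrier (\<O> V) \<Longrightarrow> crd e r V bb (frob_image p X 1 J') g = crd (e + 1) ?n V bn J' (g [^]\<^bsub>\<O> V\<^esub> p)"
    if J': "J' \<in> FB (e + 1)" "J' \<in> hilb_chart ?Y ?n V bn" "u J' \<noteq> 0" for J' g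
  proof -
    obtain x' where x': "fat_point (e + 1) x' J'" "x' \<in> D" using near [OF J'] by blast
    show "frob_image p X 1 J' \<in> hilb_chart (frob_root p X e) r V bb"
      by (rule adapted_coords(1) [OF J'(1) x'(1) V sp h D x'(2) DU rn bbV bn1 bn2 J'(2)])
    show "g \<in> carrier (\<O> V) \<Longrightarrow> crd e r V bb (frob_image p X 1 J') g = crd (e + 1) ?n V bn J' (g [^]\<^bsub>\<O> V\<^esub> p)"
      by (rule adapted_coords(2) [OF J'(1) x'(1) V sp h D x'(2) DU rn bbV bn1 bn2 J'(2)])
  qed
  \<comment> \<open>Constants, sums and products pull back formally. A coordinate of
    \<open>f\<close> becomes the coordinate of \<open>f ^ p\<close> with the same index, which is
    admissible because \<open>r\<close> is at most the length at level \<open>e + 1\<close>.\<close>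
  have pull: "\<exists>h'\<in>chart_functions ?Y ?n V bn. \<forall>J'\<in>FB (e + 1).
      J' \<in> hilb_chart ?Y ?n V bn \<longrightarrow> u J' \<noteq> 0 \<longrightarrow> h (frob_image p X 1 J') = h' J'"
    if "h \<in> chart_functions (frob_root p X e) r V bb" for h
    using that
  proof (induction rule: chart_functions.induct)
    case (const c)
    show ?case by (rule bexI [OF _ chart_functions.const [of c]]) simp
  next
    case (coeff f i)
    then have f: "f \<in> carrier (\<O> V)" by simp
    then have fp: "f [^]\<^bsub>\<O> V\<^esub> p \<in> carrier (\<O> V)" by simp
    have "(\<lambda>J. crd (e + 1) ?n V bn J (f [^]\<^bsub>\<O> V\<^esub> p) i) \<in> chart_functions ?Y ?n V bn"
      using fp coeff(2) rn by (intro crd_chart_function) simp_all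
    then show ?case
      using coord f unfolding crd_def [symmetric] by (intro bexI) auto
  next
    case (add g k)
    then obtain g' k' where g': "g' \<in> chart_functions ?Y ?n V bn" "\<forall>J'\<in>FB (e + 1).
        J' \<in> hilb_chart ?Y ?n V bn \<longrightarrow> u J' \<noteq> 0 \<longrightarrow> g (frob_image p X 1 J') = g' J'"
      and k': "k' \<in> chart_functions ?Y ?n V bn" "\<forall>J'\<in>FB (e + 1).
        J' \<in> hilb_chart ?Y ?n V bn \<longrightarrow> u J' \<noteq> 0 \<longrightarrow> k (frob_image p X 1 J') = k' J'" by blast
    show ?case
      using g' k' by (intro bexI [OF _ chart_functions.add [OF g'(1) k'(1)]]) simp
  next
    case (mult g k)
    then obtain g' k' where g': "g' \<in> chart_functions ?Y ?n V bn" "\<forall>J'\<in>FB (e + 1).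
        J' \<in> hilb_chart ?Y ?n V bn \<longrightarrow> u J' \<noteq> 0 \<longrightarrow> g (frob_image p X 1 J') = g' J'"
      and k': "k' \<in> chart_functions ?Y ?n V bn" "\<forall>J'\<in>FB (e + 1).
        J' \<in> hilb_chart ?Y ?n V bn \<longrightarrow> u J' \<noteq> 0 \<longrightarrow> k (frob_image p X 1 J') = k' J'" by blast
    show ?case
      using g' k' by (intro bexI [OF _ chart_functions.mult [OF g'(1) k'(1)]]) simp
  qed
  show thesis
    by (rule that [OF chn u _ chart pull]) (use j in \<open>simp_all add: u_def\<close>)
qed

text \<open>The same \<open>r\<close> holds throughout a neighbourhood of \<open>J\<close>, which
  contains a fibre over a smooth point. The image of that fibre is again a fibre, whose length is
  known.\<close>

lemma frob_image_length:
  assumes J: "J \<in> FB (e + 1)" and V: "affine_open X V"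
    and ch: "frob_image p X 1 J \<in> hilb_chart (frob_root p X e) r V bb"
  shows "r = len e"
proof -
  obtain bn u where chn: "J \<in> hilb_chart (frob_root p X (e + 1)) (len (e + 1)) V bn"
    and u: "u \<in> chart_functions (frob_root p X (e + 1)) (len (e + 1)) V bn" "u J \<noteq> 0"
    and near: "\<And>J'. J' \<in> FB (e + 1) \<Longrightarrow> J' \<in> hilb_chart (frob_root p X (e + 1)) (len (e + 1)) V bn \<Longrightarrow> u J' \<noteq> 0 \<Longrightarrow>
      frob_image p X 1 J' \<in> hilb_chart (frob_root p X e) r V bb"
    by (rule frob_image_local [OF J V ch]) blast
  obtain x where x: "smooth_point X x"
    "frob_fiber p X (e + 1) x \<in> hilb_chart (frob_root p X (e + 1)) (len (e + 1)) V bn"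
    "frob_fiber p X (e + 1) x \<in> FB (e + 1)" "u (frob_fiber p X (e + 1) x) \<noteq> 0"
    using FB_density [OF J V chn u] by blast
  have "frob_fiber p X e x \<in> hilb_chart (frob_root p X e) r V bb"
    using near [OF x(3,2,4)] by (simp only: frob_image_fiber)
  then show ?thesis
    by (rule smooth_fiber_length [OF x(1) V V x(2)])
qed

lemma frob_image_chart:
  assumes J: "J \<in> FB (e + 1)"
  shows "\<exists>V bb. affine_open X V \<and> frob_image p X 1 J \<in> hilb_chart (frob_root p X e) (len e) V bb"
proof -
  obtain V b where V: "affine_open X V" and ch: "J \<in> hilb_chart (frob_root p X (e + 1)) (len (e + 1)) V b"
    using FB_chart [OF J] by blast
  obtain x where x: "x \<in> V" "fat_point (e + 1) x J" using FB_fat [OF J V ch] by blast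
  obtain r bb where "frob_image p X 1 J \<in> hilb_chart (frob_root p X e) r V bb"
    using frob_image_ex_chart [OF ch x(2) affine_open_opn [OF V] x(1)] by blast
  then show ?thesis using frob_image_length [OF J V] V by blast
qed

text \<open>Continuity relative to the F-blowup, checked on the generating sets of the topology:
  there the condition that \<open>h\<close> is nonzero at the image pulls back to the condition that
  \<open>h'\<close> is nonzero, wherever \<open>u\<close> is nonzero too.\<close>

lemma frob_image_open:
  assumes T: "openin (Hilb e) T" and J: "J \<in> FB (e + 1)" "frob_image p X 1 J \<in> T"
  shows "\<exists>T'. openin (Hilb (e + 1)) T' \<and> J \<in> T' \<and> (\<forall>J'\<in>FB (e + 1) \<inter> T'. frob_image p X 1 J' \<in> T)"
proof -
  let ?S = "{{I \<in> hilb_chart (frob_root p X e) (len e) V b. h I \<noteq> 0} | V b h.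
           affine_open (frob_root p X e) V \<and> h \<in> chart_functions (frob_root p X e) (len e) V b}"
  have "generate_topology_on ?S T"
    using T unfolding Hilb_def hilb_red_def by (simp add: openin_topology_generated_by_iff)
  then show ?thesis
    using J
  proof (induction rule: generate_topology_on.induct)
    case (Int A B)
    then obtain A' B' where "openin (Hilb (e + 1)) A'" "J \<in> A'" "\<forall>J'\<in>FB (e + 1) \<inter> A'. frob_image p X 1 J' \<in> A"
      "openin (Hilb (e + 1)) B'" "J \<in> B'" "\<forall>J'\<in>FB (e + 1) \<inter> B'. frob_image p X 1 J' \<in> B" by blast
    then show ?case by (intro exI [of _ "A' \<inter> B'"]) auto
  next
    case (UN \<K>)
    then obtain k where k: "k \<in> \<K>" "frob_image p X 1 J \<in> k" by blast
    obtain T' where "openin (Hilb (e + 1)) T'" "J \<in> T'" "\<forall>J'\<in>FB (e + 1) \<inter> T'. frob_image p X 1 J' \<in> k"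
      using UN.IH [OF k(1) J(1) k(2)] by blast
    then show ?case using k(1) by (intro exI [of _ T']) blast
  next
    case (Basis s)
    then obtain V b h where V: "affine_open X V" and h: "h \<in> chart_functions (frob_root p X e) (len e) V b"
      and s: "s = {I \<in> hilb_chart (frob_root p X e) (len e) V b. h I \<noteq> 0}" by auto
    have ch: "frob_image p X 1 J \<in> hilb_chart (frob_root p X e) (len e) V b" and hJ: "h (frob_image p X 1 J) \<noteq> 0"
      using Basis(3) by (auto simp: s)
    obtain bn u where chn: "J \<in> hilb_chart (frob_root p X (e + 1)) (len (e + 1)) V bn"
      and u: "u \<in> chart_functions (frob_root p X (e + 1)) (len (e + 1)) V bn" "u J \<noteq> 0"
      and near: "\<And>J'. J' \<in> FB (e + 1) \<Longrightarrow> J' \<in> hilb_chart (frob_root p X (e + 1)) (len (e + 1)) V bn \<Longrightarrow> u J' \<noteq> 0 \<Longrightarrow>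
        frob_image p X 1 J' \<in> hilb_chart (frob_root p X e) (len e) V b"
      and pull: "\<And>h. h \<in> chart_functions (frob_root p X e) (len e) V b \<Longrightarrow>
        \<exists>h'\<in>chart_functions (frob_root p X (e + 1)) (len (e + 1)) V bn. \<forall>J'\<in>FB (e + 1).
          J' \<in> hilb_chart (frob_root p X (e + 1)) (len (e + 1)) V bn \<longrightarrow> u J' \<noteq> 0 \<longrightarrow> h (frob_image p X 1 J') = h' J'"
      by (rule frob_image_local [OF Basis(2) V ch]) (rule that)
    obtain h' where h': "h' \<in> chart_functions (frob_root p X (e + 1)) (len (e + 1)) V bn"
      "\<forall>J'\<in>FB (e + 1). J' \<in> hilb_chart (frob_root p X (e + 1)) (len (e + 1)) V bn \<longrightarrow> u J' \<noteq> 0 \<longrightarrow>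
        h (frob_image p X 1 J') = h' J'"
      using pull [OF h] by blast
    let ?T = "{I \<in> hilb_chart (frob_root p X (e + 1)) (len (e + 1)) V bn. h' I * u I \<noteq> 0}"
    have "openin (Hilb (e + 1)) ?T"
      by (rule open_chart_nonzero [OF V chart_functions.mult [OF h'(1) u(1)]])
    moreover have "J \<in> ?T" using chn u(2) h'(2) hJ Basis(2) by auto
    moreover have "frob_image p X 1 J' \<in> s" if "J' \<in> FB (e + 1) \<inter> ?T" for J'
      using that near [of J'] h'(2) by (auto simp: s)
    ultimately show ?case by blast
  qed simp
qed

text \<open>Fibres map to fibres, and continuity carries this to the closure: a neighbourhood of the
  image of \<open>J\<close> pulls back to a neighbourhood of \<open>J\<close>, which meets the
  fibres over smooth points.\<close>

lemma frob_image_FB: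
  assumes J: "J \<in> FB (e + 1)"
  shows "frob_image p X 1 J \<in> FB e"
  unfolding FB_iff in_closure_of
proof (intro conjI allI impI)
  obtain V bb where V: "affine_open X V" and ch: "frob_image p X 1 J \<in> hilb_chart (frob_root p X e) (len e) V bb"
    using frob_image_chart [OF J] by blast
  \<comment> \<open>The constant function 1 makes a whole chart one of the generating open
    sets.\<close>
  have "openin (Hilb e) {I \<in> hilb_chart (frob_root p X e) (len e) V bb. (1::'k) \<noteq> 0}"
    by (rule open_chart_nonzero [OF V chart_functions.const])
  then show "frob_image p X 1 J \<in> topspace (Hilb e)"
    using ch openin_subset by fastforce
  fix T assume T: "frob_image p X 1 J \<in> T \<and> openin (Hilb e) T"
  then obtain T' where T': "openin (Hilb (e + 1)) T'" "J \<in> T'" "\<forall>J'\<in>FB (e + 1) \<inter> T'. frob_image p X 1 J' \<in> T"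
    using frob_image_open [OF _ J] by blast
  obtain x where x: "smooth_point X x" "frob_fiber p X (e + 1) x \<in> T'" "frob_fiber p X (e + 1) x \<in> FB (e + 1)"
    using FB_meets [OF J T'(1,2)] by blast
  then have "frob_image p X 1 (frob_fiber p X (e + 1) x) \<in> T" using T'(3) by blast
  then have "frob_fiber p X e x \<in> T" by (simp only: frob_image_fiber)
  then show "\<exists>y. y \<in> smooth_fibers e \<and> y \<in> T"
    using x(1) by (auto simp: smooth_fibers_def)
qed

lemma FB_subset: "FB e \<subseteq> topspace (Hilb e)"
  using closure_of_subset_topspace [of "Hilb e" "smooth_fibers e"] FB_iff by blast

lemma frob_image_continuous:
  "continuous_map (ztop (F_blowup p X (e + 1))) (ztop (F_blowup p X e)) (frob_image p X 1)"
proof -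
  have top: "topspace (subtopology (Hilb (e + 1)) (FB (e + 1))) = FB (e + 1)"
    using FB_subset by auto
  have "continuous_map (subtopology (Hilb (e + 1)) (FB (e + 1))) (Hilb e) (frob_image p X 1)"
    unfolding continuous_map_def top
  proof (intro conjI allI impI)
    show "frob_image p X 1 \<in> FB (e + 1) \<rightarrow> topspace (Hilb e)"
      using frob_image_FB FB_subset by blast
    fix T assume T: "openin (Hilb e) T"
    show "openin (subtopology (Hilb (e + 1)) (FB (e + 1))) {J \<in> FB (e + 1). frob_image p X 1 J \<in> T}"
    proof (subst openin_subopen, intro ballI)
      fix J assume "J \<in> {J \<in> FB (e + 1). frob_image p X 1 J \<in> T}"
      then obtain T' where "openin (Hilb (e + 1)) T'" "J \<in> T'" "J \<in> FB (e + 1)"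
        "\<forall>J'\<in>FB (e + 1) \<inter> T'. frob_image p X 1 J' \<in> T"
        using frob_image_open [OF T] by blast
      then show "\<exists>T'. openin (subtopology (Hilb (e + 1)) (FB (e + 1))) T' \<and> J \<in> T' \<and>
          T' \<subseteq> {J \<in> FB (e + 1). frob_image p X 1 J \<in> T}"
        by (intro exI [of _ "T' \<inter> FB (e + 1)"]) (auto simp: openin_subtopology)
    qed
  qed
  then show ?thesis
    unfolding ztop_F_blowup continuous_map_in_subtopology top using frob_image_FB by blast
qed

lemma regular_F_blowup:
  "s \<in> regular (F_blowup p X e) W \<longleftrightarrow> (\<forall>z\<in>W. \<exists>U t. openin (Hilb e) U \<and> z \<in> U \<and>
     t \<in> regular (hilb_red (frob_root p X e) (len e)) U \<and> (\<forall>w\<in>U \<inter> W. s w = t w))"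
  by (simp add: F_blowup_def reduced_closure_def Hilb_def)

lemma regular_hilb_red:
  "s \<in> regular (hilb_red (frob_root p X e) n) W \<longleftrightarrow>
    (\<forall>I\<in>W. \<exists>V b g h. affine_open X V \<and> I \<in> hilb_chart (frob_root p X e) n V b \<and>
         g \<in> chart_functions (frob_root p X e) n V b \<and> h \<in> chart_functions (frob_root p X e) n V b \<and> h I \<noteq> 0 \<and>
         (\<forall>J\<in>W \<inter> hilb_chart (frob_root p X e) n V b. h J \<noteq> 0 \<longrightarrow> s J = g J / h J))"
  by (simp add: hilb_red_def)

lemma frob_image_regular:
  assumes s: "s \<in> regular (F_blowup p X e) W"
  shows "s \<circ> frob_image p X 1 \<in> regular (F_blowup p X (e + 1)) {J \<in> FB (e + 1). frob_image p X 1 J \<in> W}"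
  unfolding regular_F_blowup
proof (intro ballI)
  let ?W = "{J \<in> FB (e + 1). frob_image p X 1 J \<in> W}" and ?Y = "frob_root p X (e + 1)" and ?n = "len (e + 1)"
  fix J assume "J \<in> ?W"
  then have J: "J \<in> FB (e + 1)" and JW: "frob_image p X 1 J \<in> W" by auto
  obtain U t where U: "openin (Hilb e) U" "frob_image p X 1 J \<in> U"
    and t: "t \<in> regular (hilb_red (frob_root p X e) (len e)) U" and st: "\<forall>w\<in>U \<inter> W. s w = t w"
    using s JW unfolding regular_F_blowup by blast
  obtain V b g h where V: "affine_open X V" and ch: "frob_image p X 1 J \<in> hilb_chart (frob_root p X e) (len e) V b"
    and g: "g \<in> chart_functions (frob_root p X e) (len e) V b" and h: "h \<in> chart_functions (frob_root p X e) (len e) V b"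
    and hJ: "h (frob_image p X 1 J) \<noteq> 0"
    and tgh: "\<forall>I\<in>U \<inter> hilb_chart (frob_root p X e) (len e) V b. h I \<noteq> 0 \<longrightarrow> t I = g I / h I"
    using t U(2) unfolding regular_hilb_red by blast
  obtain bn u where chn: "J \<in> hilb_chart ?Y ?n V bn"
    and u: "u \<in> chart_functions ?Y ?n V bn" "u J \<noteq> 0"
    and near: "\<And>J'. J' \<in> FB (e + 1) \<Longrightarrow> J' \<in> hilb_chart ?Y ?n V bn \<Longrightarrow> u J' \<noteq> 0 \<Longrightarrow>
      frob_image p X 1 J' \<in> hilb_chart (frob_root p X e) (len e) V b"
    and pull: "\<And>h. h \<in> chart_functions (frob_root p X e) (len e) V b \<Longrightarrow>
      \<exists>h'\<in>chart_functions ?Y ?n V bn. \<forall>J'\<in>FB (e + 1).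
        J' \<in> hilb_chart ?Y ?n V bn \<longrightarrow> u J' \<noteq> 0 \<longrightarrow> h (frob_image p X 1 J') = h' J'"
    by (rule frob_image_local [OF J V ch]) (rule that)
  obtain g' where g': "g' \<in> chart_functions ?Y ?n V bn"
    "\<And>J'. J' \<in> FB (e + 1) \<Longrightarrow> J' \<in> hilb_chart ?Y ?n V bn \<Longrightarrow> u J' \<noteq> 0 \<Longrightarrow> g (frob_image p X 1 J') = g' J'"
    using pull [OF g] by blast
  obtain h' where h': "h' \<in> chart_functions ?Y ?n V bn"
    "\<And>J'. J' \<in> FB (e + 1) \<Longrightarrow> J' \<in> hilb_chart ?Y ?n V bn \<Longrightarrow> u J' \<noteq> 0 \<Longrightarrow> h (frob_image p X 1 J') = h' J'"
    using pull [OF h] by blast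
  obtain T where T: "openin (Hilb (e + 1)) T" "J \<in> T" "\<forall>J'\<in>FB (e + 1) \<inter> T. frob_image p X 1 J' \<in> U"
    using frob_image_open [OF U(1) J U(2)] by blast
  \<comment> \<open>\<open>u\<close> nonzero makes the pullback formulas valid, \<open>h'\<close>
    nonzero makes the quotient defined, and \<open>T\<close> keeps the image inside
    \<open>U\<close>, where \<open>t\<close> is regular.\<close>
  define N where "N = {I \<in> hilb_chart ?Y ?n V bn. h' I * u I \<noteq> 0} \<inter> T"
  have "openin (Hilb (e + 1)) N"
    unfolding N_def by (intro openin_Int T open_chart_nonzero V chart_functions.mult h' u)
  moreover have "J \<in> N" using chn u(2) h'(2) [OF J chn u(2)] hJ T(2) by (simp add: N_def)
  moreover have "(\<lambda>I. g' I / h' I) \<in> regular (hilb_red ?Y ?n) N"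
    unfolding regular_hilb_red
  proof
    fix I assume "I \<in> N"
    then show "\<exists>V b g h. affine_open X V \<and> I \<in> hilb_chart ?Y ?n V b \<and>
         g \<in> chart_functions ?Y ?n V b \<and> h \<in> chart_functions ?Y ?n V b \<and> h I \<noteq> 0 \<and>
         (\<forall>J\<in>N \<inter> hilb_chart ?Y ?n V b. h J \<noteq> 0 \<longrightarrow> g' J / h' J = g J / h J)"
      using V g' h' by (intro exI [of _ V] exI [of _ bn] exI [of _ g'] exI [of _ h']) (simp add: N_def)
  qed
  moreover have "(s \<circ> frob_image p X 1) I = g' I / h' I" if I: "I \<in> N \<inter> ?W" for I
  proof -
    have I': "I \<in> FB (e + 1)" "I \<in> hilb_chart ?Y ?n V bn" "u I \<noteq> 0" "h' I \<noteq> 0" "I \<in> T" "frob_image p X 1 I \<in> W"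
      using I by (auto simp: N_def)
    then have IU: "frob_image p X 1 I \<in> U" using T(3) by blast
    then have "s (frob_image p X 1 I) = t (frob_image p X 1 I)" using st I'(6) by blast
    also have "\<dots> = g (frob_image p X 1 I) / h (frob_image p X 1 I)"
      using tgh IU near [OF I'(1-3)] h'(2) [OF I'(1-3)] I'(4) by simp
    finally show ?thesis using g'(2) [OF I'(1-3)] h'(2) [OF I'(1-3)] by simp
  qed
  ultimately show "\<exists>U t. openin (Hilb (e + 1)) U \<and> J \<in> U \<and> t \<in> regular (hilb_red ?Y ?n) U \<and>
      (\<forall>w\<in>U \<inter> ?W. (s \<circ> frob_image p X 1) w = t w)"
    by blast
qed

lemma frob_image_morphism:
  "fspace_morphism (F_blowup p X (e + 1)) (F_blowup p X e) (frob_image p X 1)"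
  unfolding fspace_morphism_def FB_def [symmetric]
  using frob_image_continuous frob_image_regular by blast

section \<open>Agreement with the birational map over the smooth locus\<close>

lemma FB_ex_fat:
  assumes "J \<in> FB e"
  shows "\<exists>x. fat_point e x J"
  using FB_chart [OF assms] FB_fat [OF assms] by metis

text \<open>Over a smooth point the fibre is the only point of the F-blowup, so the inverse used in
  \<open>F_blowup_map\<close> is a genuine one.\<close>

lemma inj_on_smooth_part: "inj_on (F_blowup_proj p X e) (smooth_part p X e)"
proof (rule inj_onI)
  have eq: "I = frob_fiber p X e (F_blowup_proj p X e I)" if "I \<in> smooth_part p X e" for I
  proof -
    have I: "I \<in> FB e" "smooth_point X (F_blowup_proj p X e I)"
      using that by (simp_all add: smooth_part_def FB_def)
    obtain x where "fat_point e x I" using FB_ex_fat [OF I(1)] by blast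
    then show ?thesis using FB_over_smooth [OF I(1)] I(2) fat_proj by blast
  qed
  fix I J assume IJ: "I \<in> smooth_part p X e" "J \<in> smooth_part p X e" "F_blowup_proj p X e I = F_blowup_proj p X e J"
  then show "I = J" using eq [OF IJ(1)] eq [OF IJ(2)] by simp
qed

text \<open>Taking the image under one Frobenius does not move the support, so both sides project to
  the same smooth point, and the projection is injective there.\<close>

lemma frob_image_F_blowup_map:
  assumes I: "I \<in> smooth_part p X (e + 1)"
  shows "frob_image p X 1 I = F_blowup_map p X e I"
proof -
  have FBI: "I \<in> FB (e + 1)" and sm: "smooth_point X (F_blowup_proj p X (e + 1) I)"
    using I by (simp_all add: smooth_part_def FB_def)
  obtain x where "fat_point (e + 1) x I" using FB_ex_fat [OF FBI] by blast
  then have proj: "F_blowup_proj p X (e + 1) I = x" "F_blowup_proj p X e (frob_image p X 1 I) = x"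
    using fat_proj frob_image_fat by blast+
  then have "frob_image p X 1 I \<in> smooth_part p X e"
    using frob_image_FB [OF FBI] sm by (simp add: smooth_part_def FB_def)
  then show ?thesis
    unfolding F_blowup_map_def o_def using the_inv_into_f_f [OF inj_on_smooth_part] proj by metis
qed

end

theorem theorem1p2:
  fixes X :: "('p, 's, 'k::alg_closed_field) kspace" and p :: nat
  assumes "CHAR('k) = p" and "p > 0"
    and "variety X"
    and "F_pure p X"
  shows "\<forall>e::nat. \<exists>\<phi>. fspace_morphism (F_blowup p X (e + 1)) (F_blowup p X e) \<phi> \<and>
           (\<forall>I\<in>smooth_part p X (e + 1). \<phi> I = F_blowup_map p X e I)"
proof -
  interpret F_pure_variety X p
    by unfold_locales (use assms in auto)
  show ?thesis
    using frob_image_morphism frob_image_F_blowup_map by blast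
qed

end
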